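(* Let $\Gamma$ be a countable discrete group acting continuously on a compact Hausdorff space $X$. The following are equivalent: (1) The action of $\Gamma$ on $X$ is amenable. (2) The Banach algebra $A_0(\Gamma,X)$ is right-$CX$-$\ell^1$-amenable.
   Context: All vector spaces are over $\mathbb{C}$. $CX$ denotes the $C^*$-algebra of continuous functions $X\to\mathbb{C}$ with the sup norm $\|\cdot\|_\infty$; $g.x$ denotes the action; for $g\in\Gamma$, $p\in CX$ put $p^g(x):=p(g^{-1}.x)$. The unit of $\Gamma$ is $e$. Amenable action: $\mathrm{Prob}(\Gamma)$ is the set of positive norm-one elements of $\ell^1(\Gamma)$ with the $\ell^1$-norm $\|\cdot\|_1$, with $\Gamma$-action $(g.f)(h)=f(g^{-1}h)$. The action of $\Gamma$ on $X$ is amenable if there is a net $(m_i)_i$ of continuous maps $m_i:X\to\mathrm{Prob}(\Gamma)$ such that for every $g\in\Gamma$, $\sup_{x\in X}\|m_i(g.x)-g.(m_i(x))\|_1\to 0$. The algebra $A_0(\Gamma,X)$: a countable family $\{v_i\}_{i\in I}$ in a Banach space $V$ is unconditionally summable if there is $v\in V$ such that for every bijection $\sigma:\mathbb{N}\to I$ one has $\|\sum_{n\le N}v_{\sigma(n)}-v\|\to0$ as $N\to\infty$. $A_0(\Gamma,X)$ is the space of all functions $f:\Gamma\to CX$, $g\mapsto f(g)=f_g$, that are unconditionally summable in $CX$, with norm $\|f\|_{A_0}:=\big\|\sum_{g\in\Gamma}|f_g|\big\|_\infty$. It is a Banach algebra with product $(f_1*f_2)(g):=\sum_{h\in\Gamma}f_1(h)\cdot(f_2(h^{-1}g))^h$.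 $CX$ is regarded as a Banach subalgebra by identifying $p\in CX$ with the function supported at $e$ with value $p$. Bimodules and derivations: for a Banach algebra $A$, an $A$-$A$-Banach bimodule is a Banach space $E$ that is an $A$-$A$-bimodule with contractive left and right actions. The dual $E^*$ is an $A$-$A$-Banach bimodule by $(a.\phi.b)(v):=\phi(b.v.a)$. A derivation $D:A\to E^*$ is a bounded linear map with $D(ab)=a.D(b)+D(a).b$; it is inner if there is $\tau\in E^*$ with $D(a)=a.\tau-\tau.a$ for all $a\in A$. Let $A$ be a Banach algebra containing $CX$ as a Banach subalgebra. An $A$-$A$-Banach bimodule $E$ is right-$CX$-$\ell^1$-geometric if the restricted right action of $CX$ on $E$ is $\ell^1$-geometric, i.e. $\sum_{k=1}^n\|v.p_k\|\le\big\|\sum_{k=1}^np_k\big\|_\infty\cdot\|v\|$ for all $n$, all $p_1,\dots,p_n\in C(X,[0,1])$ and all $v\in E$. $A$ is right-$CX$-$\ell^1$-amenable if for every right-$CX$-$\ell^1$-geometric $A$-$A$-Banach bimodule $E$, every bounded derivation $D:A\to E^*$ is inner. *)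

theory Defs
  imports
    "HOL-Analysis.Analysis"
    "HOL-Algebra.Group_Action"
    "HOL-Algebra.Module"
    "HOL-Algebra.Algebraic_Closure_Type"
begin

text \<open>
  Bimodules have to be quantified over inside a definition, so Banach spaces are records with a
  carrier, extending the modules of HOL-Algebra by a norm. As there, the ring fields
  \<open>mult\<close> and \<open>one\<close> are meaningless for a mere space; for a Banach algebra
  \<open>mult\<close> is the product.
\<close>

record 'e normed_space = "(complex, 'e) module" +
  nrm :: "'e \<Rightarrow> real"

record ('a, 'e) bimodule = "'e normed_space" +
  lact :: "'a \<Rightarrow> 'e \<Rightarrow> 'e"
  ract :: "'e \<Rightarrow> 'a \<Rightarrow> 'e"

locale complex_banach_space =
  module "ring_of_type_algebra :: complex ring" E
  for E :: "('e, 'n) normed_space_scheme" (structure) +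
  assumes nrm_nonneg: "v \<in> carrier E \<Longrightarrow> 0 \<le> nrm E v"
    and nrm_eq_0_iff: "v \<in> carrier E \<Longrightarrow> nrm E v = 0 \<longleftrightarrow> v = \<zero>\<^bsub>E\<^esub>"
    and nrm_triangle:
      "v \<in> carrier E \<Longrightarrow> w \<in> carrier E \<Longrightarrow> nrm E (v \<oplus>\<^bsub>E\<^esub> w) \<le> nrm E v + nrm E w"
    and nrm_smult: "v \<in> carrier E \<Longrightarrow> nrm E (c \<odot>\<^bsub>E\<^esub> v) = cmod c * nrm E v"
    and complete:
      "range s \<subseteq> carrier E \<Longrightarrow>
       (\<forall>\<epsilon>>0. \<exists>N. \<forall>m\<ge>N. \<forall>n\<ge>N. nrm E (s m \<ominus>\<^bsub>E\<^esub> s n) < \<epsilon>) \<Longrightarrow>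
       \<exists>l\<in>carrier E. (\<lambda>n. nrm E (s n \<ominus>\<^bsub>E\<^esub> l)) \<longlonglongrightarrow> 0"

text \<open>No unit of \<open>A\<close> is required to act as the identity.\<close>

locale banach_bimodule = complex_banach_space E
  for A :: "('a, 'm) normed_space_scheme" and E :: "('a, 'e, 'n) bimodule_scheme" (structure) +
  assumes lact_closed: "a \<in> carrier A \<Longrightarrow> v \<in> carrier E \<Longrightarrow> lact E a v \<in> carrier E"
    and ract_closed: "a \<in> carrier A \<Longrightarrow> v \<in> carrier E \<Longrightarrow> ract E v a \<in> carrier E"
    and lact_add_left: "a \<in> carrier A \<Longrightarrow> b \<in> carrier A \<Longrightarrow> v \<in> carrier E \<Longrightarrow>
      lact E (a \<oplus>\<^bsub>A\<^esub> b) v = lact E a v \<oplus>\<^bsub>E\<^esub> lact E b v"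
    and lact_add_right: "a \<in> carrier A \<Longrightarrow> v \<in> carrier E \<Longrightarrow> w \<in> carrier E \<Longrightarrow>
      lact E a (v \<oplus>\<^bsub>E\<^esub> w) = lact E a v \<oplus>\<^bsub>E\<^esub> lact E a w"
    and lact_smult_left: "a \<in> carrier A \<Longrightarrow> v \<in> carrier E \<Longrightarrow>
      lact E (c \<odot>\<^bsub>A\<^esub> a) v = c \<odot>\<^bsub>E\<^esub> lact E a v"
    and lact_smult_right: "a \<in> carrier A \<Longrightarrow> v \<in> carrier E \<Longrightarrow>
      lact E a (c \<odot>\<^bsub>E\<^esub> v) = c \<odot>\<^bsub>E\<^esub> lact E a v"
    and ract_add_left: "a \<in> carrier A \<Longrightarrow> v \<in> carrier E \<Longrightarrow> w \<in> carrier E \<Longrightarrow>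
      ract E (v \<oplus>\<^bsub>E\<^esub> w) a = ract E v a \<oplus>\<^bsub>E\<^esub> ract E w a"
    and ract_add_right: "a \<in> carrier A \<Longrightarrow> b \<in> carrier A \<Longrightarrow> v \<in> carrier E \<Longrightarrow>
      ract E v (a \<oplus>\<^bsub>A\<^esub> b) = ract E v a \<oplus>\<^bsub>E\<^esub> ract E v b"
    and ract_smult_left: "a \<in> carrier A \<Longrightarrow> v \<in> carrier E \<Longrightarrow>
      ract E (c \<odot>\<^bsub>E\<^esub> v) a = c \<odot>\<^bsub>E\<^esub> ract E v a"
    and ract_smult_right: "a \<in> carrier A \<Longrightarrow> v \<in> carrier E \<Longrightarrow>
      ract E v (c \<odot>\<^bsub>A\<^esub> a) = c \<odot>\<^bsub>E\<^esub> ract E v a"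
    and lact_assoc: "a \<in> carrier A \<Longrightarrow> b \<in> carrier A \<Longrightarrow> v \<in> carrier E \<Longrightarrow>
      lact E (a \<otimes>\<^bsub>A\<^esub> b) v = lact E a (lact E b v)"
    and ract_assoc: "a \<in> carrier A \<Longrightarrow> b \<in> carrier A \<Longrightarrow> v \<in> carrier E \<Longrightarrow>
      ract E v (a \<otimes>\<^bsub>A\<^esub> b) = ract E (ract E v a) b"
    and lact_ract: "a \<in> carrier A \<Longrightarrow> b \<in> carrier A \<Longrightarrow> v \<in> carrier E \<Longrightarrow>
      lact E a (ract E v b) = ract E (lact E a v) b"
    and lact_contractive: "a \<in> carrier A \<Longrightarrow> v \<in> carrier E \<Longrightarrow>
      nrm E (lact E a v) \<le> nrm A a * nrm E v"
    and ract_contractive: "a \<in> carrier A \<Longrightarrow> v \<in> carrier E \<Longrightarrow>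
      nrm E (ract E v a) \<le> nrm E v * nrm A a"

text \<open>
  Functionals are extensional on the carrier of \<open>E\<close>, so that equality in the dual is equality
  of functions.
\<close>

definition bounded_functionals :: "('e, 'm) normed_space_scheme \<Rightarrow> ('e \<Rightarrow> complex) set" where
  "bounded_functionals E = {\<phi> \<in> extensional (carrier E).
     (\<forall>v\<in>carrier E. \<forall>w\<in>carrier E. \<phi> (v \<oplus>\<^bsub>E\<^esub> w) = \<phi> v + \<phi> w) \<and>
     (\<forall>c. \<forall>v\<in>carrier E. \<phi> (c \<odot>\<^bsub>E\<^esub> v) = c * \<phi> v) \<and>
     (\<exists>K. \<forall>v\<in>carrier E. cmod (\<phi> v) \<le> K * nrm E v)}"

definition dual_bimodule :: "('a, 'e, 'm) bimodule_scheme \<Rightarrow> ('a, 'e \<Rightarrow> complex) bimodule" where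
  "dual_bimodule E = \<lparr>
     carrier = bounded_functionals E,
     mult = undefined,
     one = undefined,
     zero = (\<lambda>v\<in>carrier E. 0),
     add = (\<lambda>\<phi> \<psi>. \<lambda>v\<in>carrier E. \<phi> v + \<psi> v),
     smult = (\<lambda>c \<phi>. \<lambda>v\<in>carrier E. c * \<phi> v),
     nrm = (\<lambda>\<phi>. SUP v\<in>{v \<in> carrier E. nrm E v \<le> 1}. cmod (\<phi> v)),
     lact = (\<lambda>a \<phi>. \<lambda>v\<in>carrier E. \<phi> (ract E v a)),
     ract = (\<lambda>\<phi> a. \<lambda>v\<in>carrier E. \<phi> (lact E a v))\<rparr>"

definition bounded_derivation ::
  "('a, 'm) normed_space_scheme \<Rightarrow> ('a, 'e, 'n) bimodule_scheme \<Rightarrow> ('a \<Rightarrow> 'e) \<Rightarrow> bool" where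
  "bounded_derivation A M D \<longleftrightarrow>
     D \<in> carrier A \<rightarrow> carrier M \<and>
     (\<forall>a\<in>carrier A. \<forall>b\<in>carrier A. D (a \<oplus>\<^bsub>A\<^esub> b) = D a \<oplus>\<^bsub>M\<^esub> D b) \<and>
     (\<forall>c. \<forall>a\<in>carrier A. D (c \<odot>\<^bsub>A\<^esub> a) = c \<odot>\<^bsub>M\<^esub> D a) \<and>
     (\<exists>K. \<forall>a\<in>carrier A. nrm M (D a) \<le> K * nrm A a) \<and>
     (\<forall>a\<in>carrier A. \<forall>b\<in>carrier A.
        D (a \<otimes>\<^bsub>A\<^esub> b) = lact M a (D b) \<oplus>\<^bsub>M\<^esub> ract M (D a) b)"

definition inner_derivation ::
  "('a, 'm) normed_space_scheme \<Rightarrow> ('a, 'e, 'n) bimodule_scheme \<Rightarrow> ('a \<Rightarrow> 'e) \<Rightarrow> bool" where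
  "inner_derivation A M D \<longleftrightarrow>
     (\<exists>\<tau>\<in>carrier M. \<forall>a\<in>carrier A. D a = lact M a \<tau> \<ominus>\<^bsub>M\<^esub> ract M \<tau> a)"

text \<open>
  For compact \<open>X\<close> every continuous function is bounded, so \<open>CX\<close> with the supremum norm is the
  library type of bounded continuous functions \<open>'x \<Rightarrow>\<^sub>C complex\<close>, which lacks
  only the pointwise operations below.
\<close>

definition cx_mult :: "('x::topological_space \<Rightarrow>\<^sub>C complex) \<Rightarrow> ('x \<Rightarrow>\<^sub>C complex) \<Rightarrow> ('x \<Rightarrow>\<^sub>C complex)" where
  "cx_mult p q = Bcontfun (\<lambda>x. apply_bcontfun p x * apply_bcontfun q x)"

definition cx_scale :: "complex \<Rightarrow> ('x::topological_space \<Rightarrow>\<^sub>C complex) \<Rightarrow> ('x \<Rightarrow>\<^sub>C complex)" where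
  "cx_scale c p = Bcontfun (\<lambda>x. c * apply_bcontfun p x)"

definition cx_abs :: "('x::topological_space \<Rightarrow>\<^sub>C complex) \<Rightarrow> ('x \<Rightarrow>\<^sub>C complex)" where
  "cx_abs p = Bcontfun (\<lambda>x. complex_of_real (cmod (apply_bcontfun p x)))"

text \<open>\<open>\<iota>\<close> is the embedding of \<open>CX\<close> into the algebra acting on \<open>E\<close>.\<close>

definition right_l1_geometric ::
  "(('x::topological_space \<Rightarrow>\<^sub>C complex) \<Rightarrow> 'a) \<Rightarrow> ('a, 'e, 'm) bimodule_scheme \<Rightarrow> bool" where
  "right_l1_geometric \<iota> E \<longleftrightarrow>
     (\<forall>n::nat. \<forall>p. (\<forall>k\<in>{1..n}. \<forall>x. apply_bcontfun (p k) x \<in> complex_of_real ` {0..1}) \<longrightarrow>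
        (\<forall>v\<in>carrier E.
           (\<Sum>k=1..n. nrm E (ract E v (\<iota> (p k)))) \<le> norm (\<Sum>k=1..n. p k) * nrm E v))"

text \<open>
  HOL cannot quantify over all types inside a formula; the first argument fixes the type whose
  subsets serve as carriers of the bimodules \<open>E\<close>. For \<open>A = A\<^sub>0(\<Gamma>, X)\<close> a type at
  least as large as \<open>A\<close> loses nothing: \<open>\<ell>\<^sup>1\<close>-sums and weak-* compactness reduce
  the general case to bimodules no larger than \<open>A\<close>. The functions from
  \<open>('x \<Rightarrow>\<^sub>C complex) \<Rightarrow> 'x \<Rightarrow> 'g \<Rightarrow> complex\<close> to
  \<open>complex\<close> form such a type; it contains the dual of the operators
  \<open>CX \<rightarrow> C(X, \<ell>\<^sup>1(\<Gamma>))\<close>.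
\<close>

definition right_l1_amenable ::
  "'e itself \<Rightarrow> ('a, 'm) normed_space_scheme \<Rightarrow>
   (('x::topological_space \<Rightarrow>\<^sub>C complex) \<Rightarrow> 'a) \<Rightarrow> bool" where
  "right_l1_amenable _ A \<iota> \<longleftrightarrow>
     (\<forall>E :: ('a, 'e) bimodule. banach_bimodule A E \<and> right_l1_geometric \<iota> E \<longrightarrow>
        (\<forall>D. bounded_derivation A (dual_bimodule E) D \<longrightarrow>
             inner_derivation A (dual_bimodule E) D))"

definition l1_norm :: "('g, 'm) monoid_scheme \<Rightarrow> ('g \<Rightarrow> real) \<Rightarrow> real" where
  "l1_norm G f = (\<Sum>\<^sub>\<infinity>h\<in>carrier G. \<bar>f h\<bar>)"

text \<open>Positive elements of complex \<open>\<ell>\<^sup>1\<close> are real-valued; functions on the group vanish off its carrier.\<close>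

definition Prob :: "('g, 'm) monoid_scheme \<Rightarrow> ('g \<Rightarrow> real) set" where
  "Prob G = {f. (\<forall>h. 0 \<le> f h) \<and> (\<forall>h. h \<notin> carrier G \<longrightarrow> f h = 0) \<and>
                f summable_on carrier G \<and> l1_norm G f = 1}"

definition l1_translate :: "('g, 'm) monoid_scheme \<Rightarrow> 'g \<Rightarrow> ('g \<Rightarrow> real) \<Rightarrow> 'g \<Rightarrow> real" where
  "l1_translate G g f = (\<lambda>h. if h \<in> carrier G then f (inv\<^bsub>G\<^esub> g \<otimes>\<^bsub>G\<^esub> h) else 0)"

text \<open>
  Continuity is with respect to the \<open>\<ell>\<^sup>1\<close>-norm, not the product topology that
  the library puts on functions.
\<close>

definition continuous_prob_maps ::
  "('g, 'm) monoid_scheme \<Rightarrow> ('x::topological_space \<Rightarrow> 'g \<Rightarrow> real) set" where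
  "continuous_prob_maps G = {m. (\<forall>x. m x \<in> Prob G) \<and>
     (\<forall>x. ((\<lambda>y. l1_norm G (\<lambda>h. m y h - m x h)) \<longlongrightarrow> 0) (at x))}"

text \<open>
  A net of maps \<open>m\<^sub>i\<close> is given by the proper filter of its tails; conversely a proper filter
  \<open>F\<close> yields the net of pairs \<open>(m, P)\<close> with \<open>m\<close> in an \<open>F\<close>-large set \<open>P\<close>.
\<close>

definition amenable_action ::
  "('g, 'm) monoid_scheme \<Rightarrow> ('g \<Rightarrow> 'x::topological_space \<Rightarrow> 'x) \<Rightarrow> bool" where
  "amenable_action G act \<longleftrightarrow>
     (\<exists>F :: ('x \<Rightarrow> 'g \<Rightarrow> real) filter. F \<noteq> bot \<and>
        (\<forall>\<^sub>F m in F. m \<in> continuous_prob_maps G) \<and>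
        (\<forall>g\<in>carrier G.
           ((\<lambda>m. SUP x. l1_norm G (\<lambda>h. m (act g x) h - l1_translate G g (m x) h)) \<longlongrightarrow> 0) F))"

text \<open>For finite \<open>I\<close> there is no bijection from the naturals and every family is summable.\<close>

definition unconditionally_summable :: "('i \<Rightarrow> 'v::real_normed_vector) \<Rightarrow> 'i set \<Rightarrow> bool" where
  "unconditionally_summable f I \<longleftrightarrow>
     (\<exists>v. \<forall>\<sigma> :: nat \<Rightarrow> 'i. bij_betw \<sigma> UNIV I \<longrightarrow> (\<lambda>N. \<Sum>n\<le>N. f (\<sigma> n)) \<longlonglongrightarrow> v)"

definition cx_translate ::
  "('g, 'm) monoid_scheme \<Rightarrow> ('g \<Rightarrow> 'x \<Rightarrow> 'x) \<Rightarrow> 'g \<Rightarrow>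
   ('x::topological_space \<Rightarrow>\<^sub>C complex) \<Rightarrow> ('x \<Rightarrow>\<^sub>C complex)" where
  "cx_translate G act g p = Bcontfun (\<lambda>x. apply_bcontfun p (act (inv\<^bsub>G\<^esub> g) x))"

definition cx_embed ::
  "('g, 'm) monoid_scheme \<Rightarrow> ('x::topological_space \<Rightarrow>\<^sub>C complex) \<Rightarrow> 'g \<Rightarrow> ('x \<Rightarrow>\<^sub>C complex)" where
  "cx_embed G p = (\<lambda>g. if g = \<one>\<^bsub>G\<^esub> then p else 0)"

text \<open>The infinite sums are sums in the Banach space \<open>CX\<close>, not pointwise ones.\<close>

definition A0 ::
  "('g, 'm) monoid_scheme \<Rightarrow> ('g \<Rightarrow> 'x \<Rightarrow> 'x) \<Rightarrow>
   ('g \<Rightarrow> ('x::topological_space \<Rightarrow>\<^sub>C complex)) normed_space" where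
  "A0 G act = \<lparr>
     carrier = {f. (\<forall>g. g \<notin> carrier G \<longrightarrow> f g = 0) \<and> unconditionally_summable f (carrier G)},
     mult = (\<lambda>f1 f2 g. if g \<in> carrier G
               then \<Sum>\<^sub>\<infinity>h\<in>carrier G. cx_mult (f1 h) (cx_translate G act h (f2 (inv\<^bsub>G\<^esub> h \<otimes>\<^bsub>G\<^esub> g)))
               else 0),
     one = cx_embed G (const_bcontfun 1),
     zero = (\<lambda>g. 0),
     add = (\<lambda>f1 f2 g. f1 g + f2 g),
     smult = (\<lambda>c f g. cx_scale c (f g)),
     nrm = (\<lambda>f. norm (\<Sum>\<^sub>\<infinity>g\<in>carrier G. cx_abs (f g)))\<rparr>"

end

theory Submission
  imports Defs
begin

text \<open>
  Write \<open>\<A>\<close> for \<open>A\<^sub>0(\<Gamma>, X)\<close>, \<open>\<delta>\<^sub>g\<close> for the point mass at \<open>g\<close> with value \<open>1\<close>, and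
  \<open>\<phi>.a\<close>, \<open>a.\<phi>\<close> for the actions on a dual bimodule.

  From amenability to inner derivations. Let \<open>D: \<A> \<rightarrow> E\<^sup>*\<close> be a bounded derivation. Subtracting inner
  derivations one may assume \<open>D(1) = 0\<close> (\<open>inner_at_idempotent\<close>) and then \<open>D = 0\<close> on \<open>CX\<close>: the
  unitaries \<open>u\<close> of \<open>CX\<close> form an abelian group, which has an invariant mean, and the mean of the
  functionals \<open>u.D(u\<^sup>*)\<close> implements \<open>D\<close> on \<open>CX\<close> (\<open>inner_on_cx\<close>). Now
  \<open>\<phi>\<^sub>h = \<delta>\<^sub>h.D(\<delta>\<^sub>h\<^sup>-\<^sup>1)\<close> commutes with \<open>CX\<close> and satisfies
  \<open>\<delta>\<^sub>g.\<phi>\<^sub>h - \<phi>\<^sub>g\<^sub>h.\<delta>\<^sub>g = D(\<delta>\<^sub>g)\<close> (\<open>cocycle_shift\<close>), so an average of the \<open>\<phi>\<^sub>h\<close> over an invariant family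
  of weights would implement \<open>D\<close>. The weights are functions on \<open>X\<close>: a continuous map
  \<open>m: X \<rightarrow> Prob(\<Gamma>)\<close> gives \<open>\<Sum>\<^sub>h m\<^sub>h.\<phi>\<^sub>h\<close>. This is where the geometric condition on \<open>E\<close> is used: it
  bounds such a sum by the supremum over \<open>x\<close> of the total weight (\<open>weighted_sum\<close>), so that it
  converges and depends on \<open>m\<close> continuously for the very norm in which \<open>m\<close> is almost invariant
  (\<open>averaged_coboundary\<close>). A weak-* cluster point of these averages along the net \<open>m\<^sub>i\<close> implements \<open>D\<close>.

  From inner derivations to amenability. Summation over \<open>\<Gamma>\<close> is a homomorphism \<open>\<sigma>: \<A> \<rightarrow> CX\<close> of left
  modules, with the linear section \<open>T\<^sub>0(q) = q\<delta>\<^sub>e\<close>. Operators \<open>T: CX \<rightarrow> \<A>\<close> form a bimodule under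
  \<open>(a.T.b)(q) = a * T(b.q)\<close>, and those with values in the kernel of \<open>\<sigma>\<close> form a sub-bimodule \<open>\<L>\<close>. The
  commutators \<open>a.T\<^sub>0 - T\<^sub>0.a\<close> lie in \<open>\<L>\<close> although \<open>T\<^sub>0\<close> does not, so they define a derivation of \<open>\<A>\<close>
  into \<open>\<L>\<close>, hence into its bidual, which is the dual of \<open>\<L>\<^sup>*\<close>. Because the norm of \<open>\<L>\<close> is a supremum
  over the points of \<open>X\<close>, the bimodule \<open>\<L>\<^sup>*\<close> is right-\<open>\<ell>\<^sup>1\<close>-geometric (\<open>dual_operator_geometric\<close>). If the
  derivation is inner in the bidual, the Hahn--Banach theorem finds, for every finite set of group
  elements \<open>s\<close>, an element \<open>T\<close> of \<open>\<L>\<close> such that \<open>T\<^sub>0 - T\<close> commutes up to a small error with the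
  \<open>\<delta>\<^sub>s\<close> (\<open>approximately_inner\<close>). Then \<open>a = (T\<^sub>0 - T)(1)\<close> has \<open>\<sigma>(a) = 1\<close> and is almost fixed
  by the \<open>\<delta>\<^sub>s\<close>, and the normalised absolute value of \<open>a\<close> is an almost invariant map \<open>X \<rightarrow> Prob(\<Gamma>)\<close>
  (\<open>almost_invariant_map\<close>).

  Both directions work with pointwise sums: a family in \<open>CX\<close> is unconditionally summable if and only
  if its absolute values have uniformly small tails (\<open>unconditionally_summable_iff\<close>).
\<close>

section \<open>Cluster points and invariant means\<close>

text \<open>
  By Tychonoff's theorem the functionals bounded by \<open>C\<close> form a compact set for pointwise convergence.
  The cluster point inherits every limiting relation that is continuous for pointwise convergence;
  the quantification over \<open>H\<close> makes linearity, invariance and derivation identities instances of one statement.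
\<close>

lemma pointwise_cluster_point:
  fixes \<Phi> :: "'i \<Rightarrow> 'e \<Rightarrow> complex" and C :: "'e \<Rightarrow> real"
  assumes "F \<noteq> bot" and bnd: "\<forall>\<^sub>F i in F. \<forall>v. cmod (\<Phi> i v) \<le> C v"
  obtains \<tau> where "\<And>v. cmod (\<tau> v) \<le> C v"
    and "\<And>H c. continuous_on UNIV H \<Longrightarrow> ((\<lambda>i. H (\<Phi> i)) \<longlongrightarrow> (c::complex)) F \<Longrightarrow> H \<tau> = c"
proof -
  define K where "K = (Pi\<^sub>E UNIV (\<lambda>v. cball 0 (C v)) :: ('e \<Rightarrow> complex) set)"
  have "compactin (product_topology (\<lambda>_. euclidean) UNIV) K"
    unfolding K_def compactin_PiE by simp
  then have "compact K"
    by (simp add: euclidean_product_topology)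
  moreover have "\<forall>\<^sub>F x in filtermap \<Phi> F. x \<in> K"
    unfolding eventually_filtermap K_def using bnd by (rule eventually_mono) auto
  moreover have "filtermap \<Phi> F \<noteq> bot"
    using assms(1) by (simp add: filtermap_bot_iff)
  ultimately obtain \<tau> where \<tau>: "\<tau> \<in> K" "inf (nhds \<tau>) (filtermap \<Phi> F) \<noteq> bot"
    unfolding compact_filter by blast
  show thesis
  proof (rule that)
    show "cmod (\<tau> v) \<le> C v" for v
      using \<tau>(1) by (auto simp: K_def PiE_iff)
    show "H \<tau> = c" if H: "continuous_on UNIV H" "((\<lambda>i. H (\<Phi> i)) \<longlongrightarrow> c) F" for H and c :: complex
    proof (rule tendsto_unique[OF \<tau>(2)])
      have "(H \<longlongrightarrow> H \<tau>) (nhds \<tau>)"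
        using H(1) by (simp add: continuous_on_def tendsto_at_iff_tendsto_nhds)
      then show "(H \<longlongrightarrow> H \<tau>) (inf (nhds \<tau>) (filtermap \<Phi> F))"
        by (rule tendsto_mono[rotated]) simp
      have "(H \<longlongrightarrow> c) (filtermap \<Phi> F)"
        using H(2) by (simp add: filterlim_filtermap)
      then show "(H \<longlongrightarrow> c) (inf (nhds \<tau>) (filtermap \<Phi> F))"
        by (rule tendsto_mono[rotated]) simp
    qed
  qed
qed

lemma continuous_on_evaluation [continuous_intros]:
  "continuous_on S (\<lambda>\<tau>. \<tau> v :: complex)"
  using continuous_on_product_coordinates[of v] continuous_on_subset by blast

text \<open>
  The average of \<open>f\<close> over the box of all products \<open>\<Prod>\<^bsub>u\<in>S\<^esub> u\<^sup>k\<^sup>u\<close> with exponents \<open>k\<^sub>u < N\<close>, counted with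
  multiplicity.
\<close>

definition (in comm_monoid) folner_average :: "'a set \<Rightarrow> nat \<Rightarrow> ('a \<Rightarrow> complex) \<Rightarrow> complex" where
  "folner_average S N f =
     (\<Sum>k\<in>S \<rightarrow>\<^sub>E {..<N}. f (finprod G (\<lambda>u. u [^] k u) S)) / of_nat (N ^ card S)"

lemma (in comm_monoid) folner_average_bound:
  assumes S: "finite S" "S \<subseteq> carrier G" and N: "0 < N"
    and f: "\<And>u. u \<in> carrier G \<Longrightarrow> cmod (f u) \<le> B"
  shows "cmod (folner_average S N f) \<le> B"
proof -
  have "cmod (\<Sum>k\<in>S \<rightarrow>\<^sub>E {..<N}. f (finprod G (\<lambda>u. u [^] k u) S)) \<le> of_nat (card (S \<rightarrow>\<^sub>E {..<N})) * B"
    using S(2) by (intro sum_norm_bound f finprod_closed) auto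
  also have "card (S \<rightarrow>\<^sub>E {..<N}) = N ^ card S"
    using S(1) by (simp add: card_PiE)
  finally show ?thesis
    unfolding folner_average_def norm_divide norm_of_nat
    using N by (simp add: pos_divide_le_eq mult.commute)
qed

text \<open>
  Translation by \<open>w \<in> S\<close> shifts the exponent of \<open>w\<close> by one, so the sum over that exponent telescopes and
  only the two faces of the box remain, a fraction \<open>2 / N\<close> of its points.
\<close>

lemma (in comm_monoid) folner_average_translate:
  assumes S: "finite S" "S \<subseteq> carrier G" "w \<in> S" and N: "0 < N"
    and f: "\<And>u. u \<in> carrier G \<Longrightarrow> cmod (f u) \<le> B"
  shows "cmod (folner_average S N (\<lambda>u. f (w \<otimes> u)) - folner_average S N f) \<le> 2 * B / real N"
proof -
  define R where "R = S - {w}"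
  have R: "finite R" "R \<subseteq> carrier G" "w \<notin> R" "S = insert w R" "w \<in> carrier G"
    using S by (auto simp: R_def)
  define P where "P k = finprod G (\<lambda>u. u [^] k u) R" for k :: "'a \<Rightarrow> nat"
  have P: "P k \<in> carrier G" for k
    unfolding P_def using R(2) by (intro finprod_closed) auto
  have sum_S: "(\<Sum>k\<in>S \<rightarrow>\<^sub>E {..<N}. h (finprod G (\<lambda>u. u [^] k u) S))
      = (\<Sum>r\<in>R \<rightarrow>\<^sub>E {..<N}. \<Sum>i<N. h (w [^] i \<otimes> P r))" for h :: "'a \<Rightarrow> complex"
  proof -
    have inj: "inj_on (\<lambda>(y, g). g(w := y)) ({..<N} \<times> (R \<rightarrow>\<^sub>E {..<N}))"
      using R(3) by (rule inj_combinator)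
    have fp: "finprod G (\<lambda>u. u [^] (g(w := y)) u) S = w [^] y \<otimes> P g" for g y
    proof -
      have "finprod G (\<lambda>u. u [^] (g(w := y)) u) R = P g"
        unfolding P_def using R(2,3) by (intro finprod_cong') auto
      then show ?thesis
        unfolding R(4) using R by (subst finprod_insert) auto
    qed
    have "(\<Sum>k\<in>S \<rightarrow>\<^sub>E {..<N}. h (finprod G (\<lambda>u. u [^] k u) S))
        = (\<Sum>(y, g)\<in>{..<N} \<times> (R \<rightarrow>\<^sub>E {..<N}). h (w [^] y \<otimes> P g))"
      unfolding R(4) PiE_insert_eq
      by (subst sum.reindex[OF inj]) (auto intro!: sum.cong simp: fp[unfolded fun_upd_apply] R(4)[symmetric])
    also have "\<dots> = (\<Sum>y<N. \<Sum>g\<in>R \<rightarrow>\<^sub>E {..<N}. h (w [^] y \<otimes> P g))"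
      by (subst sum.cartesian_product) simp
    finally show ?thesis
      by (simp add: sum.swap[of _ "{..<N}"])
  qed
  have tel: "(\<Sum>i<N. f (w \<otimes> (w [^] i \<otimes> P r))) - (\<Sum>i<N. f (w [^] i \<otimes> P r))
      = f (w [^] N \<otimes> P r) - f (P r)" for r
  proof -
    have "w \<otimes> (w [^] i \<otimes> P r) = w [^] Suc i \<otimes> P r" for i
      using R(5) P[of r] nat_pow_Suc2[of w i] by (metis m_assoc nat_pow_closed)
    then have "(\<Sum>i<N. f (w \<otimes> (w [^] i \<otimes> P r))) - (\<Sum>i<N. f (w [^] i \<otimes> P r))
        = (\<Sum>i<N. f (w [^] Suc i \<otimes> P r) - f (w [^] i \<otimes> P r))"
      by (simp add: sum_subtractf)
    also have "\<dots> = f (w [^] N \<otimes> P r) - f (w [^] (0::nat) \<otimes> P r)"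
      by (rule sum_lessThan_telescope)
    finally show ?thesis using P by simp
  qed
  have "(\<Sum>r\<in>R \<rightarrow>\<^sub>E {..<N}. \<Sum>i<N. f (w \<otimes> (w [^] i \<otimes> P r)))
      - (\<Sum>r\<in>R \<rightarrow>\<^sub>E {..<N}. \<Sum>i<N. f (w [^] i \<otimes> P r))
      = (\<Sum>r\<in>R \<rightarrow>\<^sub>E {..<N}. f (w [^] N \<otimes> P r) - f (P r))"
    by (subst sum_subtractf[symmetric]) (simp only: tel)
  then have "folner_average S N (\<lambda>u. f (w \<otimes> u)) - folner_average S N f
      = (\<Sum>r\<in>R \<rightarrow>\<^sub>E {..<N}. f (w [^] N \<otimes> P r) - f (P r)) / of_nat (N ^ card S)"
    unfolding folner_average_def sum_S[of f] sum_S[of "\<lambda>u. f (w \<otimes> u)"] diff_divide_distrib[symmetric] by simp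
  also have "cmod \<dots> \<le> (of_nat (card (R \<rightarrow>\<^sub>E {..<N})) * (2 * B)) / real (N ^ card S)"
    unfolding norm_divide norm_of_nat
  proof (intro divide_right_mono sum_norm_bound)
    fix r
    have "cmod (f (w [^] N \<otimes> P r)) \<le> B" "cmod (f (P r)) \<le> B"
      using P R(5) by (auto intro!: f)
    then show "cmod (f (w [^] N \<otimes> P r) - f (P r)) \<le> 2 * B"
      using norm_triangle_ineq4[of "f (w [^] N \<otimes> P r)" "f (P r)"] by linarith
  qed simp
  also have "\<dots> = 2 * B / real N"
    using R N by (simp add: card_PiE)
  finally show ?thesis .
qed

text \<open>
  Commutative monoids are amenable: by \<open>folner_average_translate\<close> a cluster point of the averages over
  boxes, as \<open>S\<close> and \<open>N\<close> grow, is invariant. The mean acts on all functions, but linearity and invariance are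
  claimed only for those bounded on the carrier.
\<close>

lemma (in comm_monoid) invariant_mean:
  "\<exists>\<mu> :: ('a \<Rightarrow> complex) \<Rightarrow> complex.
    (\<forall>f B. (\<forall>u\<in>carrier G. cmod (f u) \<le> B) \<longrightarrow> cmod (\<mu> f) \<le> B) \<and>
    (\<forall>f g B B'. (\<forall>u\<in>carrier G. cmod (f u) \<le> B) \<longrightarrow> (\<forall>u\<in>carrier G. cmod (g u) \<le> B')
      \<longrightarrow> \<mu> (\<lambda>u. f u + g u) = \<mu> f + \<mu> g) \<and>
    (\<forall>f B c. (\<forall>u\<in>carrier G. cmod (f u) \<le> B) \<longrightarrow> \<mu> (\<lambda>u. c * f u) = c * \<mu> f) \<and>
    (\<forall>c. \<mu> (\<lambda>u. c) = c) \<and>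
    (\<forall>f B w. (\<forall>u\<in>carrier G. cmod (f u) \<le> B) \<longrightarrow> w \<in> carrier G \<longrightarrow> \<mu> (\<lambda>u. f (w \<otimes> u)) = \<mu> f)"
proof -
  define bd where "bd f \<longleftrightarrow> (\<exists>B. \<forall>u\<in>carrier G. cmod (f u) \<le> B)" for f :: "'a \<Rightarrow> complex"
  define F where "F = finite_subsets_at_top (carrier G) \<times>\<^sub>F sequentially"
  (* Unbounded functions get the value 0, so that the averages stay in a compact set. *)
  define \<Phi> where "\<Phi> = (\<lambda>(S, N) f. if bd f then folner_average S N f else 0)"
  define C where "C f = (SUP u\<in>carrier G. cmod (f u))" for f :: "'a \<Rightarrow> complex"
  have C: "cmod (f u) \<le> C f" if "bd f" "u \<in> carrier G" for f u
    unfolding C_def using that by (intro cSUP_upper) (auto simp: bd_def intro: bdd_aboveI2)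
  have C_le: "C f \<le> B" if "\<And>u. u \<in> carrier G \<Longrightarrow> cmod (f u) \<le> B" for f B
    unfolding C_def using that by (intro cSUP_least) auto
  have F: "F \<noteq> bot"
    unfolding F_def by (simp add: prod_filter_eq_bot)
  have big: "\<forall>\<^sub>F (S, N) in F. finite S \<and> S \<subseteq> carrier G \<and> T \<subseteq> S \<and> 0 < N"
    if "finite T" "T \<subseteq> carrier G" for T
    unfolding F_def eventually_prod_filter case_prod_conv
    using that
    by (intro exI[of _ "\<lambda>S. finite S \<and> S \<subseteq> carrier G \<and> T \<subseteq> S"] exI[of _ "\<lambda>N. 0 < N"])
      (auto simp: eventually_finite_subsets_at_top eventually_gt_at_top)
  have "\<forall>\<^sub>F i in F. \<forall>f. cmod (\<Phi> i f) \<le> (if bd f then C f else 0)"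
    using big[of "{}"] by (rule eventually_mono, simp)
      (auto simp: \<Phi>_def intro!: folner_average_bound C)
  from pointwise_cluster_point[OF F this] obtain \<mu> where
    \<mu>_le: "\<And>f. cmod (\<mu> f) \<le> (if bd f then C f else 0)" and
    \<mu>_lim: "\<And>H c. continuous_on UNIV H \<Longrightarrow> ((\<lambda>i. H (\<Phi> i)) \<longlongrightarrow> (c::complex)) F \<Longrightarrow> H \<mu> = c"
    by blast
  show ?thesis
  proof (intro exI[of _ \<mu>] conjI allI impI)
    fix f g :: "'a \<Rightarrow> complex" and B B' :: real and c :: complex
    assume B: "\<forall>u\<in>carrier G. cmod (f u) \<le> B"
    then have bf: "bd f" by (auto simp: bd_def)
    show "cmod (\<mu> f) \<le> B"
      using \<mu>_le[of f] C_le[of f B] B bf by simp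
    have bc: "bd (\<lambda>u. c * f u)"
      unfolding bd_def norm_mult
      by (rule exI[of _ "cmod c * B"]) (use B in \<open>auto intro: mult_left_mono\<close>)
    have "\<mu> (\<lambda>u. c * f u) - c * \<mu> f = 0"
    proof (rule \<mu>_lim)
      show "((\<lambda>i. \<Phi> i (\<lambda>u. c * f u) - c * \<Phi> i f) \<longlongrightarrow> 0) F"
        using bf bc by (simp add: \<Phi>_def split_beta folner_average_def sum_distrib_left[symmetric])
    qed (intro continuous_intros)
    then show "\<mu> (\<lambda>u. c * f u) = c * \<mu> f" by simp
    show "\<mu> (\<lambda>u. f u + g u) = \<mu> f + \<mu> g" if B': "\<forall>u\<in>carrier G. cmod (g u) \<le> B'"
    proof -
      have bg: "bd g" using B' by (auto simp: bd_def)
      have bs: "bd (\<lambda>u. f u + g u)"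
        unfolding bd_def using B B' by (meson norm_add_rule_thm)
      have "\<mu> (\<lambda>u. f u + g u) - (\<mu> f + \<mu> g) = 0"
      proof (rule \<mu>_lim)
        show "((\<lambda>i. \<Phi> i (\<lambda>u. f u + g u) - (\<Phi> i f + \<Phi> i g)) \<longlongrightarrow> 0) F"
          using bf bg bs
          by (simp add: \<Phi>_def split_beta folner_average_def sum.distrib add_divide_distrib)
      qed (intro continuous_intros)
      then show ?thesis by simp
    qed
    show "\<mu> (\<lambda>u. f (w \<otimes> u)) = \<mu> f" if w: "w \<in> carrier G" for w
    proof -
      have bw: "bd (\<lambda>u. f (w \<otimes> u))"
        unfolding bd_def using B w by (intro exI[of _ B]) auto
      have lim: "((\<lambda>i. 2 * B / real (snd i)) \<longlongrightarrow> 0) F"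
        unfolding F_def
        by (rule filterlim_compose[OF _ filterlim_snd]) real_asymp
      have "\<mu> (\<lambda>u. f (w \<otimes> u)) - \<mu> f = 0"
      proof (rule \<mu>_lim)
        show "((\<lambda>i. \<Phi> i (\<lambda>u. f (w \<otimes> u)) - \<Phi> i f) \<longlongrightarrow> 0) F"
        proof (rule Lim_null_comparison[OF _ lim])
          show "\<forall>\<^sub>F i in F. cmod (\<Phi> i (\<lambda>u. f (w \<otimes> u)) - \<Phi> i f) \<le> 2 * B / real (snd i)"
            by (rule eventually_mono[OF big[of "{w}"]])
              (use w bf bw B in \<open>auto simp: \<Phi>_def intro!: folner_average_translate\<close>)
        qed
      qed (intro continuous_intros)
      then show ?thesis by simp
    qed
  next
    fix c :: complex
    have bc: "bd (\<lambda>_. c)" by (auto simp: bd_def)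
    show "\<mu> (\<lambda>u. c) = c"
    proof (rule \<mu>_lim[of "\<lambda>\<mu>. \<mu> (\<lambda>u. c)"])
      show "((\<lambda>i. \<Phi> i (\<lambda>u. c)) \<longlongrightarrow> c) F"
      proof (rule tendsto_eventually)
        show "\<forall>\<^sub>F i in F. \<Phi> i (\<lambda>u. c) = c"
          using big[of "{}"] by (rule eventually_mono, simp)
            (auto simp: \<Phi>_def bc folner_average_def card_PiE)
      qed
    qed (intro continuous_intros)
  qed
qed

section \<open>The Hahn--Banach theorem\<close>

text \<open>
  Vectors are functions on an index set with the pointwise operations. Tuples of such vectors are again of
  this form, with a larger index set, so a functional on a finite power of a space needs no further type.
\<close>

definition complex_linear_space :: "('i \<Rightarrow> complex) set \<Rightarrow> bool" where
  "complex_linear_space W \<longleftrightarrow> (\<lambda>_. 0) \<in> W \<and> (\<forall>v\<in>W. \<forall>w\<in>W. (\<lambda>i. v i + w i) \<in> W) \<and>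
     (\<forall>c. \<forall>v\<in>W. (\<lambda>i. c * v i) \<in> W)"

lemma complex_linear_spaceD:
  assumes "complex_linear_space W"
  shows "(\<lambda>_. 0) \<in> W" "v \<in> W \<Longrightarrow> w \<in> W \<Longrightarrow> (\<lambda>i. v i + w i) \<in> W"
    "v \<in> W \<Longrightarrow> (\<lambda>i. c * v i) \<in> W" "v \<in> W \<Longrightarrow> (\<lambda>i. - v i) \<in> W"
    "v \<in> W \<Longrightarrow> w \<in> W \<Longrightarrow> (\<lambda>i. v i - w i) \<in> W"
proof -
  show *: "(\<lambda>_. 0) \<in> W" "v \<in> W \<Longrightarrow> w \<in> W \<Longrightarrow> (\<lambda>i. v i + w i) \<in> W" "v \<in> W \<Longrightarrow> (\<lambda>i. c * v i) \<in> W" for v w c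
    using assms by (auto simp: complex_linear_space_def)
  show **: "v \<in> W \<Longrightarrow> (\<lambda>i. - v i) \<in> W" for v using *(3)[of v "-1"] by simp
  show "v \<in> W \<Longrightarrow> w \<in> W \<Longrightarrow> (\<lambda>i. v i - w i) \<in> W" using *(2)[OF _ **, of v w] by simp
qed

definition sublinear_on :: "('i \<Rightarrow> complex) set \<Rightarrow> (('i \<Rightarrow> complex) \<Rightarrow> real) \<Rightarrow> bool" where
  "sublinear_on W q \<longleftrightarrow>
     (\<forall>v\<in>W. \<forall>w\<in>W. q (\<lambda>i. v i + w i) \<le> q v + q w) \<and>
     (\<forall>r\<ge>0. \<forall>v\<in>W. q (\<lambda>i. complex_of_real r * v i) \<le> r * q v)"

lemma sublinear_onD:
  assumes q: "sublinear_on W q" and W: "complex_linear_space W"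
  shows "v \<in> W \<Longrightarrow> w \<in> W \<Longrightarrow> q (\<lambda>i. v i + w i) \<le> q v + q w"
    and "q (\<lambda>_. 0) = 0"
    and "v \<in> W \<Longrightarrow> 0 \<le> r \<Longrightarrow> q (\<lambda>i. complex_of_real r * v i) = r * q v"
    and "v \<in> W \<Longrightarrow> - q (\<lambda>i. - v i) \<le> q v"
proof -
  note W = complex_linear_spaceD[OF W]
  show add: "q (\<lambda>i. v i + w i) \<le> q v + q w" if "v \<in> W" "w \<in> W" for v w
    using q that by (simp add: sublinear_on_def)
  have le: "q (\<lambda>i. complex_of_real r * v i) \<le> r * q v" if "v \<in> W" "0 \<le> r" for v r
    using q that by (simp add: sublinear_on_def)
  show 0: "q (\<lambda>_. 0) = 0"
    using add[OF W(1) W(1)] le[OF W(1), of 0] by simp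
  show "q (\<lambda>i. complex_of_real r * v i) = r * q v" if v: "v \<in> W" and r: "0 \<le> r"
  proof (cases "r = 0")
    case False
    have "q (\<lambda>i. complex_of_real (1 / r) * (complex_of_real r * v i)) \<le> 1 / r * q (\<lambda>i. complex_of_real r * v i)"
      by (rule le) (use W v r in auto)
    then have "q v \<le> q (\<lambda>i. complex_of_real r * v i) / r"
      using False by (simp add: mult.assoc[symmetric])
    then show ?thesis
      using le[OF v r] r False by (simp add: le_divide_eq mult.commute)
  qed (use 0 in simp)
  show "- q (\<lambda>i. - v i) \<le> q v" if "v \<in> W"
    using add[OF that W(4)[OF that]] 0 by simp
qed

lemma le_cInf_add_cInf:
  fixes x :: real
  assumes "\<And>a b. a \<in> A \<Longrightarrow> b \<in> B \<Longrightarrow> x \<le> a + b" "A \<noteq> {}" "B \<noteq> {}"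
  shows "x \<le> Inf A + Inf B"
proof -
  have "x - b \<le> Inf A" if "b \<in> B" for b
    using assms(2) by (rule cInf_greatest) (use assms(1)[OF _ that] in \<open>simp add: diff_le_eq\<close>)
  then have "x - Inf A \<le> b" if "b \<in> B" for b
    using that by (metis diff_le_eq add.commute)
  then have "x - Inf A \<le> Inf B"
    using assms(3) by (intro cInf_greatest)
  then show ?thesis by simp
qed

text \<open>
  The two infima needed for the Hahn--Banach theorem, over a chain of sublinear functionals and along a ray or
  cone of vectors, are sublinear for the same reason: any two indices have a common one that bounds the value at
  the sum of two vectors.
\<close>

lemma sublinear_on_INF:
  assumes W: "complex_linear_space W" and "I \<noteq> {}"
    and bdd: "\<And>v. v \<in> W \<Longrightarrow> bdd_below ((\<lambda>i. p i v) ` I)"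
    and add: "\<And>v w i j. v \<in> W \<Longrightarrow> w \<in> W \<Longrightarrow> i \<in> I \<Longrightarrow> j \<in> I \<Longrightarrow>
      \<exists>k\<in>I. p k (\<lambda>x. v x + w x) \<le> p i v + p j w"
    and scale: "\<And>v r i. v \<in> W \<Longrightarrow> 0 < r \<Longrightarrow> i \<in> I \<Longrightarrow> \<exists>k\<in>I. p k (\<lambda>x. complex_of_real r * v x) \<le> r * p i v"
    and zero: "\<exists>k\<in>I. p k (\<lambda>_. 0) \<le> 0"
  shows "sublinear_on W (\<lambda>v. INF i\<in>I. p i v)"
  unfolding sublinear_on_def
proof (intro conjI ballI allI impI)
  note W = complex_linear_spaceD[OF W]
  fix v assume v: "v \<in> W"
  show "(INF i\<in>I. p i (\<lambda>x. v x + w x)) \<le> (INF i\<in>I. p i v) + (INF i\<in>I. p i w)" if w: "w \<in> W" for w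
  proof (rule le_cInf_add_cInf)
    fix a b assume "a \<in> (\<lambda>i. p i v) ` I" "b \<in> (\<lambda>i. p i w) ` I"
    then obtain i j where "i \<in> I" "j \<in> I" "a = p i v" "b = p j w" by auto
    then obtain k where "k \<in> I" "p k (\<lambda>x. v x + w x) \<le> a + b"
      using add[OF v w, of i j] by metis
    then show "(INF i\<in>I. p i (\<lambda>x. v x + w x)) \<le> a + b"
      using cINF_lower[OF bdd[OF W(2)[OF v w]], of k] by linarith
  qed (use \<open>I \<noteq> {}\<close> in auto)
  fix r :: real assume r: "0 \<le> r"
  show "(INF i\<in>I. p i (\<lambda>x. complex_of_real r * v x)) \<le> r * (INF i\<in>I. p i v)"
  proof (cases "r = 0")
    case True
    obtain k where "k \<in> I" "p k (\<lambda>_. 0) \<le> 0" using zero by blast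
    with cINF_lower[OF bdd[OF W(1)], of k] have "(INF i\<in>I. p i (\<lambda>_. 0)) \<le> 0" by linarith
    with True show ?thesis by simp
  next
    case False
    have "(INF i\<in>I. p i (\<lambda>x. complex_of_real r * v x)) / r \<le> (INF i\<in>I. p i v)"
    proof (rule cINF_greatest[OF \<open>I \<noteq> {}\<close>])
      fix i assume "i \<in> I"
      moreover have "0 < r" using r False by simp
      ultimately obtain k where "k \<in> I" "p k (\<lambda>x. complex_of_real r * v x) \<le> r * p i v"
        using scale[OF v, of r i] by metis
      then have "(INF i\<in>I. p i (\<lambda>x. complex_of_real r * v x)) \<le> r * p i v"
        using cINF_lower[OF bdd[OF W(3)[OF v, of "complex_of_real r"]], of k] by linarith
      then show "(INF i\<in>I. p i (\<lambda>x. complex_of_real r * v x)) / r \<le> p i v"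
        using r False by (simp add: divide_le_eq mult.commute)
    qed
    then show ?thesis
      using r False by (simp add: divide_le_eq mult.commute)
  qed
qed

text \<open>
  Zorn's lemma for the pointwise order. A chain below \<open>p\<close> is bounded below, because sublinearity gives
  \<open>q(v) \<ge> - q(- v) \<ge> - p(- v)\<close>, so its infimum is a sublinear lower bound.
\<close>

lemma minimal_sublinear:
  assumes W: "complex_linear_space W" and p: "sublinear_on W p"
  shows "\<exists>q. sublinear_on W q \<and> (\<forall>v\<in>W. q v \<le> p v) \<and>
    (\<forall>q'. sublinear_on W q' \<longrightarrow> (\<forall>v\<in>W. q' v \<le> q v) \<longrightarrow> (\<forall>v\<in>W. q v = q' v))"
proof -
  (* Functionals vanish off W, so that the pointwise order is antisymmetric. *)
  define \<S> where "\<S> = {q. sublinear_on W q \<and> (\<forall>v\<in>W. q v \<le> p v) \<and> (\<forall>v. v \<notin> W \<longrightarrow> q v = 0)}"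
  define P where "P q q' \<longleftrightarrow> q' \<le> q" for q q' :: "('a \<Rightarrow> complex) \<Rightarrow> real"
  have restr: "sublinear_on W (\<lambda>v. if v \<in> W then q v else 0)" if "sublinear_on W q" for q
    using that complex_linear_spaceD[OF W] by (simp add: sublinear_on_def)
  have "\<exists>m\<in>\<S>. \<forall>q\<in>\<S>. P m q \<longrightarrow> q = m"
  proof (rule predicate_Zorn)
    show "partial_order_on \<S> (relation_of P \<S>)"
      by (rule partial_order_on_relation_ofI) (auto simp: P_def)
    fix C assume "C \<in> Chains (relation_of P \<S>)"
    then have C: "C \<subseteq> \<S>" "\<And>q q'. q \<in> C \<Longrightarrow> q' \<in> C \<Longrightarrow> q \<le> q' \<or> q' \<le> q"
      by (auto simp: Chains_def relation_of_def P_def)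
    show "\<exists>u\<in>\<S>. \<forall>q\<in>C. P q u"
    proof (cases "C = {}")
      case True
      have "(\<lambda>v. if v \<in> W then p v else 0) \<in> \<S>"
        using restr[OF p] by (simp add: \<S>_def)
      with True show ?thesis by blast
    next
      case False
      define u where "u v = (INF q\<in>C. q v)" for v
      have bdd: "bdd_below ((\<lambda>q. q v) ` C)" for v
      proof (cases "v \<in> W")
        case True
        have "- p (\<lambda>i. - v i) \<le> q v" if "q \<in> C" for q
        proof -
          have "q \<in> \<S>" using that C by blast
          then have "- q (\<lambda>i. - v i) \<le> q v" "q (\<lambda>i. - v i) \<le> p (\<lambda>i. - v i)"
            using sublinear_onD(4)[OF _ W True] complex_linear_spaceD(4)[OF W True]
            by (auto simp: \<S>_def)
          then show ?thesis by linarith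
        qed
        then show ?thesis by (intro bdd_belowI2)
      next
        case False
        then show ?thesis using C(1) by (intro bdd_belowI2[of _ 0]) (auto simp: \<S>_def)
      qed
      have le: "u \<le> q" if "q \<in> C" for q
        unfolding le_fun_def u_def using bdd that by (auto intro: cINF_lower)
      have "sublinear_on W u"
        unfolding u_def
      proof (rule sublinear_on_INF[OF W False bdd])
        fix v w i j assume *: "v \<in> W" "w \<in> W" "i \<in> C" "j \<in> C"
        define k where "k = (if i \<le> j then i else j)"
        have k: "k \<in> C" "k \<le> i" "k \<le> j"
          using C(2)[OF *(3,4)] * by (auto simp: k_def)
        then have "sublinear_on W k" using C by (auto simp: \<S>_def)
        then have "k (\<lambda>x. v x + w x) \<le> k v + k w"
          using * by (simp add: sublinear_on_def)
        also have "\<dots> \<le> i v + j w"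
          using k by (intro add_mono) (auto simp: le_fun_def)
        finally show "\<exists>k\<in>C. k (\<lambda>x. v x + w x) \<le> i v + j w"
          using k(1) by blast
      next
        fix v i and r :: real assume *: "v \<in> W" "0 < r" "i \<in> C"
        then have "i (\<lambda>x. complex_of_real r * v x) \<le> r * i v"
          using C(1) by (auto simp: \<S>_def sublinear_on_def)
        then show "\<exists>k\<in>C. k (\<lambda>x. complex_of_real r * v x) \<le> r * i v"
          using *(3) by blast
      next
        obtain k where "k \<in> C" using False by blast
        moreover have "k (\<lambda>_. 0) = 0"
          using sublinear_onD(2)[OF _ W] C(1) calculation by (auto simp: \<S>_def)
        ultimately show "\<exists>k\<in>C. k (\<lambda>_. 0) \<le> 0" by (intro bexI[of _ k]) auto
      qed
      moreover have "u v \<le> p v" if "v \<in> W" for v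
      proof -
        obtain q where "q \<in> C" using False by blast
        then have "u v \<le> q v" "q v \<le> p v"
          using le[of q] C(1) that by (auto simp: \<S>_def le_fun_def)
        then show ?thesis by linarith
      qed
      moreover have "u v = 0" if "v \<notin> W" for v
      proof -
        have "u v = (INF q\<in>C. 0)"
          unfolding u_def using C(1) that by (intro INF_cong) (auto simp: \<S>_def)
        then show ?thesis using False by simp
      qed
      ultimately have "u \<in> \<S>" by (simp add: \<S>_def)
      then show ?thesis using le by (auto simp: P_def)
    qed
  qed
  then obtain q where q: "q \<in> \<S>" "\<And>q'. q' \<in> \<S> \<Longrightarrow> q' \<le> q \<Longrightarrow> q' = q"
    by (auto simp: P_def)
  show ?thesis
  proof (intro exI[of _ q] conjI ballI allI impI)
    show "sublinear_on W q" using q(1) by (auto simp: \<S>_def)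
    show "q v \<le> p v" if "v \<in> W" for v
      using q(1) that by (auto simp: \<S>_def)
    fix q' v assume q': "sublinear_on W q'" "\<forall>v\<in>W. q' v \<le> q v" and v: "v \<in> W"
    define q'' where "q'' v = (if v \<in> W then q' v else 0)" for v
    have "q'' v \<le> p v" if "v \<in> W" for v
      using q'(2) q(1) that by (fastforce simp: \<S>_def q''_def)
    moreover have "q'' = (\<lambda>v. if v \<in> W then q' v else 0)"
      by (auto simp: q''_def)
    ultimately have "q'' \<in> \<S>"
      using restr[OF q'(1)] by (simp add: \<S>_def)
    moreover have "q'' \<le> q"
      using q'(2) q(1) by (auto simp: le_fun_def q''_def \<S>_def)
    ultimately have "q'' = q" by (rule q(2))
    then show "q v = q' v" using v q''_def by metis
  qed
qed

text \<open>
  A minimal sublinear functional \<open>q\<close> is linear. For fixed \<open>w\<close> the functional \<open>v \<mapsto> inf\<^sub>t (q(v + t w) - t q(w))\<close>, with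
  \<open>t \<ge> 0\<close>, is sublinear and at most \<open>q\<close>, hence equal to \<open>q\<close>, and \<open>t = 1\<close> gives \<open>q(v) + q(w) \<le> q(v + w)\<close>.
\<close>

lemma sublinear_dominates_linear:
  assumes W: "complex_linear_space W" and p: "sublinear_on W p"
  shows "\<exists>\<phi>. (\<forall>v\<in>W. \<phi> v \<le> p v) \<and> (\<forall>v\<in>W. \<forall>w\<in>W. \<phi> (\<lambda>i. v i + w i) = \<phi> v + \<phi> w) \<and>
    (\<forall>v\<in>W. \<forall>r. \<phi> (\<lambda>i. complex_of_real r * v i) = r * \<phi> v)"
proof -
  note Wd = complex_linear_spaceD[OF W]
  obtain q where q: "sublinear_on W q" and qp: "\<forall>v\<in>W. q v \<le> p v" and
    qmin: "\<forall>q'. sublinear_on W q' \<longrightarrow> (\<forall>v\<in>W. q' v \<le> q v) \<longrightarrow> (\<forall>v\<in>W. q v = q' v)"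
    using minimal_sublinear[OF W p] by (elim exE conjE)
  note qd = sublinear_onD[OF q W]
  have add: "q (\<lambda>i. v i + w i) = q v + q w" if v: "v \<in> W" and w: "w \<in> W" for v w
  proof -
    define f where "f t v = q (\<lambda>i. v i + complex_of_real t * w i) - t * q w" for t v
    have bdd: "bdd_below ((\<lambda>t. f t v) ` {0..})" if v: "v \<in> W" for v
    proof (rule bdd_belowI2)
      fix t :: real assume "t \<in> {0..}"
      then have "t * q w = q (\<lambda>i. (v i + complex_of_real t * w i) + - v i)"
        using qd(3)[OF w, of t] by simp
      also have "\<dots> \<le> q (\<lambda>i. v i + complex_of_real t * w i) + q (\<lambda>i. - v i)"
        by (intro qd(1) Wd v w)
      finally show "- q (\<lambda>i. - v i) \<le> f t v" by (simp add: f_def)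
    qed
    have "sublinear_on W (\<lambda>v. INF t\<in>{0..}. f t v)"
    proof (rule sublinear_on_INF[OF W _ bdd])
      fix v v' i j assume *: "v \<in> W" "v' \<in> W" "i \<in> {0::real..}" "j \<in> {0::real..}"
      have "q (\<lambda>x. (v x + v' x) + complex_of_real (i + j) * w x)
          = q (\<lambda>x. (v x + complex_of_real i * w x) + (v' x + complex_of_real j * w x))"
        by (rule arg_cong[of _ _ q]) (auto simp: algebra_simps)
      also have "\<dots> \<le> q (\<lambda>x. v x + complex_of_real i * w x) + q (\<lambda>x. v' x + complex_of_real j * w x)"
        by (intro qd(1) Wd * w)
      finally have "f (i + j) (\<lambda>x. v x + v' x) \<le> f i v + f j v'"
        unfolding f_def distrib_right[of i j] by linarith
      then show "\<exists>k\<in>{0..}. f k (\<lambda>x. v x + v' x) \<le> f i v + f j v'"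
        using * by (intro bexI[of _ "i + j"]) auto
    next
      fix v i and r :: real assume *: "v \<in> W" "0 < r" "i \<in> {0::real..}"
      have "q (\<lambda>x. complex_of_real r * v x + complex_of_real (r * i) * w x)
          = q (\<lambda>x. complex_of_real r * (v x + complex_of_real i * w x))"
        by (rule arg_cong[of _ _ q]) (auto simp: algebra_simps)
      also have "\<dots> = r * q (\<lambda>x. v x + complex_of_real i * w x)"
        using * by (intro qd(3) Wd w) auto
      finally have "f (r * i) (\<lambda>x. complex_of_real r * v x) \<le> r * f i v"
        unfolding f_def right_diff_distrib by simp
      then show "\<exists>k\<in>{0..}. f k (\<lambda>x. complex_of_real r * v x) \<le> r * f i v"
        using * by (intro bexI[of _ "r * i"]) auto
    next
      show "\<exists>k\<in>{0..}. f k (\<lambda>_. 0) \<le> 0"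
        by (intro bexI[of _ 0]) (simp_all add: f_def qd(2))
    qed simp_all
    moreover have "(INF t\<in>{0..}. f t v) \<le> q v" if "v \<in> W" for v
      using cINF_lower[OF bdd[OF that], of 0] by (simp add: f_def)
    ultimately have "q v = (INF t\<in>{0..}. f t v)"
      using qmin v by meson
    also have "\<dots> \<le> f 1 v"
      using bdd[OF v] by (intro cINF_lower) auto
    finally show ?thesis
      using qd(1)[OF v w] by (simp add: f_def)
  qed
  have "q (\<lambda>i. complex_of_real r * v i) = r * q v" if v: "v \<in> W" for v r
  proof (cases "0 \<le> r")
    case False
    have "q (\<lambda>i. complex_of_real r * v i + complex_of_real (- r) * v i)
        = q (\<lambda>i. complex_of_real r * v i) + q (\<lambda>i. complex_of_real (- r) * v i)"
      by (intro add Wd v)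
    then show ?thesis
      using qd(2) qd(3)[OF v, of "- r"] False by simp
  qed (use qd(3) v in simp)
  with qp add show ?thesis by (intro exI[of _ q]) simp
qed

text \<open>
  The distance of \<open>b\<close> from \<open>Y\<close> is at least \<open>\<epsilon>\<close>, and a linear functional below the sublinear
  \<open>p(v) = inf (N(v + t b + y) - t \<epsilon>)\<close>, over \<open>t \<ge> 0\<close> and \<open>y \<in> Y\<close>, is bounded by \<open>N\<close>, vanishes on \<open>Y\<close> and is at least
  \<open>\<epsilon>\<close> at \<open>b\<close>. The factor \<open>2\<close> comes from estimating the real and the imaginary part of its
  complexification \<open>\<phi>(v) - \<i> \<phi>(\<i> v)\<close> separately.
\<close>

lemma separating_functional:
  assumes W: "complex_linear_space W" and Y: "complex_linear_space Y" "Y \<subseteq> W" and b: "b \<in> W"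
    and Nadd: "\<And>v w. v \<in> W \<Longrightarrow> w \<in> W \<Longrightarrow> N (\<lambda>i. v i + w i) \<le> N v + N w"
    and Nscale: "\<And>c v. v \<in> W \<Longrightarrow> N (\<lambda>i. c * v i) = cmod c * N v"
    and \<epsilon>: "0 < \<epsilon>" "\<And>y. y \<in> Y \<Longrightarrow> \<epsilon> \<le> N (\<lambda>i. b i + y i)"
  shows "\<exists>\<phi> :: ('i \<Rightarrow> complex) \<Rightarrow> complex.
    (\<forall>v\<in>W. \<forall>w\<in>W. \<phi> (\<lambda>i. v i + w i) = \<phi> v + \<phi> w) \<and> (\<forall>c. \<forall>v\<in>W. \<phi> (\<lambda>i. c * v i) = c * \<phi> v) \<and>
    (\<forall>v\<in>W. cmod (\<phi> v) \<le> 2 * N v) \<and> (\<forall>y\<in>Y. \<phi> y = 0) \<and> \<phi> b \<noteq> 0"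
proof -
  note Wd = complex_linear_spaceD[OF W] and Yd = complex_linear_spaceD[OF Y(1)]
  have YW: "y \<in> W" if "y \<in> Y" for y using that Y(2) by blast
  have N0: "N (\<lambda>_. 0) = 0" using Nscale[OF Wd(1), of 0] by simp
  have Nminus: "N (\<lambda>i. - v i) = N v" if "v \<in> W" for v
    using Nscale[OF that, of "-1"] by simp
  have Npos: "0 \<le> N v" if "v \<in> W" for v
    using Nadd[OF that Wd(4)[OF that]] Nminus[OF that] N0 by simp
  define g where "g = (\<lambda>(t, y) v. N (\<lambda>i. v i + (complex_of_real t * b i + y i)) - t * \<epsilon>)"
  define p where "p v = (INF ty\<in>{0::real..} \<times> Y. g ty v)" for v
  have lower: "- N v \<le> g (t, y) v" if v: "v \<in> W" and t: "0 \<le> t" and y: "y \<in> Y" for v t y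
  proof -
    have mem: "(\<lambda>i. complex_of_real t * b i + y i) \<in> W"
      by (intro Wd b YW y)
    have "t * \<epsilon> \<le> N (\<lambda>i. complex_of_real t * b i + y i)"
    proof (cases "t = 0")
      case False
      have "(\<lambda>i. complex_of_real t * b i + y i)
          = (\<lambda>i. complex_of_real t * (b i + complex_of_real (1 / t) * y i))"
        using False by (auto simp: algebra_simps)
      then have "N (\<lambda>i. complex_of_real t * b i + y i) = t * N (\<lambda>i. b i + complex_of_real (1 / t) * y i)"
        using Nscale[OF Wd(2)[OF b Wd(3)[OF YW[OF y]]], of "complex_of_real t" "complex_of_real (1 / t)"] t
        by simp
      moreover have "\<epsilon> \<le> N (\<lambda>i. b i + complex_of_real (1 / t) * y i)"
        by (intro \<epsilon>(2) Yd y)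
      ultimately show ?thesis using t by (simp add: mult_left_mono)
    qed (use Npos[OF mem] in simp)
    also have "\<dots> = N (\<lambda>i. (v i + (complex_of_real t * b i + y i)) + - v i)" by simp
    also have "\<dots> \<le> N (\<lambda>i. v i + (complex_of_real t * b i + y i)) + N (\<lambda>i. - v i)"
      by (intro Nadd Wd v mem)
    finally show ?thesis using Nminus[OF v] by (simp add: g_def)
  qed
  have bdd: "bdd_below ((\<lambda>ty. g ty v) ` ({0::real..} \<times> Y))" if "v \<in> W" for v
    using lower[OF that] by (intro bdd_belowI2[of _ "- N v"]) auto
  have p_le: "p v \<le> g (t, y) v" if "v \<in> W" "0 \<le> t" "y \<in> Y" for v t y
    unfolding p_def using bdd[OF that(1)] that by (intro cINF_lower) auto
  have "sublinear_on W p"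
    unfolding p_def
  proof (rule sublinear_on_INF[OF W _ bdd])
    have "(0, \<lambda>_. 0) \<in> {0::real..} \<times> Y" using Yd(1) by simp
    then show "{0::real..} \<times> Y \<noteq> {}" by blast
    show "\<exists>k\<in>{0::real..} \<times> Y. g k (\<lambda>_. 0) \<le> 0"
      by (intro bexI[of _ "(0, \<lambda>_. 0)"]) (auto simp: g_def N0 Yd(1))
    fix v w ty ty' assume vw: "v \<in> W" "w \<in> W" and "ty \<in> {0::real..} \<times> Y" "ty' \<in> {0::real..} \<times> Y"
    then obtain t y t' y' where ty: "ty = (t, y)" "ty' = (t', y')" "0 \<le> t" "0 \<le> t'" "y \<in> Y" "y' \<in> Y"
      by auto
    have "N (\<lambda>i. (v i + w i) + (complex_of_real (t + t') * b i + (y i + y' i)))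
        = N (\<lambda>i. (v i + (complex_of_real t * b i + y i)) + (w i + (complex_of_real t' * b i + y' i)))"
      by (rule arg_cong[of _ _ N]) (auto simp: algebra_simps)
    also have "\<dots> \<le> N (\<lambda>i. v i + (complex_of_real t * b i + y i)) + N (\<lambda>i. w i + (complex_of_real t' * b i + y' i))"
      by (intro Nadd Wd vw b YW ty)
    finally show "\<exists>k\<in>{0::real..} \<times> Y. g k (\<lambda>x. v x + w x) \<le> g ty v + g ty' w"
      using ty by (intro bexI[of _ "(t + t', \<lambda>i. y i + y' i)"]) (auto simp: g_def Yd algebra_simps)
  next
    fix v ty and r :: real assume v: "v \<in> W" and r: "0 < r" and "ty \<in> {0::real..} \<times> Y"
    then obtain t y where ty: "ty = (t, y)" "0 \<le> t" "y \<in> Y"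
      by auto
    have "N (\<lambda>i. complex_of_real r * v i + (complex_of_real (r * t) * b i + complex_of_real r * y i))
        = N (\<lambda>i. complex_of_real r * (v i + (complex_of_real t * b i + y i)))"
      by (rule arg_cong[of _ _ N]) (auto simp: algebra_simps)
    also have "\<dots> = r * N (\<lambda>i. v i + (complex_of_real t * b i + y i))"
    proof -
      have "(\<lambda>i. v i + (complex_of_real t * b i + y i)) \<in> W" by (intro Wd v b YW ty)
      then show ?thesis using r by (simp add: Nscale)
    qed
    finally show "\<exists>k\<in>{0::real..} \<times> Y. g k (\<lambda>x. complex_of_real r * v x) \<le> r * g ty v"
      using ty r by (intro bexI[of _ "(r * t, \<lambda>i. complex_of_real r * y i)"]) (auto simp: g_def Yd algebra_simps)
  qed
  from sublinear_dominates_linear[OF W this] obtain \<phi> where \<phi>p': "\<forall>v\<in>W. \<phi> v \<le> p v"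
    and \<phi>add': "\<forall>v\<in>W. \<forall>w\<in>W. \<phi> (\<lambda>i. v i + w i) = \<phi> v + \<phi> w"
    and \<phi>scale': "\<forall>v\<in>W. \<forall>r. \<phi> (\<lambda>i. complex_of_real r * v i) = r * \<phi> v"
    by (elim exE conjE)
  note \<phi>p = \<phi>p'[rule_format] and \<phi>add = \<phi>add'[rule_format] and \<phi>scale = \<phi>scale'[rule_format]
  have \<phi>minus: "\<phi> (\<lambda>i. - v i) = - \<phi> v" if "v \<in> W" for v
    using \<phi>scale[OF that, of "-1"] by simp
  have \<phi>N: "\<phi> v \<le> N v" if "v \<in> W" for v
    using \<phi>p[OF that] p_le[OF that _ Yd(1), of 0] by (simp add: g_def)
  have \<phi>abs: "\<bar>\<phi> v\<bar> \<le> N v" if "v \<in> W" for v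
    using \<phi>N[OF that] \<phi>N[OF Wd(4)[OF that]] \<phi>minus[OF that] Nminus[OF that] by simp
  have \<phi>Y_le: "\<phi> y \<le> 0" if "y \<in> Y" for y
    using \<phi>p[OF YW[OF that]] p_le[OF YW[OF that] _ Yd(4)[OF that], of 0] by (simp add: g_def N0)
  have \<phi>Y: "\<phi> y = 0" if "y \<in> Y" for y
    using \<phi>Y_le[OF that] \<phi>Y_le[OF Yd(4)[OF that]] \<phi>minus[OF YW[OF that]] by simp
  have \<phi>b: "\<phi> b \<ge> \<epsilon>"
    using \<phi>p[OF Wd(4)[OF b]] p_le[OF Wd(4)[OF b] _ Yd(1), of 1] \<phi>minus[OF b] by (simp add: g_def N0)
  define \<Phi> where "\<Phi> v = complex_of_real (\<phi> v) - \<i> * complex_of_real (\<phi> (\<lambda>i. \<i> * v i))" for v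
  show ?thesis
  proof (intro exI[of _ \<Phi>] conjI ballI allI)
    fix v assume v: "v \<in> W"
    show "\<Phi> (\<lambda>i. v i + w i) = \<Phi> v + \<Phi> w" if w: "w \<in> W" for w
      using \<phi>add[OF v w] \<phi>add[OF Wd(3)[OF v] Wd(3)[OF w], of \<i> \<i>]
      by (simp add: \<Phi>_def algebra_simps)
    show "cmod (\<Phi> v) \<le> 2 * N v"
    proof -
      have "cmod (\<Phi> v) \<le> \<bar>\<phi> v\<bar> + \<bar>\<phi> (\<lambda>i. \<i> * v i)\<bar>"
        unfolding \<Phi>_def by (rule order_trans[OF norm_triangle_ineq4]) (simp add: norm_mult)
      also have "\<dots> \<le> N v + N v"
        using \<phi>abs[OF v] \<phi>abs[OF Wd(3)[OF v], of \<i>] Nscale[OF v, of \<i>] by simp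
      finally show ?thesis by simp
    qed
    show "\<Phi> (\<lambda>i. c * v i) = c * \<Phi> v" for c
    proof -
      have lin: "\<phi> (\<lambda>i. d * v i) = Re d * \<phi> v + Im d * \<phi> (\<lambda>i. \<i> * v i)" for d
      proof -
        have "(\<lambda>i. d * v i) = (\<lambda>i. complex_of_real (Re d) * v i + complex_of_real (Im d) * (\<i> * v i))"
          by (rule ext) (subst (1) complex_eq[of d], simp add: algebra_simps)
        then have "\<phi> (\<lambda>i. d * v i) = \<phi> (\<lambda>i. complex_of_real (Re d) * v i) + \<phi> (\<lambda>i. complex_of_real (Im d) * (\<i> * v i))"
          by (simp add: \<phi>add Wd v)
        then show ?thesis
          by (simp add: \<phi>scale Wd v)
      qed
      show ?thesis
        using lin[of c] lin[of "\<i> * c"]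
        by (simp add: \<Phi>_def complex_eq_iff mult.assoc[symmetric])
    qed
  next
    show "\<Phi> y = 0" if "y \<in> Y" for y
      using \<phi>Y[OF that] \<phi>Y[OF Yd(3)[OF that]] by (simp add: \<Phi>_def)
    show "\<Phi> b \<noteq> 0"
      using \<phi>b \<epsilon>(1) by (auto simp: \<Phi>_def complex_eq_iff)
  qed
qed

section \<open>Unconditional summability\<close>

text \<open>
  Inside each block \<open>{n k..<n (Suc k)}\<close> a chosen subset is moved to the front. The partial sums of a series
  rearranged in this way contain the sum over \<open>A k\<close> as the difference of two of them.
\<close>

lemma permutation_of_blocks:
  fixes n :: "nat \<Rightarrow> nat"
  assumes n: "strict_mono n" "n 0 = 0" and A: "\<And>k. A k \<subseteq> {n k..<n (Suc k)}"
  obtains \<pi> :: "nat \<Rightarrow> nat" where "bij \<pi>"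
    "\<And>k. \<pi> ` {..<n k} = {..<n k}" "\<And>k. \<pi> ` {..<n k + card (A k)} = {..<n k} \<union> A k"
proof -
  define B where "B k = {n k..<n (Suc k)}" for k
  have fA: "finite (A k)" for k using A finite_subset by blast
  have card_A: "n k + card (A k) \<le> n (Suc k)" for k
    using card_mono[OF _ A[of k]] strict_monoD[OF n(1), of k "Suc k"] by simp
  have ex: "\<exists>p. bij_betw p (B k) (B k) \<and> p ` {n k..<n k + card (A k)} = A k" for k
  proof -
    let ?C = "{n k..<n k + card (A k)}"
    have C: "?C \<subseteq> B k" using card_A by (auto simp: B_def)
    obtain p where p: "bij_betw p ?C (A k)"
      using finite_same_card_bij[of ?C "A k"] fA by auto
    have "card (B k - ?C) = card (B k - A k)"
      using C A[of k] fA[of k] by (simp add: card_Diff_subset B_def)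
    then obtain p' where p': "bij_betw p' (B k - ?C) (B k - A k)"
      using finite_same_card_bij[of "B k - ?C" "B k - A k"] by (auto simp: B_def)
    have "bij_betw (\<lambda>x. if x \<in> ?C then p x else p' x) (?C \<union> (B k - ?C)) (A k \<union> (B k - A k))"
      using p p' by (rule bij_betw_disjoint_Un) auto
    moreover have "?C \<union> (B k - ?C) = B k" "A k \<union> (B k - A k) = B k"
      using C A[of k] by (auto simp: B_def)
    ultimately have "bij_betw (\<lambda>x. if x \<in> ?C then p x else p' x) (B k) (B k)"
      by (simp only:)
    moreover have "(\<lambda>x. if x \<in> ?C then p x else p' x) ` ?C = A k"
      using p by (simp add: bij_betw_def)
    ultimately show ?thesis by blast
  qed
  then obtain P where P: "\<And>k. bij_betw (P k) (B k) (B k)"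
    "\<And>k. P k ` {n k..<n k + card (A k)} = A k" by metis
  define blk where "blk j = (LEAST k. j < n (Suc k))" for j
  have ge: "k \<le> n k" for k using n(1) by (rule strict_mono_imp_increasing)
  have blk: "j \<in> B (blk j)" for j
  proof -
    have "j < n (Suc (blk j))"
      using ge[of "Suc j"] LeastI[of "\<lambda>k. j < n (Suc k)" j] by (simp add: blk_def)
    moreover have "n (blk j) \<le> j"
    proof (cases "blk j")
      case (Suc i)
      then have "\<not> j < n (Suc i)" using not_less_Least[of i "\<lambda>k. j < n (Suc k)"] unfolding blk_def by simp
      with Suc show ?thesis by simp
    qed (simp add: n)
    ultimately show ?thesis by (simp add: B_def)
  qed
  have uniq: "k = k'" if "j \<in> B k" "j \<in> B k'" for j k k'
  proof (rule ccontr)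
    assume "k \<noteq> k'"
    then have "Suc k \<le> k' \<or> Suc k' \<le> k" by auto
    then have "n (Suc k) \<le> n k' \<or> n (Suc k') \<le> n k"
      using strict_mono_mono[OF n(1)] by (auto simp: mono_def)
    with that show False by (auto simp: B_def)
  qed
  have blkI: "blk j = k" if "j \<in> B k" for j k using uniq[OF blk that] .
  define \<pi> where "\<pi> j = P (blk j) j" for j
  have \<pi>_B: "\<pi> ` B k = B k" for k
    using P(1)[of k] blkI by (force simp: \<pi>_def bij_betw_def)
  have UB: "{..<n k} = (\<Union>i<k. B i)" for k
  proof (induction k)
    case (Suc k)
    have "{..<n (Suc k)} = {..<n k} \<union> B k"
      using strict_monoD[OF n(1), of k "Suc k"] by (auto simp: B_def)
    then show ?case unfolding Suc by (auto simp: lessThan_Suc)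
  qed (simp add: n)
  have blocks: "\<pi> ` {..<n k} = {..<n k}" for k
    unfolding UB image_UN \<pi>_B ..
  show thesis
  proof (rule that)
    show "bij \<pi>"
    proof (rule bijI)
      show "inj \<pi>"
      proof (rule injI)
        fix i j assume eq: "\<pi> i = \<pi> j"
        have "\<pi> i \<in> B (blk i)" "\<pi> j \<in> B (blk j)" using \<pi>_B blk by blast+
        then have b: "blk i = blk j" using uniq eq by metis
        then show "i = j"
          using eq P(1)[of "blk j"] blk[of i] blk[of j] by (auto simp: \<pi>_def bij_betw_def inj_on_def)
      qed
      show "surj \<pi>"
        unfolding surj_def using \<pi>_B blk by blast
    qed
    show "\<pi> ` {..<n k} = {..<n k}" for k by (rule blocks)
    show "\<pi> ` {..<n k + card (A k)} = {..<n k} \<union> A k" for k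
    proof -
      have "\<pi> ` {n k..<n k + card (A k)} = P k ` {n k..<n k + card (A k)}"
      proof (rule image_cong)
        fix j assume "j \<in> {n k..<n k + card (A k)}"
        then have "j \<in> B k" using card_A[of k] by (auto simp: B_def)
        then show "\<pi> j = P k j" by (simp add: \<pi>_def blkI)
      qed simp
      moreover have "{..<n k + card (A k)} = {..<n k} \<union> {n k..<n k + card (A k)}" by auto
      ultimately show ?thesis by (simp add: image_Un blocks P(2))
    qed
  qed
qed

text \<open>
  Otherwise there are finite sets arbitrarily far out with sums of norm at least \<open>\<epsilon>\<close>; a permutation that
  enumerates infinitely many of them as contiguous blocks has partial sums that are not Cauchy.
\<close>

lemma unconditionally_summable_small_tails:
  fixes f :: "'i \<Rightarrow> 'v::real_normed_vector"
  assumes I: "countable I" and f: "unconditionally_summable f I" and \<epsilon>: "0 < \<epsilon>"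
  shows "\<exists>F. finite F \<and> F \<subseteq> I \<and> (\<forall>F'. finite F' \<longrightarrow> F' \<subseteq> I - F \<longrightarrow> norm (sum f F') < \<epsilon>)"
proof (rule ccontr)
  assume neg: "\<not> ?thesis"
  have big: "\<exists>F'. finite F' \<and> F' \<subseteq> I - F \<and> \<epsilon> \<le> norm (sum f F')" if "finite F" "F \<subseteq> I" for F
  proof -
    have "\<forall>F. finite F \<and> F \<subseteq> I \<longrightarrow> (\<exists>F'. finite F' \<and> F' \<subseteq> I - F \<and> \<not> norm (sum f F') < \<epsilon>)"
      using neg by simp
    then show ?thesis using that by (simp add: not_less)
  qed
  have inf: "infinite I"
    using big[of I] \<epsilon> by auto
  define e where "e = from_nat_into I"
  have e: "bij_betw e UNIV I"
    unfolding e_def using I inf by (rule bij_betw_from_nat_into)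
  have "\<exists>A. finite A \<and> A \<subseteq> {m..} \<and> \<epsilon> \<le> norm (sum (f \<circ> e) A)" for m
  proof -
    obtain F' where F': "finite F'" "F' \<subseteq> I - e ` {..<m}" "\<epsilon> \<le> norm (sum f F')"
      using big[of "e ` {..<m}"] e by (auto simp: bij_betw_def)
    define A where "A = e -` F'"
    have eA: "e ` A = F'" using F' e by (auto simp: A_def bij_betw_def)
    have inj: "inj e" using e by (simp add: bij_betw_def)
    have "finite A" unfolding A_def using F'(1) inj by (rule finite_vimageI)
    moreover have "A \<subseteq> {m..}" using F'(2) by (fastforce simp: A_def not_less[symmetric])
    moreover have "sum (f \<circ> e) A = sum f F'"
      using inj eA by (metis inj_on_subset subset_UNIV sum.reindex)
    ultimately show ?thesis using F'(3) by auto
  qed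
  then obtain A where A: "\<And>m. finite (A m)" "\<And>m. A m \<subseteq> {m..}" "\<And>m. \<epsilon> \<le> norm (sum (f \<circ> e) (A m))"
    by metis
  define n where "n = rec_nat 0 (\<lambda>_ m. Suc (Max (insert m (A m))))"
  have n_Suc: "n (Suc k) = Suc (Max (insert (n k) (A (n k))))" and n_0: "n 0 = 0" for k
    by (simp_all add: n_def)
  have A_le: "i < n (Suc k)" if "i \<in> insert (n k) (A (n k))" for i k
    unfolding n_Suc less_Suc_eq_le using that A(1) by (intro Max_ge) auto
  have mono: "strict_mono n"
    using A_le by (auto simp: strict_mono_Suc_iff)
  obtain \<pi> where \<pi>: "bij \<pi>" "\<And>k. \<pi> ` {..<n k} = {..<n k}"
    "\<And>k. \<pi> ` {..<n k + card (A (n k))} = {..<n k} \<union> A (n k)"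
  proof (rule permutation_of_blocks[OF mono n_0, of "\<lambda>k. A (n k)"])
    show "A (n k) \<subseteq> {n k..<n (Suc k)}" for k
      using A(2)[of "n k"] A_le[of _ k] by auto
  qed blast
  define h where "h j = f (e (\<pi> j))" for j
  have e\<pi>: "bij_betw (e \<circ> \<pi>) UNIV I"
    using \<pi>(1) e by (rule bij_betw_trans)
  from f obtain v where v: "\<forall>\<sigma>. bij_betw \<sigma> UNIV I \<longrightarrow> (\<lambda>N. \<Sum>n\<le>N. f (\<sigma> n)) \<longlonglongrightarrow> v"
    unfolding unconditionally_summable_def by (elim exE)
  have "(\<lambda>N. \<Sum>j\<le>N. h j) \<longlonglongrightarrow> v"
    using v[rule_format, OF e\<pi>] by (simp add: h_def)
  then have "Cauchy (\<lambda>N. \<Sum>j<N. h j)"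
    unfolding LIMSEQ_lessThan_iff_atMost[symmetric] by (rule LIMSEQ_imp_Cauchy)
  then obtain M where M: "\<And>i j. M \<le> i \<Longrightarrow> M \<le> j \<Longrightarrow> dist (\<Sum>j<i. h j) (\<Sum>j<j. h j) < \<epsilon>"
    using \<epsilon> unfolding Cauchy_def by metis
  define k where "k = n M"
  have kM: "M \<le> k" unfolding k_def using mono by (rule strict_mono_imp_increasing)
  have sum_h: "(\<Sum>j<i. h j) = sum (f \<circ> e) (\<pi> ` {..<i})" for i
    using \<pi>(1) by (subst sum.reindex) (auto simp: h_def o_def bij_def inj_on_def)
  have "(\<Sum>j<k + card (A k). h j) = sum (f \<circ> e) {..<k} + sum (f \<circ> e) (A k)"
    unfolding sum_h k_def \<pi>(3)
    using A(1,2)[of "n M"] by (intro sum.union_disjoint) auto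
  moreover have "(\<Sum>j<k. h j) = sum (f \<circ> e) {..<k}"
    unfolding sum_h k_def \<pi>(2) ..
  ultimately have "norm (sum (f \<circ> e) (A k)) < \<epsilon>"
    using M[of "k + card (A k)" k] kM by (simp add: dist_norm)
  with A(3)[of k] show False by simp
qed

text \<open>
  Split the real parts and the imaginary parts by sign: each of the four partial sums is at most \<open>\<epsilon>\<close> in
  absolute value.
\<close>

lemma sum_cmod_le:
  fixes z :: "'i \<Rightarrow> complex"
  assumes "finite A" and \<epsilon>: "\<And>B. B \<subseteq> A \<Longrightarrow> cmod (sum z B) \<le> \<epsilon>"
  shows "(\<Sum>i\<in>A. cmod (z i)) \<le> 4 * \<epsilon>"
proof -
  have real: "(\<Sum>i\<in>A. \<bar>r i\<bar>) \<le> 2 * \<epsilon>" if r: "\<And>B. B \<subseteq> A \<Longrightarrow> \<bar>sum r B\<bar> \<le> \<epsilon>" for r :: "'i \<Rightarrow> real"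
  proof -
    have "(\<Sum>i\<in>A. \<bar>r i\<bar>) = (\<Sum>i\<in>{i\<in>A. 0 \<le> r i}. \<bar>r i\<bar>) + (\<Sum>i\<in>A - {i\<in>A. 0 \<le> r i}. \<bar>r i\<bar>)"
      using \<open>finite A\<close> by (subst add.commute) (rule sum.subset_diff, auto)
    also have "\<dots> = sum r {i\<in>A. 0 \<le> r i} - sum r (A - {i\<in>A. 0 \<le> r i})"
      by (simp add: sum_negf[symmetric] del: sum_negf) (rule sum.cong, auto)
    also have "\<dots> \<le> 2 * \<epsilon>"
      using r[of "{i\<in>A. 0 \<le> r i}"] r[of "A - {i\<in>A. 0 \<le> r i}"] by auto
    finally show ?thesis .
  qed
  have "(\<Sum>i\<in>A. cmod (z i)) \<le> (\<Sum>i\<in>A. \<bar>Re (z i)\<bar> + \<bar>Im (z i)\<bar>)"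
    by (intro sum_mono cmod_le)
  also have "\<dots> \<le> 2 * \<epsilon> + 2 * \<epsilon>"
    unfolding sum.distrib
  proof (intro add_mono real)
    fix B assume "B \<subseteq> A"
    then have "cmod (sum z B) \<le> \<epsilon>" by (rule \<epsilon>)
    then show "\<bar>sum (\<lambda>i. Re (z i)) B\<bar> \<le> \<epsilon>" "\<bar>sum (\<lambda>i. Im (z i)) B\<bar> \<le> \<epsilon>"
      unfolding Re_sum[symmetric] Im_sum[symmetric]
      using abs_Re_le_cmod abs_Im_le_cmod order_trans by blast+
  qed
  finally show ?thesis by simp
qed

section \<open>Bounded continuous functions\<close>

lemma apply_cx_mult [simp]: "apply_bcontfun (cx_mult p q) x = apply_bcontfun p x * apply_bcontfun q x"
  unfolding cx_mult_def
  by (subst Bcontfun_inverse)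
    (auto intro!: bcontfun_normI[where b = "norm p * norm q"] continuous_intros mult_mono norm_bounded
      simp: norm_mult)

lemma apply_cx_scale [simp]: "apply_bcontfun (cx_scale c p) x = c * apply_bcontfun p x"
  unfolding cx_scale_def
  by (subst Bcontfun_inverse)
    (auto intro!: bcontfun_normI[where b = "norm c * norm p"] continuous_intros mult_mono norm_bounded
      simp: norm_mult)

lemma apply_cx_abs [simp]: "apply_bcontfun (cx_abs p) x = complex_of_real (cmod (apply_bcontfun p x))"
  unfolding cx_abs_def
  by (subst Bcontfun_inverse)
    (auto intro!: bcontfun_normI[where b = "norm p"] continuous_intros norm_bounded)

lemma apply_bcontfun_sum: "apply_bcontfun (sum f F) x = (\<Sum>g\<in>F. apply_bcontfun (f g) x)"
  by (induction F rule: infinite_finite_induct) auto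

definition uniformly_abs_summable :: "('i \<Rightarrow> ('x::topological_space \<Rightarrow>\<^sub>C complex)) \<Rightarrow> 'i set \<Rightarrow> bool" where
  "uniformly_abs_summable f I \<longleftrightarrow> (\<forall>\<epsilon>>0. \<exists>F. finite F \<and> F \<subseteq> I \<and>
     (\<forall>F' x. finite F' \<longrightarrow> F' \<subseteq> I - F \<longrightarrow> (\<Sum>g\<in>F'. cmod (apply_bcontfun (f g) x)) \<le> \<epsilon>))"

lemma uniformly_abs_summableD:
  assumes "uniformly_abs_summable f I" "0 < \<epsilon>"
  obtains F where "finite F" "F \<subseteq> I"
    "\<And>F' x. finite F' \<Longrightarrow> F' \<subseteq> I - F \<Longrightarrow> (\<Sum>g\<in>F'. cmod (apply_bcontfun (f g) x)) \<le> \<epsilon>"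
  using assms unfolding uniformly_abs_summable_def by metis

lemma uniformly_abs_summable_pointwise:
  assumes "uniformly_abs_summable f I"
  shows "(\<lambda>g. cmod (apply_bcontfun (f g) x)) summable_on I"
proof -
  obtain F where F: "finite F" "F \<subseteq> I"
    "\<And>F' x. finite F' \<Longrightarrow> F' \<subseteq> I - F \<Longrightarrow> (\<Sum>g\<in>F'. cmod (apply_bcontfun (f g) x)) \<le> 1"
    using uniformly_abs_summableD[OF assms, of 1] by auto
  have "(\<lambda>g. cmod (apply_bcontfun (f g) x)) summable_on (I - F)"
    using F(3) by (intro nonneg_bdd_above_summable_on) (auto intro!: bdd_aboveI2[of _ _ 1])
  then have "(\<lambda>g. cmod (apply_bcontfun (f g) x)) summable_on (I - F) \<union> F"
    using F(1) by (intro summable_on_Un_disjoint) auto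
  then show ?thesis using F(2) by (simp add: Un_absorb2)
qed

lemma uniformly_abs_summable_tail:
  assumes "uniformly_abs_summable f I" "0 < \<epsilon>"
  obtains F where "finite F" "F \<subseteq> I"
    "\<And>Y x. F \<subseteq> Y \<Longrightarrow> (\<Sum>\<^sub>\<infinity>g\<in>I - Y. cmod (apply_bcontfun (f g) x)) \<le> \<epsilon>"
proof -
  obtain F where F: "finite F" "F \<subseteq> I"
    "\<And>F' x. finite F' \<Longrightarrow> F' \<subseteq> I - F \<Longrightarrow> (\<Sum>g\<in>F'. cmod (apply_bcontfun (f g) x)) \<le> \<epsilon>"
    using uniformly_abs_summableD[OF assms] by metis
  show thesis
  proof (rule that[OF F(1,2)])
    fix Y x assume "F \<subseteq> Y"
    then show "(\<Sum>\<^sub>\<infinity>g\<in>I - Y. cmod (apply_bcontfun (f g) x)) \<le> \<epsilon>"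
      using summable_on_subset_banach[OF uniformly_abs_summable_pointwise[OF assms(1)]]
      by (intro infsum_le_finite_sums F(3)) auto
  qed
qed

text \<open>
  The partial sums converge uniformly, so the pointwise sum is continuous and is the sum in \<open>CX\<close>.
\<close>

lemma uniformly_abs_summable_has_sum:
  assumes "uniformly_abs_summable f I"
  obtains s where "(f has_sum s) I"
    "\<And>x. apply_bcontfun s x = (\<Sum>\<^sub>\<infinity>g\<in>I. apply_bcontfun (f g) x)"
proof -
  have "uniform_limit UNIV (\<lambda>F. apply_bcontfun (sum f F)) (\<lambda>x. \<Sum>\<^sub>\<infinity>g\<in>I. apply_bcontfun (f g) x)
      (finite_subsets_at_top I)"
  proof (rule uniform_limitI)
    fix \<epsilon> :: real assume "0 < \<epsilon>"
    then obtain F where F: "finite F" "F \<subseteq> I"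
      "\<And>Y x. F \<subseteq> Y \<Longrightarrow> (\<Sum>\<^sub>\<infinity>g\<in>I - Y. cmod (apply_bcontfun (f g) x)) \<le> \<epsilon> / 2"
      using uniformly_abs_summable_tail[OF assms, of "\<epsilon> / 2"] by auto
    have "dist (apply_bcontfun (sum f Y) x) (\<Sum>\<^sub>\<infinity>g\<in>I. apply_bcontfun (f g) x) < \<epsilon>"
      if Y: "finite Y" "F \<subseteq> Y" "Y \<subseteq> I" for Y x
    proof -
      have abs: "(\<lambda>g. cmod (apply_bcontfun (f g) x)) summable_on J" if "J \<subseteq> I" for J
        using uniformly_abs_summable_pointwise[OF assms] that by (rule summable_on_subset_banach)
      have sm: "(\<lambda>g. apply_bcontfun (f g) x) summable_on (I - Y)"
        by (rule abs_summable_summable[OF abs]) simp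
      have "I = Y \<union> (I - Y)" using Y by auto
      then have "(\<Sum>\<^sub>\<infinity>g\<in>I. apply_bcontfun (f g) x)
          = (\<Sum>\<^sub>\<infinity>g\<in>Y. apply_bcontfun (f g) x) + (\<Sum>\<^sub>\<infinity>g\<in>I - Y. apply_bcontfun (f g) x)"
        using infsum_Un_disjoint[of "\<lambda>g. apply_bcontfun (f g) x" Y "I - Y"] sm Y by auto
      then have "dist (apply_bcontfun (sum f Y) x) (\<Sum>\<^sub>\<infinity>g\<in>I. apply_bcontfun (f g) x)
          = cmod (\<Sum>\<^sub>\<infinity>g\<in>I - Y. apply_bcontfun (f g) x)"
        using Y by (simp add: apply_bcontfun_sum dist_norm)
      also have "\<dots> \<le> (\<Sum>\<^sub>\<infinity>g\<in>I - Y. cmod (apply_bcontfun (f g) x))"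
        by (rule norm_infsum_bound[OF abs]) simp
      also have "\<dots> < \<epsilon>" using F(3)[OF Y(2), of x] \<open>0 < \<epsilon>\<close> by linarith
      finally show ?thesis .
    qed
    then show "\<forall>\<^sub>F Y in finite_subsets_at_top I. \<forall>x\<in>UNIV.
        dist (apply_bcontfun (sum f Y) x) (\<Sum>\<^sub>\<infinity>g\<in>I. apply_bcontfun (f g) x) < \<epsilon>"
      using F(1,2) unfolding eventually_finite_subsets_at_top by blast
  qed
  then obtain s where "(\<lambda>x. \<Sum>\<^sub>\<infinity>g\<in>I. apply_bcontfun (f g) x) = apply_bcontfun s"
    "(sum f \<longlongrightarrow> s) (finite_subsets_at_top I)"
    by (rule uniform_limit_bcontfunE) (auto simp: o_def)
  then show thesis
    by (intro that[of s]) (auto simp: has_sum_def fun_eq_iff)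
qed

lemma apply_infsum:
  assumes "uniformly_abs_summable f I"
  shows "apply_bcontfun (infsum f I) x = (\<Sum>\<^sub>\<infinity>g\<in>I. apply_bcontfun (f g) x)"
  using uniformly_abs_summable_has_sum[OF assms] infsumI by metis

lemma uniformly_abs_summable_dominated:
  assumes f: "uniformly_abs_summable f I" and "0 \<le> B"
    and le: "\<And>g x. g \<in> I \<Longrightarrow> cmod (apply_bcontfun (k g) x) \<le> B * cmod (apply_bcontfun (f g) x)"
  shows "uniformly_abs_summable k I"
  unfolding uniformly_abs_summable_def
proof (intro allI impI)
  fix \<epsilon> :: real assume "0 < \<epsilon>"
  then obtain F where F: "finite F" "F \<subseteq> I"
    "\<And>F' x. finite F' \<Longrightarrow> F' \<subseteq> I - F \<Longrightarrow> (\<Sum>g\<in>F'. cmod (apply_bcontfun (f g) x)) \<le> \<epsilon> / (B + 1)"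
    using uniformly_abs_summableD[OF f, of "\<epsilon> / (B + 1)"] \<open>0 \<le> B\<close> by auto
  have "(\<Sum>g\<in>F'. cmod (apply_bcontfun (k g) x)) \<le> \<epsilon>" if "finite F'" "F' \<subseteq> I - F" for F' x
  proof -
    have "(\<Sum>g\<in>F'. cmod (apply_bcontfun (k g) x)) \<le> B * (\<Sum>g\<in>F'. cmod (apply_bcontfun (f g) x))"
      unfolding sum_distrib_left using that by (intro sum_mono le) auto
    also have "\<dots> \<le> B * (\<epsilon> / (B + 1))"
      using F(3)[OF that] \<open>0 \<le> B\<close> by (rule mult_left_mono)
    also have "\<dots> \<le> \<epsilon>"
      using \<open>0 \<le> B\<close> \<open>0 < \<epsilon>\<close> by (simp add: field_simps)
    finally show ?thesis .
  qed
  then show "\<exists>F. finite F \<and> F \<subseteq> I \<and> (\<forall>F' x. finite F' \<longrightarrow> F' \<subseteq> I - F \<longrightarrow>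
      (\<Sum>g\<in>F'. cmod (apply_bcontfun (k g) x)) \<le> \<epsilon>)"
    using F(1,2) by blast
qed

lemma uniformly_abs_summable_finite:
  assumes "\<And>g. g \<notin> F \<Longrightarrow> f g = 0" "finite F"
  shows "uniformly_abs_summable f I"
  unfolding uniformly_abs_summable_def
proof (intro allI impI exI[of _ "F \<inter> I"] conjI)
  fix \<epsilon> :: real and F' x assume "0 < \<epsilon>" "F' \<subseteq> I - F \<inter> I"
  then have "f g = 0" if "g \<in> F'" for g using assms(1) that by blast
  then have "(\<Sum>g\<in>F'. cmod (apply_bcontfun (f g) x)) = 0"
    by simp
  then show "(\<Sum>g\<in>F'. cmod (apply_bcontfun (f g) x)) \<le> \<epsilon>" using \<open>0 < \<epsilon>\<close> by simp
qed (use assms in auto)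

lemma uniformly_abs_summable_add:
  assumes f: "uniformly_abs_summable f I" and g: "uniformly_abs_summable g I"
  shows "uniformly_abs_summable (\<lambda>i. f i + g i) I"
  unfolding uniformly_abs_summable_def
proof (intro allI impI)
  fix \<epsilon> :: real assume "0 < \<epsilon>"
  then obtain F F\<^sub>2 where F: "finite F" "F \<subseteq> I"
    "\<And>F' x. finite F' \<Longrightarrow> F' \<subseteq> I - F \<Longrightarrow> (\<Sum>g\<in>F'. cmod (apply_bcontfun (f g) x)) \<le> \<epsilon> / 2"
    and F\<^sub>2: "finite F\<^sub>2" "F\<^sub>2 \<subseteq> I"
    "\<And>F' x. finite F' \<Longrightarrow> F' \<subseteq> I - F\<^sub>2 \<Longrightarrow> (\<Sum>i\<in>F'. cmod (apply_bcontfun (g i) x)) \<le> \<epsilon> / 2"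
    using uniformly_abs_summableD[OF f, of "\<epsilon> / 2"] uniformly_abs_summableD[OF g, of "\<epsilon> / 2"]
    by (metis half_gt_zero)
  have "(\<Sum>i\<in>F'. cmod (apply_bcontfun (f i + g i) x)) \<le> \<epsilon>"
    if "finite F'" "F' \<subseteq> I - (F \<union> F\<^sub>2)" for F' x
  proof -
    have "(\<Sum>i\<in>F'. cmod (apply_bcontfun (f i + g i) x))
        \<le> (\<Sum>i\<in>F'. cmod (apply_bcontfun (f i) x) + cmod (apply_bcontfun (g i) x))"
      by (intro sum_mono) (simp add: norm_triangle_ineq)
    also have "\<dots> \<le> \<epsilon> / 2 + \<epsilon> / 2"
      unfolding sum.distrib using that by (intro add_mono F(3) F\<^sub>2(3)) auto
    finally show ?thesis by simp
  qed
  then show "\<exists>F. finite F \<and> F \<subseteq> I \<and> (\<forall>F' x. finite F' \<longrightarrow> F' \<subseteq> I - F \<longrightarrow>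
      (\<Sum>i\<in>F'. cmod (apply_bcontfun (f i + g i) x)) \<le> \<epsilon>)"
    using F(1,2) F\<^sub>2(1,2) by (intro exI[of _ "F \<union> F\<^sub>2"]) auto
qed

text \<open>
  Small norms of all finite sums far out give, at each point, small sums of absolute values
  (\<open>sum_cmod_le\<close>). Conversely, small tails give convergence along finite subsets, which no
  rearrangement affects.
\<close>

lemma unconditionally_summable_iff:
  fixes f :: "'i \<Rightarrow> ('x::topological_space \<Rightarrow>\<^sub>C complex)"
  assumes "countable I"
  shows "unconditionally_summable f I \<longleftrightarrow> uniformly_abs_summable f I"
proof
  assume f: "unconditionally_summable f I"
  show "uniformly_abs_summable f I"
    unfolding uniformly_abs_summable_def
  proof (intro allI impI)
    fix \<epsilon> :: real assume "0 < \<epsilon>"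
    then obtain F where F: "finite F" "F \<subseteq> I"
      "\<And>F'. finite F' \<Longrightarrow> F' \<subseteq> I - F \<Longrightarrow> norm (sum f F') < \<epsilon> / 4"
      using unconditionally_summable_small_tails[OF assms f, of "\<epsilon> / 4"] by (metis divide_pos_pos zero_less_numeral)
    have "(\<Sum>g\<in>F'. cmod (apply_bcontfun (f g) x)) \<le> 4 * (\<epsilon> / 4)"
      if F': "finite F'" "F' \<subseteq> I - F" for F' x
    proof (rule sum_cmod_le[OF F'(1)])
      fix B assume "B \<subseteq> F'"
      then have "norm (sum f B) < \<epsilon> / 4"
        using F' by (intro F(3)) (auto intro: finite_subset)
      then show "cmod (\<Sum>g\<in>B. apply_bcontfun (f g) x) \<le> \<epsilon> / 4"
        using norm_bounded[of "sum f B" x] by (simp add: apply_bcontfun_sum)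
    qed
    then show "\<exists>F. finite F \<and> F \<subseteq> I \<and> (\<forall>F' x. finite F' \<longrightarrow> F' \<subseteq> I - F \<longrightarrow>
        (\<Sum>g\<in>F'. cmod (apply_bcontfun (f g) x)) \<le> \<epsilon>)"
      using F(1,2) by auto
  qed
next
  assume "uniformly_abs_summable f I"
  then obtain s where s: "(f has_sum s) I"
    by (rule uniformly_abs_summable_has_sum)
  show "unconditionally_summable f I"
    unfolding unconditionally_summable_def
  proof (intro exI[of _ s] allI impI)
    fix \<sigma> :: "nat \<Rightarrow> 'i" assume "bij_betw \<sigma> UNIV I"
    then have "((\<lambda>n. f (\<sigma> n)) has_sum s) UNIV"
      using s by (simp add: has_sum_reindex_bij_betw)
    then have "(\<lambda>n. f (\<sigma> n)) sums s" by (rule has_sum_imp_sums)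
    then show "(\<lambda>N. \<Sum>n\<le>N. f (\<sigma> n)) \<longlonglongrightarrow> s"
      by (simp add: sums_def LIMSEQ_lessThan_iff_atMost)
  qed
qed

section \<open>Convolution\<close>

lemma has_sum_finite_sum:
  fixes f :: "'i \<Rightarrow> 'j \<Rightarrow> 'a::real_normed_vector"
  assumes "\<And>j. j \<in> F \<Longrightarrow> ((\<lambda>i. f i j) has_sum s j) I"
  shows "((\<lambda>i. \<Sum>j\<in>F. f i j) has_sum (\<Sum>j\<in>F. s j)) I"
  using assms by (induction F rule: infinite_finite_induct) (auto intro: has_sum_add)

lemma (in group) bij_left_mult: "g \<in> carrier G \<Longrightarrow> bij_betw (\<lambda>h. g \<otimes> h) (carrier G) (carrier G)"
  by (rule bij_betw_byWitness[of _ "\<lambda>k. inv g \<otimes> k"]) (auto simp: m_assoc[symmetric])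

text \<open>
  Fubini and the substitution \<open>l = h k\<close>. The family \<open>b\<close> may depend on \<open>h\<close>, because in a crossed product the
  second factor is translated by \<open>h\<close>. Pairing with a bounded \<open>Q\<close> covers associativity of the product
  (\<open>Q\<close> another element), the module law on \<open>CX\<close> (\<open>Q\<close> a function on an orbit), and multiplicativity of row
  sums (\<open>Q = 1\<close>).
\<close>

lemma (in group) convolution_pairing:
  fixes a Q :: "'a \<Rightarrow> complex" and b :: "'a \<Rightarrow> 'a \<Rightarrow> complex"
  assumes a: "(\<lambda>h. cmod (a h)) summable_on carrier G"
    and b: "\<And>h. h \<in> carrier G \<Longrightarrow> (\<lambda>k. cmod (b h k)) summable_on carrier G"
    and B: "\<And>h. h \<in> carrier G \<Longrightarrow> (\<Sum>\<^sub>\<infinity>k\<in>carrier G. cmod (b h k)) \<le> B"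
    and Q: "\<And>l. l \<in> carrier G \<Longrightarrow> cmod (Q l) \<le> C"
  shows "(\<Sum>\<^sub>\<infinity>l\<in>carrier G. (\<Sum>\<^sub>\<infinity>h\<in>carrier G. a h * b h (inv h \<otimes> l)) * Q l)
      = (\<Sum>\<^sub>\<infinity>h\<in>carrier G. a h * (\<Sum>\<^sub>\<infinity>k\<in>carrier G. b h k * Q (h \<otimes> k)))"
    and "(\<Sum>\<^sub>\<infinity>l\<in>carrier G. cmod (\<Sum>\<^sub>\<infinity>h\<in>carrier G. a h * b h (inv h \<otimes> l)))
      \<le> (\<Sum>\<^sub>\<infinity>h\<in>carrier G. cmod (a h)) * B"
proof -
  have bij: "bij_betw (\<lambda>l. inv h \<otimes> l) (carrier G) (carrier G)" if "h \<in> carrier G" for h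
    using that by (intro bij_left_mult) simp
  have B0: "0 \<le> B"
    using order_trans[OF infsum_nonneg B[OF one_closed]] by simp
  have main: "(\<lambda>(h, l). cmod (a h * b h (inv h \<otimes> l) * Q l)) summable_on carrier G \<times> carrier G"
      "(\<Sum>\<^sub>\<infinity>(h, l)\<in>carrier G \<times> carrier G. cmod (a h * b h (inv h \<otimes> l) * Q l))
        \<le> (\<Sum>\<^sub>\<infinity>h\<in>carrier G. cmod (a h)) * B * C"
    if Q: "\<And>l. l \<in> carrier G \<Longrightarrow> cmod (Q l) \<le> C" for Q C
  proof -
    have "0 \<le> C" using order_trans[OF norm_ge_zero Q[OF one_closed]] .
    have s: "(\<lambda>l. cmod (a h * b h (inv h \<otimes> l) * Q l)) summable_on carrier G"
      and le: "(\<Sum>\<^sub>\<infinity>l\<in>carrier G. cmod (a h * b h (inv h \<otimes> l) * Q l)) \<le> cmod (a h) * (B * C)"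
      if h: "h \<in> carrier G" for h
    proof -
      have sb: "(\<lambda>l. cmod (b h (inv h \<otimes> l))) summable_on carrier G"
        using b[OF h] summable_on_reindex_bij_betw[OF bij[OF h], of "\<lambda>k. cmod (b h k)"] by simp
      have eb: "(\<Sum>\<^sub>\<infinity>l\<in>carrier G. cmod (b h (inv h \<otimes> l))) \<le> B"
        using B[OF h] infsum_reindex_bij_betw[OF bij[OF h], of "\<lambda>k. cmod (b h k)"] by simp
      have dom: "cmod (a h * b h (inv h \<otimes> l) * Q l) \<le> cmod (a h) * C * cmod (b h (inv h \<otimes> l))"
        if "l \<in> carrier G" for l
        using mult_left_mono[OF Q[OF that], of "cmod (a h) * cmod (b h (inv h \<otimes> l))"]
        by (simp add: norm_mult ac_simps)
      have s': "(\<lambda>l. cmod (a h) * C * cmod (b h (inv h \<otimes> l))) summable_on carrier G"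
        by (intro summable_on_cmult_right sb)
      show s: "(\<lambda>l. cmod (a h * b h (inv h \<otimes> l) * Q l)) summable_on carrier G"
        by (rule summable_on_comparison_test[OF s' dom]) auto
      have "(\<Sum>\<^sub>\<infinity>l\<in>carrier G. cmod (a h * b h (inv h \<otimes> l) * Q l))
          \<le> (\<Sum>\<^sub>\<infinity>l\<in>carrier G. cmod (a h) * C * cmod (b h (inv h \<otimes> l)))"
        by (rule infsum_mono[OF s s' dom])
      also have "\<dots> = cmod (a h) * C * (\<Sum>\<^sub>\<infinity>l\<in>carrier G. cmod (b h (inv h \<otimes> l)))"
        by (intro infsum_cmult_right sb)
      also have "\<dots> \<le> cmod (a h) * C * B"
        using eb \<open>0 \<le> C\<close> by (intro mult_left_mono) auto
      finally show "(\<Sum>\<^sub>\<infinity>l\<in>carrier G. cmod (a h * b h (inv h \<otimes> l) * Q l)) \<le> cmod (a h) * (B * C)"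
        by (simp add: ac_simps)
    qed
    have sa: "(\<lambda>h. cmod (a h) * (B * C)) summable_on carrier G"
      by (intro summable_on_cmult_left a)
    have sh: "(\<lambda>h. \<Sum>\<^sub>\<infinity>l\<in>carrier G. cmod (a h * b h (inv h \<otimes> l) * Q l)) summable_on carrier G"
      by (rule summable_on_comparison_test[OF sa le]) (auto intro: infsum_nonneg)
    show S: "(\<lambda>(h, l). cmod (a h * b h (inv h \<otimes> l) * Q l)) summable_on carrier G \<times> carrier G"
      by (rule summable_on_SigmaI[OF _ sh]) (use s in auto)
    have "(\<Sum>\<^sub>\<infinity>(h, l)\<in>carrier G \<times> carrier G. cmod (a h * b h (inv h \<otimes> l) * Q l))
        = (\<Sum>\<^sub>\<infinity>h\<in>carrier G. \<Sum>\<^sub>\<infinity>l\<in>carrier G. cmod (a h * b h (inv h \<otimes> l) * Q l))"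
      using infsum_Sigma_banach[OF S] by simp
    also have "\<dots> \<le> (\<Sum>\<^sub>\<infinity>h\<in>carrier G. cmod (a h) * (B * C))"
      by (rule infsum_mono[OF sh sa le])
    also have "\<dots> = (\<Sum>\<^sub>\<infinity>h\<in>carrier G. cmod (a h)) * (B * C)"
      by (intro infsum_cmult_left a)
    finally show "(\<Sum>\<^sub>\<infinity>(h, l)\<in>carrier G \<times> carrier G. cmod (a h * b h (inv h \<otimes> l) * Q l))
        \<le> (\<Sum>\<^sub>\<infinity>h\<in>carrier G. cmod (a h)) * B * C"
      by (simp add: ac_simps)
  qed
  have S: "(\<lambda>(h, l). a h * b h (inv h \<otimes> l) * Q l) summable_on carrier G \<times> carrier G"
    by (rule abs_summable_summable) (use main(1)[OF Q] in \<open>simp add: case_prod_unfold\<close>)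
  have "(\<Sum>\<^sub>\<infinity>l\<in>carrier G. (\<Sum>\<^sub>\<infinity>h\<in>carrier G. a h * b h (inv h \<otimes> l)) * Q l)
      = (\<Sum>\<^sub>\<infinity>l\<in>carrier G. \<Sum>\<^sub>\<infinity>h\<in>carrier G. a h * b h (inv h \<otimes> l) * Q l)"
    by (intro infsum_cong infsum_cmult_left'[symmetric])
  also have "\<dots> = (\<Sum>\<^sub>\<infinity>h\<in>carrier G. \<Sum>\<^sub>\<infinity>l\<in>carrier G. a h * b h (inv h \<otimes> l) * Q l)"
    using infsum_swap_banach[OF S] by simp
  also have "\<dots> = (\<Sum>\<^sub>\<infinity>h\<in>carrier G. a h * (\<Sum>\<^sub>\<infinity>k\<in>carrier G. b h k * Q (h \<otimes> k)))"
  proof (rule infsum_cong)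
    fix h assume h: "h \<in> carrier G"
    have "(\<Sum>\<^sub>\<infinity>l\<in>carrier G. a h * b h (inv h \<otimes> l) * Q l)
        = (\<Sum>\<^sub>\<infinity>l\<in>carrier G. a h * (b h (inv h \<otimes> l) * Q (h \<otimes> (inv h \<otimes> l))))"
      by (rule infsum_cong) (use h in \<open>simp add: m_assoc[symmetric]\<close>)
    also have "\<dots> = a h * (\<Sum>\<^sub>\<infinity>l\<in>carrier G. b h (inv h \<otimes> l) * Q (h \<otimes> (inv h \<otimes> l)))"
      by (rule infsum_cmult_right')
    also have "(\<Sum>\<^sub>\<infinity>l\<in>carrier G. b h (inv h \<otimes> l) * Q (h \<otimes> (inv h \<otimes> l)))
        = (\<Sum>\<^sub>\<infinity>k\<in>carrier G. b h k * Q (h \<otimes> k))"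
      by (rule infsum_reindex_bij_betw[OF bij[OF h]])
    finally show "(\<Sum>\<^sub>\<infinity>l\<in>carrier G. a h * b h (inv h \<otimes> l) * Q l)
        = a h * (\<Sum>\<^sub>\<infinity>k\<in>carrier G. b h k * Q (h \<otimes> k))" .
  qed
  finally show "(\<Sum>\<^sub>\<infinity>l\<in>carrier G. (\<Sum>\<^sub>\<infinity>h\<in>carrier G. a h * b h (inv h \<otimes> l)) * Q l)
      = (\<Sum>\<^sub>\<infinity>h\<in>carrier G. a h * (\<Sum>\<^sub>\<infinity>k\<in>carrier G. b h k * Q (h \<otimes> k)))" .
  have m1: "(\<lambda>(h, l). cmod (a h * b h (inv h \<otimes> l))) summable_on carrier G \<times> carrier G"
      "(\<Sum>\<^sub>\<infinity>(h, l)\<in>carrier G \<times> carrier G. cmod (a h * b h (inv h \<otimes> l)))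
        \<le> (\<Sum>\<^sub>\<infinity>h\<in>carrier G. cmod (a h)) * B"
    using main[of "\<lambda>_. 1" 1] by simp_all
  have m1': "(\<lambda>(l, h). cmod (a h * b h (inv h \<otimes> l))) summable_on carrier G \<times> carrier G"
    using summable_on_swap[of "\<lambda>(h, l). cmod (a h * b h (inv h \<otimes> l))" "carrier G" "carrier G"] m1(1)
    by (simp add: case_prod_unfold)
  have sl: "(\<lambda>h. cmod (a h * b h (inv h \<otimes> l))) summable_on carrier G" if "l \<in> carrier G" for l
    using summable_on_SigmaD1[OF m1'] that by simp
  have sc: "(\<lambda>l. \<Sum>\<^sub>\<infinity>h\<in>carrier G. cmod (a h * b h (inv h \<otimes> l))) summable_on carrier G"
    using summable_on_Sigma_banach[OF m1'] by simp
  have le: "cmod (\<Sum>\<^sub>\<infinity>h\<in>carrier G. a h * b h (inv h \<otimes> l))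
      \<le> (\<Sum>\<^sub>\<infinity>h\<in>carrier G. cmod (a h * b h (inv h \<otimes> l)))" if "l \<in> carrier G" for l
    by (rule norm_infsum_bound[OF sl[OF that]])
  have "(\<lambda>l. cmod (\<Sum>\<^sub>\<infinity>h\<in>carrier G. a h * b h (inv h \<otimes> l))) summable_on carrier G"
    by (rule summable_on_comparison_test[OF sc le]) auto
  then have "(\<Sum>\<^sub>\<infinity>l\<in>carrier G. cmod (\<Sum>\<^sub>\<infinity>h\<in>carrier G. a h * b h (inv h \<otimes> l)))
      \<le> (\<Sum>\<^sub>\<infinity>l\<in>carrier G. \<Sum>\<^sub>\<infinity>h\<in>carrier G. cmod (a h * b h (inv h \<otimes> l)))"
    using sc le by (rule infsum_mono)
  also have "\<dots> = (\<Sum>\<^sub>\<infinity>(h, l)\<in>carrier G \<times> carrier G. cmod (a h * b h (inv h \<otimes> l)))"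
    using infsum_swap_banach[OF m1(1)] infsum_Sigma_banach[OF m1(1)] by simp
  also note m1(2)
  finally show "(\<Sum>\<^sub>\<infinity>l\<in>carrier G. cmod (\<Sum>\<^sub>\<infinity>h\<in>carrier G. a h * b h (inv h \<otimes> l)))
      \<le> (\<Sum>\<^sub>\<infinity>h\<in>carrier G. cmod (a h)) * B" .
qed

locale continuous_action = group G + action: group_action G UNIV act
  for G :: "('g, 'm) monoid_scheme" (structure) and act :: "'g \<Rightarrow> 'x::t2_space \<Rightarrow> 'x" +
  assumes countable_group: "countable (carrier G)"
    and continuous_act: "g \<in> carrier G \<Longrightarrow> continuous_on UNIV (act g)"
begin

abbreviation \<A> where "\<A> \<equiv> A0 G act"

lemma act_mult: "g \<in> carrier G \<Longrightarrow> h \<in> carrier G \<Longrightarrow> act (g \<otimes> h) x = act g (act h x)"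
  by (rule action.composition_rule) auto

lemma act_one [simp]: "act \<one> x = x"
  using fun_cong[OF action.id_eq_one, of x] by simp

lemma act_inv [simp]:
  assumes "g \<in> carrier G"
  shows "act (inv g) (act g x) = x" "act g (act (inv g) x) = x"
  using assms act_mult[of "inv g" g x] act_mult[of g "inv g" x] by simp_all

lemma apply_cx_translate [simp]:
  assumes "g \<in> carrier G"
  shows "apply_bcontfun (cx_translate G act g p) x = p (act (inv g) x)"
  unfolding cx_translate_def using assms
  by (subst Bcontfun_inverse)
    (auto intro!: bcontfun_normI[where b = "norm p"] norm_bounded continuous_act
      continuous_on_compose2[OF continuous_on_apply_bcontfun[of UNIV p]])

lemma carrier_A0: "f \<in> carrier \<A> \<longleftrightarrow>
    (\<forall>g. g \<notin> carrier G \<longrightarrow> f g = 0) \<and> uniformly_abs_summable f (carrier G)"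
  by (simp add: A0_def unconditionally_summable_iff[OF countable_group])

lemma A0_simps [simp]:
  "\<zero>\<^bsub>\<A>\<^esub> = (\<lambda>_. 0)" "f1 \<oplus>\<^bsub>\<A>\<^esub> f2 = (\<lambda>g. f1 g + f2 g)" "c \<odot>\<^bsub>\<A>\<^esub> f1 = (\<lambda>g. cx_scale c (f1 g))"
  by (simp_all add: A0_def)

lemma A0_summable:
  assumes "f \<in> carrier \<A>"
  shows "(\<lambda>g. cmod (f g x)) summable_on carrier G"
  using assms uniformly_abs_summable_pointwise by (auto simp: carrier_A0)

lemma apply_sum_abs:
  assumes "f \<in> carrier \<A>"
  shows "apply_bcontfun (\<Sum>\<^sub>\<infinity>g\<in>carrier G. cx_abs (f g)) x
    = complex_of_real (\<Sum>\<^sub>\<infinity>g\<in>carrier G. cmod (f g x))"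
proof -
  have "uniformly_abs_summable (\<lambda>g. cx_abs (f g)) (carrier G)"
    by (rule uniformly_abs_summable_dominated[of f _ 1]) (use assms in \<open>auto simp: carrier_A0\<close>)
  then have "apply_bcontfun (\<Sum>\<^sub>\<infinity>g\<in>carrier G. cx_abs (f g)) x
      = (\<Sum>\<^sub>\<infinity>g\<in>carrier G. complex_of_real (cmod (f g x)))"
    by (simp add: apply_infsum)
  also have "\<dots> = complex_of_real (\<Sum>\<^sub>\<infinity>g\<in>carrier G. cmod (f g x))"
    by (rule infsumI) (use A0_summable[OF assms, of x] in \<open>simp add: has_sum_of_real_iff\<close>)
  finally show ?thesis .
qed

lemma nrm_A0_ge:
  assumes "f \<in> carrier \<A>"
  shows "(\<Sum>\<^sub>\<infinity>g\<in>carrier G. cmod (f g x)) \<le> nrm \<A> f"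
  using norm_bounded[of "\<Sum>\<^sub>\<infinity>g\<in>carrier G. cx_abs (f g)" x]
  by (simp add: A0_def apply_sum_abs[OF assms] infsum_nonneg)

lemma nrm_A0_le:
  assumes "f \<in> carrier \<A>" "\<And>x. (\<Sum>\<^sub>\<infinity>g\<in>carrier G. cmod (f g x)) \<le> C"
  shows "nrm \<A> f \<le> C"
  unfolding A0_def by (simp, rule norm_bound) (simp add: apply_sum_abs[OF assms(1)] infsum_nonneg assms(2))

lemma nrm_A0_nonneg: "0 \<le> nrm \<A> f"
  by (simp add: A0_def)

lemma A0_sum_le:
  assumes "f \<in> carrier \<A>" "finite F" "F \<subseteq> carrier G"
  shows "(\<Sum>g\<in>F. cmod (f g x)) \<le> nrm \<A> f"
  using finite_sum_le_infsum[OF A0_summable[OF assms(1), of x] assms(2,3)] nrm_A0_ge[OF assms(1), of x]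
  by fastforce

lemma A0_apply_le:
  assumes "f \<in> carrier \<A>"
  shows "cmod (f g x) \<le> nrm \<A> f"
proof (cases "g \<in> carrier G")
  case True
  then show ?thesis using A0_sum_le[OF assms, of "{g}" x] by simp
next
  case False
  then show ?thesis using assms nrm_A0_nonneg by (simp add: carrier_A0)
qed

lemma A0_add_closed: "f1 \<in> carrier \<A> \<Longrightarrow> f2 \<in> carrier \<A> \<Longrightarrow> (\<lambda>g. f1 g + f2 g) \<in> carrier \<A>"
  by (auto simp: carrier_A0 intro: uniformly_abs_summable_add)

lemma A0_scale_closed: "f \<in> carrier \<A> \<Longrightarrow> (\<lambda>g. cx_scale c (f g)) \<in> carrier \<A>"
proof -
  assume f: "f \<in> carrier \<A>"
  have "cx_scale c (0 :: 'x \<Rightarrow>\<^sub>C complex) = 0" by (rule bcontfun_eqI) simp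
  then show ?thesis
    using f uniformly_abs_summable_dominated[of f "carrier G" "cmod c" "\<lambda>g. cx_scale c (f g)"]
    by (auto simp: carrier_A0 norm_mult)
qed

lemma A0_mult_summable:
  fixes q :: "'g \<Rightarrow> ('x \<Rightarrow>\<^sub>C complex)"
  assumes "f1 \<in> carrier \<A>" "\<And>h x. h \<in> carrier G \<Longrightarrow> cmod (q h x) \<le> B"
  shows "uniformly_abs_summable (\<lambda>h. cx_mult (f1 h) (cx_translate G act h (q h))) (carrier G)"
proof (rule uniformly_abs_summable_dominated)
  show "uniformly_abs_summable f1 (carrier G)" using assms(1) by (simp add: carrier_A0)
  show "0 \<le> B" using order_trans[OF norm_ge_zero assms(2)[OF one_closed]] .
  show "cmod (apply_bcontfun (cx_mult (f1 h) (cx_translate G act h (q h))) x) \<le> B * cmod (f1 h x)"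
    if "h \<in> carrier G" for h x
    using that mult_right_mono[OF assms(2)[OF that, of "act (inv h) x"], of "cmod (f1 h x)"]
    by (simp add: norm_mult mult.commute)
qed

lemma apply_A0_mult:
  assumes "f1 \<in> carrier \<A>" "f2 \<in> carrier \<A>" "g \<in> carrier G"
  shows "apply_bcontfun ((f1 \<otimes>\<^bsub>\<A>\<^esub> f2) g) x
    = (\<Sum>\<^sub>\<infinity>h\<in>carrier G. f1 h x * f2 (inv h \<otimes> g) (act (inv h) x))"
proof -
  have "(f1 \<otimes>\<^bsub>\<A>\<^esub> f2) g
      = (\<Sum>\<^sub>\<infinity>h\<in>carrier G. cx_mult (f1 h) (cx_translate G act h (f2 (inv h \<otimes> g))))"
    using assms(3) by (simp add: A0_def)
  also have "apply_bcontfun \<dots> x = (\<Sum>\<^sub>\<infinity>h\<in>carrier G. f1 h x * f2 (inv h \<otimes> g) (act (inv h) x))"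
    by (subst apply_infsum[OF A0_mult_summable[OF assms(1) A0_apply_le[OF assms(2)]]])
      (auto intro: infsum_cong)
  finally show ?thesis .
qed

lemma A0_mult_outside: "g \<notin> carrier G \<Longrightarrow> (f1 \<otimes>\<^bsub>\<A>\<^esub> f2) g = 0"
  by (simp add: A0_def)

lemma A0_mult_pairing:
  fixes Q :: "'g \<Rightarrow> complex"
  assumes f: "f1 \<in> carrier \<A>" "f2 \<in> carrier \<A>"
    and Q: "\<And>l. l \<in> carrier G \<Longrightarrow> cmod (Q l) \<le> C"
  shows "(\<Sum>\<^sub>\<infinity>l\<in>carrier G. (f1 \<otimes>\<^bsub>\<A>\<^esub> f2) l x * Q l)
    = (\<Sum>\<^sub>\<infinity>h\<in>carrier G. f1 h x * (\<Sum>\<^sub>\<infinity>k\<in>carrier G. f2 k (act (inv h) x) * Q (h \<otimes> k)))"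
proof -
  have "(\<Sum>\<^sub>\<infinity>l\<in>carrier G. (f1 \<otimes>\<^bsub>\<A>\<^esub> f2) l x * Q l)
      = (\<Sum>\<^sub>\<infinity>l\<in>carrier G. (\<Sum>\<^sub>\<infinity>h\<in>carrier G. f1 h x * f2 (inv h \<otimes> l) (act (inv h) x)) * Q l)"
    by (intro infsum_cong) (simp add: apply_A0_mult f)
  also have "\<dots> = (\<Sum>\<^sub>\<infinity>h\<in>carrier G. f1 h x * (\<Sum>\<^sub>\<infinity>k\<in>carrier G. f2 k (act (inv h) x) * Q (h \<otimes> k)))"
    by (rule convolution_pairing(1)[where B = "nrm \<A> f2" and C = C])
      (auto intro: A0_summable f nrm_A0_ge Q)
  finally show ?thesis .
qed

text \<open>
  If \<open>F1\<close> and \<open>F2\<close> carry \<open>f1\<close> and \<open>f2\<close> up to small tails, then the set of products \<open>F1 F2\<close> carries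
  \<open>f1 * f2\<close>: for \<open>g\<close> outside it, either \<open>h\<close> lies outside \<open>F1\<close> or \<open>h\<^sup>-\<^sup>1 g\<close> lies outside \<open>F2\<close>.
\<close>

lemma A0_mult_closed [simp]:
  assumes f: "f1 \<in> carrier \<A>" "f2 \<in> carrier \<A>"
  shows "f1 \<otimes>\<^bsub>\<A>\<^esub> f2 \<in> carrier \<A>"
  unfolding carrier_A0
proof (intro conjI allI impI)
  show "(f1 \<otimes>\<^bsub>\<A>\<^esub> f2) g = 0" if "g \<notin> carrier G" for g
    using that by (rule A0_mult_outside)
  show "uniformly_abs_summable (f1 \<otimes>\<^bsub>\<A>\<^esub> f2) (carrier G)"
    unfolding uniformly_abs_summable_def
  proof (intro allI impI)
    fix \<epsilon> :: real assume "0 < \<epsilon>"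
    define N where "N = nrm \<A> f1 + nrm \<A> f2 + 1"
    define \<delta> where "\<delta> = \<epsilon> / N"
    have N: "0 < N" using nrm_A0_nonneg[of f1] nrm_A0_nonneg[of f2] by (simp add: N_def)
    then have \<delta>: "0 < \<delta>" using \<open>0 < \<epsilon>\<close> by (simp add: \<delta>_def)
    obtain F1 where F1: "finite F1" "F1 \<subseteq> carrier G"
      "\<And>Y x. F1 \<subseteq> Y \<Longrightarrow> (\<Sum>\<^sub>\<infinity>g\<in>carrier G - Y. cmod (f1 g x)) \<le> \<delta>"
      using uniformly_abs_summable_tail[OF _ \<delta>, of f1 "carrier G"] f(1) unfolding carrier_A0 by metis
    obtain F2 where F2: "finite F2" "F2 \<subseteq> carrier G"
      "\<And>F' x. finite F' \<Longrightarrow> F' \<subseteq> carrier G - F2 \<Longrightarrow> (\<Sum>g\<in>F'. cmod (f2 g x)) \<le> \<delta>"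
      using uniformly_abs_summableD[OF _ \<delta>, of f2 "carrier G"] f(2) unfolding carrier_A0 by metis
    let ?F = "(\<lambda>(h, k). h \<otimes> k) ` (F1 \<times> F2)"
    have "(\<Sum>g\<in>F'. cmod ((f1 \<otimes>\<^bsub>\<A>\<^esub> f2) g x)) \<le> \<epsilon>"
      if F': "finite F'" "F' \<subseteq> carrier G - ?F" for F' x
    proof -
      let ?t = "\<lambda>h g. cmod (f1 h x * f2 (inv h \<otimes> g) (act (inv h) x))"
      have s1: "(\<lambda>h. cmod (f1 h x)) summable_on carrier G" by (rule A0_summable[OF f(1)])
      have st: "(\<lambda>h. ?t h g) summable_on carrier G" for g
        by (rule summable_on_comparison_test[OF summable_on_cmult_left[OF s1, of "nrm \<A> f2"]])
          (auto simp: norm_mult intro!: mult_left_mono A0_apply_le f)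
      have inner: "(\<Sum>g\<in>F'. cmod (f2 (inv h \<otimes> g) (act (inv h) x))) = (\<Sum>k\<in>(\<otimes>) (inv h) ` F'. cmod (f2 k (act (inv h) x)))"
        and img: "(\<otimes>) (inv h) ` F' \<subseteq> carrier G" if "h \<in> carrier G" for h
      proof -
        have "F' \<subseteq> carrier G" using F' by blast
        then show "(\<otimes>) (inv h) ` F' \<subseteq> carrier G" using that by auto
        have "inj_on ((\<otimes>) (inv h)) F'"
          using that \<open>F' \<subseteq> carrier G\<close> by (intro inj_onI) (simp add: subset_iff)
        then show "(\<Sum>g\<in>F'. cmod (f2 (inv h \<otimes> g) (act (inv h) x)))
            = (\<Sum>k\<in>(\<otimes>) (inv h) ` F'. cmod (f2 k (act (inv h) x)))"
          by (simp add: sum.reindex)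
      qed
      have bound: "(\<Sum>g\<in>F'. ?t h g) \<le> cmod (f1 h x) * \<delta> + (if h \<in> F1 then 0 else cmod (f1 h x)) * nrm \<A> f2"
        if h: "h \<in> carrier G" for h
      proof -
        have eq: "(\<Sum>g\<in>F'. ?t h g) = cmod (f1 h x) * (\<Sum>k\<in>(\<otimes>) (inv h) ` F'. cmod (f2 k (act (inv h) x)))"
          unfolding inner[OF h, symmetric] by (simp add: norm_mult sum_distrib_left)
        show ?thesis
        proof (cases "h \<in> F1")
          case True
          have "(\<otimes>) (inv h) ` F' \<subseteq> carrier G - F2"
          proof
            fix k assume "k \<in> (\<otimes>) (inv h) ` F'"
            then obtain g where g: "g \<in> F'" "k = inv h \<otimes> g" by auto
            then have "g = h \<otimes> k" using h F' by (auto simp: m_assoc[symmetric])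
            then have "k \<notin> F2" using g(1) F'(2) True by auto
            then show "k \<in> carrier G - F2" using g h F' by auto
          qed
          then have "(\<Sum>k\<in>(\<otimes>) (inv h) ` F'. cmod (f2 k (act (inv h) x))) \<le> \<delta>"
            using F'(1) by (intro F2(3)) auto
          then show ?thesis unfolding eq using True by (simp add: mult_left_mono)
        next
          case False
          have "(\<Sum>k\<in>(\<otimes>) (inv h) ` F'. cmod (f2 k (act (inv h) x))) \<le> nrm \<A> f2"
            using F'(1) by (intro A0_sum_le f img h) auto
          then have "(\<Sum>g\<in>F'. ?t h g) \<le> cmod (f1 h x) * nrm \<A> f2"
            unfolding eq by (simp add: mult_left_mono)
          then show ?thesis using False \<delta> by (simp add: add_increasing)
        qed
      qed
      have s2: "(\<lambda>h. (if h \<in> F1 then 0 else cmod (f1 h x))) summable_on carrier G"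
        by (rule summable_on_comparison_test[OF s1]) auto
      have "(\<Sum>g\<in>F'. cmod ((f1 \<otimes>\<^bsub>\<A>\<^esub> f2) g x)) \<le> (\<Sum>g\<in>F'. \<Sum>\<^sub>\<infinity>h\<in>carrier G. ?t h g)"
      proof (rule sum_mono)
        fix g assume "g \<in> F'"
        then have "g \<in> carrier G" using F' by auto
        then show "cmod ((f1 \<otimes>\<^bsub>\<A>\<^esub> f2) g x) \<le> (\<Sum>\<^sub>\<infinity>h\<in>carrier G. ?t h g)"
          unfolding apply_A0_mult[OF f \<open>g \<in> carrier G\<close>] by (intro norm_infsum_bound st)
      qed
      also have "\<dots> = (\<Sum>\<^sub>\<infinity>h\<in>carrier G. \<Sum>g\<in>F'. ?t h g)"
        by (rule infsumI[symmetric], rule has_sum_finite_sum) (simp add: st)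
      also have "\<dots> \<le> (\<Sum>\<^sub>\<infinity>h\<in>carrier G. cmod (f1 h x) * \<delta> + (if h \<in> F1 then 0 else cmod (f1 h x)) * nrm \<A> f2)"
        using has_sum_finite_sum[where f = ?t and F = F' and I = "carrier G" and s = "\<lambda>g. \<Sum>\<^sub>\<infinity>h\<in>carrier G. ?t h g"] st
        by (intro infsum_mono bound summable_on_add summable_on_cmult_left s1 s2) (auto intro: has_sum_imp_summable)
      also have "\<dots> = (\<Sum>\<^sub>\<infinity>h\<in>carrier G. cmod (f1 h x)) * \<delta>
          + (\<Sum>\<^sub>\<infinity>h\<in>carrier G. if h \<in> F1 then 0 else cmod (f1 h x)) * nrm \<A> f2"
        by (subst infsum_add) (auto intro!: summable_on_cmult_left s1 s2 simp: infsum_cmult_left s1 s2)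
      also have "(\<Sum>\<^sub>\<infinity>h\<in>carrier G. if h \<in> F1 then 0 else cmod (f1 h x)) = (\<Sum>\<^sub>\<infinity>h\<in>carrier G - F1. cmod (f1 h x))"
        by (rule infsum_cong_neutral) auto
      also have "(\<Sum>\<^sub>\<infinity>h\<in>carrier G. cmod (f1 h x)) * \<delta> + (\<Sum>\<^sub>\<infinity>h\<in>carrier G - F1. cmod (f1 h x)) * nrm \<A> f2
          \<le> nrm \<A> f1 * \<delta> + \<delta> * nrm \<A> f2"
        using \<delta> by (intro add_mono mult_right_mono nrm_A0_ge f F1(3) nrm_A0_nonneg) auto
      also have "\<dots> \<le> N * \<delta>" using \<delta> by (simp add: N_def algebra_simps)
      also have "\<dots> = \<epsilon>" using N by (simp add: \<delta>_def)
      finally show ?thesis .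
    qed
    then show "\<exists>F. finite F \<and> F \<subseteq> carrier G \<and> (\<forall>F' x. finite F' \<longrightarrow> F' \<subseteq> carrier G - F \<longrightarrow>
        (\<Sum>g\<in>F'. cmod ((f1 \<otimes>\<^bsub>\<A>\<^esub> f2) g x)) \<le> \<epsilon>)"
      using F1(1,2) F2(1,2) by (intro exI[of _ ?F]) auto
  qed
qed

lemma nrm_A0_mult_le:
  assumes f: "f1 \<in> carrier \<A>" "f2 \<in> carrier \<A>"
  shows "nrm \<A> (f1 \<otimes>\<^bsub>\<A>\<^esub> f2) \<le> nrm \<A> f1 * nrm \<A> f2"
proof (rule nrm_A0_le[OF A0_mult_closed[OF f]])
  fix x
  have "(\<Sum>\<^sub>\<infinity>g\<in>carrier G. cmod ((f1 \<otimes>\<^bsub>\<A>\<^esub> f2) g x))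
      = (\<Sum>\<^sub>\<infinity>g\<in>carrier G. cmod (\<Sum>\<^sub>\<infinity>h\<in>carrier G. f1 h x * f2 (inv h \<otimes> g) (act (inv h) x)))"
    by (intro infsum_cong) (simp add: apply_A0_mult f)
  also have "\<dots> \<le> (\<Sum>\<^sub>\<infinity>h\<in>carrier G. cmod (f1 h x)) * nrm \<A> f2"
    by (rule convolution_pairing(2)[where Q = "\<lambda>_. 0" and C = 0]) (auto intro: A0_summable f nrm_A0_ge)
  also have "\<dots> \<le> nrm \<A> f1 * nrm \<A> f2"
    by (intro mult_right_mono nrm_A0_ge f nrm_A0_nonneg)
  finally show "(\<Sum>\<^sub>\<infinity>g\<in>carrier G. cmod ((f1 \<otimes>\<^bsub>\<A>\<^esub> f2) g x)) \<le> nrm \<A> f1 * nrm \<A> f2" .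
qed

end

section \<open>Normed bimodules and their duals\<close>

lemma carrier_ring_of_type_algebra [simp]:
  "carrier (ring_of_type_algebra :: complex ring) = UNIV"
  "\<one>\<^bsub>ring_of_type_algebra :: complex ring\<^esub> = 1"
  "a \<oplus>\<^bsub>ring_of_type_algebra :: complex ring\<^esub> b = a + b"
  "a \<otimes>\<^bsub>ring_of_type_algebra :: complex ring\<^esub> b = a * b"
  by (simp_all add: ring_of_type_algebra_def)

text \<open>
  A dual is complete even if the predual is merely normed. With the completeness left out, the
  bimodule \<open>\<L>\<close> of operators below can be dualised directly.
\<close>

locale normed_bimodule = module "ring_of_type_algebra :: complex ring" E
  for A :: "('a, 'm) normed_space_scheme" and E :: "('a, 'e, 'n) bimodule_scheme" (structure) +
  assumes nrm_algebra_nonneg: "a \<in> carrier A \<Longrightarrow> 0 \<le> nrm A a"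
    and nrm_nonneg: "v \<in> carrier E \<Longrightarrow> 0 \<le> nrm E v"
    and nrm_eq_0_iff: "v \<in> carrier E \<Longrightarrow> nrm E v = 0 \<longleftrightarrow> v = \<zero>\<^bsub>E\<^esub>"
    and nrm_triangle:
      "v \<in> carrier E \<Longrightarrow> w \<in> carrier E \<Longrightarrow> nrm E (v \<oplus>\<^bsub>E\<^esub> w) \<le> nrm E v + nrm E w"
    and nrm_smult: "v \<in> carrier E \<Longrightarrow> nrm E (c \<odot>\<^bsub>E\<^esub> v) = cmod c * nrm E v"
    and lact_closed: "a \<in> carrier A \<Longrightarrow> v \<in> carrier E \<Longrightarrow> lact E a v \<in> carrier E"
    and ract_closed: "a \<in> carrier A \<Longrightarrow> v \<in> carrier E \<Longrightarrow> ract E v a \<in> carrier E"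
    and lact_add_left: "a \<in> carrier A \<Longrightarrow> b \<in> carrier A \<Longrightarrow> v \<in> carrier E \<Longrightarrow>
      lact E (a \<oplus>\<^bsub>A\<^esub> b) v = lact E a v \<oplus>\<^bsub>E\<^esub> lact E b v"
    and lact_add_right: "a \<in> carrier A \<Longrightarrow> v \<in> carrier E \<Longrightarrow> w \<in> carrier E \<Longrightarrow>
      lact E a (v \<oplus>\<^bsub>E\<^esub> w) = lact E a v \<oplus>\<^bsub>E\<^esub> lact E a w"
    and lact_smult_left: "a \<in> carrier A \<Longrightarrow> v \<in> carrier E \<Longrightarrow>
      lact E (c \<odot>\<^bsub>A\<^esub> a) v = c \<odot>\<^bsub>E\<^esub> lact E a v"
    and lact_smult_right: "a \<in> carrier A \<Longrightarrow> v \<in> carrier E \<Longrightarrow>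
      lact E a (c \<odot>\<^bsub>E\<^esub> v) = c \<odot>\<^bsub>E\<^esub> lact E a v"
    and ract_add_left: "a \<in> carrier A \<Longrightarrow> v \<in> carrier E \<Longrightarrow> w \<in> carrier E \<Longrightarrow>
      ract E (v \<oplus>\<^bsub>E\<^esub> w) a = ract E v a \<oplus>\<^bsub>E\<^esub> ract E w a"
    and ract_add_right: "a \<in> carrier A \<Longrightarrow> b \<in> carrier A \<Longrightarrow> v \<in> carrier E \<Longrightarrow>
      ract E v (a \<oplus>\<^bsub>A\<^esub> b) = ract E v a \<oplus>\<^bsub>E\<^esub> ract E v b"
    and ract_smult_left: "a \<in> carrier A \<Longrightarrow> v \<in> carrier E \<Longrightarrow>
      ract E (c \<odot>\<^bsub>E\<^esub> v) a = c \<odot>\<^bsub>E\<^esub> ract E v a"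
    and ract_smult_right: "a \<in> carrier A \<Longrightarrow> v \<in> carrier E \<Longrightarrow>
      ract E v (c \<odot>\<^bsub>A\<^esub> a) = c \<odot>\<^bsub>E\<^esub> ract E v a"
    and lact_assoc: "a \<in> carrier A \<Longrightarrow> b \<in> carrier A \<Longrightarrow> v \<in> carrier E \<Longrightarrow>
      lact E (a \<otimes>\<^bsub>A\<^esub> b) v = lact E a (lact E b v)"
    and ract_assoc: "a \<in> carrier A \<Longrightarrow> b \<in> carrier A \<Longrightarrow> v \<in> carrier E \<Longrightarrow>
      ract E v (a \<otimes>\<^bsub>A\<^esub> b) = ract E (ract E v a) b"
    and lact_ract: "a \<in> carrier A \<Longrightarrow> b \<in> carrier A \<Longrightarrow> v \<in> carrier E \<Longrightarrow>
      lact E a (ract E v b) = ract E (lact E a v) b"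
    and lact_contractive: "a \<in> carrier A \<Longrightarrow> v \<in> carrier E \<Longrightarrow>
      nrm E (lact E a v) \<le> nrm A a * nrm E v"
    and ract_contractive: "a \<in> carrier A \<Longrightarrow> v \<in> carrier E \<Longrightarrow>
      nrm E (ract E v a) \<le> nrm E v * nrm A a"

lemma banach_bimodule_imp_normed_bimodule:
  assumes "banach_bimodule A E" and nonneg: "\<And>a. a \<in> carrier A \<Longrightarrow> 0 \<le> nrm A a"
  shows "normed_bimodule A E"
proof -
  interpret banach_bimodule A E by (rule assms(1))
  show ?thesis
    by unfold_locales
      (rule nonneg nrm_nonneg nrm_eq_0_iff nrm_triangle nrm_smult lact_closed ract_closed lact_add_left
        lact_add_right lact_smult_left lact_smult_right ract_add_left ract_add_right ract_smult_left
        ract_smult_right lact_assoc ract_assoc lact_ract lact_contractive ract_contractive; assumption)+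
qed

lemma dual_bimodule_simps [simp]:
  "carrier (dual_bimodule E) = bounded_functionals E"
  "\<zero>\<^bsub>dual_bimodule E\<^esub> = (\<lambda>v\<in>carrier E. 0)"
  "\<phi> \<oplus>\<^bsub>dual_bimodule E\<^esub> \<psi> = (\<lambda>v\<in>carrier E. \<phi> v + \<psi> v)"
  "c \<odot>\<^bsub>dual_bimodule E\<^esub> \<phi> = (\<lambda>v\<in>carrier E. c * \<phi> v)"
  "nrm (dual_bimodule E) \<phi> = (SUP v\<in>{v \<in> carrier E. nrm E v \<le> 1}. cmod (\<phi> v))"
  "lact (dual_bimodule E) a \<phi> = (\<lambda>v\<in>carrier E. \<phi> (ract E v a))"
  "ract (dual_bimodule E) \<phi> a = (\<lambda>v\<in>carrier E. \<phi> (lact E a v))"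
  by (simp_all add: dual_bimodule_def)

context normed_bimodule
begin

lemma nrm_zero [simp]: "nrm E \<zero> = 0"
  using nrm_eq_0_iff[of \<zero>] by simp

lemma bounded_functionalI:
  assumes "\<And>v w. v \<in> carrier E \<Longrightarrow> w \<in> carrier E \<Longrightarrow> f (v \<oplus> w) = f v + f w"
    and "\<And>c v. v \<in> carrier E \<Longrightarrow> f (c \<odot> v) = c * f v"
    and "\<And>v. v \<in> carrier E \<Longrightarrow> cmod (f v) \<le> K * nrm E v"
  shows "restrict f (carrier E) \<in> bounded_functionals E"
  unfolding bounded_functionals_def using assms by (auto intro!: exI[of _ K])

lemma bounded_functionalD:
  assumes "\<phi> \<in> bounded_functionals E"
  shows "v \<in> carrier E \<Longrightarrow> w \<in> carrier E \<Longrightarrow> \<phi> (v \<oplus> w) = \<phi> v + \<phi> w"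
    and "v \<in> carrier E \<Longrightarrow> \<phi> (c \<odot> v) = c * \<phi> v"
    and "restrict \<phi> (carrier E) = \<phi>"
    and "\<phi> \<zero> = 0"
    and "\<exists>K\<ge>0. \<forall>v\<in>carrier E. cmod (\<phi> v) \<le> K * nrm E v"
proof -
  show *: "v \<in> carrier E \<Longrightarrow> w \<in> carrier E \<Longrightarrow> \<phi> (v \<oplus> w) = \<phi> v + \<phi> w" for v w
    using assms by (simp add: bounded_functionals_def)
  show "v \<in> carrier E \<Longrightarrow> \<phi> (c \<odot> v) = c * \<phi> v"
    using assms by (simp add: bounded_functionals_def)
  show "restrict \<phi> (carrier E) = \<phi>"
    using assms by (simp add: bounded_functionals_def extensional_restrict)
  show "\<phi> \<zero> = 0" using *[of \<zero> \<zero>] by simp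
  obtain K where K: "\<forall>v\<in>carrier E. cmod (\<phi> v) \<le> K * nrm E v"
    using assms by (auto simp: bounded_functionals_def)
  have "cmod (\<phi> v) \<le> \<bar>K\<bar> * nrm E v" if "v \<in> carrier E" for v
    using K nrm_nonneg[OF that] that by (meson abs_ge_self mult_right_mono order_trans)
  then show "\<exists>K\<ge>0. \<forall>v\<in>carrier E. cmod (\<phi> v) \<le> K * nrm E v"
    by (intro exI[of _ "\<bar>K\<bar>"]) auto
qed

lemma dual_nrm_le:
  assumes "0 \<le> C" "\<And>v. v \<in> carrier E \<Longrightarrow> cmod (\<phi> v) \<le> C * nrm E v"
  shows "nrm (dual_bimodule E) \<phi> \<le> C"
  unfolding dual_bimodule_simps
proof (rule cSUP_least)
  show "{v \<in> carrier E. nrm E v \<le> 1} \<noteq> {}" by (auto intro: exI[of _ \<zero>])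
  show "cmod (\<phi> v) \<le> C" if "v \<in> {v \<in> carrier E. nrm E v \<le> 1}" for v
    using assms(2)[of v] that mult_left_mono[of "nrm E v" 1 C] assms(1) by auto
qed

lemma unit_ball_le_dual_nrm:
  assumes "\<phi> \<in> bounded_functionals E" "v \<in> carrier E" "nrm E v \<le> 1"
  shows "cmod (\<phi> v) \<le> nrm (dual_bimodule E) \<phi>"
proof -
  obtain K where K: "0 \<le> K" "\<forall>v\<in>carrier E. cmod (\<phi> v) \<le> K * nrm E v"
    using bounded_functionalD(5)[OF assms(1)] by blast
  have "cmod (\<phi> w) \<le> K" if "w \<in> {v \<in> carrier E. nrm E v \<le> 1}" for w
    using K that mult_left_mono[of "nrm E w" 1 K] by fastforce
  then show ?thesis
    unfolding dual_bimodule_simps using assms by (intro cSUP_upper) (auto intro!: bdd_aboveI2)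
qed

lemma dual_nrm_nonneg: "\<phi> \<in> bounded_functionals E \<Longrightarrow> 0 \<le> nrm (dual_bimodule E) \<phi>"
  using unit_ball_le_dual_nrm[of \<phi> \<zero>] order_trans[OF norm_ge_zero] by auto

lemma le_dual_nrm:
  assumes "\<phi> \<in> bounded_functionals E" "v \<in> carrier E"
  shows "cmod (\<phi> v) \<le> nrm (dual_bimodule E) \<phi> * nrm E v"
proof (cases "nrm E v = 0")
  case True
  then show ?thesis using nrm_eq_0_iff[OF assms(2)] bounded_functionalD(4)[OF assms(1)] by simp
next
  case False
  define r where "r = nrm E v"
  have r: "0 < r" using False nrm_nonneg[OF assms(2)] by (simp add: r_def)
  have "nrm E (complex_of_real (1 / r) \<odot> v) \<le> 1"
    using assms(2) r by (simp add: nrm_smult r_def[symmetric] norm_divide)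
  then have "cmod (\<phi> (complex_of_real (1 / r) \<odot> v)) \<le> nrm (dual_bimodule E) \<phi>"
    using assms by (intro unit_ball_le_dual_nrm) auto
  then show ?thesis
    using r bounded_functionalD(2)[OF assms] by (simp add: norm_mult norm_divide divide_le_eq r_def)
qed

lemma dual_add_closed:
  assumes "\<phi> \<in> bounded_functionals E" "\<psi> \<in> bounded_functionals E"
  shows "(\<lambda>v\<in>carrier E. \<phi> v + \<psi> v) \<in> bounded_functionals E"
proof (rule bounded_functionalI)
  show "cmod (\<phi> v + \<psi> v) \<le> (nrm (dual_bimodule E) \<phi> + nrm (dual_bimodule E) \<psi>) * nrm E v"
    if "v \<in> carrier E" for v
    using le_dual_nrm[OF assms(1) that] le_dual_nrm[OF assms(2) that]
    unfolding distrib_right by (rule norm_triangle_mono)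
qed (simp_all add: bounded_functionalD[OF assms(1)] bounded_functionalD[OF assms(2)] algebra_simps)

lemma dual_smult_closed:
  assumes "\<phi> \<in> bounded_functionals E"
  shows "(\<lambda>v\<in>carrier E. c * \<phi> v) \<in> bounded_functionals E"
proof (rule bounded_functionalI)
  show "cmod (c * \<phi> v) \<le> (cmod c * nrm (dual_bimodule E) \<phi>) * nrm E v" if "v \<in> carrier E" for v
    using mult_left_mono[OF le_dual_nrm[OF assms that], of "cmod c"] by (simp add: norm_mult mult.assoc)
qed (simp_all add: bounded_functionalD[OF assms] algebra_simps)

lemma dual_zero_closed: "(\<lambda>v\<in>carrier E. 0) \<in> bounded_functionals E"
  by (rule bounded_functionalI[where K = 0]) auto

lemma dual_lact_closed:
  assumes "a \<in> carrier A" "\<phi> \<in> bounded_functionals E"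
  shows "(\<lambda>v\<in>carrier E. \<phi> (ract E v a)) \<in> bounded_functionals E"
    and "nrm (dual_bimodule E) (\<lambda>v\<in>carrier E. \<phi> (ract E v a)) \<le> nrm A a * nrm (dual_bimodule E) \<phi>"
proof -
  have le: "cmod (\<phi> (ract E v a)) \<le> (nrm A a * nrm (dual_bimodule E) \<phi>) * nrm E v"
    if "v \<in> carrier E" for v
    using le_dual_nrm[OF assms(2) ract_closed[OF assms(1) that]]
      mult_left_mono[OF ract_contractive[OF assms(1) that] dual_nrm_nonneg[OF assms(2)]]
    by (simp only: ac_simps)
  show "(\<lambda>v\<in>carrier E. \<phi> (ract E v a)) \<in> bounded_functionals E"
    by (rule bounded_functionalI[OF _ _ le])
      (simp_all add: bounded_functionalD[OF assms(2)] ract_closed assms(1) ract_add_left ract_smult_left)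
  show "nrm (dual_bimodule E) (\<lambda>v\<in>carrier E. \<phi> (ract E v a)) \<le> nrm A a * nrm (dual_bimodule E) \<phi>"
    using le dual_nrm_nonneg[OF assms(2)] nrm_algebra_nonneg[OF assms(1)]
    by (intro dual_nrm_le mult_nonneg_nonneg) auto
qed

lemma dual_ract_closed:
  assumes "a \<in> carrier A" "\<phi> \<in> bounded_functionals E"
  shows "(\<lambda>v\<in>carrier E. \<phi> (lact E a v)) \<in> bounded_functionals E"
    and "nrm (dual_bimodule E) (\<lambda>v\<in>carrier E. \<phi> (lact E a v)) \<le> nrm (dual_bimodule E) \<phi> * nrm A a"
proof -
  have le: "cmod (\<phi> (lact E a v)) \<le> (nrm (dual_bimodule E) \<phi> * nrm A a) * nrm E v"
    if "v \<in> carrier E" for v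
    using le_dual_nrm[OF assms(2) lact_closed[OF assms(1) that]]
      mult_left_mono[OF lact_contractive[OF assms(1) that] dual_nrm_nonneg[OF assms(2)]]
    by (simp only: ac_simps)
  show "(\<lambda>v\<in>carrier E. \<phi> (lact E a v)) \<in> bounded_functionals E"
    by (rule bounded_functionalI[OF _ _ le])
      (simp_all add: bounded_functionalD[OF assms(2)] lact_closed assms(1) lact_add_right lact_smult_right)
  show "nrm (dual_bimodule E) (\<lambda>v\<in>carrier E. \<phi> (lact E a v)) \<le> nrm (dual_bimodule E) \<phi> * nrm A a"
    using le dual_nrm_nonneg[OF assms(2)] nrm_algebra_nonneg[OF assms(1)]
    by (intro dual_nrm_le mult_nonneg_nonneg) auto
qed

lemma dual_eqI:
  assumes "\<phi> \<in> bounded_functionals E" "\<psi> \<in> bounded_functionals E"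
    and "\<And>v. v \<in> carrier E \<Longrightarrow> \<phi> v = \<psi> v"
  shows "\<phi> = \<psi>"
  by (rule extensionalityI[of _ "carrier E"]) (use assms in \<open>auto simp: bounded_functionals_def\<close>)

lemma dual_abelian_group: "abelian_group (dual_bimodule E)"
proof (rule abelian_groupI)
  fix \<phi> assume "\<phi> \<in> carrier (dual_bimodule E)"
  then have \<phi>: "\<phi> \<in> bounded_functionals E" by simp
  show "\<exists>\<psi>\<in>carrier (dual_bimodule E). \<psi> \<oplus>\<^bsub>dual_bimodule E\<^esub> \<phi> = \<zero>\<^bsub>dual_bimodule E\<^esub>"
    using dual_smult_closed[OF \<phi>, of "-1"] by (intro bexI[of _ "\<lambda>v\<in>carrier E. -1 * \<phi> v"]) auto
  show "\<zero>\<^bsub>dual_bimodule E\<^esub> \<oplus>\<^bsub>dual_bimodule E\<^esub> \<phi> = \<phi>"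
    using bounded_functionalD(3)[OF \<phi>] by (simp cong: restrict_cong)
qed (auto simp: dual_add_closed dual_zero_closed ac_simps cong: restrict_cong)

lemma dual_minus:
  assumes "\<phi> \<in> bounded_functionals E" "\<psi> \<in> bounded_functionals E"
  shows "\<phi> \<ominus>\<^bsub>dual_bimodule E\<^esub> \<psi> = (\<lambda>v\<in>carrier E. \<phi> v - \<psi> v)"
proof -
  interpret D: abelian_group "dual_bimodule E" by (rule dual_abelian_group)
  have "\<ominus>\<^bsub>dual_bimodule E\<^esub> \<psi> = (\<lambda>v\<in>carrier E. -1 * \<psi> v)"
    using assms(2) dual_smult_closed[OF assms(2), of "-1"]
    by (intro D.minus_equality) auto
  then show ?thesis by (simp add: a_minus_def cong: restrict_cong)
qed

lemma dual_minus_closed: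
  assumes "\<phi> \<in> bounded_functionals E" "\<psi> \<in> bounded_functionals E"
  shows "(\<lambda>v\<in>carrier E. \<phi> v - \<psi> v) \<in> bounded_functionals E"
proof -
  have "(\<lambda>v\<in>carrier E. \<phi> v + (\<lambda>v\<in>carrier E. -1 * \<psi> v) v) \<in> bounded_functionals E"
    by (intro dual_add_closed dual_smult_closed assms)
  then show ?thesis by (simp cong: restrict_cong)
qed

text \<open>
  A Cauchy sequence of functionals converges pointwise, and uniformly on the unit ball.
\<close>

lemma dual_complete:
  assumes s: "range s \<subseteq> bounded_functionals E"
    and cauchy: "\<forall>\<epsilon>>0. \<exists>N. \<forall>m\<ge>N. \<forall>n\<ge>N. nrm (dual_bimodule E) (s m \<ominus>\<^bsub>dual_bimodule E\<^esub> s n) < \<epsilon>"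
  shows "\<exists>l\<in>bounded_functionals E. (\<lambda>n. nrm (dual_bimodule E) (s n \<ominus>\<^bsub>dual_bimodule E\<^esub> l)) \<longlonglongrightarrow> 0"
proof -
  have sn: "s n \<in> bounded_functionals E" for n using s by blast
  have unif: "\<exists>N. \<forall>m\<ge>N. \<forall>n\<ge>N. \<forall>v\<in>carrier E. cmod (s m v - s n v) \<le> \<epsilon> * nrm E v" if "0 < \<epsilon>" for \<epsilon>
  proof -
    obtain N where N: "\<And>m n. m \<ge> N \<Longrightarrow> n \<ge> N \<Longrightarrow> nrm (dual_bimodule E) (s m \<ominus>\<^bsub>dual_bimodule E\<^esub> s n) < \<epsilon>"
      using cauchy \<open>0 < \<epsilon>\<close> by metis
    have "cmod (s m v - s n v) \<le> \<epsilon> * nrm E v" if "m \<ge> N" "n \<ge> N" "v \<in> carrier E" for m n v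
    proof -
      have "cmod (s m v - s n v) \<le> nrm (dual_bimodule E) (s m \<ominus>\<^bsub>dual_bimodule E\<^esub> s n) * nrm E v"
        using le_dual_nrm[OF dual_minus_closed[OF sn sn] that(3), of m n] that(3)
        by (simp add: dual_minus[OF sn sn] del: dual_bimodule_simps(5))
      also have "\<dots> \<le> \<epsilon> * nrm E v"
        using N[OF that(1,2)] nrm_nonneg[OF that(3)] by (intro mult_right_mono) auto
      finally show ?thesis .
    qed
    then show ?thesis by blast
  qed
  have "convergent (\<lambda>n. s n v)" if v: "v \<in> carrier E" for v
  proof (rule Cauchy_convergent, rule CauchyI)
    fix \<epsilon> :: real assume "0 < \<epsilon>"
    define \<delta> where "\<delta> = \<epsilon> / (nrm E v + 1)"
    have \<delta>: "0 < \<delta>" using \<open>0 < \<epsilon>\<close> nrm_nonneg[OF v] by (simp add: \<delta>_def add_nonneg_pos)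
    obtain N where N: "\<forall>m\<ge>N. \<forall>n\<ge>N. \<forall>v\<in>carrier E. cmod (s m v - s n v) \<le> \<delta> * nrm E v"
      using unif[OF \<delta>] by blast
    have "\<delta> * nrm E v < \<delta> * (nrm E v + 1)" using \<delta> by simp
    also have "\<dots> = \<epsilon>" using nrm_nonneg[OF v] by (simp add: \<delta>_def)
    finally show "\<exists>N. \<forall>m\<ge>N. \<forall>n\<ge>N. cmod (s m v - s n v) < \<epsilon>"
      using N v by (meson le_less_trans)
  qed
  then obtain l where l: "\<And>v. v \<in> carrier E \<Longrightarrow> (\<lambda>n. s n v) \<longlonglongrightarrow> l v"
    unfolding convergent_def by metis
  have l_le: "cmod (s n v - l v) \<le> \<epsilon> * nrm E v"
    if N: "\<forall>m\<ge>N. \<forall>n\<ge>N. \<forall>v\<in>carrier E. cmod (s m v - s n v) \<le> \<epsilon> * nrm E v" and "n \<ge> N" "v \<in> carrier E"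
    for \<epsilon> N n v
  proof (rule tendsto_upperbound)
    show "(\<lambda>m. cmod (s n v - s m v)) \<longlonglongrightarrow> cmod (s n v - l v)"
      by (intro tendsto_intros l that)
    show "\<forall>\<^sub>F m in sequentially. cmod (s n v - s m v) \<le> \<epsilon> * nrm E v"
      using that by (auto simp: eventually_sequentially)
  qed simp
  obtain N1 where N1: "\<forall>m\<ge>N1. \<forall>n\<ge>N1. \<forall>v\<in>carrier E. cmod (s m v - s n v) \<le> 1 * nrm E v"
    using unif[of 1] by auto
  have lB: "restrict l (carrier E) \<in> bounded_functionals E"
  proof (rule bounded_functionalI)
    fix v w c assume v: "v \<in> carrier E"
    show "l (v \<oplus> w) = l v + l w" if w: "w \<in> carrier E"
    proof (rule LIMSEQ_unique[OF l])
      show "(\<lambda>n. s n (v \<oplus> w)) \<longlonglongrightarrow> l v + l w"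
        using tendsto_add[OF l[OF v] l[OF w]] by (simp add: bounded_functionalD[OF sn] v w)
    qed (use v w in simp)
    show "l (c \<odot> v) = c * l v"
    proof (rule LIMSEQ_unique[OF l])
      show "(\<lambda>n. s n (c \<odot> v)) \<longlonglongrightarrow> c * l v"
        using tendsto_mult_left[OF l[OF v], of c] by (simp add: bounded_functionalD[OF sn] v)
    qed (use v in simp)
    have "cmod (l v) \<le> cmod (s N1 v) + cmod (s N1 v - l v)"
      using norm_triangle_ineq4[of "s N1 v" "s N1 v - l v"] by simp
    also have "\<dots> \<le> nrm (dual_bimodule E) (s N1) * nrm E v + 1 * nrm E v"
      using le_dual_nrm[OF sn v] l_le[OF N1 order_refl v] by (rule add_mono)
    finally show "cmod (l v) \<le> (nrm (dual_bimodule E) (s N1) + 1) * nrm E v"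
      by (simp add: distrib_right)
  qed
  have "(\<lambda>n. nrm (dual_bimodule E) (s n \<ominus>\<^bsub>dual_bimodule E\<^esub> restrict l (carrier E))) \<longlonglongrightarrow> 0"
  proof (rule LIMSEQ_I)
    fix \<epsilon> :: real assume "0 < \<epsilon>"
    then obtain N where N: "\<forall>m\<ge>N. \<forall>n\<ge>N. \<forall>v\<in>carrier E. cmod (s m v - s n v) \<le> (\<epsilon> / 2) * nrm E v"
      using unif[of "\<epsilon> / 2"] by auto
    have "norm (nrm (dual_bimodule E) (s n \<ominus>\<^bsub>dual_bimodule E\<^esub> restrict l (carrier E)) - 0) < \<epsilon>"
      if "n \<ge> N" for n
    proof -
      have "nrm (dual_bimodule E) (s n \<ominus>\<^bsub>dual_bimodule E\<^esub> restrict l (carrier E)) \<le> \<epsilon> / 2"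
        unfolding dual_minus[OF sn lB]
        using \<open>0 < \<epsilon>\<close> l_le[OF N that] by (intro dual_nrm_le) auto
      moreover have "0 \<le> nrm (dual_bimodule E) (s n \<ominus>\<^bsub>dual_bimodule E\<^esub> restrict l (carrier E))"
        unfolding dual_minus[OF sn lB] by (intro dual_nrm_nonneg dual_minus_closed sn lB)
      ultimately show ?thesis using \<open>0 < \<epsilon>\<close> by simp
    qed
    then show "\<exists>N. \<forall>n\<ge>N. norm (nrm (dual_bimodule E) (s n \<ominus>\<^bsub>dual_bimodule E\<^esub> restrict l (carrier E)) - 0) < \<epsilon>"
      by blast
  qed
  with lB show ?thesis by blast
qed

lemma dual_banach_bimodule: "banach_bimodule A (dual_bimodule E)"
proof -
  note BD = bounded_functionalD
  have "module (ring_of_type_algebra :: complex ring) (dual_bimodule E)"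
  proof (rule moduleI)
    show "\<one>\<^bsub>ring_of_type_algebra :: complex ring\<^esub> \<odot>\<^bsub>dual_bimodule E\<^esub> \<phi> = \<phi>"
      if "\<phi> \<in> carrier (dual_bimodule E)" for \<phi>
      using that BD(3)[of \<phi>] by (simp cong: restrict_cong)
  qed (auto simp: dual_abelian_group dual_smult_closed algebra_simps cong: restrict_cong)
  then interpret D: module "ring_of_type_algebra :: complex ring" "dual_bimodule E" .
  show ?thesis
  proof (unfold_locales, unfold dual_bimodule_simps(1))
    fix \<phi> assume \<phi>: "\<phi> \<in> bounded_functionals E"
    show "0 \<le> nrm (dual_bimodule E) \<phi>" by (rule dual_nrm_nonneg[OF \<phi>])
    show "nrm (dual_bimodule E) \<phi> = 0 \<longleftrightarrow> \<phi> = \<zero>\<^bsub>dual_bimodule E\<^esub>"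
    proof
      assume "nrm (dual_bimodule E) \<phi> = 0"
      then have "\<phi> v = 0" if "v \<in> carrier E" for v
        using le_dual_nrm[OF \<phi> that] by simp
      then show "\<phi> = \<zero>\<^bsub>dual_bimodule E\<^esub>"
        using \<phi> by (intro dual_eqI) (auto simp: dual_zero_closed)
    next
      assume "\<phi> = \<zero>\<^bsub>dual_bimodule E\<^esub>"
      then have "nrm (dual_bimodule E) \<phi> \<le> 0" by (intro dual_nrm_le) auto
      then show "nrm (dual_bimodule E) \<phi> = 0" using dual_nrm_nonneg[OF \<phi>] by linarith
    qed
    show "nrm (dual_bimodule E) (\<phi> \<oplus>\<^bsub>dual_bimodule E\<^esub> \<psi>) \<le> nrm (dual_bimodule E) \<phi> + nrm (dual_bimodule E) \<psi>"
      if \<psi>: "\<psi> \<in> bounded_functionals E" for \<psi>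
    proof (rule dual_nrm_le)
      show "cmod ((\<phi> \<oplus>\<^bsub>dual_bimodule E\<^esub> \<psi>) v) \<le> (nrm (dual_bimodule E) \<phi> + nrm (dual_bimodule E) \<psi>) * nrm E v"
        if v: "v \<in> carrier E" for v
        using norm_triangle_mono[OF le_dual_nrm[OF \<phi> v] le_dual_nrm[OF \<psi> v]] v
        by (simp add: distrib_right del: dual_bimodule_simps(5))
    qed (intro add_nonneg_nonneg dual_nrm_nonneg \<phi> \<psi>)
    have smult_le: "nrm (dual_bimodule E) (c \<odot>\<^bsub>dual_bimodule E\<^esub> \<psi>) \<le> cmod c * nrm (dual_bimodule E) \<psi>"
      if \<psi>: "\<psi> \<in> bounded_functionals E" for \<psi> c
    proof (rule dual_nrm_le)
      show "cmod ((c \<odot>\<^bsub>dual_bimodule E\<^esub> \<psi>) v) \<le> cmod c * nrm (dual_bimodule E) \<psi> * nrm E v"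
        if v: "v \<in> carrier E" for v
        using mult_left_mono[OF le_dual_nrm[OF \<psi> v], of "cmod c"] v
        by (simp add: norm_mult mult.assoc del: dual_bimodule_simps(5))
    qed (intro mult_nonneg_nonneg dual_nrm_nonneg \<psi> norm_ge_zero)
    show "nrm (dual_bimodule E) (c \<odot>\<^bsub>dual_bimodule E\<^esub> \<phi>) = cmod c * nrm (dual_bimodule E) \<phi>" for c
    proof (cases "c = 0")
      case True
      then show ?thesis
        using smult_le[OF \<phi>, of 0] dual_nrm_nonneg[OF dual_smult_closed[OF \<phi>, of 0]]
        by (simp del: dual_bimodule_simps(5))
    next
      case False
      have "(1 / c) \<odot>\<^bsub>dual_bimodule E\<^esub> (c \<odot>\<^bsub>dual_bimodule E\<^esub> \<phi>) = \<phi>"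
        using BD(3)[OF \<phi>] False by (simp cong: restrict_cong)
      moreover have "c \<odot>\<^bsub>dual_bimodule E\<^esub> \<phi> \<in> bounded_functionals E"
        using dual_smult_closed[OF \<phi>] by simp
      ultimately have "nrm (dual_bimodule E) \<phi> \<le> cmod (1 / c) * nrm (dual_bimodule E) (c \<odot>\<^bsub>dual_bimodule E\<^esub> \<phi>)"
        using smult_le[of "c \<odot>\<^bsub>dual_bimodule E\<^esub> \<phi>" "1 / c"] by (simp only:)
      then have "cmod c * nrm (dual_bimodule E) \<phi> \<le> nrm (dual_bimodule E) (c \<odot>\<^bsub>dual_bimodule E\<^esub> \<phi>)"
        using False by (simp add: norm_divide le_divide_eq mult.commute del: dual_bimodule_simps)
      with smult_le[OF \<phi>, of c] show ?thesis by linarith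
    qed
    fix a assume a: "a \<in> carrier A"
    show "lact (dual_bimodule E) a \<phi> \<in> bounded_functionals E" "ract (dual_bimodule E) \<phi> a \<in> bounded_functionals E"
      "nrm (dual_bimodule E) (lact (dual_bimodule E) a \<phi>) \<le> nrm A a * nrm (dual_bimodule E) \<phi>"
      "nrm (dual_bimodule E) (ract (dual_bimodule E) \<phi> a) \<le> nrm (dual_bimodule E) \<phi> * nrm A a"
      using dual_lact_closed[OF a \<phi>] dual_ract_closed[OF a \<phi>] by (simp_all del: dual_bimodule_simps(5))
  next
    fix s :: "nat \<Rightarrow> 'e \<Rightarrow> complex" assume "range s \<subseteq> bounded_functionals E"
      "\<forall>\<epsilon>>0. \<exists>N. \<forall>m\<ge>N. \<forall>n\<ge>N. nrm (dual_bimodule E) (s m \<ominus>\<^bsub>dual_bimodule E\<^esub> s n) < \<epsilon>"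
    then show "\<exists>l\<in>bounded_functionals E. (\<lambda>n. nrm (dual_bimodule E) (s n \<ominus>\<^bsub>dual_bimodule E\<^esub> l)) \<longlonglongrightarrow> 0"
      by (rule dual_complete)
  qed (auto simp: BD lact_closed ract_closed lact_add_left lact_add_right ract_add_left ract_add_right
      lact_smult_left lact_smult_right ract_smult_left ract_smult_right lact_assoc ract_assoc lact_ract
      cong: restrict_cong simp del: dual_bimodule_simps(5))
qed

lemma inner_derivation_dual_iff:
  "inner_derivation A (dual_bimodule E) D \<longleftrightarrow>
    (\<exists>\<tau>\<in>bounded_functionals E. \<forall>a\<in>carrier A. D a = (\<lambda>v\<in>carrier E. \<tau> (ract E v a) - \<tau> (lact E a v)))"
proof -
  have "lact (dual_bimodule E) a \<tau> \<ominus>\<^bsub>dual_bimodule E\<^esub> ract (dual_bimodule E) \<tau> a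
      = (\<lambda>v\<in>carrier E. \<tau> (ract E v a) - \<tau> (lact E a v))"
    if "a \<in> carrier A" "\<tau> \<in> bounded_functionals E" for a \<tau>
    using dual_minus[OF dual_lact_closed(1)[OF that] dual_ract_closed(1)[OF that]]
    by (simp cong: restrict_cong)
  then show ?thesis unfolding inner_derivation_def dual_bimodule_simps(1) by simp
qed

lemma bounded_derivation_dual_iff:
  "bounded_derivation A (dual_bimodule E) D \<longleftrightarrow>
    (\<forall>a\<in>carrier A. D a \<in> bounded_functionals E) \<and>
    (\<forall>a\<in>carrier A. \<forall>b\<in>carrier A. D (a \<oplus>\<^bsub>A\<^esub> b) = (\<lambda>v\<in>carrier E. D a v + D b v)) \<and>
    (\<forall>c. \<forall>a\<in>carrier A. D (c \<odot>\<^bsub>A\<^esub> a) = (\<lambda>v\<in>carrier E. c * D a v)) \<and>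
    (\<exists>K. \<forall>a\<in>carrier A. nrm (dual_bimodule E) (D a) \<le> K * nrm A a) \<and>
    (\<forall>a\<in>carrier A. \<forall>b\<in>carrier A.
       D (a \<otimes>\<^bsub>A\<^esub> b) = (\<lambda>v\<in>carrier E. D b (ract E v a) + D a (lact E b v)))"
  unfolding bounded_derivation_def by (simp add: Pi_iff cong: restrict_cong)

end

section \<open>Derivations into a dual bimodule\<close>

context normed_bimodule
begin

text \<open>
  A bounded derivation into \<open>E\<^sup>*\<close>, with all identities evaluated at vectors of \<open>E\<close>, so that the
  extensional operations of the dual bimodule do not occur in computations.
\<close>

definition dual_derivation :: "('a \<Rightarrow> 'e \<Rightarrow> complex) \<Rightarrow> bool" where
  "dual_derivation D \<longleftrightarrow>
    (\<forall>a\<in>carrier A. D a \<in> bounded_functionals E) \<and>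
    (\<forall>a\<in>carrier A. \<forall>b\<in>carrier A. \<forall>v\<in>carrier E. D (a \<oplus>\<^bsub>A\<^esub> b) v = D a v + D b v) \<and>
    (\<forall>c. \<forall>a\<in>carrier A. \<forall>v\<in>carrier E. D (c \<odot>\<^bsub>A\<^esub> a) v = c * D a v) \<and>
    (\<exists>K\<ge>0. \<forall>a\<in>carrier A. \<forall>v\<in>carrier E. cmod (D a v) \<le> K * nrm A a * nrm E v) \<and>
    (\<forall>a\<in>carrier A. \<forall>b\<in>carrier A. \<forall>v\<in>carrier E.
       D (a \<otimes>\<^bsub>A\<^esub> b) v = D b (ract E v a) + D a (lact E b v))"

lemma dual_derivationD:
  assumes "dual_derivation D"
  shows "a \<in> carrier A \<Longrightarrow> D a \<in> bounded_functionals E"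
    and "a \<in> carrier A \<Longrightarrow> b \<in> carrier A \<Longrightarrow> v \<in> carrier E \<Longrightarrow> D (a \<oplus>\<^bsub>A\<^esub> b) v = D a v + D b v"
    and "a \<in> carrier A \<Longrightarrow> v \<in> carrier E \<Longrightarrow> D (c \<odot>\<^bsub>A\<^esub> a) v = c * D a v"
    and "\<exists>K\<ge>0. \<forall>a\<in>carrier A. \<forall>v\<in>carrier E. cmod (D a v) \<le> K * nrm A a * nrm E v"
    and "a \<in> carrier A \<Longrightarrow> b \<in> carrier A \<Longrightarrow> v \<in> carrier E \<Longrightarrow>
      D (a \<otimes>\<^bsub>A\<^esub> b) v = D b (ract E v a) + D a (lact E b v)"
  using assms unfolding dual_derivation_def by blast+

lemma bounded_derivation_imp_dual_derivation:
  assumes "bounded_derivation A (dual_bimodule E) D"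
  shows "dual_derivation D"
proof -
  note D = assms[unfolded bounded_derivation_dual_iff]
  obtain K where K: "\<forall>a\<in>carrier A. nrm (dual_bimodule E) (D a) \<le> K * nrm A a"
    using D by blast
  have "cmod (D a v) \<le> \<bar>K\<bar> * nrm A a * nrm E v" if a: "a \<in> carrier A" and v: "v \<in> carrier E" for a v
  proof -
    have "cmod (D a v) \<le> nrm (dual_bimodule E) (D a) * nrm E v"
      using D a v by (intro le_dual_nrm) auto
    also have "\<dots> \<le> (K * nrm A a) * nrm E v"
      using K a nrm_nonneg[OF v] by (intro mult_right_mono) auto
    also have "\<dots> \<le> (\<bar>K\<bar> * nrm A a) * nrm E v"
      using nrm_nonneg[OF v] nrm_algebra_nonneg[OF a] by (intro mult_right_mono) auto
    finally show ?thesis .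
  qed
  then have "\<exists>K\<ge>0. \<forall>a\<in>carrier A. \<forall>v\<in>carrier E. cmod (D a v) \<le> K * nrm A a * nrm E v"
    by (intro exI[of _ "\<bar>K\<bar>"]) auto
  then show ?thesis using D unfolding dual_derivation_def by simp
qed

lemma dual_derivation_minus_inner:
  assumes D: "dual_derivation D" and \<tau>: "\<tau> \<in> bounded_functionals E"
  shows "dual_derivation (\<lambda>a. \<lambda>v\<in>carrier E. D a v - (\<tau> (ract E v a) - \<tau> (lact E a v)))"
proof -
  note Dd = dual_derivationD[OF D] and \<tau>d = bounded_functionalD[OF \<tau>]
  have "(\<lambda>v\<in>carrier E. D a v - (\<lambda>v\<in>carrier E. (\<lambda>v\<in>carrier E. \<tau> (ract E v a)) v - (\<lambda>v\<in>carrier E. \<tau> (lact E a v)) v) v)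
      \<in> bounded_functionals E" if "a \<in> carrier A" for a
    by (intro dual_minus_closed Dd dual_lact_closed dual_ract_closed \<tau> that)
  then have mem: "(\<lambda>v\<in>carrier E. D a v - (\<tau> (ract E v a) - \<tau> (lact E a v))) \<in> bounded_functionals E"
    if "a \<in> carrier A" for a
    using that by (simp cong: restrict_cong)
  obtain K where K: "0 \<le> K" "\<forall>a\<in>carrier A. \<forall>v\<in>carrier E. cmod (D a v) \<le> K * nrm A a * nrm E v"
    using Dd(4) by blast
  let ?T = "nrm (dual_bimodule E) \<tau>"
  have bound: "cmod (D a v - (\<tau> (ract E v a) - \<tau> (lact E a v))) \<le> (K + 2 * ?T) * nrm A a * nrm E v"
    if a: "a \<in> carrier A" and v: "v \<in> carrier E" for a v
  proof -
    have "cmod (\<tau> (ract E v a)) \<le> ?T * (nrm E v * nrm A a)"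
      using le_dual_nrm[OF \<tau> ract_closed[OF a v]]
        mult_left_mono[OF ract_contractive[OF a v] dual_nrm_nonneg[OF \<tau>]] by linarith
    moreover have "cmod (\<tau> (lact E a v)) \<le> ?T * (nrm A a * nrm E v)"
      using le_dual_nrm[OF \<tau> lact_closed[OF a v]]
        mult_left_mono[OF lact_contractive[OF a v] dual_nrm_nonneg[OF \<tau>]] by linarith
    moreover have "cmod (D a v) \<le> K * nrm A a * nrm E v" using K a v by blast
    moreover have "cmod (D a v - (\<tau> (ract E v a) - \<tau> (lact E a v)))
        \<le> cmod (D a v) + (cmod (\<tau> (ract E v a)) + cmod (\<tau> (lact E a v)))"
      by (rule norm_triangle_le_diff) (simp add: norm_triangle_ineq4)
    ultimately show ?thesis by (simp add: algebra_simps del: dual_bimodule_simps)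
  qed
  have K': "0 \<le> K + 2 * ?T" using K(1) dual_nrm_nonneg[OF \<tau>] by simp
  show ?thesis
    unfolding dual_derivation_def
  proof (intro conjI ballI allI)
    show "(\<lambda>v\<in>carrier E. D a v - (\<tau> (ract E v a) - \<tau> (lact E a v))) \<in> bounded_functionals E"
      if "a \<in> carrier A" for a by (rule mem[OF that])
    show "\<exists>K\<ge>0. \<forall>a\<in>carrier A. \<forall>v\<in>carrier E.
        cmod ((\<lambda>v\<in>carrier E. D a v - (\<tau> (ract E v a) - \<tau> (lact E a v))) v) \<le> K * nrm A a * nrm E v"
      using bound K' by (intro exI[of _ "K + 2 * ?T"]) (simp del: dual_bimodule_simps)
  qed (simp_all add: Dd \<tau>d lact_closed ract_closed lact_add_left ract_add_right
      lact_smult_left ract_smult_right lact_assoc ract_assoc lact_ract algebra_simps)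
qed

text \<open>For an idempotent \<open>e\<close> the derivation equation forces \<open>e.D(e).e = 0\<close>, so that the
  inner derivation given by \<open>\<tau> = e.D(e) - D(e).e\<close> takes the value \<open>D(e)\<close> at \<open>e\<close>.\<close>

lemma inner_at_idempotent:
  assumes D: "dual_derivation D" and e: "e \<in> carrier A" "e \<otimes>\<^bsub>A\<^esub> e = e"
  shows "\<exists>\<tau>\<in>bounded_functionals E. \<forall>v\<in>carrier E. D e v = \<tau> (ract E v e) - \<tau> (lact E e v)"
proof -
  note Dd = dual_derivationD[OF D]
  have De: "D e v = D e (ract E v e) + D e (lact E e v)" if "v \<in> carrier E" for v
    using Dd(5)[OF e(1) e(1) that] e(2) by simp
  have rr: "ract E (ract E v e) e = ract E v e" and ll: "lact E e (lact E e v) = lact E e v"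
    if "v \<in> carrier E" for v
    using ract_assoc[OF e(1) e(1) that] lact_assoc[OF e(1) e(1) that] e(2) by simp_all
  have mid: "D e (lact E e (ract E v e)) = 0" if "v \<in> carrier E" for v
    using De[of "lact E e (ract E v e)"] that rr[of "lact E e v"] ll[of "ract E v e"]
    by (simp add: lact_closed ract_closed e(1) lact_ract)
  define \<tau> where "\<tau> = (\<lambda>v\<in>carrier E. (\<lambda>v\<in>carrier E. D e (ract E v e)) v - (\<lambda>v\<in>carrier E. D e (lact E e v)) v)"
  have "\<tau> \<in> bounded_functionals E"
    unfolding \<tau>_def by (intro dual_minus_closed dual_lact_closed dual_ract_closed Dd e)
  moreover have "D e v = \<tau> (ract E v e) - \<tau> (lact E e v)" if v: "v \<in> carrier E" for v
    using De[OF v] mid[OF v] v rr[OF v] ll[OF v]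
    by (simp add: \<tau>_def lact_closed ract_closed e(1) lact_ract)
  ultimately show ?thesis by blast
qed

end

section \<open>Point masses in the crossed product\<close>

context continuous_action
begin

definition point_mass :: "'g \<Rightarrow> ('x \<Rightarrow>\<^sub>C complex) \<Rightarrow> 'g \<Rightarrow> ('x \<Rightarrow>\<^sub>C complex)" where
  "point_mass g p = (\<lambda>h. if h = g then p else 0)"

abbreviation \<delta> where "\<delta> g \<equiv> point_mass g (const_bcontfun 1)"

lemma cx_embed_eq: "cx_embed G p = point_mass \<one> p"
  by (simp add: cx_embed_def point_mass_def)

lemma point_mass_closed [simp]: "g \<in> carrier G \<Longrightarrow> point_mass g p \<in> carrier \<A>"
  unfolding carrier_A0
  using uniformly_abs_summable_finite[of "{g}" "point_mass g p" "carrier G"] by (auto simp: point_mass_def)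

lemma nrm_point_mass_le:
  assumes "g \<in> carrier G"
  shows "nrm \<A> (point_mass g p) \<le> norm p"
proof (rule nrm_A0_le[OF point_mass_closed[OF assms]])
  fix x
  have "(\<Sum>\<^sub>\<infinity>h\<in>carrier G. cmod (point_mass g p h x)) = (\<Sum>\<^sub>\<infinity>h\<in>{g}. cmod (p x))"
    using assms by (intro infsum_cong_neutral) (auto simp: point_mass_def)
  then show "(\<Sum>\<^sub>\<infinity>h\<in>carrier G. cmod (point_mass g p h x)) \<le> norm p"
    using norm_bounded[of p x] by simp
qed

lemma norm_unit_le: "norm (const_bcontfun 1 :: 'x \<Rightarrow>\<^sub>C complex) \<le> 1"
  by (rule norm_bound) simp

lemma point_mass_mult_apply:
  assumes "g \<in> carrier G" "f \<in> carrier \<A>" "l \<in> carrier G"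
  shows "apply_bcontfun ((point_mass g p \<otimes>\<^bsub>\<A>\<^esub> f) l) x = p x * f (inv g \<otimes> l) (act (inv g) x)"
proof -
  have "apply_bcontfun ((point_mass g p \<otimes>\<^bsub>\<A>\<^esub> f) l) x
      = (\<Sum>\<^sub>\<infinity>h\<in>carrier G. point_mass g p h x * f (inv h \<otimes> l) (act (inv h) x))"
    by (rule apply_A0_mult) (use assms in auto)
  also have "\<dots> = (\<Sum>\<^sub>\<infinity>h\<in>{g}. p x * f (inv g \<otimes> l) (act (inv g) x))"
    using assms by (intro infsum_cong_neutral) (auto simp: point_mass_def)
  finally show ?thesis by simp
qed

lemma point_mass_mult:
  assumes g: "g \<in> carrier G" and h: "h \<in> carrier G"
  shows "point_mass g p \<otimes>\<^bsub>\<A>\<^esub> point_mass h q = point_mass (g \<otimes> h) (cx_mult p (cx_translate G act g q))"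
proof (rule ext)
  fix l
  show "(point_mass g p \<otimes>\<^bsub>\<A>\<^esub> point_mass h q) l = point_mass (g \<otimes> h) (cx_mult p (cx_translate G act g q)) l"
  proof (cases "l \<in> carrier G")
    case False
    then show ?thesis using g h by (auto simp: A0_mult_outside point_mass_def)
  next
    case True
    have "inv g \<otimes> l = h \<longleftrightarrow> l = g \<otimes> h"
      using g h True by (metis inv_closed inv_solve_left)
    then have "point_mass h q (inv g \<otimes> l) = (if l = g \<otimes> h then q else 0)"
      by (simp add: point_mass_def)
    then show ?thesis
      by (intro bcontfun_eqI) (simp add: point_mass_mult_apply[OF g point_mass_closed[OF h] True]
        point_mass_def[of "g \<otimes> h"] g)
  qed
qed

lemma cx_mult_one [simp]: "cx_mult (const_bcontfun 1) p = p" "cx_mult p (const_bcontfun 1) = p"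
  by (auto intro: bcontfun_eqI)

lemma cx_translate_unit [simp]: "g \<in> carrier G \<Longrightarrow> cx_translate G act g (const_bcontfun 1) = const_bcontfun 1"
  "cx_translate G act \<one> p = p"
  by (auto intro: bcontfun_eqI)

text \<open>
  The relations of the crossed product; the third says that conjugation by \<open>\<delta>\<^sub>g\<close> implements the action on \<open>CX\<close>.
\<close>

lemma delta_mult:
  assumes "g \<in> carrier G" "h \<in> carrier G"
  shows "\<delta> g \<otimes>\<^bsub>\<A>\<^esub> \<delta> h = \<delta> (g \<otimes> h)"
    and "cx_embed G p \<otimes>\<^bsub>\<A>\<^esub> \<delta> g = point_mass g p"
    and "\<delta> g \<otimes>\<^bsub>\<A>\<^esub> cx_embed G p = cx_embed G (cx_translate G act g p) \<otimes>\<^bsub>\<A>\<^esub> \<delta> g"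
    and "cx_embed G p \<otimes>\<^bsub>\<A>\<^esub> cx_embed G q = cx_embed G (cx_mult p q)"
  using assms by (simp_all add: point_mass_mult cx_embed_eq)

lemma cx_embed_closed [simp]: "cx_embed G p \<in> carrier \<A>"
  by (simp add: cx_embed_eq)

lemma nrm_cx_embed_le: "nrm \<A> (cx_embed G p) \<le> norm p"
  by (simp add: cx_embed_eq nrm_point_mass_le)

lemma cx_embed_add: "cx_embed G (p + q) = cx_embed G p \<oplus>\<^bsub>\<A>\<^esub> cx_embed G q"
  by (auto simp: cx_embed_def)

lemma cx_embed_scale: "cx_embed G (cx_scale c p) = c \<odot>\<^bsub>\<A>\<^esub> cx_embed G p"
  by (rule ext, rule bcontfun_eqI) (simp add: cx_embed_def)

text \<open>Elements of finite support are dense, so a bounded additive map is determined by its values on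
  point masses.\<close>

lemma additive_eq_zero:
  fixes \<Delta> :: "('g \<Rightarrow> ('x \<Rightarrow>\<^sub>C complex)) \<Rightarrow> complex"
  assumes add: "\<And>a b. a \<in> carrier \<A> \<Longrightarrow> b \<in> carrier \<A> \<Longrightarrow> \<Delta> (a \<oplus>\<^bsub>\<A>\<^esub> b) = \<Delta> a + \<Delta> b"
    and K: "0 \<le> K" "\<And>a. a \<in> carrier \<A> \<Longrightarrow> cmod (\<Delta> a) \<le> K * nrm \<A> a"
    and zero: "\<And>g p. g \<in> carrier G \<Longrightarrow> \<Delta> (point_mass g p) = 0"
    and a: "a \<in> carrier \<A>"
  shows "\<Delta> a = 0"
proof -
  define trunc where "trunc F = (\<lambda>g. if g \<in> F then a g else 0)" for F
  have trunc_closed: "trunc F \<in> carrier \<A>" for F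
    unfolding carrier_A0
  proof (intro conjI allI impI)
    show "trunc F g = 0" if "g \<notin> carrier G" for g
      using a that by (auto simp: trunc_def carrier_A0)
    show "uniformly_abs_summable (trunc F) (carrier G)"
      by (rule uniformly_abs_summable_dominated[of a _ 1]) (use a in \<open>auto simp: carrier_A0 trunc_def\<close>)
  qed
  have \<Delta>0: "\<Delta> (\<lambda>_. 0) = 0"
    using zero[OF one_closed, of 0] by (simp add: point_mass_def)
  have fin: "\<Delta> (trunc F) = 0" if "finite F" "F \<subseteq> carrier G" for F
    using that
  proof (induction F rule: finite_induct)
    case empty
    then show ?case using \<Delta>0 by (simp add: trunc_def)
  next
    case (insert g F)
    have "trunc (insert g F) = point_mass g (a g) \<oplus>\<^bsub>\<A>\<^esub> trunc F"
      using insert.hyps by (auto simp: trunc_def point_mass_def)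
    then have "\<Delta> (trunc (insert g F)) = \<Delta> (point_mass g (a g)) + \<Delta> (trunc F)"
      using insert.prems by (simp only: add[OF point_mass_closed trunc_closed] insert_subset)
    then show ?case using insert zero by simp
  qed
  have small: "cmod (\<Delta> a) \<le> K * \<epsilon>" if \<epsilon>: "0 < \<epsilon>" for \<epsilon>
  proof -
    obtain F where F: "finite F" "F \<subseteq> carrier G"
      "\<And>Y x. F \<subseteq> Y \<Longrightarrow> (\<Sum>\<^sub>\<infinity>g\<in>carrier G - Y. cmod (a g x)) \<le> \<epsilon>"
      using uniformly_abs_summable_tail[OF _ \<epsilon>, of a "carrier G"] a unfolding carrier_A0 by metis
    have "nrm \<A> (trunc (- F)) \<le> \<epsilon>"
    proof (rule nrm_A0_le[OF trunc_closed])
      fix x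
      have "(\<Sum>\<^sub>\<infinity>g\<in>carrier G. cmod (trunc (- F) g x)) = (\<Sum>\<^sub>\<infinity>g\<in>carrier G - F. cmod (a g x))"
        by (rule infsum_cong_neutral) (auto simp: trunc_def)
      then show "(\<Sum>\<^sub>\<infinity>g\<in>carrier G. cmod (trunc (- F) g x)) \<le> \<epsilon>" using F(3)[of F x] by simp
    qed
    moreover have "a = trunc F \<oplus>\<^bsub>\<A>\<^esub> trunc (- F)" by (auto simp: trunc_def)
    then have "\<Delta> a = \<Delta> (trunc F) + \<Delta> (trunc (- F))" using add[OF trunc_closed trunc_closed] by metis
    ultimately show ?thesis
      using K(2)[OF trunc_closed, of "- F"] mult_left_mono[OF _ K(1)] fin[OF F(1,2)] by fastforce
  qed
  have "cmod (\<Delta> a) \<le> 0 + e" if "0 < e" for e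
  proof -
    have "K * (e / (K + 1)) \<le> e"
      using K(1) that by (simp add: field_simps)
    moreover have "cmod (\<Delta> a) \<le> K * (e / (K + 1))"
      using K(1) that by (intro small) simp
    ultimately show ?thesis by simp
  qed
  then have "cmod (\<Delta> a) \<le> 0" by (rule field_le_epsilon)
  then show ?thesis by simp
qed

end

section \<open>Probability maps\<close>

lemma Prob_facts:
  assumes "f \<in> Prob G"
  shows "f h \<ge> 0" "f summable_on carrier G" "(\<Sum>\<^sub>\<infinity>h\<in>carrier G. f h) = 1"
  using assms by (auto simp: Prob_def l1_norm_def)

lemma abs_diff_summable:
  assumes "f summable_on carrier G" "g summable_on carrier G"
  shows "(\<lambda>h. \<bar>f h - g h :: real\<bar>) summable_on carrier G"
proof -
  have "(\<lambda>h. f h + - g h) summable_on carrier G"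
    by (rule summable_on_add[OF assms(1)]) (simp add: summable_on_uminus assms(2))
  from this[THEN summable_on_iff_abs_summable_on_real[THEN iffD1]] show ?thesis by simp
qed

lemma sum_abs_diff_le_l1_norm:
  assumes "f summable_on carrier G" "g summable_on carrier G" "finite F" "F \<subseteq> carrier G"
  shows "(\<Sum>h\<in>F. \<bar>f h - g h\<bar>) \<le> l1_norm G (\<lambda>h. f h - g h)"
  unfolding l1_norm_def by (intro finite_sum_le_infsum abs_diff_summable assms) auto

lemma continuous_prob_maps_facts:
  assumes "m \<in> continuous_prob_maps G"
  shows "m x \<in> Prob G" "((\<lambda>y. l1_norm G (\<lambda>h. m y h - m x h)) \<longlongrightarrow> 0) (at x)"
  using assms by (auto simp: continuous_prob_maps_def)

lemma continuous_prob_map_component: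
  assumes m: "m \<in> continuous_prob_maps G"
  shows "continuous_on UNIV (\<lambda>x. m x h)"
proof (cases "h \<in> carrier G")
  case True
  note P = Prob_facts[OF continuous_prob_maps_facts(1)[OF m]]
  have "((\<lambda>y. m y h - m x h) \<longlongrightarrow> 0) (at x)" for x
  proof (rule Lim_null_comparison[OF _ continuous_prob_maps_facts(2)[OF m]])
    show "\<forall>\<^sub>F y in at x. norm (m y h - m x h) \<le> l1_norm G (\<lambda>h. m y h - m x h)"
      using sum_abs_diff_le_l1_norm[OF P(2) P(2), of "{h}"] True by simp
  qed
  then have "((\<lambda>y. m y h) \<longlongrightarrow> m x h) (at x)" for x
    using Lim_null by blast
  then show ?thesis by (simp add: continuous_on_def)
next
  case False
  then have "m x h = 0" for x
    using continuous_prob_maps_facts(1)[OF m, of x] by (auto simp: Prob_def)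
  then show ?thesis by simp
qed

text \<open>
  Near each point finitely many group elements carry almost all of the mass, by continuity of finitely many
  components; compactness makes the finite set uniform.
\<close>

lemma continuous_prob_map_uniform:
  fixes m :: "'x::topological_space \<Rightarrow> 'g \<Rightarrow> real"
  assumes X: "compact (UNIV :: 'x set)" and m: "m \<in> continuous_prob_maps G" and \<epsilon>: "0 < \<epsilon>"
  obtains F where "finite F" "F \<subseteq> carrier G" "\<And>x. 1 - \<epsilon> \<le> (\<Sum>h\<in>F. m x h)"
proof -
  note P = Prob_facts[OF continuous_prob_maps_facts(1)[OF m]]
  have loc: "\<exists>F U. finite F \<and> F \<subseteq> carrier G \<and> open U \<and> x \<in> U \<and> (\<forall>y\<in>U. 1 - \<epsilon> \<le> (\<Sum>h\<in>F. m y h))" for x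
  proof -
    have "(m x has_sum 1) (carrier G)" using P(2,3) by (simp add: has_sum_iff)
    from has_sum_finite_approximation[OF this, of "\<epsilon> / 2"] \<epsilon>
    obtain F where F: "finite F" "F \<subseteq> carrier G" "dist (sum (m x) F) 1 \<le> \<epsilon> / 2" by auto
    have "continuous_on UNIV (\<lambda>y. \<Sum>h\<in>F. m y h)"
      by (intro continuous_on_sum continuous_prob_map_component[OF m])
    then have "open {y. 1 - \<epsilon> < (\<Sum>h\<in>F. m y h)}"
      by (rule open_Collect_less[OF continuous_on_const])
    moreover have "1 - \<epsilon> < (\<Sum>h\<in>F. m x h)"
      using F(3) \<epsilon> unfolding dist_real_def by linarith
    ultimately show ?thesis
      using F(1,2) by (intro exI[of _ F] exI[of _ "{y. 1 - \<epsilon> < (\<Sum>h\<in>F. m y h)}"]) auto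
  qed
  then obtain F U where FU: "\<And>x. finite (F x)" "\<And>x. F x \<subseteq> carrier G" "\<And>x. open (U x)" "\<And>x. x \<in> U x"
    "\<And>x y. y \<in> U x \<Longrightarrow> 1 - \<epsilon> \<le> (\<Sum>h\<in>F x. m y h)" by metis
  have "UNIV \<subseteq> (\<Union>x\<in>UNIV. U x)" using FU(4) by blast
  with X obtain T where T: "finite T" "UNIV \<subseteq> (\<Union>x\<in>T. U x)"
    using compactE_image[of UNIV UNIV U] FU(3) by metis
  show thesis
  proof (rule that[of "\<Union>x\<in>T. F x"])
    fix y
    obtain x where x: "x \<in> T" "y \<in> U x" using T(2) by blast
    have "1 - \<epsilon> \<le> (\<Sum>h\<in>F x. m y h)" by (rule FU(5)[OF x(2)])
    also have "\<dots> \<le> (\<Sum>h\<in>(\<Union>x\<in>T. F x). m y h)"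
      using T(1) FU(1) x(1) P(1) by (intro sum_mono2) auto
    finally show "1 - \<epsilon> \<le> (\<Sum>h\<in>(\<Union>x\<in>T. F x). m y h)" .
  qed (use T(1) FU(1,2) in auto)
qed

section \<open>Amenable actions: derivations are inner\<close>

text \<open>
  Take \<open>r \<plusminus> \<i> \<surd>(1 - r\<^sup>2)\<close>.
\<close>

lemma unitary_pair:
  fixes r :: "'x::topological_space \<Rightarrow> real"
  assumes "continuous_on UNIV r" "\<And>x. \<bar>r x\<bar> \<le> 1"
  obtains u w :: "'x \<Rightarrow>\<^sub>C complex" where "\<And>x. cmod (u x) = 1" "\<And>x. cmod (w x) = 1"
    "\<And>x. u x + w x = 2 * complex_of_real (r x)"
proof -
  define s where "s x = sqrt (1 - (r x)\<^sup>2)" for x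
  have s: "continuous_on UNIV s" unfolding s_def by (intro continuous_intros assms(1))
  have rs: "(r x)\<^sup>2 + (s x)\<^sup>2 = 1" for x
    using assms(2)[of x] by (simp add: s_def abs_square_le_1)
  have 1: "cmod (Complex (r x) (s x)) = 1" "cmod (Complex (r x) (- s x)) = 1" for x
    using rs[of x] by (simp_all add: cmod_def)
  have c: "continuous_on UNIV (\<lambda>x. Complex (r x) (s x))" "continuous_on UNIV (\<lambda>x. Complex (r x) (- s x))"
    unfolding Complex_eq by (intro continuous_intros s assms(1))+
  have B: "(\<lambda>x. Complex (r x) (s x)) \<in> bcontfun" "(\<lambda>x. Complex (r x) (- s x)) \<in> bcontfun"
    using c 1 by (auto intro!: bcontfun_normI[where b = 1])
  show thesis
    by (rule that[of "Bcontfun (\<lambda>x. Complex (r x) (s x))" "Bcontfun (\<lambda>x. Complex (r x) (- s x))"])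
      (simp_all add: Bcontfun_inverse B 1 complex_eq_iff)
qed

locale l1_geometric_bimodule = E: normed_bimodule "A0 G act" E + continuous_action G act
  for G :: "('g, 'm) monoid_scheme" (structure) and act :: "'g \<Rightarrow> 'x::t2_space \<Rightarrow> 'x"
    and E :: "('g \<Rightarrow> ('x \<Rightarrow>\<^sub>C complex), 'e, 'n) bimodule_scheme" +
  assumes geometric: "right_l1_geometric (cx_embed G) E"
begin

abbreviation \<iota> where "\<iota> \<equiv> cx_embed G"
abbreviation right_action (infixl "\<triangleleft>" 75) where "v \<triangleleft> a \<equiv> ract E v a"
abbreviation left_action (infixr "\<triangleright>" 75) where "a \<triangleright> v \<equiv> lact E a v"

lemma geometric_finite:
  assumes F: "finite F" and q: "\<And>h x. h \<in> F \<Longrightarrow> apply_bcontfun (q h) x \<in> complex_of_real ` {0..1}"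
    and v: "v \<in> carrier E"
  shows "(\<Sum>h\<in>F. nrm E (v \<triangleleft> \<iota> (q h))) \<le> norm (\<Sum>h\<in>F. q h) * nrm E v"
proof -
  obtain b where b: "bij_betw b {1..card F} F"
    using ex_bij_betw_nat_finite_1[OF F] by blast
  have "\<forall>k\<in>{1..card F}. \<forall>x. apply_bcontfun (q (b k)) x \<in> complex_of_real ` {0..1}"
    using q bij_betwE[OF b] by blast
  then have "(\<Sum>k=1..card F. nrm E (v \<triangleleft> \<iota> (q (b k)))) \<le> norm (\<Sum>k=1..card F. q (b k)) * nrm E v"
    using geometric v unfolding right_l1_geometric_def by (elim allE[of _ "card F"] allE[of _ "\<lambda>k. q (b k)"]) blast
  then show ?thesis
    using sum.reindex_bij_betw[OF b, of "\<lambda>h. nrm E (v \<triangleleft> \<iota> (q h))"] sum.reindex_bij_betw[OF b, of q] by simp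
qed

text \<open>The unitaries of \<open>CX\<close> form an abelian group and span \<open>CX\<close>.  Averaging the functionals
  \<open>u.D(u\<^sup>*)\<close> by an invariant mean yields a functional that implements \<open>D\<close> on unitaries, since
  \<open>w.(u.D(u\<^sup>*)) = D(w) + (wu).D((wu)\<^sup>*).w\<close>, and hence on all of \<open>CX\<close>.\<close>

lemma inner_on_cx:
  assumes D: "E.dual_derivation D"
    and unit: "\<And>v. v \<in> carrier E \<Longrightarrow> D (\<iota> (const_bcontfun 1)) v = 0"
  shows "\<exists>\<tau>\<in>bounded_functionals E. \<forall>p. \<forall>v\<in>carrier E. D (\<iota> p) v = \<tau> (v \<triangleleft> \<iota> p) - \<tau> (\<iota> p \<triangleright> v)"
proof -
  note Dd = E.dual_derivationD[OF D]
  obtain K where K: "0 \<le> K" "\<And>a v. a \<in> carrier \<A> \<Longrightarrow> v \<in> carrier E \<Longrightarrow> cmod (D a v) \<le> K * nrm \<A> a * nrm E v"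
    using Dd(4) by blast
  define cnjf :: "('x \<Rightarrow>\<^sub>C complex) \<Rightarrow> ('x \<Rightarrow>\<^sub>C complex)" where "cnjf u = Bcontfun (\<lambda>x. cnj (u x))" for u
  have cnjf [simp]: "cnjf u x = cnj (u x)" for u x
    unfolding cnjf_def
    by (subst Bcontfun_inverse)
      (auto intro!: bcontfun_normI[where b = "norm u"] continuous_intros norm_bounded)
  define U :: "('x \<Rightarrow>\<^sub>C complex) monoid" where "U = \<lparr>carrier = {u :: 'x \<Rightarrow>\<^sub>C complex. \<forall>x. cmod (u x) = 1}, monoid.mult = cx_mult, one = const_bcontfun 1\<rparr>"
  interpret U: comm_monoid U
    by (rule comm_monoidI) (auto simp: U_def norm_mult intro!: bcontfun_eqI)
  have norm_U: "norm u \<le> 1" "norm (cnjf u) \<le> 1" if "u \<in> carrier U" for u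
    using that by (auto simp: U_def intro!: norm_bound)
  from U.invariant_mean obtain \<mu> :: "(('x \<Rightarrow>\<^sub>C complex) \<Rightarrow> complex) \<Rightarrow> complex" where
    \<mu>: "\<forall>f B. (\<forall>u\<in>carrier U. cmod (f u) \<le> B) \<longrightarrow> cmod (\<mu> f) \<le> B"
      "\<forall>f g B B'. (\<forall>u\<in>carrier U. cmod (f u) \<le> B) \<longrightarrow> (\<forall>u\<in>carrier U. cmod (g u) \<le> B')
        \<longrightarrow> \<mu> (\<lambda>u. f u + g u) = \<mu> f + \<mu> g"
      "\<forall>f B c. (\<forall>u\<in>carrier U. cmod (f u) \<le> B) \<longrightarrow> \<mu> (\<lambda>u. c * f u) = c * \<mu> f"
      "\<forall>c. \<mu> (\<lambda>u. c) = c"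
      "\<forall>f B w. (\<forall>u\<in>carrier U. cmod (f u) \<le> B) \<longrightarrow> w \<in> carrier U \<longrightarrow> \<mu> (\<lambda>u. f (w \<otimes>\<^bsub>U\<^esub> u)) = \<mu> f"
    by (elim exE conjE)
  note \<mu>_le = \<mu>(1)[rule_format] and \<mu>_add = \<mu>(2)[rule_format] and \<mu>_scale = \<mu>(3)[rule_format]
    and \<mu>_const = \<mu>(4)[rule_format] and \<mu>_inv = \<mu>(5)[rule_format]
  have \<mu>_cong: "\<mu> f = \<mu> g"
    if "\<And>u. u \<in> carrier U \<Longrightarrow> f u = g u" "\<And>u. u \<in> carrier U \<Longrightarrow> cmod (g u) \<le> B" for f g B
  proof -
    have "cmod (\<mu> (\<lambda>u. f u + (-1) * g u)) \<le> 0"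
      by (rule \<mu>_le) (simp add: that)
    moreover have "\<mu> (\<lambda>u. f u + (-1) * g u) = \<mu> f + \<mu> (\<lambda>u. (-1) * g u)"
      by (rule \<mu>_add[of _ B _ B]) (simp_all add: that)
    moreover have "\<mu> (\<lambda>u. (-1) * g u) = (-1) * \<mu> g"
      by (rule \<mu>_scale[of _ B]) (simp add: that)
    ultimately show ?thesis by simp
  qed
  (* The value of u.D(cnj u) at v. *)
  define f where "f v u = D (\<iota> (cnjf u)) (v \<triangleleft> \<iota> u)" for v u
  have f_le: "cmod (f v u) \<le> K * nrm E v" if v: "v \<in> carrier E" and u: "u \<in> carrier U" for v u
  proof -
    have "nrm E (v \<triangleleft> \<iota> u) \<le> nrm E v * 1"
      using E.ract_contractive[OF cx_embed_closed v, of u] order_trans[OF nrm_cx_embed_le norm_U(1)[OF u]]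
        E.nrm_nonneg[OF v] mult_left_mono order_trans by blast
    moreover have "K * nrm \<A> (\<iota> (cnjf u)) \<le> K * 1"
      using order_trans[OF nrm_cx_embed_le norm_U(2)[OF u]] K(1) by (rule mult_left_mono)
    moreover have "cmod (f v u) \<le> K * nrm \<A> (\<iota> (cnjf u)) * nrm E (v \<triangleleft> \<iota> u)"
      unfolding f_def by (intro K(2) E.ract_closed v) auto
    moreover have "K * nrm \<A> (\<iota> (cnjf u)) * nrm E (v \<triangleleft> \<iota> u) \<le> (K * 1) * (nrm E v * 1)"
      by (rule mult_mono) (use calculation K(1) E.nrm_nonneg[OF E.ract_closed[OF cx_embed_closed v]] in auto)
    ultimately show ?thesis by simp
  qed
  define \<tau> where "\<tau> = restrict (\<lambda>v. \<mu> (f v)) (carrier E)"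
  have \<tau>: "\<tau> \<in> bounded_functionals E"
    unfolding \<tau>_def
  proof (rule E.bounded_functionalI)
    fix v w c assume v: "v \<in> carrier E"
    show "cmod (\<mu> (f v)) \<le> K * nrm E v"
      by (rule \<mu>_le) (rule f_le[OF v])
    show "\<mu> (f (v \<oplus>\<^bsub>E\<^esub> w)) = \<mu> (f v) + \<mu> (f w)" if w: "w \<in> carrier E"
    proof -
      have "f (v \<oplus>\<^bsub>E\<^esub> w) = (\<lambda>u. f v u + f w u)"
        by (simp add: f_def fun_eq_iff E.ract_add_left v w E.ract_closed E.bounded_functionalD(1)[OF Dd(1)])
      then show ?thesis using \<mu>_add[OF f_le[OF v] f_le[OF w]] by simp
    qed
    show "\<mu> (f (c \<odot>\<^bsub>E\<^esub> v)) = c * \<mu> (f v)"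
    proof -
      have "f (c \<odot>\<^bsub>E\<^esub> v) = (\<lambda>u. c * f v u)"
        by (simp add: f_def fun_eq_iff E.ract_smult_left v E.ract_closed E.bounded_functionalD(2)[OF Dd(1)])
      then show ?thesis using \<mu>_scale[OF f_le[OF v]] by simp
    qed
  qed
  have unitary: "D (\<iota> w) v = \<tau> (v \<triangleleft> \<iota> w) - \<tau> (\<iota> w \<triangleright> v)" if w: "w \<in> carrier U" and v: "v \<in> carrier E" for w v
  proof -
    have v1: "D (\<iota> p) (v \<triangleleft> \<iota> (const_bcontfun 1)) = D (\<iota> p) v" for p
      using Dd(5)[OF cx_embed_closed cx_embed_closed v, of "const_bcontfun 1" p]
      by (simp add: delta_mult(4)[OF one_closed one_closed] unit E.lact_closed v)
    (* Apply the derivation rule to cnj u = cnj (w u) * w. *)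
    have fw: "f (v \<triangleleft> \<iota> w) u = D (\<iota> w) v + f (\<iota> w \<triangleright> v) (w \<otimes>\<^bsub>U\<^esub> u)" if u: "u \<in> carrier U" for u
    proof -
      define wu where "wu = w \<otimes>\<^bsub>U\<^esub> u"
      have wu: "cx_mult w u = wu" by (simp add: wu_def U_def)
      have one: "z x * cnj (z x) = 1" if "z \<in> carrier U" for z :: "'x \<Rightarrow>\<^sub>C complex" and x
        using complex_norm_square[of "z x"] that by (simp add: U_def)
      have eq1: "cnjf u = cx_mult (cnjf wu) w"
      proof (rule bcontfun_eqI)
        fix x
        have "cnj (w x * u x) * w x = cnj (u x) * (w x * cnj (w x))" by (simp add: ac_simps)
        then show "cnjf u x = cx_mult (cnjf wu) w x" by (simp add: wu[symmetric] one[OF w])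
      qed
      have eq2: "cx_mult wu (cnjf wu) = const_bcontfun 1"
      proof (rule bcontfun_eqI)
        fix x
        have "w x * u x * cnj (w x * u x) = (w x * cnj (w x)) * (u x * cnj (u x))" by (simp add: ac_simps)
        then show "cx_mult wu (cnjf wu) x = const_bcontfun 1 x"
          by (simp add: wu[symmetric] one[OF w] one[OF u] del: complex_cnj_mult)
      qed
      have vw: "v \<triangleleft> \<iota> w \<triangleleft> \<iota> u = v \<triangleleft> \<iota> wu"
        using E.ract_assoc[OF cx_embed_closed cx_embed_closed v, of w u]
        by (simp add: delta_mult(4)[OF one_closed one_closed] wu)
      have "f (v \<triangleleft> \<iota> w) u = D (\<iota> (cnjf wu) \<otimes>\<^bsub>\<A>\<^esub> \<iota> w) (v \<triangleleft> \<iota> wu)"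
        unfolding f_def vw eq1 by (simp add: delta_mult(4)[OF one_closed one_closed])
      also have "\<dots> = D (\<iota> w) (v \<triangleleft> \<iota> wu \<triangleleft> \<iota> (cnjf wu)) + D (\<iota> (cnjf wu)) (\<iota> w \<triangleright> (v \<triangleleft> \<iota> wu))"
        by (rule Dd(5)) (simp_all add: E.ract_closed v)
      also have "v \<triangleleft> \<iota> wu \<triangleleft> \<iota> (cnjf wu) = v \<triangleleft> \<iota> (const_bcontfun 1)"
        using E.ract_assoc[OF cx_embed_closed cx_embed_closed v, of wu "cnjf wu"]
        by (simp add: delta_mult(4)[OF one_closed one_closed] eq2)
      finally show ?thesis
        by (simp add: v1 f_def wu_def E.lact_ract v)
    qed
    have bd: "cmod (f (\<iota> w \<triangleright> v) (w \<otimes>\<^bsub>U\<^esub> u)) \<le> K * nrm E (\<iota> w \<triangleright> v)" if "u \<in> carrier U" for u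
      by (rule f_le) (use that w in \<open>auto simp: E.lact_closed v\<close>)
    have "\<mu> (f (v \<triangleleft> \<iota> w)) = \<mu> (\<lambda>u. D (\<iota> w) v + f (\<iota> w \<triangleright> v) (w \<otimes>\<^bsub>U\<^esub> u))"
      by (rule \<mu>_cong[of _ _ "cmod (D (\<iota> w) v) + K * nrm E (\<iota> w \<triangleright> v)"])
        (auto simp: fw intro!: norm_triangle_mono bd)
    also have "\<dots> = \<mu> (\<lambda>u. D (\<iota> w) v) + \<mu> (\<lambda>u. f (\<iota> w \<triangleright> v) (w \<otimes>\<^bsub>U\<^esub> u))"
      by (rule \<mu>_add[of "\<lambda>u. D (\<iota> w) v" "cmod (D (\<iota> w) v)" _ "K * nrm E (\<iota> w \<triangleright> v)"]) (simp_all add: bd)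
    also have "\<mu> (\<lambda>u. f (\<iota> w \<triangleright> v) (w \<otimes>\<^bsub>U\<^esub> u)) = \<mu> (f (\<iota> w \<triangleright> v))"
      by (rule \<mu>_inv[OF f_le w]) (simp_all add: E.lact_closed v)
    finally show ?thesis
      by (simp add: \<mu>_const \<tau>_def E.lact_closed E.ract_closed v)
  qed
  define D' where "D' = (\<lambda>a. \<lambda>v\<in>carrier E. D a v - (\<tau> (v \<triangleleft> a) - \<tau> (a \<triangleright> v)))"
  have "E.dual_derivation D'"
    unfolding D'_def by (rule E.dual_derivation_minus_inner[OF D \<tau>])
  note D'd = E.dual_derivationD[OF this]
  have D'U: "D' (\<iota> w) v = 0" if "w \<in> carrier U" "v \<in> carrier E" for w v
    using unitary[OF that] that by (simp add: D'_def)
  have "D' (\<iota> p) v = 0" if v: "v \<in> carrier E" for p v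
  proof -
    (* Every function is a combination of real functions bounded by 1, and these are means of two unitaries. *)
    have real: "D' (\<iota> q) v = 0"
      if r: "continuous_on UNIV r" "\<And>x. \<bar>r x\<bar> \<le> 1" and q: "\<And>x. q x = complex_of_real (r x)"
      for r :: "'x \<Rightarrow> real" and q :: "'x \<Rightarrow>\<^sub>C complex"
    proof -
      obtain u w :: "'x \<Rightarrow>\<^sub>C complex" where uw: "\<And>x. cmod (u x) = 1" "\<And>x. cmod (w x) = 1"
        "\<And>x. u x + w x = 2 * complex_of_real (r x)"
        using unitary_pair[OF r] by metis
      have "q = cx_scale (1 / 2) (u + w)"
        by (rule bcontfun_eqI) (simp add: uw(3) q)
      then have "\<iota> q = (1 / 2) \<odot>\<^bsub>\<A>\<^esub> (\<iota> u \<oplus>\<^bsub>\<A>\<^esub> \<iota> w)"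
        by (simp only: cx_embed_scale cx_embed_add)
      moreover have "\<iota> u \<oplus>\<^bsub>\<A>\<^esub> \<iota> w \<in> carrier \<A>"
        using cx_embed_closed[of "u + w"] by (simp only: cx_embed_add)
      ultimately have "D' (\<iota> q) v = (1 / 2) * (D' (\<iota> u) v + D' (\<iota> w) v)"
        by (simp only: D'd(2,3) cx_embed_closed v)
      then show ?thesis using uw(1,2) v D'U by (simp add: U_def)
    qed
    define M where "M = norm p + 1"
    have M: "0 < M" by (simp add: M_def add_nonneg_pos)
    have pM: "cmod (p x) \<le> M" for x using norm_bounded[of p x] by (simp add: M_def)
    define q1 q2 :: "'x \<Rightarrow>\<^sub>C complex" where "q1 = Bcontfun (\<lambda>x. complex_of_real (Re (p x) / M))"
      and "q2 = Bcontfun (\<lambda>x. complex_of_real (Im (p x) / M))"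
    have c1: "continuous_on UNIV (\<lambda>x. Re (p x) / M)" "continuous_on UNIV (\<lambda>x. Im (p x) / M)"
      using M by (auto intro!: continuous_intros)
    have b1: "\<bar>Re (p x) / M\<bar> \<le> 1" "\<bar>Im (p x) / M\<bar> \<le> 1" for x
      using M order_trans[OF abs_Re_le_cmod pM] order_trans[OF abs_Im_le_cmod pM] by (auto simp: abs_divide)
    have B: "(\<lambda>x. complex_of_real (Re (p x) / M)) \<in> bcontfun" "(\<lambda>x. complex_of_real (Im (p x) / M)) \<in> bcontfun"
      using c1 b1 by (auto intro!: bcontfun_normI[where b = 1] continuous_on_of_real simp del: of_real_divide)
    have q: "q1 x = complex_of_real (Re (p x) / M)" "q2 x = complex_of_real (Im (p x) / M)" for x
      unfolding q1_def q2_def by (simp_all only: Bcontfun_inverse[OF B(1)] Bcontfun_inverse[OF B(2)])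
    have "p = cx_scale (complex_of_real M) (q1 + cx_scale \<i> q2)"
      using M by (intro bcontfun_eqI) (simp add: q complex_eq_iff)
    then have "\<iota> p = complex_of_real M \<odot>\<^bsub>\<A>\<^esub> (\<iota> q1 \<oplus>\<^bsub>\<A>\<^esub> \<i> \<odot>\<^bsub>\<A>\<^esub> \<iota> q2)"
      by (simp only: cx_embed_scale cx_embed_add)
    moreover have "\<i> \<odot>\<^bsub>\<A>\<^esub> \<iota> q2 \<in> carrier \<A>" "\<iota> q1 \<oplus>\<^bsub>\<A>\<^esub> \<i> \<odot>\<^bsub>\<A>\<^esub> \<iota> q2 \<in> carrier \<A>"
      using cx_embed_closed[of "cx_scale \<i> q2"] cx_embed_closed[of "q1 + cx_scale \<i> q2"]
      by (simp_all only: cx_embed_add cx_embed_scale)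
    ultimately have "D' (\<iota> p) v = complex_of_real M * (D' (\<iota> q1) v + \<i> * D' (\<iota> q2) v)"
      by (simp only: D'd(2,3) cx_embed_closed v)
    then show ?thesis
      using real[OF c1(1) b1(1) q(1)] real[OF c1(2) b1(2) q(2)] by simp
  qed
  then have "D (\<iota> p) v = \<tau> (v \<triangleleft> \<iota> p) - \<tau> (\<iota> p \<triangleright> v)" if "v \<in> carrier E" for p v
    using that by (simp add: D'_def)
  with \<tau> show ?thesis by blast
qed

end

section \<open>The group cocycle of a derivation\<close>

lemma l1_norm_diff_le_2:
  assumes "f \<in> Prob G" "g \<in> Prob G"
  shows "l1_norm G (\<lambda>h. f h - g h) \<le> 2"
proof -
  note f = Prob_facts[OF assms(1)] and g = Prob_facts[OF assms(2)]
  have "l1_norm G (\<lambda>h. f h - g h) \<le> (\<Sum>\<^sub>\<infinity>h\<in>carrier G. f h + g h)"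
    unfolding l1_norm_def
  proof (intro infsum_mono abs_diff_summable summable_on_add f(2) g(2))
    show "\<bar>f h - g h\<bar> \<le> f h + g h" for h using f(1)[of h] g(1)[of h] by simp
  qed
  also have "\<dots> = 2" using f g by (simp add: infsum_add)
  finally show ?thesis .
qed

context group
begin

lemma l1_translate_Prob:
  assumes "g \<in> carrier G" "f \<in> Prob G"
  shows "l1_translate G g f \<in> Prob G"
proof -
  note f = Prob_facts[OF assms(2)]
  have b: "bij_betw (\<lambda>h. inv g \<otimes> h) (carrier G) (carrier G)" using assms(1) by (intro bij_left_mult) simp
  have s: "l1_translate G g f summable_on carrier G \<longleftrightarrow> f summable_on carrier G"
    unfolding summable_on_reindex_bij_betw[OF b, of f, symmetric]
    by (rule summable_on_cong) (simp add: l1_translate_def)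
  have e: "infsum (l1_translate G g f) (carrier G) = infsum f (carrier G)"
    unfolding infsum_reindex_bij_betw[OF b, of f, symmetric]
    by (rule infsum_cong) (simp add: l1_translate_def)
  have p: "0 \<le> l1_translate G g f h" for h using f(1) by (simp add: l1_translate_def)
  show ?thesis
    using s e f p by (auto simp: Prob_def l1_norm_def l1_translate_def)
qed

end

definition cx_of_real :: "('x::topological_space \<Rightarrow> real) \<Rightarrow> ('x \<Rightarrow>\<^sub>C complex)" where
  "cx_of_real r = Bcontfun (\<lambda>x. complex_of_real (r x))"

lemma apply_cx_of_real:
  assumes "continuous_on UNIV r" "\<And>x. \<bar>r x\<bar> \<le> 1"
  shows "apply_bcontfun (cx_of_real r) x = complex_of_real (r x)"
  unfolding cx_of_real_def using assms
  by (subst Bcontfun_inverse) (auto intro!: bcontfun_normI[where b = 1] continuous_on_of_real)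

text \<open>
  The situation after the first two corrections by inner derivations. A derivation that vanishes on
  \<open>CX\<close> is \<open>CX\<close>-linear on both sides (\<open>D_ract_cx\<close>, \<open>D_lact_cx\<close>).
\<close>

locale cx_vanishing_derivation = l1_geometric_bimodule G act E
  for G :: "('g, 'm) monoid_scheme" (structure) and act :: "'g \<Rightarrow> 'x::t2_space \<Rightarrow> 'x"
    and E :: "('g \<Rightarrow> ('x \<Rightarrow>\<^sub>C complex), 'e, 'n) bimodule_scheme" +
  fixes D :: "('g \<Rightarrow> ('x \<Rightarrow>\<^sub>C complex)) \<Rightarrow> 'e \<Rightarrow> complex" and K :: real
  assumes D: "E.dual_derivation D"
    and D_cx: "v \<in> carrier E \<Longrightarrow> D (\<iota> p) v = 0"
    and K_nonneg: "0 \<le> K"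
    and D_le: "a \<in> carrier \<A> \<Longrightarrow> v \<in> carrier E \<Longrightarrow> cmod (D a v) \<le> K * nrm \<A> a * nrm E v"
begin

lemmas Dd = E.dual_derivationD[OF D]

lemma D_ract_cx:
  assumes "a \<in> carrier \<A>" "v \<in> carrier E"
  shows "D a (v \<triangleleft> \<iota> p) = D (\<iota> p \<otimes>\<^bsub>\<A>\<^esub> a) v"
  using Dd(5)[OF cx_embed_closed assms, of p] D_cx[of "a \<triangleright> v" p] assms by (simp add: E.lact_closed)

lemma D_lact_cx:
  assumes "a \<in> carrier \<A>" "v \<in> carrier E"
  shows "D a (\<iota> p \<triangleright> v) = D (a \<otimes>\<^bsub>\<A>\<^esub> \<iota> p) v"
  using Dd(5)[OF assms(1) cx_embed_closed assms(2), of p] D_cx[of "v \<triangleleft> a" p] assms by (simp add: E.ract_closed)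

lemma nrm_delta_le: "g \<in> carrier G \<Longrightarrow> nrm \<A> (\<delta> g) \<le> 1"
  using nrm_point_mass_le[of g "const_bcontfun 1"] norm_unit_le by linarith

text \<open>
  The functional \<open>\<phi>\<^sub>h = \<delta>\<^sub>h.D(\<delta>\<^sub>h\<^sup>-\<^sup>1)\<close>.
\<close>

definition cocycle :: "'g \<Rightarrow> 'e \<Rightarrow> complex" where
  "cocycle h v = D (\<delta> (inv h)) (v \<triangleleft> \<delta> h)"

lemma cocycle_add: "h \<in> carrier G \<Longrightarrow> v \<in> carrier E \<Longrightarrow> w \<in> carrier E \<Longrightarrow> cocycle h (v \<oplus>\<^bsub>E\<^esub> w) = cocycle h v + cocycle h w"
  by (simp add: cocycle_def E.ract_add_left E.bounded_functionalD(1)[OF Dd(1)] E.ract_closed)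

lemma cocycle_smult: "h \<in> carrier G \<Longrightarrow> v \<in> carrier E \<Longrightarrow> cocycle h (z \<odot>\<^bsub>E\<^esub> v) = z * cocycle h v"
  by (simp add: cocycle_def E.ract_smult_left E.bounded_functionalD(2)[OF Dd(1)] E.ract_closed)

lemma cocycle_le:
  assumes h: "h \<in> carrier G" and v: "v \<in> carrier E"
  shows "cmod (cocycle h v) \<le> K * nrm E v"
proof -
  have "nrm E (v \<triangleleft> \<delta> h) \<le> nrm E v * 1"
    using E.ract_contractive[OF point_mass_closed[OF h] v, of "const_bcontfun 1"]
      mult_left_mono[OF nrm_delta_le[OF h] E.nrm_nonneg[OF v]] by linarith
  then have "K * nrm E (v \<triangleleft> \<delta> h) \<le> K * nrm E v"
    using K_nonneg by (simp add: mult_left_mono)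
  moreover have "K * nrm \<A> (\<delta> (inv h)) * nrm E (v \<triangleleft> \<delta> h) \<le> K * 1 * nrm E (v \<triangleleft> \<delta> h)"
    using nrm_delta_le[of "inv h"] h v
    by (intro mult_right_mono mult_left_mono K_nonneg E.nrm_nonneg E.ract_closed) auto
  moreover have "cmod (cocycle h v) \<le> K * nrm \<A> (\<delta> (inv h)) * nrm E (v \<triangleleft> \<delta> h)"
    unfolding cocycle_def using h v by (intro D_le E.ract_closed) auto
  ultimately show ?thesis by simp
qed

text \<open>
  Moving \<open>p\<close> through \<open>\<delta>\<^sub>h\<close> translates it by \<open>h\<^sup>-\<^sup>1\<close>, and moving it through \<open>\<delta>\<^sub>h\<^sup>-\<^sup>1\<close> translates it back.
\<close>

lemma cocycle_commute_cx:
  assumes h: "h \<in> carrier G" and v: "v \<in> carrier E"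
  shows "cocycle h (v \<triangleleft> \<iota> p) = cocycle h (\<iota> p \<triangleright> v)"
proof -
  have eq: "\<iota> p \<otimes>\<^bsub>\<A>\<^esub> \<delta> h = \<delta> h \<otimes>\<^bsub>\<A>\<^esub> \<iota> (cx_translate G act (inv h) p)"
  proof -
    have "cx_translate G act h (cx_translate G act (inv h) p) = p"
      using h by (intro bcontfun_eqI) simp
    then show ?thesis using h by (simp add: delta_mult(3)[OF h h])
  qed
  have eq': "\<iota> (cx_translate G act (inv h) p) \<otimes>\<^bsub>\<A>\<^esub> \<delta> (inv h) = \<delta> (inv h) \<otimes>\<^bsub>\<A>\<^esub> \<iota> p"
    using h by (simp add: delta_mult(3)[of "inv h" h])
  have "v \<triangleleft> \<iota> p \<triangleleft> \<delta> h = v \<triangleleft> \<delta> h \<triangleleft> \<iota> (cx_translate G act (inv h) p)"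
    using E.ract_assoc[of "\<iota> p" "\<delta> h" v] E.ract_assoc[of "\<delta> h" "\<iota> (cx_translate G act (inv h) p)" v] h v
    by (simp add: eq)
  then have "cocycle h (v \<triangleleft> \<iota> p) = D (\<delta> (inv h)) (v \<triangleleft> \<delta> h \<triangleleft> \<iota> (cx_translate G act (inv h) p))"
    by (simp add: cocycle_def)
  also have "\<dots> = D (\<delta> (inv h)) (\<iota> p \<triangleright> (v \<triangleleft> \<delta> h))"
    using h v by (simp add: D_ract_cx D_lact_cx eq' E.ract_closed)
  also have "\<dots> = cocycle h (\<iota> p \<triangleright> v)"
    using h v by (simp add: cocycle_def E.lact_ract)
  finally show ?thesis .
qed

text \<open>
  This is \<open>\<delta>\<^sub>g.\<phi>\<^sub>h - \<phi>\<^sub>g\<^sub>h.\<delta>\<^sub>g = D(\<delta>\<^sub>g)\<close>, the derivation rule for \<open>\<delta>\<^sub>h\<^sup>-\<^sup>1 = \<delta>\<^sub>k\<^sup>-\<^sup>1 \<delta>\<^sub>g\<close> with \<open>k = g h\<close>.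
\<close>

lemma cocycle_shift:
  assumes g: "g \<in> carrier G" and h: "h \<in> carrier G" and y: "y \<in> carrier E"
  shows "cocycle h (y \<triangleleft> \<delta> g) = D (\<delta> g) y + cocycle (g \<otimes> h) (\<delta> g \<triangleright> y)"
proof -
  define k where "k = g \<otimes> h"
  have k: "k \<in> carrier G" using g h by (simp add: k_def)
  have ih: "inv h = inv k \<otimes> g"
    using g h by (simp add: k_def inv_mult_group m_assoc)
  have "cocycle h (y \<triangleleft> \<delta> g) = D (\<delta> (inv h)) (y \<triangleleft> \<delta> k)"
    using E.ract_assoc[of "\<delta> g" "\<delta> h" y] g h y by (simp add: cocycle_def delta_mult(1) k_def)
  also have "\<dots> = D (\<delta> (inv k) \<otimes>\<^bsub>\<A>\<^esub> \<delta> g) (y \<triangleleft> \<delta> k)"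
    using g k by (simp add: ih delta_mult(1))
  also have "\<dots> = D (\<delta> g) (y \<triangleleft> \<delta> k \<triangleleft> \<delta> (inv k)) + D (\<delta> (inv k)) (\<delta> g \<triangleright> (y \<triangleleft> \<delta> k))"
    using g k y by (intro Dd(5)) (auto simp: E.ract_closed)
  also have "y \<triangleleft> \<delta> k \<triangleleft> \<delta> (inv k) = y \<triangleleft> \<iota> (const_bcontfun 1)"
    using E.ract_assoc[of "\<delta> k" "\<delta> (inv k)" y] k y by (simp add: delta_mult(1) cx_embed_eq)
  also have "D (\<delta> g) \<dots> = D (\<delta> g) y"
    using g y by (simp add: D_ract_cx delta_mult(2))
  also have "D (\<delta> (inv k)) (\<delta> g \<triangleright> (y \<triangleleft> \<delta> k)) = cocycle k (\<delta> g \<triangleright> y)"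
    using g k y by (simp add: cocycle_def E.lact_ract)
  finally show ?thesis by (simp add: k_def)
qed

text \<open>Here the geometric condition enters: it bounds the sum of the norms by the supremum of the total
  weight, so the sum converges although the functionals \<open>\<phi>\<^sub>h\<close> have no decay in \<open>h\<close>.\<close>

lemma weighted_sum:
  assumes q: "\<And>h x. h \<in> carrier G \<Longrightarrow> apply_bcontfun (q h) x = complex_of_real (r h x)"
    and r: "\<And>h x. h \<in> carrier G \<Longrightarrow> 0 \<le> r h x" "\<And>h x. h \<in> carrier G \<Longrightarrow> r h x \<le> 1"
    and C: "\<And>F x. finite F \<Longrightarrow> F \<subseteq> carrier G \<Longrightarrow> (\<Sum>h\<in>F. r h x) \<le> C"
    and v: "v \<in> carrier E"
  shows "(\<lambda>h. cocycle h (v \<triangleleft> \<iota> (q h))) summable_on carrier G"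
    and "cmod (\<Sum>\<^sub>\<infinity>h\<in>carrier G. cocycle h (v \<triangleleft> \<iota> (q h))) \<le> K * C * nrm E v"
proof -
  have fin: "(\<Sum>h\<in>F. cmod (cocycle h (v \<triangleleft> \<iota> (q h)))) \<le> K * C * nrm E v" if F: "finite F" "F \<subseteq> carrier G" for F
  proof -
    have "(\<Sum>h\<in>F. cmod (cocycle h (v \<triangleleft> \<iota> (q h)))) \<le> K * (\<Sum>h\<in>F. nrm E (v \<triangleleft> \<iota> (q h)))"
      unfolding sum_distrib_left using F v by (intro sum_mono cocycle_le) (auto simp: E.ract_closed)
    also have "\<dots> \<le> K * (norm (\<Sum>h\<in>F. q h) * nrm E v)"
      using F q r by (intro mult_left_mono geometric_finite v K_nonneg) (auto simp: subset_iff)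
    also have "\<dots> \<le> K * (C * nrm E v)"
    proof (intro mult_left_mono mult_right_mono K_nonneg E.nrm_nonneg v norm_bound)
      fix x
      have "apply_bcontfun (\<Sum>h\<in>F. q h) x = complex_of_real (\<Sum>h\<in>F. r h x)"
        unfolding apply_bcontfun_sum of_real_sum using F by (intro sum.cong q) auto
      moreover have "0 \<le> (\<Sum>h\<in>F. r h x)" using F r by (intro sum_nonneg) auto
      ultimately show "cmod (apply_bcontfun (\<Sum>h\<in>F. q h) x) \<le> C"
        using C[OF F, of x] by (simp only: norm_of_real abs_of_nonneg)
    qed
    finally show ?thesis by (simp add: mult.assoc)
  qed
  have s: "(\<lambda>h. cmod (cocycle h (v \<triangleleft> \<iota> (q h)))) summable_on carrier G"
    using fin by (intro nonneg_bdd_above_summable_on) (auto intro!: bdd_aboveI2)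
  then show "(\<lambda>h. cocycle h (v \<triangleleft> \<iota> (q h))) summable_on carrier G" by (rule abs_summable_summable)
  have "cmod (\<Sum>\<^sub>\<infinity>h\<in>carrier G. cocycle h (v \<triangleleft> \<iota> (q h))) \<le> (\<Sum>\<^sub>\<infinity>h\<in>carrier G. cmod (cocycle h (v \<triangleleft> \<iota> (q h))))"
    using s by (rule norm_infsum_bound)
  also have "\<dots> \<le> K * C * nrm E v"
    using s fin by (rule infsum_le_finite_sums)
  finally show "cmod (\<Sum>\<^sub>\<infinity>h\<in>carrier G. cocycle h (v \<triangleleft> \<iota> (q h))) \<le> K * C * nrm E v" .
qed

text \<open>
  The geometric condition is about nonnegative weights, so the difference of the two weights is split into its
  positive and its negative part; each contributes at most \<open>\<eta>\<close>.
\<close>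

lemma weighted_sum_diff:
  assumes q1: "\<And>h x. h \<in> carrier G \<Longrightarrow> apply_bcontfun (q1 h) x = complex_of_real (r1 h x)"
    and q2: "\<And>h x. h \<in> carrier G \<Longrightarrow> apply_bcontfun (q2 h) x = complex_of_real (r2 h x)"
    and cont: "\<And>h. h \<in> carrier G \<Longrightarrow> continuous_on UNIV (r1 h)" "\<And>h. h \<in> carrier G \<Longrightarrow> continuous_on UNIV (r2 h)"
    and r1: "\<And>h x. h \<in> carrier G \<Longrightarrow> 0 \<le> r1 h x" "\<And>h x. h \<in> carrier G \<Longrightarrow> r1 h x \<le> 1"
      "\<And>F x. finite F \<Longrightarrow> F \<subseteq> carrier G \<Longrightarrow> (\<Sum>h\<in>F. r1 h x) \<le> C"
    and r2: "\<And>h x. h \<in> carrier G \<Longrightarrow> 0 \<le> r2 h x" "\<And>h x. h \<in> carrier G \<Longrightarrow> r2 h x \<le> 1"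
      "\<And>F x. finite F \<Longrightarrow> F \<subseteq> carrier G \<Longrightarrow> (\<Sum>h\<in>F. r2 h x) \<le> C"
    and \<eta>: "\<And>F x. finite F \<Longrightarrow> F \<subseteq> carrier G \<Longrightarrow> (\<Sum>h\<in>F. \<bar>r1 h x - r2 h x\<bar>) \<le> \<eta>"
    and v: "v \<in> carrier E"
  shows "cmod ((\<Sum>\<^sub>\<infinity>h\<in>carrier G. cocycle h (v \<triangleleft> \<iota> (q1 h))) - (\<Sum>\<^sub>\<infinity>h\<in>carrier G. cocycle h (v \<triangleleft> \<iota> (q2 h))))
    \<le> 2 * K * \<eta> * nrm E v"
proof -
  define rp rn where "rp h x = max 0 (r1 h x - r2 h x)" and "rn h x = max 0 (r2 h x - r1 h x)" for h x
  define qp qn where "qp h = cx_of_real (rp h)" and "qn h = cx_of_real (rn h)" for h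
  have rpn: "0 \<le> rp h x" "rp h x \<le> 1" "0 \<le> rn h x" "rn h x \<le> 1" if "h \<in> carrier G" for h x
    using r1(1,2)[OF that, of x] r2(1,2)[OF that, of x] by (auto simp: rp_def rn_def)
  have qp: "apply_bcontfun (qp h) x = complex_of_real (rp h x)" if h: "h \<in> carrier G" for h x
    unfolding qp_def
  proof (rule apply_cx_of_real)
    show "continuous_on UNIV (rp h)" unfolding rp_def by (intro continuous_intros cont h)
  qed (use rpn[OF h] in auto)
  have qn: "apply_bcontfun (qn h) x = complex_of_real (rn h x)" if h: "h \<in> carrier G" for h x
    unfolding qn_def
  proof (rule apply_cx_of_real)
    show "continuous_on UNIV (rn h)" unfolding rn_def by (intro continuous_intros cont h)
  qed (use rpn[OF h] in auto)
  have \<eta>p: "(\<Sum>h\<in>F. rp h x) \<le> \<eta>" and \<eta>n: "(\<Sum>h\<in>F. rn h x) \<le> \<eta>"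
    if "finite F" "F \<subseteq> carrier G" for F x
    by (rule order_trans[OF sum_mono \<eta>[OF that, of x]], simp add: rp_def rn_def)+
  have sum_eq: "cocycle h (v \<triangleleft> \<iota> (q1 h)) + cocycle h (v \<triangleleft> \<iota> (qn h)) = cocycle h (v \<triangleleft> \<iota> (q2 h)) + cocycle h (v \<triangleleft> \<iota> (qp h))"
    if h: "h \<in> carrier G" for h
  proof -
    have "q1 h + qn h = q2 h + qp h"
      by (rule bcontfun_eqI) (simp add: q1 q2 qp qn h rp_def rn_def max_def flip: of_real_add)
    moreover have "cocycle h (v \<triangleleft> \<iota> (p + q)) = cocycle h (v \<triangleleft> \<iota> p) + cocycle h (v \<triangleleft> \<iota> q)" for p q
      unfolding cx_embed_add E.ract_add_right[OF cx_embed_closed cx_embed_closed v]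
      using h v by (intro cocycle_add) (auto simp: E.ract_closed)
    ultimately show ?thesis by metis
  qed
  note s1 = weighted_sum(1)[OF q1 r1 v] and s2 = weighted_sum(1)[OF q2 r2 v]
  note sp = weighted_sum[OF qp rpn(1,2) \<eta>p v] and sn = weighted_sum[OF qn rpn(3,4) \<eta>n v]
  have "(\<Sum>\<^sub>\<infinity>h\<in>carrier G. cocycle h (v \<triangleleft> \<iota> (q1 h)) + cocycle h (v \<triangleleft> \<iota> (qn h)))
      = (\<Sum>\<^sub>\<infinity>h\<in>carrier G. cocycle h (v \<triangleleft> \<iota> (q2 h)) + cocycle h (v \<triangleleft> \<iota> (qp h)))"
    by (rule infsum_cong) (rule sum_eq)
  moreover have "(\<Sum>\<^sub>\<infinity>h\<in>carrier G. cocycle h (v \<triangleleft> \<iota> (q1 h)) + cocycle h (v \<triangleleft> \<iota> (qn h)))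
      = (\<Sum>\<^sub>\<infinity>h\<in>carrier G. cocycle h (v \<triangleleft> \<iota> (q1 h))) + (\<Sum>\<^sub>\<infinity>h\<in>carrier G. cocycle h (v \<triangleleft> \<iota> (qn h)))"
    by (rule infsum_add; rule s1 sn(1))
  moreover have "(\<Sum>\<^sub>\<infinity>h\<in>carrier G. cocycle h (v \<triangleleft> \<iota> (q2 h)) + cocycle h (v \<triangleleft> \<iota> (qp h)))
      = (\<Sum>\<^sub>\<infinity>h\<in>carrier G. cocycle h (v \<triangleleft> \<iota> (q2 h))) + (\<Sum>\<^sub>\<infinity>h\<in>carrier G. cocycle h (v \<triangleleft> \<iota> (qp h)))"
    by (rule infsum_add; rule s2 sp(1))
  ultimately have "(\<Sum>\<^sub>\<infinity>h\<in>carrier G. cocycle h (v \<triangleleft> \<iota> (q1 h))) + (\<Sum>\<^sub>\<infinity>h\<in>carrier G. cocycle h (v \<triangleleft> \<iota> (qn h)))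
      = (\<Sum>\<^sub>\<infinity>h\<in>carrier G. cocycle h (v \<triangleleft> \<iota> (q2 h))) + (\<Sum>\<^sub>\<infinity>h\<in>carrier G. cocycle h (v \<triangleleft> \<iota> (qp h)))"
    by simp
  then have "(\<Sum>\<^sub>\<infinity>h\<in>carrier G. cocycle h (v \<triangleleft> \<iota> (q1 h))) - (\<Sum>\<^sub>\<infinity>h\<in>carrier G. cocycle h (v \<triangleleft> \<iota> (q2 h)))
      = (\<Sum>\<^sub>\<infinity>h\<in>carrier G. cocycle h (v \<triangleleft> \<iota> (qp h))) - (\<Sum>\<^sub>\<infinity>h\<in>carrier G. cocycle h (v \<triangleleft> \<iota> (qn h)))"
    by (simp add: algebra_simps)
  also have "cmod \<dots> \<le> K * \<eta> * nrm E v + K * \<eta> * nrm E v"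
    by (rule order_trans[OF norm_triangle_ineq4 add_mono[OF sp(2) sn(2)]])
  finally show ?thesis by simp
qed

definition weight :: "('x \<Rightarrow> 'g \<Rightarrow> real) \<Rightarrow> 'g \<Rightarrow> ('x \<Rightarrow>\<^sub>C complex)" where
  "weight m h = cx_of_real (\<lambda>x. m x h)"

text \<open>
  The functional \<open>\<Sum>\<^sub>h m\<^sub>h.\<phi>\<^sub>h\<close>.
\<close>

definition averaged :: "('x \<Rightarrow> 'g \<Rightarrow> real) \<Rightarrow> 'e \<Rightarrow> complex" where
  "averaged m v = (\<Sum>\<^sub>\<infinity>h\<in>carrier G. cocycle h (v \<triangleleft> \<iota> (weight m h)))"

context
  fixes m :: "'x \<Rightarrow> 'g \<Rightarrow> real" assumes m: "m \<in> continuous_prob_maps G"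
begin

lemmas m_Prob = continuous_prob_maps_facts(1)[OF m]

lemma m_sum_le: "finite F \<Longrightarrow> F \<subseteq> carrier G \<Longrightarrow> (\<Sum>h\<in>F. m x h) \<le> 1"
  using finite_sum_le_infsum[of "m x" "carrier G" F] Prob_facts[OF m_Prob] by simp

lemma m_le: "h \<in> carrier G \<Longrightarrow> m x h \<le> 1"
  using m_sum_le[of "{h}" x] by simp

lemma apply_weight: "h \<in> carrier G \<Longrightarrow> apply_bcontfun (weight m h) x = complex_of_real (m x h)"
  unfolding weight_def
  by (rule apply_cx_of_real[OF continuous_prob_map_component[OF m]])
    (simp add: Prob_facts(1)[OF m_Prob] m_le)

lemmas averaged_facts = weighted_sum[OF apply_weight Prob_facts(1)[OF m_Prob] m_le m_sum_le, folded averaged_def]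

lemma averaged_summable: "v \<in> carrier E \<Longrightarrow> (\<lambda>h. cocycle h (v \<triangleleft> \<iota> (weight m h))) summable_on carrier G"
  by (rule averaged_facts(1))

lemma averaged_le: "v \<in> carrier E \<Longrightarrow> cmod (averaged m v) \<le> K * nrm E v"
  using averaged_facts(2) by simp

lemma averaged_add: "v \<in> carrier E \<Longrightarrow> w \<in> carrier E \<Longrightarrow> averaged m (v \<oplus>\<^bsub>E\<^esub> w) = averaged m v + averaged m w"
  unfolding averaged_def infsum_add[OF averaged_summable averaged_summable, symmetric]
  by (rule infsum_cong) (simp add: E.ract_add_left cocycle_add E.ract_closed)

lemma averaged_smult:
  assumes "v \<in> carrier E" shows "averaged m (z \<odot>\<^bsub>E\<^esub> v) = z * averaged m v"
  unfolding averaged_def infsum_cmult_right'[symmetric]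
  by (rule infsum_cong) (simp add: E.ract_smult_left cocycle_smult E.ract_closed assms)

lemma averaged_commute_cx:
  assumes v: "v \<in> carrier E" shows "averaged m (v \<triangleleft> \<iota> p) = averaged m (\<iota> p \<triangleright> v)"
  unfolding averaged_def
proof (rule infsum_cong)
  fix h assume h: "h \<in> carrier G"
  have "\<iota> p \<otimes>\<^bsub>\<A>\<^esub> \<iota> (weight m h) = \<iota> (weight m h) \<otimes>\<^bsub>\<A>\<^esub> \<iota> p"
    unfolding delta_mult(4)[OF one_closed one_closed]
    by (rule arg_cong[of _ _ \<iota>], rule bcontfun_eqI) simp
  then have "v \<triangleleft> \<iota> p \<triangleleft> \<iota> (weight m h) = v \<triangleleft> \<iota> (weight m h) \<triangleleft> \<iota> p"
    using E.ract_assoc[OF cx_embed_closed cx_embed_closed v] by metis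
  then show "cocycle h (v \<triangleleft> \<iota> p \<triangleleft> \<iota> (weight m h)) = cocycle h ((\<iota> p \<triangleright> v) \<triangleleft> \<iota> (weight m h))"
    using h v by (simp add: cocycle_commute_cx E.ract_closed E.lact_ract)
qed

end

end

context cx_vanishing_derivation
begin

definition defect :: "('x \<Rightarrow> 'g \<Rightarrow> real) \<Rightarrow> 'g \<Rightarrow> real" where
  "defect m g = (SUP x. l1_norm G (\<lambda>h. m (act g x) h - l1_translate G g (m x) h))"

context
  fixes m :: "'x \<Rightarrow> 'g \<Rightarrow> real" and g
  assumes X: "compact (UNIV :: 'x set)" and m: "m \<in> continuous_prob_maps G" and g: "g \<in> carrier G"
begin

lemma l1_le_defect: "l1_norm G (\<lambda>h. m (act g x) h - l1_translate G g (m x) h) \<le> defect m g"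
  unfolding defect_def
  by (intro cSUP_upper bdd_aboveI2[of _ _ 2] l1_norm_diff_le_2 l1_translate_Prob g
      continuous_prob_maps_facts(1)[OF m]) auto

text \<open>
  The functions \<open>m\<^sub>h\<close> sum to \<open>1\<close> uniformly on \<open>X\<close> by compactness, so the bounded functional
  \<open>p \<mapsto> D(\<delta>\<^sub>g)(v.p)\<close> may be applied term by term.
\<close>

lemma translated_weights_sum:
  assumes v: "v \<in> carrier E"
  shows "((\<lambda>h. D (\<delta> g) (v \<triangleleft> \<iota> (cx_translate G act g (weight m h)))) has_sum D (\<delta> g) v) (carrier G)"
proof -
  define \<psi> where "\<psi> p = D (\<delta> g) (v \<triangleleft> \<iota> p)" for p
  have \<psi>_add: "\<psi> (p + q) = \<psi> p + \<psi> q" for p q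
    unfolding \<psi>_def cx_embed_add E.ract_add_right[OF cx_embed_closed cx_embed_closed v]
    using g v by (intro E.bounded_functionalD(1)[OF Dd(1)]) (auto simp: E.ract_closed)
  have \<psi>_0: "\<psi> 0 = 0" using \<psi>_add[of 0 0] by simp
  have \<psi>_minus: "\<psi> (p - q) = \<psi> p - \<psi> q" for p q using \<psi>_add[of "p - q" q] by simp
  have \<psi>_sum: "\<psi> (sum f F) = (\<Sum>h\<in>F. \<psi> (f h))" for f :: "'g \<Rightarrow> ('x \<Rightarrow>\<^sub>C complex)" and F
    by (induction F rule: infinite_finite_induct) (auto simp: \<psi>_add \<psi>_0)
  have \<psi>_le: "cmod (\<psi> p) \<le> K * nrm E v * norm p" for p
  proof -
    have "cmod (\<psi> p) \<le> K * nrm \<A> (\<delta> g) * nrm E (v \<triangleleft> \<iota> p)"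
      unfolding \<psi>_def using g v by (intro D_le E.ract_closed) auto
    also have "\<dots> \<le> K * 1 * (nrm E v * norm p)"
    proof (intro mult_mono)
      show "nrm E (v \<triangleleft> \<iota> p) \<le> nrm E v * norm p"
        using E.ract_contractive[OF cx_embed_closed v, of p]
          mult_left_mono[OF nrm_cx_embed_le[of p] E.nrm_nonneg[OF v]] by linarith
    qed (use g K_nonneg nrm_delta_le E.nrm_nonneg[OF E.ract_closed[OF cx_embed_closed v]] in
        \<open>auto intro: nrm_A0_nonneg mult_left_le\<close>)
    finally show ?thesis by simp
  qed
  have \<psi>_1: "\<psi> (const_bcontfun 1) = D (\<delta> g) v"
    unfolding \<psi>_def using g v by (simp add: D_ract_cx delta_mult(2))
  have "(sum (\<lambda>h. \<psi> (cx_translate G act g (weight m h))) \<longlongrightarrow> \<psi> (const_bcontfun 1)) (finite_subsets_at_top (carrier G))"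
  proof (rule tendstoI)
    fix \<epsilon> :: real assume "0 < \<epsilon>"
    define C where "C = K * nrm E v + 1"
    have C: "0 < C" using K_nonneg E.nrm_nonneg[OF v] by (simp add: C_def add_nonneg_pos)
    obtain F where F: "finite F" "F \<subseteq> carrier G" "\<And>x. 1 - \<epsilon> / C \<le> (\<Sum>h\<in>F. m x h)"
      using continuous_prob_map_uniform[OF X m, of "\<epsilon> / C"] C \<open>0 < \<epsilon>\<close> by auto
    have "dist (\<Sum>h\<in>Y. \<psi> (cx_translate G act g (weight m h))) (\<psi> (const_bcontfun 1)) < \<epsilon>"
      if Y: "finite Y" "F \<subseteq> Y" "Y \<subseteq> carrier G" for Y
    proof -
      have "norm ((\<Sum>h\<in>Y. cx_translate G act g (weight m h)) - const_bcontfun 1) \<le> \<epsilon> / C"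
      proof (rule norm_bound)
        fix x
        let ?y = "act (inv g) x"
        have "apply_bcontfun ((\<Sum>h\<in>Y. cx_translate G act g (weight m h)) - const_bcontfun 1) x
            = (\<Sum>h\<in>Y. complex_of_real (m ?y h)) - 1"
          using Y g by (simp add: apply_bcontfun_sum apply_weight[OF m] subset_iff)
        also have "\<dots> = complex_of_real ((\<Sum>h\<in>Y. m ?y h) - 1)" by simp
        also have "cmod \<dots> = 1 - (\<Sum>h\<in>Y. m ?y h)"
          unfolding norm_of_real using m_sum_le[OF m Y(1,3), of ?y] by simp
        also have "\<dots> \<le> \<epsilon> / C"
          using F(3)[of ?y] sum_mono2[OF Y(1,2), of "m ?y"] Prob_facts(1)[OF m_Prob[OF m]]
          by force
        finally show "cmod (apply_bcontfun ((\<Sum>h\<in>Y. cx_translate G act g (weight m h)) - const_bcontfun 1) x) \<le> \<epsilon> / C" .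
      qed
      then have "cmod (\<psi> ((\<Sum>h\<in>Y. cx_translate G act g (weight m h)) - const_bcontfun 1)) \<le> K * nrm E v * (\<epsilon> / C)"
        using \<psi>_le K_nonneg E.nrm_nonneg[OF v] by (meson mult_left_mono mult_nonneg_nonneg order_trans)
      also have "\<dots> < C * (\<epsilon> / C)"
        using C \<open>0 < \<epsilon>\<close> by (intro mult_strict_right_mono) (auto simp: C_def)
      also have "\<dots> = \<epsilon>" using C by simp
      finally show ?thesis by (simp add: \<psi>_minus \<psi>_sum dist_norm)
    qed
    then show "\<forall>\<^sub>F Y in finite_subsets_at_top (carrier G).
        dist (\<Sum>h\<in>Y. \<psi> (cx_translate G act g (weight m h))) (\<psi> (const_bcontfun 1)) < \<epsilon>"
      using F(1,2) unfolding eventually_finite_subsets_at_top by blast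
  qed
  then show ?thesis
    unfolding has_sum_def \<psi>_1 by (simp add: \<psi>_def)
qed

text \<open>
  By \<open>cocycle_shift\<close>, \<open>\<delta>\<^sub>g.\<Sum>\<^sub>h m\<^sub>h.\<phi>\<^sub>h\<close> equals \<open>D(\<delta>\<^sub>g)\<close> plus an average of the \<open>\<phi>\<^sub>k.\<delta>\<^sub>g\<close> with the weights of
  the translate of \<open>m\<close> by \<open>g\<close>. Replacing these weights by \<open>m\<close> itself costs the defect.
\<close>

lemma averaged_coboundary:
  assumes v: "v \<in> carrier E"
  shows "cmod (averaged m (v \<triangleleft> \<delta> g) - averaged m (\<delta> g \<triangleright> v) - D (\<delta> g) v)
    \<le> 2 * K * defect m g * nrm E (\<delta> g \<triangleright> v)"
proof -
  define w where "w = \<delta> g \<triangleright> v"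
  have w: "w \<in> carrier E" using g v by (simp add: w_def E.lact_closed)
  define t where "t h = cx_translate G act g (weight m h)" for h
  define q where "q k = t (inv g \<otimes> k)" for k
  (* The weights after the substitution k = g h: the translate of m by g. *)
  define r where "r k x = m (act (inv g) x) (inv g \<otimes> k)" for k x
  have q: "apply_bcontfun (q k) x = complex_of_real (r k x)" if "k \<in> carrier G" for k x
    using that g by (simp add: q_def t_def r_def apply_weight[OF m])
  have r_eq: "r k x = l1_translate G g (m (act (inv g) x)) k" if "k \<in> carrier G" for k x
    using that by (simp add: r_def l1_translate_def)
  have rP: "l1_translate G g (m (act (inv g) x)) \<in> Prob G" for x
    by (rule l1_translate_Prob[OF g m_Prob[OF m]])
  have r_cont: "continuous_on UNIV (r k)" for k
    unfolding r_def
    by (rule continuous_on_compose2[OF continuous_prob_map_component[OF m] continuous_act]) (use g in auto)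
  have r_sum: "(\<Sum>k\<in>F. r k x) \<le> 1" if "finite F" "F \<subseteq> carrier G" for F x
  proof -
    have "(\<Sum>k\<in>F. r k x) = (\<Sum>k\<in>F. l1_translate G g (m (act (inv g) x)) k)"
      using that by (intro sum.cong r_eq) auto
    also have "\<dots> \<le> 1"
      using finite_sum_le_infsum[OF Prob_facts(2)[OF rP] that] Prob_facts[OF rP] by simp
    finally show ?thesis .
  qed
  have r0: "0 \<le> r k x" for k x by (simp add: r_def Prob_facts(1)[OF m_Prob[OF m]])
  have r1: "r k x \<le> 1" if "k \<in> carrier G" for k x using r_sum[of "{k}" x] that by simp
  have close: "(\<Sum>k\<in>F. \<bar>r k x - m x k\<bar>) \<le> defect m g" if F: "finite F" "F \<subseteq> carrier G" for F x
  proof -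
    let ?y = "act (inv g) x"
    have "(\<Sum>k\<in>F. \<bar>r k x - m x k\<bar>) = (\<Sum>k\<in>F. \<bar>m (act g ?y) k - l1_translate G g (m ?y) k\<bar>)"
      using F g by (intro sum.cong refl) (auto simp: r_eq abs_minus_commute subset_iff)
    also have "\<dots> \<le> l1_norm G (\<lambda>k. m (act g ?y) k - l1_translate G g (m ?y) k)"
      by (rule sum_abs_diff_le_l1_norm[OF Prob_facts(2)[OF m_Prob[OF m]] Prob_facts(2)[OF rP] F])
    also have "\<dots> \<le> defect m g" by (rule l1_le_defect)
    finally show ?thesis .
  qed
  have sq: "(\<lambda>k. cocycle k (w \<triangleleft> \<iota> (q k))) summable_on carrier G"
    by (rule weighted_sum(1)[where r = r and C = 1]) (use q r0 r1 r_sum w in auto)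
  have term_eq: "cocycle h (v \<triangleleft> \<delta> g \<triangleleft> \<iota> (weight m h))
      = D (\<delta> g) (v \<triangleleft> \<iota> (t h)) + cocycle (g \<otimes> h) (w \<triangleleft> \<iota> (q (g \<otimes> h)))" if h: "h \<in> carrier G" for h
  proof -
    have "v \<triangleleft> \<delta> g \<triangleleft> \<iota> (weight m h) = v \<triangleleft> \<iota> (t h) \<triangleleft> \<delta> g"
      using E.ract_assoc[of "\<delta> g" "\<iota> (weight m h)" v] E.ract_assoc[of "\<iota> (t h)" "\<delta> g" v] g v
      by (simp add: delta_mult(3)[OF g h] t_def)
    moreover have "\<delta> g \<triangleright> (v \<triangleleft> \<iota> (t h)) = w \<triangleleft> \<iota> (t h)"
      using g v by (simp add: w_def E.lact_ract)
    moreover have "inv g \<otimes> (g \<otimes> h) = h" using g h by (simp add: m_assoc[symmetric])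
    ultimately show ?thesis
      using cocycle_shift[OF g h E.ract_closed[OF cx_embed_closed v, of "t h"]] by (simp add: q_def)
  qed
  have "averaged m (v \<triangleleft> \<delta> g)
      = (\<Sum>\<^sub>\<infinity>h\<in>carrier G. D (\<delta> g) (v \<triangleleft> \<iota> (t h)) + cocycle (g \<otimes> h) (w \<triangleleft> \<iota> (q (g \<otimes> h))))"
    unfolding averaged_def by (rule infsum_cong) (rule term_eq)
  also have "\<dots> = D (\<delta> g) v + (\<Sum>\<^sub>\<infinity>k\<in>carrier G. cocycle k (w \<triangleleft> \<iota> (q k)))"
  proof (rule infsumI, rule has_sum_add)
    show "((\<lambda>h. D (\<delta> g) (v \<triangleleft> \<iota> (t h))) has_sum D (\<delta> g) v) (carrier G)"
      unfolding t_def by (rule translated_weights_sum[OF v])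
    have "((\<lambda>k. cocycle k (w \<triangleleft> \<iota> (q k))) has_sum (\<Sum>\<^sub>\<infinity>k\<in>carrier G. cocycle k (w \<triangleleft> \<iota> (q k)))) (carrier G)"
      using sq by simp
    then show "((\<lambda>h. cocycle (g \<otimes> h) (w \<triangleleft> \<iota> (q (g \<otimes> h)))) has_sum (\<Sum>\<^sub>\<infinity>k\<in>carrier G. cocycle k (w \<triangleleft> \<iota> (q k)))) (carrier G)"
      using has_sum_reindex_bij_betw[OF bij_left_mult[OF g], of "\<lambda>k. cocycle k (w \<triangleleft> \<iota> (q k))"] by simp
  qed
  finally have "averaged m (v \<triangleleft> \<delta> g) - averaged m (\<delta> g \<triangleright> v) - D (\<delta> g) v
      = (\<Sum>\<^sub>\<infinity>k\<in>carrier G. cocycle k (w \<triangleleft> \<iota> (q k))) - (\<Sum>\<^sub>\<infinity>k\<in>carrier G. cocycle k (w \<triangleleft> \<iota> (weight m k)))"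
    by (simp add: averaged_def w_def)
  also have "cmod \<dots> \<le> 2 * K * defect m g * nrm E w"
    by (rule weighted_sum_diff[OF q apply_weight[OF m] r_cont continuous_prob_map_component[OF m]
          r0 r1 r_sum Prob_facts(1)[OF m_Prob[OF m]] m_le[OF m] m_sum_le[OF m] close w])
  finally show ?thesis by (simp add: w_def)
qed

end

text \<open>
  A weak-* cluster point of the averages implements \<open>D\<close> exactly at the \<open>\<delta>\<^sub>g\<close> and commutes with \<open>CX\<close>, where
  \<open>D\<close> vanishes. Products \<open>p \<delta>\<^sub>g\<close> follow by the derivation rule, and all of \<open>\<A>\<close> by density.
\<close>

lemma amenable_imp_inner:
  assumes X: "compact (UNIV :: 'x set)" and am: "amenable_action G act"
  shows "\<exists>\<tau>\<in>bounded_functionals E. \<forall>a\<in>carrier \<A>. \<forall>v\<in>carrier E. D a v = \<tau> (v \<triangleleft> a) - \<tau> (a \<triangleright> v)"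
proof -
  obtain F where F: "F \<noteq> bot" "\<forall>\<^sub>F m in F. m \<in> continuous_prob_maps G"
    "\<And>g. g \<in> carrier G \<Longrightarrow> ((\<lambda>m. defect m g) \<longlongrightarrow> 0) F"
    using am unfolding amenable_action_def defect_def by blast
  define \<Phi> where "\<Phi> m v = (if v \<in> carrier E then averaged m v else 0)" for m v
  define C where "C v = (if v \<in> carrier E then K * nrm E v else 0)" for v
  have "\<forall>\<^sub>F m in F. \<forall>v. cmod (\<Phi> m v) \<le> C v"
    using F(2) by (rule eventually_mono) (simp add: \<Phi>_def C_def averaged_le)
  from pointwise_cluster_point[OF F(1) this] obtain \<tau> where \<tau>_le: "\<And>v. cmod (\<tau> v) \<le> C v"
    and \<tau>_lim: "\<And>H z. continuous_on UNIV H \<Longrightarrow> ((\<lambda>m. H (\<Phi> m)) \<longlongrightarrow> (z::complex)) F \<Longrightarrow> H \<tau> = z"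
    by metis
  (* Identities valid for all averages pass to the cluster point. *)
  have \<tau>_ev: "H \<tau> = 0"
    if "continuous_on UNIV H" "\<And>m. m \<in> continuous_prob_maps G \<Longrightarrow> H (\<Phi> m) = 0" for H :: "('e \<Rightarrow> complex) \<Rightarrow> complex"
    by (rule \<tau>_lim[OF that(1)], rule tendsto_eventually, rule eventually_mono[OF F(2)]) (rule that(2))
  define \<sigma> where "\<sigma> = restrict \<tau> (carrier E)"
  have \<sigma>: "\<sigma> \<in> bounded_functionals E"
    unfolding \<sigma>_def
  proof (rule E.bounded_functionalI)
    fix v w z assume v: "v \<in> carrier E"
    show "cmod (\<tau> v) \<le> K * nrm E v" using \<tau>_le[of v] v by (simp add: C_def)
    show "\<tau> (v \<oplus>\<^bsub>E\<^esub> w) = \<tau> v + \<tau> w" if w: "w \<in> carrier E"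
    proof -
      have "\<tau> (v \<oplus>\<^bsub>E\<^esub> w) - (\<tau> v + \<tau> w) = 0"
        by (rule \<tau>_ev, intro continuous_intros) (simp add: \<Phi>_def v w averaged_add)
      then show ?thesis by simp
    qed
    have "\<tau> (z \<odot>\<^bsub>E\<^esub> v) - z * \<tau> v = 0"
      by (rule \<tau>_ev, intro continuous_intros) (simp add: \<Phi>_def v averaged_smult)
    then show "\<tau> (z \<odot>\<^bsub>E\<^esub> v) = z * \<tau> v" by simp
  qed
  have comm: "\<sigma> (v \<triangleleft> \<iota> p) = \<sigma> (\<iota> p \<triangleright> v)" if v: "v \<in> carrier E" for v p
  proof -
    have "\<tau> (v \<triangleleft> \<iota> p) - \<tau> (\<iota> p \<triangleright> v) = 0"
      by (rule \<tau>_ev, intro continuous_intros)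
        (simp add: \<Phi>_def v averaged_commute_cx E.ract_closed E.lact_closed)
    then show ?thesis using v by (simp add: \<sigma>_def E.ract_closed E.lact_closed)
  qed
  have group_elt: "\<sigma> (v \<triangleleft> \<delta> g) - \<sigma> (\<delta> g \<triangleright> v) = D (\<delta> g) v" if v: "v \<in> carrier E" and g: "g \<in> carrier G" for v g
  proof -
    have "\<tau> (v \<triangleleft> \<delta> g) - \<tau> (\<delta> g \<triangleright> v) - D (\<delta> g) v = 0"
    proof (rule \<tau>_lim)
      have "((\<lambda>m. 2 * K * defect m g * nrm E (\<delta> g \<triangleright> v)) \<longlongrightarrow> 2 * K * 0 * nrm E (\<delta> g \<triangleright> v)) F"
        by (intro tendsto_intros F(3) g)
      then have lim: "((\<lambda>m. 2 * K * defect m g * nrm E (\<delta> g \<triangleright> v)) \<longlongrightarrow> 0) F" by simp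
      show "((\<lambda>m. \<Phi> m (v \<triangleleft> \<delta> g) - \<Phi> m (\<delta> g \<triangleright> v) - D (\<delta> g) v) \<longlongrightarrow> 0) F"
        by (rule Lim_null_comparison[OF eventually_mono[OF F(2)] lim])
          (use averaged_coboundary[OF X _ g v] in \<open>simp add: \<Phi>_def v g E.ract_closed E.lact_closed\<close>)
    qed (intro continuous_intros)
    then show ?thesis using v g by (simp add: \<sigma>_def E.ract_closed E.lact_closed)
  qed
  define \<Delta> where "\<Delta> = (\<lambda>a. \<lambda>v\<in>carrier E. D a v - (\<sigma> (v \<triangleleft> a) - \<sigma> (a \<triangleright> v)))"
  have "E.dual_derivation \<Delta>"
    unfolding \<Delta>_def by (rule E.dual_derivation_minus_inner[OF D \<sigma>])
  note \<Delta>d = E.dual_derivationD[OF this]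
  obtain K' where K': "0 \<le> K'" "\<And>a v. a \<in> carrier \<A> \<Longrightarrow> v \<in> carrier E \<Longrightarrow> cmod (\<Delta> a v) \<le> K' * nrm \<A> a * nrm E v"
    using \<Delta>d(4) by blast
  have \<Delta>0: "\<Delta> a v = 0" if a: "a \<in> carrier \<A>" and v: "v \<in> carrier E" for a v
  proof (rule additive_eq_zero[where \<Delta> = "\<lambda>a. \<Delta> a v" and K = "K' * nrm E v"])
    show "\<Delta> (a \<oplus>\<^bsub>\<A>\<^esub> b) v = \<Delta> a v + \<Delta> b v" if "a \<in> carrier \<A>" "b \<in> carrier \<A>" for a b
      by (rule \<Delta>d(2)[OF that v])
    show "cmod (\<Delta> a v) \<le> K' * nrm E v * nrm \<A> a" if "a \<in> carrier \<A>" for a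
      using K'(2)[OF that v] by (simp add: ac_simps)
    show "0 \<le> K' * nrm E v" using K'(1) E.nrm_nonneg[OF v] by simp
    fix g p assume g: "g \<in> carrier G"
    have cx: "\<Delta> (\<iota> p) v = 0" if "v \<in> carrier E" for v
      using that comm[OF that] D_cx[OF that] by (simp add: \<Delta>_def)
    have gr: "\<Delta> (\<delta> g) v = 0" if "v \<in> carrier E" for v
      using that group_elt[OF that g] by (simp add: \<Delta>_def)
    have "\<Delta> (\<iota> p \<otimes>\<^bsub>\<A>\<^esub> \<delta> g) v = \<Delta> (\<delta> g) (v \<triangleleft> \<iota> p) + \<Delta> (\<iota> p) (\<delta> g \<triangleright> v)"
      using g v by (intro \<Delta>d(5)) auto
    then show "\<Delta> (point_mass g p) v = 0"
      using g v by (simp add: delta_mult(2)[OF g g] cx gr E.ract_closed E.lact_closed)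
  qed (rule a)
  have "D a v = \<sigma> (v \<triangleleft> a) - \<sigma> (a \<triangleright> v)" if "a \<in> carrier \<A>" "v \<in> carrier E" for a v
    using \<Delta>0[OF that] that by (simp add: \<Delta>_def)
  with \<sigma> show ?thesis by blast
qed

end

lemma (in l1_geometric_bimodule) amenable_imp_dual_derivation_inner:
  assumes X: "compact (UNIV :: 'x set)" and am: "amenable_action G act" and D: "E.dual_derivation D"
  shows "\<exists>\<tau>\<in>bounded_functionals E. \<forall>a\<in>carrier \<A>. \<forall>v\<in>carrier E. D a v = \<tau> (v \<triangleleft> a) - \<tau> (a \<triangleright> v)"
proof -
  let ?e = "\<iota> (const_bcontfun 1)"
  have e: "?e \<in> carrier \<A>" "?e \<otimes>\<^bsub>\<A>\<^esub> ?e = ?e" by (simp_all add: delta_mult(4)[OF one_closed one_closed])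
  obtain \<tau>1 where \<tau>1: "\<tau>1 \<in> bounded_functionals E" "\<forall>v\<in>carrier E. D ?e v = \<tau>1 (v \<triangleleft> ?e) - \<tau>1 (?e \<triangleright> v)"
    using E.inner_at_idempotent[OF D e] by blast
  define D1 where "D1 = (\<lambda>a. \<lambda>v\<in>carrier E. D a v - (\<tau>1 (v \<triangleleft> a) - \<tau>1 (a \<triangleright> v)))"
  have D1: "E.dual_derivation D1"
    unfolding D1_def by (rule E.dual_derivation_minus_inner[OF D \<tau>1(1)])
  obtain \<tau>2 where \<tau>2: "\<tau>2 \<in> bounded_functionals E"
    "\<forall>p. \<forall>v\<in>carrier E. D1 (\<iota> p) v = \<tau>2 (v \<triangleleft> \<iota> p) - \<tau>2 (\<iota> p \<triangleright> v)"
    using inner_on_cx[OF D1] \<tau>1(2) by (auto simp: D1_def)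
  define D2 where "D2 = (\<lambda>a. \<lambda>v\<in>carrier E. D1 a v - (\<tau>2 (v \<triangleleft> a) - \<tau>2 (a \<triangleright> v)))"
  have D2: "E.dual_derivation D2"
    unfolding D2_def by (rule E.dual_derivation_minus_inner[OF D1 \<tau>2(1)])
  obtain K where K: "0 \<le> K" "\<forall>a\<in>carrier \<A>. \<forall>v\<in>carrier E. cmod (D2 a v) \<le> K * nrm \<A> a * nrm E v"
    using E.dual_derivationD(4)[OF D2] by blast
  interpret D2: cx_vanishing_derivation G act E D2 K
    by unfold_locales (use D2 K \<tau>2(2) in \<open>auto simp: D2_def\<close>)
  obtain \<tau>3 where \<tau>3: "\<tau>3 \<in> bounded_functionals E"
    "\<forall>a\<in>carrier \<A>. \<forall>v\<in>carrier E. D2 a v = \<tau>3 (v \<triangleleft> a) - \<tau>3 (a \<triangleright> v)"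
    using D2.amenable_imp_inner[OF X am] by blast
  define \<tau> where "\<tau> = (\<lambda>v\<in>carrier E. \<tau>1 v + (\<lambda>v\<in>carrier E. \<tau>2 v + \<tau>3 v) v)"
  have "\<tau> \<in> bounded_functionals E"
    unfolding \<tau>_def by (intro E.dual_add_closed \<tau>1(1) \<tau>2(1) \<tau>3(1))
  moreover have "D a v = \<tau> (v \<triangleleft> a) - \<tau> (a \<triangleright> v)" if "a \<in> carrier \<A>" "v \<in> carrier E" for a v
    using \<tau>3(2) that by (simp add: D2_def D1_def \<tau>_def E.ract_closed E.lact_closed algebra_simps)
  ultimately show ?thesis by blast
qed

lemma (in continuous_action) amenable_action_imp_right_l1_amenable:
  assumes X: "compact (UNIV :: 'x set)" and am: "amenable_action G act"
  shows "right_l1_amenable TYPE('e) \<A> (cx_embed G)"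
  unfolding right_l1_amenable_def
proof (intro allI impI, elim conjE)
  fix E :: "('g \<Rightarrow> ('x \<Rightarrow>\<^sub>C complex), 'e) bimodule" and D
  assume E: "banach_bimodule \<A> E" "right_l1_geometric (cx_embed G) E"
    and D: "bounded_derivation \<A> (dual_bimodule E) D"
  interpret E: normed_bimodule \<A> E
    using E(1) nrm_A0_nonneg by (rule banach_bimodule_imp_normed_bimodule)
  interpret l1_geometric_bimodule G act E
    by unfold_locales (rule E(2))
  have dual: "E.dual_derivation D" by (rule E.bounded_derivation_imp_dual_derivation[OF D])
  obtain \<tau> where \<tau>: "\<tau> \<in> bounded_functionals E"
    "\<forall>a\<in>carrier \<A>. \<forall>v\<in>carrier E. D a v = \<tau> (ract E v a) - \<tau> (lact E a v)"
    using amenable_imp_dual_derivation_inner[OF X am dual] by blast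
  have "D a = (\<lambda>v\<in>carrier E. \<tau> (ract E v a) - \<tau> (lact E a v))" if a: "a \<in> carrier \<A>" for a
    using E.bounded_functionalD(3)[OF E.dual_derivationD(1)[OF dual a]] \<tau>(2) a
    by (metis (no_types, lifting) restrict_ext)
  then show "inner_derivation \<A> (dual_bimodule E) D"
    unfolding E.inner_derivation_dual_iff using \<tau>(1) by blast
qed

section \<open>The Banach algebra and its representation on functions\<close>

context continuous_action
begin

lemma A0_mult_terms_summable:
  fixes q :: "'g \<Rightarrow> complex"
  assumes a: "a \<in> carrier \<A>" and q: "\<And>h. h \<in> carrier G \<Longrightarrow> cmod (q h) \<le> B"
  shows "(\<lambda>h. a h x * q h) summable_on carrier G"
proof (rule abs_summable_summable, rule summable_on_comparison_test)
  show "(\<lambda>h. cmod (a h x) * B) summable_on carrier G"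
    by (intro summable_on_cmult_left A0_summable a)
  show "norm (a h x * q h) \<le> cmod (a h x) * B" if "h \<in> carrier G" for h
    unfolding norm_mult using q[OF that] by (intro mult_left_mono) auto
qed auto

lemma A0_eqI:
  fixes f f' :: "'g \<Rightarrow> ('x \<Rightarrow>\<^sub>C complex)"
  assumes "\<And>g x. g \<in> carrier G \<Longrightarrow> f g x = f' g x" "\<And>g. g \<notin> carrier G \<Longrightarrow> f g = f' g"
  shows "f = f'"
proof (rule ext)
  show "f g = f' g" for g using assms by (cases "g \<in> carrier G") (auto intro: bcontfun_eqI)
qed

lemma A0_mult_add_left:
  assumes "a \<in> carrier \<A>" "b \<in> carrier \<A>" "f \<in> carrier \<A>"
  shows "(a \<oplus>\<^bsub>\<A>\<^esub> b) \<otimes>\<^bsub>\<A>\<^esub> f = (a \<otimes>\<^bsub>\<A>\<^esub> f) \<oplus>\<^bsub>\<A>\<^esub> (b \<otimes>\<^bsub>\<A>\<^esub> f)"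
proof (rule A0_eqI)
  fix g x assume g: "g \<in> carrier G"
  have ab: "a \<oplus>\<^bsub>\<A>\<^esub> b \<in> carrier \<A>" using A0_add_closed assms by simp
  show "apply_bcontfun (((a \<oplus>\<^bsub>\<A>\<^esub> b) \<otimes>\<^bsub>\<A>\<^esub> f) g) x = apply_bcontfun (((a \<otimes>\<^bsub>\<A>\<^esub> f) \<oplus>\<^bsub>\<A>\<^esub> (b \<otimes>\<^bsub>\<A>\<^esub> f)) g) x"
    using A0_mult_terms_summable[OF assms(1), of "\<lambda>h. f (inv h \<otimes> g) (act (inv h) x)", OF A0_apply_le[OF assms(3)], of x]
      A0_mult_terms_summable[OF assms(2), of "\<lambda>h. f (inv h \<otimes> g) (act (inv h) x)", OF A0_apply_le[OF assms(3)], of x]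
    by (simp add: apply_A0_mult[OF ab assms(3) g, simplified] apply_A0_mult assms g distrib_right infsum_add)
qed (simp add: A0_mult_outside)

lemma A0_mult_add_right:
  assumes "a \<in> carrier \<A>" "f \<in> carrier \<A>" "f' \<in> carrier \<A>"
  shows "a \<otimes>\<^bsub>\<A>\<^esub> (f \<oplus>\<^bsub>\<A>\<^esub> f') = (a \<otimes>\<^bsub>\<A>\<^esub> f) \<oplus>\<^bsub>\<A>\<^esub> (a \<otimes>\<^bsub>\<A>\<^esub> f')"
proof (rule A0_eqI)
  fix g x assume g: "g \<in> carrier G"
  have ff: "f \<oplus>\<^bsub>\<A>\<^esub> f' \<in> carrier \<A>" using A0_add_closed assms by simp
  show "apply_bcontfun ((a \<otimes>\<^bsub>\<A>\<^esub> (f \<oplus>\<^bsub>\<A>\<^esub> f')) g) x = apply_bcontfun (((a \<otimes>\<^bsub>\<A>\<^esub> f) \<oplus>\<^bsub>\<A>\<^esub> (a \<otimes>\<^bsub>\<A>\<^esub> f')) g) x"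
    using A0_mult_terms_summable[OF assms(1), of "\<lambda>h. f (inv h \<otimes> g) (act (inv h) x)", OF A0_apply_le[OF assms(2)], of x]
      A0_mult_terms_summable[OF assms(1), of "\<lambda>h. f' (inv h \<otimes> g) (act (inv h) x)", OF A0_apply_le[OF assms(3)], of x]
    by (simp add: apply_A0_mult[OF assms(1) ff g, simplified] apply_A0_mult assms g distrib_left infsum_add)
qed (simp add: A0_mult_outside)

lemma cx_scale_zero [simp]: "cx_scale c (0 :: 'x \<Rightarrow>\<^sub>C complex) = 0"
  by (rule bcontfun_eqI) simp

lemma A0_mult_smult:
  assumes "a \<in> carrier \<A>" "f \<in> carrier \<A>"
  shows "(c \<odot>\<^bsub>\<A>\<^esub> a) \<otimes>\<^bsub>\<A>\<^esub> f = c \<odot>\<^bsub>\<A>\<^esub> (a \<otimes>\<^bsub>\<A>\<^esub> f)"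
    and "a \<otimes>\<^bsub>\<A>\<^esub> (c \<odot>\<^bsub>\<A>\<^esub> f) = c \<odot>\<^bsub>\<A>\<^esub> (a \<otimes>\<^bsub>\<A>\<^esub> f)"
proof -
  have ca: "c \<odot>\<^bsub>\<A>\<^esub> a \<in> carrier \<A>" "c \<odot>\<^bsub>\<A>\<^esub> f \<in> carrier \<A>" using A0_scale_closed assms by simp_all
  show "(c \<odot>\<^bsub>\<A>\<^esub> a) \<otimes>\<^bsub>\<A>\<^esub> f = c \<odot>\<^bsub>\<A>\<^esub> (a \<otimes>\<^bsub>\<A>\<^esub> f)"
    by (rule A0_eqI)
      (simp_all add: apply_A0_mult[OF ca(1) assms(2), simplified] apply_A0_mult assms A0_mult_outside
        infsum_cmult_right'[symmetric] ac_simps)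
  show "a \<otimes>\<^bsub>\<A>\<^esub> (c \<odot>\<^bsub>\<A>\<^esub> f) = c \<odot>\<^bsub>\<A>\<^esub> (a \<otimes>\<^bsub>\<A>\<^esub> f)"
    by (rule A0_eqI)
      (simp_all add: apply_A0_mult[OF assms(1) ca(2), simplified] apply_A0_mult assms A0_mult_outside
        infsum_cmult_right'[symmetric] ac_simps)
qed

lemma A0_mult_assoc:
  assumes a: "a \<in> carrier \<A>" and b: "b \<in> carrier \<A>" and f: "f \<in> carrier \<A>"
  shows "(a \<otimes>\<^bsub>\<A>\<^esub> b) \<otimes>\<^bsub>\<A>\<^esub> f = a \<otimes>\<^bsub>\<A>\<^esub> (b \<otimes>\<^bsub>\<A>\<^esub> f)"
proof (rule A0_eqI)
  fix g x assume g: "g \<in> carrier G"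
  let ?Q = "\<lambda>l. f (inv l \<otimes> g) (act (inv l) x)"
  have "apply_bcontfun (((a \<otimes>\<^bsub>\<A>\<^esub> b) \<otimes>\<^bsub>\<A>\<^esub> f) g) x = (\<Sum>\<^sub>\<infinity>l\<in>carrier G. (a \<otimes>\<^bsub>\<A>\<^esub> b) l x * ?Q l)"
    by (rule apply_A0_mult) (use assms g in auto)
  also have "\<dots> = (\<Sum>\<^sub>\<infinity>h\<in>carrier G. a h x * (\<Sum>\<^sub>\<infinity>k\<in>carrier G. b k (act (inv h) x) * ?Q (h \<otimes> k)))"
    by (rule A0_mult_pairing[OF a b]) (rule A0_apply_le[OF f])
  also have "\<dots> = (\<Sum>\<^sub>\<infinity>h\<in>carrier G. a h x * (b \<otimes>\<^bsub>\<A>\<^esub> f) (inv h \<otimes> g) (act (inv h) x))"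
  proof (rule infsum_cong)
    fix h assume h: "h \<in> carrier G"
    have "apply_bcontfun ((b \<otimes>\<^bsub>\<A>\<^esub> f) (inv h \<otimes> g)) (act (inv h) x)
        = (\<Sum>\<^sub>\<infinity>k\<in>carrier G. b k (act (inv h) x) * f (inv k \<otimes> (inv h \<otimes> g)) (act (inv k) (act (inv h) x)))"
      using h g by (intro apply_A0_mult b f) auto
    also have "\<dots> = (\<Sum>\<^sub>\<infinity>k\<in>carrier G. b k (act (inv h) x) * ?Q (h \<otimes> k))"
      by (rule infsum_cong) (use h g in \<open>simp add: inv_mult_group act_mult m_assoc\<close>)
    finally show "a h x * (\<Sum>\<^sub>\<infinity>k\<in>carrier G. b k (act (inv h) x) * ?Q (h \<otimes> k))
        = a h x * (b \<otimes>\<^bsub>\<A>\<^esub> f) (inv h \<otimes> g) (act (inv h) x)" by simp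
  qed
  also have "\<dots> = apply_bcontfun ((a \<otimes>\<^bsub>\<A>\<^esub> (b \<otimes>\<^bsub>\<A>\<^esub> f)) g) x"
    by (rule apply_A0_mult[symmetric]) (use assms g in auto)
  finally show "apply_bcontfun (((a \<otimes>\<^bsub>\<A>\<^esub> b) \<otimes>\<^bsub>\<A>\<^esub> f) g) x = apply_bcontfun ((a \<otimes>\<^bsub>\<A>\<^esub> (b \<otimes>\<^bsub>\<A>\<^esub> f)) g) x" .
qed (simp add: A0_mult_outside)

text \<open>
  The covariant representation of \<open>\<A>\<close> on \<open>CX\<close>: functions multiply and \<open>\<delta>\<^sub>g\<close> translates.
\<close>

definition cx_action :: "('g \<Rightarrow> ('x \<Rightarrow>\<^sub>C complex)) \<Rightarrow> ('x \<Rightarrow>\<^sub>C complex) \<Rightarrow> ('x \<Rightarrow>\<^sub>C complex)" where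
  "cx_action a q = (\<Sum>\<^sub>\<infinity>h\<in>carrier G. cx_mult (a h) (cx_translate G act h q))"

lemma apply_cx_action:
  assumes "a \<in> carrier \<A>"
  shows "apply_bcontfun (cx_action a q) x = (\<Sum>\<^sub>\<infinity>h\<in>carrier G. a h x * q (act (inv h) x))"
  unfolding cx_action_def
  by (subst apply_infsum[OF A0_mult_summable[OF assms norm_bounded[of q]]]) (auto intro: infsum_cong)

lemma cx_action_summable:
  fixes q :: "'x \<Rightarrow>\<^sub>C complex"
  assumes "a \<in> carrier \<A>"
  shows "(\<lambda>h. a h x * q (act (inv h) x)) summable_on carrier G"
  by (rule A0_mult_terms_summable[OF assms norm_bounded[of q]])

lemma cx_action_add_left:
  assumes "a \<in> carrier \<A>" "b \<in> carrier \<A>"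
  shows "cx_action (a \<oplus>\<^bsub>\<A>\<^esub> b) q = cx_action a q + cx_action b q"
proof -
  have ab: "a \<oplus>\<^bsub>\<A>\<^esub> b \<in> carrier \<A>" using A0_add_closed assms by simp
  show ?thesis
    by (rule bcontfun_eqI)
      (simp add: apply_cx_action[OF ab, simplified] apply_cx_action assms distrib_right
        infsum_add[OF cx_action_summable cx_action_summable])
qed

lemma cx_action_add_right:
  assumes "a \<in> carrier \<A>"
  shows "cx_action a (q + q') = cx_action a q + cx_action a q'"
  by (rule bcontfun_eqI)
    (simp add: apply_cx_action assms distrib_left infsum_add[OF cx_action_summable cx_action_summable])

lemma cx_action_scale:
  assumes "a \<in> carrier \<A>"
  shows "cx_action (c \<odot>\<^bsub>\<A>\<^esub> a) q = cx_scale c (cx_action a q)"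
    and "cx_action a (cx_scale c q) = cx_scale c (cx_action a q)"
proof -
  have ca: "c \<odot>\<^bsub>\<A>\<^esub> a \<in> carrier \<A>" using A0_scale_closed assms by simp
  show "cx_action (c \<odot>\<^bsub>\<A>\<^esub> a) q = cx_scale c (cx_action a q)"
    by (rule bcontfun_eqI)
      (simp add: apply_cx_action[OF ca, simplified] apply_cx_action assms infsum_cmult_right'[symmetric] ac_simps)
  show "cx_action a (cx_scale c q) = cx_scale c (cx_action a q)"
    by (rule bcontfun_eqI) (simp add: apply_cx_action assms infsum_cmult_right'[symmetric] ac_simps)
qed

lemma cx_action_assoc:
  assumes a: "a \<in> carrier \<A>" and b: "b \<in> carrier \<A>"
  shows "cx_action (a \<otimes>\<^bsub>\<A>\<^esub> b) q = cx_action a (cx_action b q)"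
proof (rule bcontfun_eqI)
  fix x
  have "apply_bcontfun (cx_action (a \<otimes>\<^bsub>\<A>\<^esub> b) q) x
      = (\<Sum>\<^sub>\<infinity>l\<in>carrier G. (a \<otimes>\<^bsub>\<A>\<^esub> b) l x * q (act (inv l) x))"
    by (rule apply_cx_action) (use assms in simp)
  also have "\<dots> = (\<Sum>\<^sub>\<infinity>h\<in>carrier G. a h x * (\<Sum>\<^sub>\<infinity>k\<in>carrier G. b k (act (inv h) x) * q (act (inv (h \<otimes> k)) x)))"
    by (rule A0_mult_pairing[OF a b norm_bounded])
  also have "\<dots> = (\<Sum>\<^sub>\<infinity>h\<in>carrier G. a h x * cx_action b q (act (inv h) x))"
    by (intro infsum_cong arg_cong2[of _ _ _ _ "(*)"] refl, simp add: apply_cx_action[OF b])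
      (intro infsum_cong, simp add: inv_mult_group act_mult)
  also have "\<dots> = apply_bcontfun (cx_action a (cx_action b q)) x"
    by (rule apply_cx_action[OF a, symmetric])
  finally show "apply_bcontfun (cx_action (a \<otimes>\<^bsub>\<A>\<^esub> b) q) x = apply_bcontfun (cx_action a (cx_action b q)) x" .
qed

lemma norm_cx_action_le:
  assumes a: "a \<in> carrier \<A>"
  shows "norm (cx_action a q) \<le> nrm \<A> a * norm q"
proof (rule norm_bound)
  fix x
  have "cmod (apply_bcontfun (cx_action a q) x) \<le> (\<Sum>\<^sub>\<infinity>h\<in>carrier G. cmod (a h x) * norm q)"
    unfolding apply_cx_action[OF a]
    by (rule norm_infsum_le[OF has_sum_infsum has_sum_infsum])
      (auto simp: norm_mult intro!: cx_action_summable a summable_on_cmult_left A0_summable mult_left_mono norm_bounded)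
  also have "\<dots> = (\<Sum>\<^sub>\<infinity>h\<in>carrier G. cmod (a h x)) * norm q"
    by (intro infsum_cmult_left A0_summable a)
  also have "\<dots> \<le> nrm \<A> a * norm q"
    by (intro mult_right_mono nrm_A0_ge a) simp
  finally show "cmod (apply_bcontfun (cx_action a q) x) \<le> nrm \<A> a * norm q" .
qed

lemma cx_action_delta:
  assumes "g \<in> carrier G"
  shows "cx_action (\<delta> g) q = cx_translate G act g q"
proof (rule bcontfun_eqI)
  fix x
  have "apply_bcontfun (cx_action (\<delta> g) q) x = (\<Sum>\<^sub>\<infinity>h\<in>carrier G. \<delta> g h x * q (act (inv h) x))"
    by (rule apply_cx_action) (use assms in simp)
  also have "\<dots> = (\<Sum>\<^sub>\<infinity>h\<in>{g}. q (act (inv g) x))"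
    using assms by (intro infsum_cong_neutral) (auto simp: point_mass_def)
  finally show "apply_bcontfun (cx_action (\<delta> g) q) x = apply_bcontfun (cx_translate G act g q) x"
    using assms by simp
qed

text \<open>Summation over \<open>\<Gamma>\<close> is a homomorphism of left modules from the algebra to \<open>CX\<close>.\<close>

lemma row_sum_mult:
  assumes a: "a \<in> carrier \<A>" and f: "f \<in> carrier \<A>"
  shows "(\<Sum>\<^sub>\<infinity>g\<in>carrier G. (a \<otimes>\<^bsub>\<A>\<^esub> f) g x)
    = (\<Sum>\<^sub>\<infinity>h\<in>carrier G. a h x * (\<Sum>\<^sub>\<infinity>k\<in>carrier G. f k (act (inv h) x)))"
  using A0_mult_pairing[OF a f, of "\<lambda>_. 1" 1 x] by simp

lemma row_sum_cx_embed: "(\<Sum>\<^sub>\<infinity>g\<in>carrier G. cx_embed G q g x) = apply_bcontfun q x"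
proof -
  have "(\<Sum>\<^sub>\<infinity>g\<in>carrier G. cx_embed G q g x) = (\<Sum>\<^sub>\<infinity>g\<in>{\<one>}. q x)"
    by (intro infsum_cong_neutral) (auto simp: cx_embed_def)
  then show ?thesis by simp
qed

lemma A0_row_summable: "f \<in> carrier \<A> \<Longrightarrow> (\<lambda>g. apply_bcontfun (f g) x) summable_on carrier G"
  by (rule abs_summable_summable) (rule A0_summable)

end

section \<open>The bimodule of operators\<close>

context continuous_action
begin

lemma nrm_A0_add:
  assumes "f \<in> carrier \<A>" "f' \<in> carrier \<A>"
  shows "nrm \<A> (f \<oplus>\<^bsub>\<A>\<^esub> f') \<le> nrm \<A> f + nrm \<A> f'"
proof (rule nrm_A0_le)
  show "f \<oplus>\<^bsub>\<A>\<^esub> f' \<in> carrier \<A>" using A0_add_closed assms by simp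
  fix x
  have "(\<Sum>\<^sub>\<infinity>g\<in>carrier G. cmod (f g x + f' g x)) \<le> (\<Sum>\<^sub>\<infinity>g\<in>carrier G. cmod (f g x) + cmod (f' g x))"
    using A0_summable[OF A0_add_closed[OF assms], of x]
    by (intro infsum_mono summable_on_add A0_summable assms norm_triangle_ineq) simp
  also have "\<dots> = (\<Sum>\<^sub>\<infinity>g\<in>carrier G. cmod (f g x)) + (\<Sum>\<^sub>\<infinity>g\<in>carrier G. cmod (f' g x))"
    by (intro infsum_add A0_summable assms)
  also have "\<dots> \<le> nrm \<A> f + nrm \<A> f'"
    by (intro add_mono nrm_A0_ge assms)
  finally show "(\<Sum>\<^sub>\<infinity>g\<in>carrier G. cmod ((f \<oplus>\<^bsub>\<A>\<^esub> f') g x)) \<le> nrm \<A> f + nrm \<A> f'"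
    by simp
qed

lemma nrm_A0_scale_le:
  assumes "f \<in> carrier \<A>"
  shows "nrm \<A> (c \<odot>\<^bsub>\<A>\<^esub> f) \<le> cmod c * nrm \<A> f"
proof (rule nrm_A0_le)
  show "c \<odot>\<^bsub>\<A>\<^esub> f \<in> carrier \<A>" using A0_scale_closed assms by simp
  show "(\<Sum>\<^sub>\<infinity>g\<in>carrier G. cmod ((c \<odot>\<^bsub>\<A>\<^esub> f) g x)) \<le> cmod c * nrm \<A> f" for x
    using mult_left_mono[OF nrm_A0_ge[OF assms, of x], of "cmod c"]
    by (simp add: norm_mult infsum_cmult_right')
qed

text \<open>
  The elements of the bimodule are plain complex-valued functions of \<open>q\<close>, \<open>x\<close> and \<open>g\<close>, whose algebraic
  operations are pointwise; \<open>pointwise\<close> and \<open>convolve\<close> carry elements of \<open>\<A>\<close> and their product to such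
  functions.
\<close>

definition pointwise :: "('g \<Rightarrow> ('x \<Rightarrow>\<^sub>C complex)) \<Rightarrow> 'x \<Rightarrow> 'g \<Rightarrow> complex" where
  "pointwise f = (\<lambda>x g. apply_bcontfun (f g) x)"

definition convolve :: "('g \<Rightarrow> ('x \<Rightarrow>\<^sub>C complex)) \<Rightarrow> ('x \<Rightarrow> 'g \<Rightarrow> complex) \<Rightarrow> 'x \<Rightarrow> 'g \<Rightarrow> complex" where
  "convolve a k = (\<lambda>x g. if g \<in> carrier G
     then \<Sum>\<^sub>\<infinity>h\<in>carrier G. apply_bcontfun (a h) x * k (act (inv h) x) (inv h \<otimes> g) else 0)"

lemma convolve_pointwise:
  assumes "a \<in> carrier \<A>" "f \<in> carrier \<A>"
  shows "convolve a (pointwise f) = pointwise (a \<otimes>\<^bsub>\<A>\<^esub> f)"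
  using assms by (auto simp: convolve_def pointwise_def fun_eq_iff apply_A0_mult A0_mult_outside)

lemma pointwise_simps:
  "(\<lambda>x g. pointwise f x g + pointwise f' x g) = pointwise (f \<oplus>\<^bsub>\<A>\<^esub> f')"
  "(\<lambda>x g. c * pointwise f x g) = pointwise (c \<odot>\<^bsub>\<A>\<^esub> f)"
  by (simp_all add: pointwise_def)

text \<open>
  Bounded linear maps from \<open>CX\<close> to \<open>\<A>\<close>.
\<close>

definition operator_family :: "(('x \<Rightarrow>\<^sub>C complex) \<Rightarrow> 'g \<Rightarrow> ('x \<Rightarrow>\<^sub>C complex)) \<Rightarrow> bool" where
  "operator_family F \<longleftrightarrow> (\<forall>q. F q \<in> carrier \<A>) \<and> (\<forall>q q'. F (q + q') = F q \<oplus>\<^bsub>\<A>\<^esub> F q') \<and>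
     (\<forall>c q. F (cx_scale c q) = c \<odot>\<^bsub>\<A>\<^esub> F q) \<and> (\<exists>K\<ge>0. \<forall>q. nrm \<A> (F q) \<le> K * norm q)"

text \<open>
  Those with values in the kernel of summation over \<open>\<Gamma>\<close>.
\<close>

definition null_family :: "(('x \<Rightarrow>\<^sub>C complex) \<Rightarrow> 'g \<Rightarrow> ('x \<Rightarrow>\<^sub>C complex)) \<Rightarrow> bool" where
  "null_family F \<longleftrightarrow> operator_family F \<and> (\<forall>q x. (\<Sum>\<^sub>\<infinity>g\<in>carrier G. apply_bcontfun (F q g) x) = 0)"

text \<open>
  The bimodule \<open>\<L>\<close> of operators, with \<open>(a.T.b)(q) = a * T(b.q)\<close> and the operator norm. As
  \<open>\<parallel>f\<parallel> = sup\<^sub>x \<Sum>\<^sub>g |f\<^sub>g(x)|\<close> in \<open>\<A>\<close>, the operator norm is a single supremum over \<open>q\<close> and \<open>x\<close>.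
\<close>

definition operator_bimodule ::
    "('g \<Rightarrow> ('x \<Rightarrow>\<^sub>C complex), ('x \<Rightarrow>\<^sub>C complex) \<Rightarrow> 'x \<Rightarrow> 'g \<Rightarrow> complex) bimodule" where
  "operator_bimodule = \<lparr>
     carrier = {\<lambda>q. pointwise (F q) | F. null_family F},
     mult = undefined,
     one = undefined,
     zero = (\<lambda>q x g. 0),
     add = (\<lambda>S T q x g. S q x g + T q x g),
     smult = (\<lambda>c T q x g. c * T q x g),
     nrm = (\<lambda>T. SUP (q, x)\<in>{q. norm q \<le> 1} \<times> UNIV. \<Sum>\<^sub>\<infinity>g\<in>carrier G. cmod (T q x g)),
     lact = (\<lambda>a T q. convolve a (T q)),
     ract = (\<lambda>T a q. T (cx_action a q))\<rparr>"

abbreviation \<L> where "\<L> \<equiv> operator_bimodule"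

lemma operator_bimodule_simps [simp]:
  "carrier \<L> = {\<lambda>q. pointwise (F q) | F. null_family F}"
  "\<zero>\<^bsub>\<L>\<^esub> = (\<lambda>q x g. 0)"
  "S \<oplus>\<^bsub>\<L>\<^esub> T = (\<lambda>q x g. S q x g + T q x g)"
  "c \<odot>\<^bsub>\<L>\<^esub> T = (\<lambda>q x g. c * T q x g)"
  "nrm \<L> T = (SUP (q, x)\<in>{q. norm q \<le> 1} \<times> UNIV. \<Sum>\<^sub>\<infinity>g\<in>carrier G. cmod (T q x g))"
  "lact \<L> a T = (\<lambda>q. convolve a (T q))"
  "ract \<L> T a = (\<lambda>q. T (cx_action a q))"
  by (simp_all add: operator_bimodule_def)

lemma operator_familyD:
  assumes "operator_family F"
  shows "F q \<in> carrier \<A>" "F (q + q') = F q \<oplus>\<^bsub>\<A>\<^esub> F q'" "F (cx_scale c q) = c \<odot>\<^bsub>\<A>\<^esub> F q"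
    "\<exists>K\<ge>0. \<forall>q. nrm \<A> (F q) \<le> K * norm q"
  using assms unfolding operator_family_def by blast+

lemma operator_nrm_le:
  assumes "0 \<le> C" "\<And>q x. (\<Sum>\<^sub>\<infinity>g\<in>carrier G. cmod (T q x g)) \<le> C * norm q"
  shows "nrm \<L> T \<le> C"
  unfolding operator_bimodule_simps
proof (rule cSUP_least)
  have "(0 :: 'x \<Rightarrow>\<^sub>C complex, undefined :: 'x) \<in> {q. norm q \<le> 1} \<times> UNIV" by simp
  then show "{q :: 'x \<Rightarrow>\<^sub>C complex. norm q \<le> 1} \<times> (UNIV :: 'x set) \<noteq> {}" by blast
  fix p :: "('x \<Rightarrow>\<^sub>C complex) \<times> 'x" assume "p \<in> {q. norm q \<le> 1} \<times> UNIV"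
  then obtain q x where p: "p = (q, x)" "norm q \<le> 1" by auto
  have "(\<Sum>\<^sub>\<infinity>g\<in>carrier G. cmod (T q x g)) \<le> C * 1"
    using assms(2)[of q x] mult_left_mono[OF p(2) assms(1)] by linarith
  then show "(case p of (q, x) \<Rightarrow> \<Sum>\<^sub>\<infinity>g\<in>carrier G. cmod (T q x g)) \<le> C" by (simp add: p)
qed

lemma le_operator_nrm_ball:
  assumes F: "operator_family F" and "norm q \<le> 1"
  shows "(\<Sum>\<^sub>\<infinity>g\<in>carrier G. cmod (F q g x)) \<le> nrm \<L> (\<lambda>q. pointwise (F q))"
proof -
  obtain K where K: "0 \<le> K" "\<And>q. nrm \<A> (F q) \<le> K * norm q" using operator_familyD(4)[OF F] by blast
  have "(\<Sum>\<^sub>\<infinity>g\<in>carrier G. cmod (F q g x)) \<le> K" if "norm q \<le> 1" for q x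
    using nrm_A0_ge[OF operator_familyD(1)[OF F, of q], of x] K(2)[of q] mult_left_mono[OF that K(1)] by linarith
  then have "bdd_above ((\<lambda>(q, x). \<Sum>\<^sub>\<infinity>g\<in>carrier G. cmod (pointwise (F q) x g)) ` ({q. norm q \<le> 1} \<times> UNIV))"
    by (intro bdd_aboveI2[of _ _ K]) (auto simp: pointwise_def)
  from cSUP_upper[OF _ this, of "(q, x)"] assms(2) show ?thesis
    unfolding operator_bimodule_simps by (simp add: pointwise_def)
qed

lemma le_operator_nrm:
  assumes F: "operator_family F"
  shows "nrm \<A> (F q) \<le> nrm \<L> (\<lambda>q. pointwise (F q)) * norm q"
proof (rule nrm_A0_le[OF operator_familyD(1)[OF F]])
  fix x
  show "(\<Sum>\<^sub>\<infinity>g\<in>carrier G. cmod (F q g x)) \<le> nrm \<L> (\<lambda>q. pointwise (F q)) * norm q"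
  proof (cases "q = 0")
    case True
    have "F (cx_scale 0 q) = 0 \<odot>\<^bsub>\<A>\<^esub> F q" by (rule operator_familyD(3)[OF F])
    moreover have "cx_scale 0 q = 0" "\<And>p :: 'x \<Rightarrow>\<^sub>C complex. cx_scale 0 p = 0" by (auto intro: bcontfun_eqI)
    ultimately have "F q = (\<lambda>_. 0)" using True by simp
    then show ?thesis using True by simp
  next
    case False
    define r where "r = norm q"
    have r: "0 < r" using False by (simp add: r_def)
    define q' where "q' = cx_scale (complex_of_real (1 / r)) q"
    have "norm q' \<le> 1"
    proof (rule norm_bound)
      show "cmod (q' x) \<le> 1" for x
        using norm_bounded[of q x] r by (simp add: q'_def norm_divide divide_le_eq r_def)
    qed
    then have "(\<Sum>\<^sub>\<infinity>g\<in>carrier G. cmod (F q' g x)) \<le> nrm \<L> (\<lambda>q. pointwise (F q))"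
      by (rule le_operator_nrm_ball[OF F])
    also have "F q' = complex_of_real (1 / r) \<odot>\<^bsub>\<A>\<^esub> F q"
      unfolding q'_def by (rule operator_familyD(3)[OF F])
    also have "(\<Sum>\<^sub>\<infinity>g\<in>carrier G. cmod ((complex_of_real (1 / r) \<odot>\<^bsub>\<A>\<^esub> F q) g x))
        = (1 / r) * (\<Sum>\<^sub>\<infinity>g\<in>carrier G. cmod (F q g x))"
      using r by (simp only: A0_simps apply_cx_scale norm_mult infsum_cmult_right') (simp add: norm_divide)
    finally show ?thesis using r by (simp add: divide_le_eq r_def[symmetric])
  qed
qed

lemma operator_nrm_le_family:
  assumes F: "operator_family F" and "0 \<le> C" "\<And>q. nrm \<A> (F q) \<le> C * norm q"
  shows "nrm \<L> (\<lambda>q. pointwise (F q)) \<le> C"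
  using assms(2)
proof (rule operator_nrm_le)
  show "(\<Sum>\<^sub>\<infinity>g\<in>carrier G. cmod (pointwise (F q) x g)) \<le> C * norm q" for q x
    using nrm_A0_ge[OF operator_familyD(1)[OF F, of q], of x] assms(3)[of q] by (simp add: pointwise_def)
qed

lemma operator_nrm_nonneg: "operator_family F \<Longrightarrow> 0 \<le> nrm \<L> (\<lambda>q. pointwise (F q))"
  using le_operator_nrm_ball[of F 0 undefined] infsum_nonneg[of "carrier G" "\<lambda>g. cmod (F 0 g undefined)"]
  by (simp del: operator_bimodule_simps)

lemma null_family_zero: "null_family (\<lambda>q g. 0)"
proof -
  have z: "(\<lambda>_. 0) \<in> carrier \<A>"
    by (auto simp: carrier_A0 intro: uniformly_abs_summable_finite[of "{}"])
  have "nrm \<A> (\<lambda>_. 0) \<le> 0" by (rule nrm_A0_le[OF z]) simp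
  then show ?thesis
    unfolding null_family_def operator_family_def using z by (auto intro!: exI[of _ 0])
qed

lemma operator_family_add:
  assumes "operator_family F" "operator_family F'"
  shows "operator_family (\<lambda>q. F q \<oplus>\<^bsub>\<A>\<^esub> F' q)"
  unfolding operator_family_def
proof (intro conjI allI)
  note F = operator_familyD[OF assms(1)] and F' = operator_familyD[OF assms(2)]
  show "F q \<oplus>\<^bsub>\<A>\<^esub> F' q \<in> carrier \<A>" for q using A0_add_closed F(1) F'(1) by simp
  show "F (q + q') \<oplus>\<^bsub>\<A>\<^esub> F' (q + q') = (F q \<oplus>\<^bsub>\<A>\<^esub> F' q) \<oplus>\<^bsub>\<A>\<^esub> (F q' \<oplus>\<^bsub>\<A>\<^esub> F' q')" for q q'
    unfolding F(2) F'(2) by (simp add: ac_simps)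
  show "F (cx_scale c q) \<oplus>\<^bsub>\<A>\<^esub> F' (cx_scale c q) = c \<odot>\<^bsub>\<A>\<^esub> (F q \<oplus>\<^bsub>\<A>\<^esub> F' q)" for c q
    unfolding F(3) F'(3) by (auto intro!: bcontfun_eqI simp: fun_eq_iff algebra_simps)
  obtain K K' where "0 \<le> K" "\<And>q. nrm \<A> (F q) \<le> K * norm q" "0 \<le> K'" "\<And>q. nrm \<A> (F' q) \<le> K' * norm q"
    using F(4) F'(4) by blast
  then have "nrm \<A> (F q \<oplus>\<^bsub>\<A>\<^esub> F' q) \<le> (K + K') * norm q" for q
    using nrm_A0_add[OF F(1)[of q] F'(1)[of q]] by (smt (verit) distrib_right)
  then show "\<exists>K\<ge>0. \<forall>q. nrm \<A> (F q \<oplus>\<^bsub>\<A>\<^esub> F' q) \<le> K * norm q"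
    using \<open>0 \<le> K\<close> \<open>0 \<le> K'\<close> by (intro exI[of _ "K + K'"]) auto
qed

lemma null_family_add:
  assumes "null_family F" "null_family F'"
  shows "null_family (\<lambda>q. F q \<oplus>\<^bsub>\<A>\<^esub> F' q)"
  using assms operator_family_add unfolding null_family_def
  by (auto simp: infsum_add A0_row_summable operator_familyD(1))

lemma operator_family_scale:
  assumes "operator_family F"
  shows "operator_family (\<lambda>q. c \<odot>\<^bsub>\<A>\<^esub> F q)"
  unfolding operator_family_def
proof (intro conjI allI)
  note F = operator_familyD[OF assms]
  show "c \<odot>\<^bsub>\<A>\<^esub> F q \<in> carrier \<A>" for q using A0_scale_closed F(1) by simp
  show "c \<odot>\<^bsub>\<A>\<^esub> F (q + q') = (c \<odot>\<^bsub>\<A>\<^esub> F q) \<oplus>\<^bsub>\<A>\<^esub> (c \<odot>\<^bsub>\<A>\<^esub> F q')" for q q'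
    unfolding F(2) by (auto intro!: bcontfun_eqI simp: fun_eq_iff algebra_simps)
  show "c \<odot>\<^bsub>\<A>\<^esub> F (cx_scale d q) = d \<odot>\<^bsub>\<A>\<^esub> (c \<odot>\<^bsub>\<A>\<^esub> F q)" for d q
    unfolding F(3) by (auto intro!: bcontfun_eqI simp: fun_eq_iff algebra_simps)
  obtain K where K: "0 \<le> K" "\<And>q. nrm \<A> (F q) \<le> K * norm q" using F(4) by blast
  have "nrm \<A> (c \<odot>\<^bsub>\<A>\<^esub> F q) \<le> (cmod c * K) * norm q" for q
    using nrm_A0_scale_le[OF F(1)[of q], of c] mult_left_mono[OF K(2)[of q], of "cmod c"] by (simp add: mult.assoc)
  then show "\<exists>K\<ge>0. \<forall>q. nrm \<A> (c \<odot>\<^bsub>\<A>\<^esub> F q) \<le> K * norm q"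
    using K(1) by (intro exI[of _ "cmod c * K"]) auto
qed

lemma null_family_scale: "null_family F \<Longrightarrow> null_family (\<lambda>q. c \<odot>\<^bsub>\<A>\<^esub> F q)"
  using operator_family_scale unfolding null_family_def by (auto simp: infsum_cmult_right')

lemma operator_family_lact:
  assumes a: "a \<in> carrier \<A>" and "operator_family F"
  shows "operator_family (\<lambda>q. a \<otimes>\<^bsub>\<A>\<^esub> F q)"
  unfolding operator_family_def
proof (intro conjI allI)
  note F = operator_familyD[OF assms(2)]
  show "a \<otimes>\<^bsub>\<A>\<^esub> F q \<in> carrier \<A>" for q by (rule A0_mult_closed[OF a F(1)])
  show "a \<otimes>\<^bsub>\<A>\<^esub> F (q + q') = (a \<otimes>\<^bsub>\<A>\<^esub> F q) \<oplus>\<^bsub>\<A>\<^esub> (a \<otimes>\<^bsub>\<A>\<^esub> F q')" for q q'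
    unfolding F(2) by (rule A0_mult_add_right[OF a F(1) F(1)])
  show "a \<otimes>\<^bsub>\<A>\<^esub> F (cx_scale c q) = c \<odot>\<^bsub>\<A>\<^esub> (a \<otimes>\<^bsub>\<A>\<^esub> F q)" for c q
    unfolding F(3) by (rule A0_mult_smult(2)[OF a F(1)])
  obtain K where K: "0 \<le> K" "\<And>q. nrm \<A> (F q) \<le> K * norm q" using F(4) by blast
  have "nrm \<A> (a \<otimes>\<^bsub>\<A>\<^esub> F q) \<le> (nrm \<A> a * K) * norm q" for q
    using nrm_A0_mult_le[OF a F(1)[of q]] mult_left_mono[OF K(2)[of q] nrm_A0_nonneg[of a]] by (simp add: mult.assoc)
  then show "\<exists>K\<ge>0. \<forall>q. nrm \<A> (a \<otimes>\<^bsub>\<A>\<^esub> F q) \<le> K * norm q"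
    using K(1) nrm_A0_nonneg[of a] by (intro exI[of _ "nrm \<A> a * K"]) auto
qed

lemma null_family_lact:
  assumes "a \<in> carrier \<A>" "null_family F"
  shows "null_family (\<lambda>q. a \<otimes>\<^bsub>\<A>\<^esub> F q)"
  using assms operator_family_lact unfolding null_family_def
  by (auto simp: row_sum_mult operator_familyD(1))

lemma operator_family_ract:
  assumes a: "a \<in> carrier \<A>" and "operator_family F"
  shows "operator_family (\<lambda>q. F (cx_action a q))"
  unfolding operator_family_def
proof (intro conjI allI)
  note F = operator_familyD[OF assms(2)]
  show "F (cx_action a q) \<in> carrier \<A>" for q by (rule F(1))
  show "F (cx_action a (q + q')) = F (cx_action a q) \<oplus>\<^bsub>\<A>\<^esub> F (cx_action a q')" for q q'
    unfolding cx_action_add_right[OF a] by (rule F(2))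
  show "F (cx_action a (cx_scale c q)) = c \<odot>\<^bsub>\<A>\<^esub> F (cx_action a q)" for c q
    unfolding cx_action_scale(2)[OF a] by (rule F(3))
  obtain K where K: "0 \<le> K" "\<And>q. nrm \<A> (F q) \<le> K * norm q" using F(4) by blast
  have "nrm \<A> (F (cx_action a q)) \<le> (K * nrm \<A> a) * norm q" for q
    using K(2)[of "cx_action a q"] mult_left_mono[OF norm_cx_action_le[OF a, of q] K(1)] by (simp add: mult.assoc)
  then show "\<exists>K\<ge>0. \<forall>q. nrm \<A> (F (cx_action a q)) \<le> K * norm q"
    using K(1) nrm_A0_nonneg[of a] by (intro exI[of _ "K * nrm \<A> a"]) auto
qed

lemma null_family_ract: "a \<in> carrier \<A> \<Longrightarrow> null_family F \<Longrightarrow> null_family (\<lambda>q. F (cx_action a q))"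
  using operator_family_ract unfolding null_family_def by auto

lemma operator_carrierE:
  assumes "T \<in> carrier \<L>"
  obtains F where "null_family F" "operator_family F" "T = (\<lambda>q. pointwise (F q))" "\<And>q. F q \<in> carrier \<A>"
  using assms unfolding operator_bimodule_simps null_family_def operator_family_def by blast

lemma operator_carrierI: "null_family F \<Longrightarrow> (\<lambda>q. pointwise (F q)) \<in> carrier \<L>"
  unfolding operator_bimodule_simps by blast

lemma operator_add:
  "(\<lambda>q. pointwise (F q)) \<oplus>\<^bsub>\<L>\<^esub> (\<lambda>q. pointwise (F' q)) = (\<lambda>q. pointwise (F q \<oplus>\<^bsub>\<A>\<^esub> F' q))"
  by (simp add: pointwise_simps)

lemma operator_smult: "c \<odot>\<^bsub>\<L>\<^esub> (\<lambda>q. pointwise (F q)) = (\<lambda>q. pointwise (c \<odot>\<^bsub>\<A>\<^esub> F q))"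
  by (simp add: pointwise_simps)

lemma operator_add_closed:
  assumes "S \<in> carrier \<L>" "T \<in> carrier \<L>" shows "S \<oplus>\<^bsub>\<L>\<^esub> T \<in> carrier \<L>"
proof -
  obtain F H where "null_family F" "S = (\<lambda>q. pointwise (F q))" "null_family H" "T = (\<lambda>q. pointwise (H q))"
    using assms operator_carrierE by metis
  then show ?thesis by (simp only: operator_add operator_carrierI null_family_add)
qed

lemma operator_smult_closed:
  assumes "T \<in> carrier \<L>" shows "c \<odot>\<^bsub>\<L>\<^esub> T \<in> carrier \<L>"
proof -
  obtain F where "null_family F" "T = (\<lambda>q. pointwise (F q))" using assms operator_carrierE by metis
  then show ?thesis by (simp only: operator_smult operator_carrierI null_family_scale)
qed

lemma operator_zero_closed: "\<zero>\<^bsub>\<L>\<^esub> \<in> carrier \<L>"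
  using operator_carrierI[OF null_family_zero] by (simp add: pointwise_def del: operator_bimodule_simps(1))

lemma operator_lact:
  assumes "a \<in> carrier \<A>" "\<And>q. F q \<in> carrier \<A>"
  shows "lact \<L> a (\<lambda>q. pointwise (F q)) = (\<lambda>q. pointwise (a \<otimes>\<^bsub>\<A>\<^esub> F q))"
  using assms by (simp add: convolve_pointwise)

lemma operator_abelian_group: "abelian_group \<L>"
proof (rule abelian_groupI)
  fix S T U assume "S \<in> carrier \<L>" "T \<in> carrier \<L>"
  then show "S \<oplus>\<^bsub>\<L>\<^esub> T \<in> carrier \<L>" by (rule operator_add_closed)
next
  show "\<zero>\<^bsub>\<L>\<^esub> \<in> carrier \<L>" by (rule operator_zero_closed)
next
  fix T assume "T \<in> carrier \<L>"
  from operator_smult_closed[OF this, of "-1"]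
  show "\<exists>S\<in>carrier \<L>. S \<oplus>\<^bsub>\<L>\<^esub> T = \<zero>\<^bsub>\<L>\<^esub>"
    by (intro bexI[of _ "(-1) \<odot>\<^bsub>\<L>\<^esub> T"]) (simp_all del: operator_bimodule_simps(1))
qed (simp_all add: ac_simps del: operator_bimodule_simps(1))

lemma operator_normed_bimodule: "normed_bimodule \<A> \<L>"
proof -
  have "module (ring_of_type_algebra :: complex ring) \<L>"
    by (rule moduleI) (simp_all add: operator_abelian_group cring_from_type_algebra algebra_simps
        operator_smult_closed[simplified operator_bimodule_simps(4)] del: operator_bimodule_simps(1))
  then interpret L: module "ring_of_type_algebra :: complex ring" \<L> .
  show ?thesis
  proof
    show "0 \<le> nrm \<A> a" for a by (rule nrm_A0_nonneg)
    fix T assume T: "T \<in> carrier \<L>"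
    obtain F where F: "null_family F" "operator_family F" "T = (\<lambda>q. pointwise (F q))" "\<And>q. F q \<in> carrier \<A>"
      using operator_carrierE[OF T] by metis
    show nn: "0 \<le> nrm \<L> T" unfolding F(3) by (rule operator_nrm_nonneg[OF F(2)])
    show "nrm \<L> T = 0 \<longleftrightarrow> T = \<zero>\<^bsub>\<L>\<^esub>"
    proof
      assume 0: "nrm \<L> T = 0"
      have "nrm \<A> (F q) \<le> 0" for q
        using le_operator_nrm[OF F(2), of q] 0 unfolding F(3) by (simp only: mult_zero_left)
      then have "F q g x = 0" for q g x
        using A0_apply_le[OF F(4)[of q], of g x] by (meson norm_le_zero_iff order_trans)
      then show "T = \<zero>\<^bsub>\<L>\<^esub>" by (simp add: F(3) pointwise_def)
    next
      assume "T = \<zero>\<^bsub>\<L>\<^esub>"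
      then have "nrm \<L> T \<le> 0" by (intro operator_nrm_le) auto
      then show "nrm \<L> T = 0" using nn by linarith
    qed
    have scale_le: "nrm \<L> (c \<odot>\<^bsub>\<L>\<^esub> S) \<le> cmod c * nrm \<L> S" if "S \<in> carrier \<L>" for S c
    proof -
      obtain H where H: "operator_family H" "S = (\<lambda>q. pointwise (H q))" "\<And>q. H q \<in> carrier \<A>"
        using operator_carrierE[OF \<open>S \<in> carrier \<L>\<close>] by metis
      show ?thesis
        unfolding H(2) operator_smult
      proof (rule operator_nrm_le_family[OF operator_family_scale[OF H(1)]])
        show "0 \<le> cmod c * nrm \<L> (\<lambda>q. pointwise (H q))"
          by (intro mult_nonneg_nonneg operator_nrm_nonneg H(1)) simp
        show "nrm \<A> (c \<odot>\<^bsub>\<A>\<^esub> H q) \<le> cmod c * nrm \<L> (\<lambda>q. pointwise (H q)) * norm q" for q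
          unfolding mult.assoc
          by (rule order_trans[OF nrm_A0_scale_le[OF H(3)] mult_left_mono[OF le_operator_nrm[OF H(1)] norm_ge_zero]])
      qed
    qed
    show "nrm \<L> (c \<odot>\<^bsub>\<L>\<^esub> T) = cmod c * nrm \<L> T" for c
    proof (cases "c = 0")
      case True
      have "0 \<odot>\<^bsub>\<L>\<^esub> T = \<zero>\<^bsub>\<L>\<^esub>" by simp
      moreover have "nrm \<L> \<zero>\<^bsub>\<L>\<^esub> = 0"
      proof (rule antisym)
        show "nrm \<L> \<zero>\<^bsub>\<L>\<^esub> \<le> 0" by (intro operator_nrm_le) auto
        show "0 \<le> nrm \<L> \<zero>\<^bsub>\<L>\<^esub>"
          using operator_nrm_nonneg[of "\<lambda>q g. 0"] null_family_zero
          by (simp add: pointwise_def null_family_def del: operator_bimodule_simps(5))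
      qed
      ultimately show ?thesis using True by (simp only: norm_zero mult_zero_left)
    next
      case False
      have "nrm \<L> ((1 / c) \<odot>\<^bsub>\<L>\<^esub> (c \<odot>\<^bsub>\<L>\<^esub> T)) \<le> cmod (1 / c) * nrm \<L> (c \<odot>\<^bsub>\<L>\<^esub> T)"
        by (rule scale_le[OF operator_smult_closed[OF T]])
      moreover have "(1 / c) \<odot>\<^bsub>\<L>\<^esub> (c \<odot>\<^bsub>\<L>\<^esub> T) = T" using False by simp
      ultimately have "cmod c * nrm \<L> T \<le> nrm \<L> (c \<odot>\<^bsub>\<L>\<^esub> T)"
        using False by (simp add: norm_divide le_divide_eq mult.commute del: operator_bimodule_simps)
      with scale_le[OF T, of c] show ?thesis by linarith
    qed
    show "nrm \<L> (T \<oplus>\<^bsub>\<L>\<^esub> S) \<le> nrm \<L> T + nrm \<L> S" if "S \<in> carrier \<L>" for S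
    proof -
      obtain H where H: "operator_family H" "S = (\<lambda>q. pointwise (H q))" "\<And>q. H q \<in> carrier \<A>"
        using operator_carrierE[OF \<open>S \<in> carrier \<L>\<close>] by metis
      show ?thesis
        unfolding H(2) F(3) operator_add
      proof (rule operator_nrm_le_family[OF operator_family_add[OF F(2) H(1)]])
        show "0 \<le> nrm \<L> (\<lambda>q. pointwise (F q)) + nrm \<L> (\<lambda>q. pointwise (H q))"
          by (intro add_nonneg_nonneg operator_nrm_nonneg F(2) H(1))
        show "nrm \<A> (F q \<oplus>\<^bsub>\<A>\<^esub> H q) \<le> (nrm \<L> (\<lambda>q. pointwise (F q)) + nrm \<L> (\<lambda>q. pointwise (H q))) * norm q" for q
          unfolding distrib_right
          using nrm_A0_add[OF F(4)[of q] H(3)[of q]] le_operator_nrm[OF F(2), of q] le_operator_nrm[OF H(1), of q]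
          by linarith
      qed
    qed
    fix a assume a: "a \<in> carrier \<A>"
    show "lact \<L> a T \<in> carrier \<L>"
      unfolding F(3) operator_lact[OF a F(4)] by (intro operator_carrierI null_family_lact a F(1))
    show "ract \<L> T a \<in> carrier \<L>"
      using operator_carrierI[OF null_family_ract[OF a F(1)]] by (simp add: F(3) del: operator_bimodule_simps(1))
    show "nrm \<L> (lact \<L> a T) \<le> nrm \<A> a * nrm \<L> T"
      unfolding F(3) operator_lact[OF a F(4)]
    proof (rule operator_nrm_le_family[OF operator_family_lact[OF a F(2)]])
      show "0 \<le> nrm \<A> a * nrm \<L> (\<lambda>q. pointwise (F q))"
        by (intro mult_nonneg_nonneg operator_nrm_nonneg nrm_A0_nonneg F(2))
      show "nrm \<A> (a \<otimes>\<^bsub>\<A>\<^esub> F q) \<le> nrm \<A> a * nrm \<L> (\<lambda>q. pointwise (F q)) * norm q" for q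
        using nrm_A0_mult_le[OF a F(4)[of q]] mult_left_mono[OF le_operator_nrm[OF F(2), of q] nrm_A0_nonneg[of a]]
        by (simp only: mult.assoc)
    qed
    have "nrm \<L> (\<lambda>q. pointwise (F (cx_action a q))) \<le> nrm \<L> (\<lambda>q. pointwise (F q)) * nrm \<A> a"
    proof (rule operator_nrm_le_family[OF operator_family_ract[OF a F(2)]])
      show "0 \<le> nrm \<L> (\<lambda>q. pointwise (F q)) * nrm \<A> a"
        by (intro mult_nonneg_nonneg operator_nrm_nonneg nrm_A0_nonneg F(2))
      show "nrm \<A> (F (cx_action a q)) \<le> nrm \<L> (\<lambda>q. pointwise (F q)) * nrm \<A> a * norm q" for q
        using le_operator_nrm[OF F(2), of "cx_action a q"]
          mult_left_mono[OF norm_cx_action_le[OF a, of q] operator_nrm_nonneg[OF F(2)]]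
        by (simp only: mult.assoc)
    qed
    then show "nrm \<L> (ract \<L> T a) \<le> nrm \<L> T * nrm \<A> a"
      by (simp add: F(3) del: operator_bimodule_simps(5))
    show "lact \<L> (c \<odot>\<^bsub>\<A>\<^esub> a) T = c \<odot>\<^bsub>\<L>\<^esub> lact \<L> a T" for c
      using A0_scale_closed[OF a, of c]
      unfolding F(3) operator_lact[OF a F(4)] operator_smult
      by (subst operator_lact) (simp_all add: A0_mult_smult(1)[OF a F(4), simplified] F(4))
    show "lact \<L> a (c \<odot>\<^bsub>\<L>\<^esub> T) = c \<odot>\<^bsub>\<L>\<^esub> lact \<L> a T" for c
      using A0_scale_closed[OF F(4), of c]
      unfolding F(3) operator_lact[OF a F(4)] operator_smult
      by (subst operator_lact) (simp_all add: A0_mult_smult(2)[OF a F(4), simplified] a)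
    show "ract \<L> (c \<odot>\<^bsub>\<L>\<^esub> T) a = c \<odot>\<^bsub>\<L>\<^esub> ract \<L> T a" for c by simp
    show "ract \<L> T (c \<odot>\<^bsub>\<A>\<^esub> a) = c \<odot>\<^bsub>\<L>\<^esub> ract \<L> T a" for c
      using cx_action_scale(1)[OF a, of c] operator_familyD(3)[OF F(2)] by (simp add: F(3) pointwise_simps)
    show "lact \<L> a (T \<oplus>\<^bsub>\<L>\<^esub> S) = lact \<L> a T \<oplus>\<^bsub>\<L>\<^esub> lact \<L> a S" if "S \<in> carrier \<L>" for S
    proof -
      obtain H where H: "S = (\<lambda>q. pointwise (H q))" "\<And>q. H q \<in> carrier \<A>"
        using operator_carrierE[OF \<open>S \<in> carrier \<L>\<close>] by metis
      show ?thesis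
        using A0_add_closed[OF F(4) H(2)]
        unfolding F(3) H(1) operator_add operator_lact[OF a F(4)] operator_lact[OF a H(2)]
        by (subst operator_lact) (simp_all add: A0_mult_add_right[OF a F(4) H(2), simplified] a)
    qed
    show "ract \<L> (T \<oplus>\<^bsub>\<L>\<^esub> S) a = ract \<L> T a \<oplus>\<^bsub>\<L>\<^esub> ract \<L> S a" for S by simp
    fix b assume b: "b \<in> carrier \<A>"
    show "lact \<L> (a \<oplus>\<^bsub>\<A>\<^esub> b) T = lact \<L> a T \<oplus>\<^bsub>\<L>\<^esub> lact \<L> b T"
      using A0_add_closed[OF a b]
      unfolding F(3) operator_lact[OF a F(4)] operator_lact[OF b F(4)] operator_add
      by (subst operator_lact) (simp_all add: A0_mult_add_left[OF a b F(4), simplified] F(4))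
    show "ract \<L> T (a \<oplus>\<^bsub>\<A>\<^esub> b) = ract \<L> T a \<oplus>\<^bsub>\<L>\<^esub> ract \<L> T b"
      using cx_action_add_left[OF a b] operator_familyD(2)[OF F(2)] by (simp add: F(3) pointwise_simps)
    show "lact \<L> (a \<otimes>\<^bsub>\<A>\<^esub> b) T = lact \<L> a (lact \<L> b T)"
      unfolding F(3) operator_lact[OF b F(4)] operator_lact[OF a A0_mult_closed[OF b F(4)]]
        operator_lact[OF A0_mult_closed[OF a b] F(4)] A0_mult_assoc[OF a b F(4)] ..
    show "ract \<L> T (a \<otimes>\<^bsub>\<A>\<^esub> b) = ract \<L> (ract \<L> T a) b"
      by (simp add: cx_action_assoc[OF a b])
    show "lact \<L> a (ract \<L> T b) = ract \<L> (lact \<L> a T) b" by simp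
  qed
qed

end

section \<open>Normalising almost invariant families\<close>

text \<open>
  With \<open>P\<close> and \<open>Q\<close> the two sums, \<open>p/P - q/Q = (p - q)/P - q (P - Q)/(P Q)\<close>. Both terms have norm at most
  the norm of \<open>p - q\<close>, since \<open>P \<ge> 1\<close> and \<open>|P - Q|\<close> is bounded by that norm.
\<close>

lemma infsum_abs_normalised_diff_le:
  fixes p q :: "'i \<Rightarrow> real"
  assumes p: "\<And>h. 0 \<le> p h" "p summable_on I" "1 \<le> infsum p I"
    and q: "\<And>h. 0 \<le> q h" "q summable_on I" "1 \<le> infsum q I"
    and d: "(\<lambda>h. \<bar>p h - q h\<bar>) summable_on I"
  shows "(\<Sum>\<^sub>\<infinity>h\<in>I. \<bar>p h / infsum p I - q h / infsum q I\<bar>) \<le> 2 * (\<Sum>\<^sub>\<infinity>h\<in>I. \<bar>p h - q h\<bar>)"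
proof -
  define P Q where "P = infsum p I" and "Q = infsum q I"
  have P: "1 \<le> P" and Q: "1 \<le> Q" using p q by (simp_all add: P_def Q_def)
  have PQ: "\<bar>P - Q\<bar> \<le> (\<Sum>\<^sub>\<infinity>h\<in>I. \<bar>p h - q h\<bar>)"
  proof -
    have "((\<lambda>h. p h + - q h) has_sum (P + - Q)) I"
      unfolding P_def Q_def by (intro has_sum_add has_sum_uminusI has_sum_infsum p q)
    then have "P - Q = (\<Sum>\<^sub>\<infinity>h\<in>I. p h - q h)" by (simp add: infsumI)
    then show ?thesis using norm_infsum_bound[of "\<lambda>h. p h - q h" I] d by simp
  qed
  have dP: "u / P \<le> u" if "0 \<le> u" for u
    using mult_left_mono[OF P that] P by (simp add: divide_le_eq)
  have trm: "\<bar>p h / P - q h / Q\<bar> \<le> \<bar>p h - q h\<bar> + q h * (\<bar>P - Q\<bar> / Q)" for h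
  proof -
    have "p h / P - q h / Q = (p h - q h) / P - q h * ((P - Q) / Q) / P"
      using P Q by (simp add: field_simps)
    also have "\<bar>\<dots>\<bar> \<le> \<bar>p h - q h\<bar> / P + q h * (\<bar>P - Q\<bar> / Q) / P"
      using P Q q(1)[of h] by (intro order_trans[OF abs_triangle_ineq4]) (simp add: abs_mult)
    also have "\<dots> \<le> \<bar>p h - q h\<bar> + q h * (\<bar>P - Q\<bar> / Q)"
      using Q q(1)[of h] by (intro add_mono dP) auto
    finally show ?thesis .
  qed
  have s: "(\<lambda>h. \<bar>p h - q h\<bar> + q h * (\<bar>P - Q\<bar> / Q)) summable_on I"
    by (intro summable_on_add summable_on_cmult_left d q)
  have "(\<Sum>\<^sub>\<infinity>h\<in>I. \<bar>p h / P - q h / Q\<bar>) \<le> (\<Sum>\<^sub>\<infinity>h\<in>I. \<bar>p h - q h\<bar> + q h * (\<bar>P - Q\<bar> / Q))"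
    by (rule infsum_mono[OF summable_on_comparison_test[OF s trm] s trm]) auto
  also have "\<dots> = (\<Sum>\<^sub>\<infinity>h\<in>I. \<bar>p h - q h\<bar>) + Q * (\<bar>P - Q\<bar> / Q)"
    by (simp only: infsum_add[OF d summable_on_cmult_left[OF q(2)]] infsum_cmult_left[OF q(2)] Q_def)
  also have "Q * (\<bar>P - Q\<bar> / Q) = \<bar>P - Q\<bar>" using Q by simp
  finally show ?thesis using PQ by (simp add: P_def Q_def)
qed

context continuous_action
begin

definition normalised :: "('g \<Rightarrow> ('x \<Rightarrow>\<^sub>C complex)) \<Rightarrow> 'x \<Rightarrow> 'g \<Rightarrow> real" where
  "normalised a x g = cmod (a g x) / (\<Sum>\<^sub>\<infinity>h\<in>carrier G. cmod (a h x))"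

lemma A0_diff_summable:
  assumes "a \<in> carrier \<A>" "b \<in> carrier \<A>"
  shows "(\<lambda>g. cmod (a g x - b g y)) summable_on carrier G"
    and "(\<lambda>g. \<bar>cmod (a g x) - cmod (b g y)\<bar>) summable_on carrier G"
proof -
  have s: "(\<lambda>g. cmod (a g x) + cmod (b g y)) summable_on carrier G"
    by (intro summable_on_add A0_summable assms)
  show "(\<lambda>g. cmod (a g x - b g y)) summable_on carrier G"
    by (rule summable_on_comparison_test[OF s norm_triangle_ineq4]) simp
  show "(\<lambda>g. \<bar>cmod (a g x) - cmod (b g y)\<bar>) summable_on carrier G"
  proof (rule summable_on_comparison_test[OF s])
    show "\<bar>cmod (a g x) - cmod (b g y)\<bar> \<le> cmod (a g x) + cmod (b g y)" for g
      using norm_ge_zero[of "a g x"] norm_ge_zero[of "b g y"] by (simp only: abs_le_iff) linarith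
  qed simp
qed

text \<open>
  Subtracting from \<open>a\<close> its value at \<open>x\<close> gives a family of continuous functions which again has uniformly small
  tails, so the sum of its absolute values is a continuous function, and it vanishes at \<open>x\<close>.
\<close>

lemma A0_continuous_l1:
  assumes a: "a \<in> carrier \<A>"
  shows "((\<lambda>y. \<Sum>\<^sub>\<infinity>g\<in>carrier G. cmod (a g y - a g x)) \<longlongrightarrow> 0) (at x)"
proof -
  define b where "b g = a g + const_bcontfun (- a g x)" for g
  have "uniformly_abs_summable (\<lambda>g. const_bcontfun (- a g x) :: 'x \<Rightarrow>\<^sub>C complex) (carrier G)"
    unfolding uniformly_abs_summable_def
  proof (intro allI impI)
    fix \<epsilon> :: real assume "0 < \<epsilon>"
    then obtain F where F: "finite F" "F \<subseteq> carrier G"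
      "\<And>F' x. finite F' \<Longrightarrow> F' \<subseteq> carrier G - F \<Longrightarrow> (\<Sum>g\<in>F'. cmod (a g x)) \<le> \<epsilon>"
      using uniformly_abs_summableD[of a "carrier G" \<epsilon>] a unfolding carrier_A0 by metis
    then show "\<exists>F. finite F \<and> F \<subseteq> carrier G \<and> (\<forall>F' y. finite F' \<longrightarrow> F' \<subseteq> carrier G - F \<longrightarrow>
        (\<Sum>g\<in>F'. cmod (apply_bcontfun (const_bcontfun (- a g x) :: 'x \<Rightarrow>\<^sub>C complex) y)) \<le> \<epsilon>)"
      by (intro exI[of _ F]) simp
  qed
  then have b: "b \<in> carrier \<A>"
    using a unfolding b_def carrier_A0 by (auto intro: uniformly_abs_summable_add)
  define s where "s = (\<Sum>\<^sub>\<infinity>g\<in>carrier G. cx_abs (b g))"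
  have s: "apply_bcontfun s y = complex_of_real (\<Sum>\<^sub>\<infinity>g\<in>carrier G. cmod (a g y - a g x))" for y
    unfolding s_def apply_sum_abs[OF b] by (simp add: b_def)
  have "continuous_on UNIV (\<lambda>y. Re (s y))" by (intro continuous_intros) simp
  then have "((\<lambda>y. Re (s y)) \<longlongrightarrow> Re (s x)) (at x)"
    by (simp add: continuous_on_def)
  then show ?thesis by (simp add: s)
qed

context
  fixes a :: "'g \<Rightarrow> ('x \<Rightarrow>\<^sub>C complex)"
  assumes a: "a \<in> carrier \<A>" and sum_1: "\<And>x. (\<Sum>\<^sub>\<infinity>g\<in>carrier G. a g x) = 1"
begin

text \<open>
  This keeps the denominator in \<open>normalised\<close> away from zero.
\<close>

lemma row_sum_abs_ge_1: "1 \<le> (\<Sum>\<^sub>\<infinity>g\<in>carrier G. cmod (a g x))"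
  using norm_infsum_bound[of "\<lambda>g. apply_bcontfun (a g) x" "carrier G"] A0_summable[OF a, of x] sum_1[of x]
  by simp

lemma normalised_diff_le:
  fixes q :: "'g \<Rightarrow> real"
  assumes "\<And>h. 0 \<le> q h" "q summable_on carrier G" "1 \<le> infsum q (carrier G)"
    and "(\<lambda>h. \<bar>cmod (a h y) - q h\<bar>) summable_on carrier G"
  shows "l1_norm G (\<lambda>h. normalised a y h - q h / infsum q (carrier G))
    \<le> 2 * (\<Sum>\<^sub>\<infinity>h\<in>carrier G. \<bar>cmod (a h y) - q h\<bar>)"
  unfolding l1_norm_def normalised_def
  by (rule infsum_abs_normalised_diff_le) (use assms A0_summable[OF a] row_sum_abs_ge_1 in auto)

lemma normalised_continuous: "normalised a \<in> continuous_prob_maps G"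
  unfolding continuous_prob_maps_def
proof (intro CollectI conjI allI)
  fix x
  have N: "(\<Sum>\<^sub>\<infinity>h\<in>carrier G. cmod (a h x)) > 0" using row_sum_abs_ge_1[of x] by linarith
  have "(\<lambda>g. cmod (a g x) * (1 / (\<Sum>\<^sub>\<infinity>h\<in>carrier G. cmod (a h x)))) summable_on carrier G"
    by (intro summable_on_cmult_left A0_summable a)
  moreover have "(\<Sum>\<^sub>\<infinity>g\<in>carrier G. cmod (a g x) * (1 / (\<Sum>\<^sub>\<infinity>h\<in>carrier G. cmod (a h x)))) = 1"
    using N by (subst infsum_cmult_left) (auto intro: A0_summable a)
  ultimately show "normalised a x \<in> Prob G"
    using a N unfolding Prob_def l1_norm_def by (auto simp: normalised_def[abs_def] carrier_A0)
  have lim: "((\<lambda>y. 2 * (\<Sum>\<^sub>\<infinity>g\<in>carrier G. cmod (a g y - a g x))) \<longlongrightarrow> 0) (at x)"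
    using tendsto_mult_left[OF A0_continuous_l1[OF a], of 2 x] by simp
  show "((\<lambda>y. l1_norm G (\<lambda>h. normalised a y h - normalised a x h)) \<longlongrightarrow> 0) (at x)"
  proof (rule Lim_null_comparison[OF always_eventually lim], rule allI)
    fix y
    have "l1_norm G (\<lambda>h. normalised a y h - normalised a x h) \<le> 2 * (\<Sum>\<^sub>\<infinity>h\<in>carrier G. \<bar>cmod (a h y) - cmod (a h x)\<bar>)"
      unfolding normalised_def[of a x]
      by (rule normalised_diff_le) (use A0_summable[OF a] row_sum_abs_ge_1 A0_diff_summable(2)[OF a a] in auto)
    also have "\<dots> \<le> 2 * (\<Sum>\<^sub>\<infinity>h\<in>carrier G. cmod (a h y - a h x))"
      by (intro mult_left_mono infsum_mono A0_diff_summable a norm_triangle_ineq3) simp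
    finally show "norm (l1_norm G (\<lambda>h. normalised a y h - normalised a x h)) \<le> 2 * (\<Sum>\<^sub>\<infinity>h\<in>carrier G. cmod (a h y - a h x))"
      by (simp add: l1_norm_def infsum_nonneg)
  qed
qed

text \<open>
  Normalisation commutes with translation, so an element that \<open>\<delta>\<^sub>s\<close> almost fixes has an almost equivariant
  normalisation.
\<close>

lemma normalised_defect_le:
  assumes s: "s \<in> carrier G" and \<epsilon>: "\<And>x. (\<Sum>\<^sub>\<infinity>g\<in>carrier G. cmod (a g x - (\<delta> s \<otimes>\<^bsub>\<A>\<^esub> a) g x)) \<le> \<epsilon>"
  shows "l1_norm G (\<lambda>h. normalised a (act s x) h - l1_translate G s (normalised a x) h) \<le> 2 * \<epsilon>"
proof -
  define y where "y = act s x"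
  have x: "act (inv s) y = x" using s by (simp add: y_def)
  have sa: "\<delta> s \<otimes>\<^bsub>\<A>\<^esub> a \<in> carrier \<A>" using s a by simp
  define q where "q h = cmod ((\<delta> s \<otimes>\<^bsub>\<A>\<^esub> a) h y)" for h
  have q: "q h = cmod (a (inv s \<otimes> h) x)" if "h \<in> carrier G" for h
    using point_mass_mult_apply[OF s a that] by (simp add: q_def x)
  have qs: "q summable_on carrier G" unfolding q_def by (rule A0_summable[OF sa])
  have Q: "infsum q (carrier G) = (\<Sum>\<^sub>\<infinity>h\<in>carrier G. cmod (a h x))"
  proof -
    have "infsum q (carrier G) = (\<Sum>\<^sub>\<infinity>h\<in>carrier G. cmod (a (inv s \<otimes> h) x))"
      by (rule infsum_cong) (rule q)
    also have "\<dots> = (\<Sum>\<^sub>\<infinity>h\<in>carrier G. cmod (a h x))"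
      using s by (intro infsum_reindex_bij_betw[OF bij_left_mult]) simp
    finally show ?thesis .
  qed
  have "l1_norm G (\<lambda>h. normalised a y h - l1_translate G s (normalised a x) h)
      = l1_norm G (\<lambda>h. normalised a y h - q h / infsum q (carrier G))"
    unfolding l1_norm_def by (rule infsum_cong) (simp add: l1_translate_def normalised_def q Q)
  also have "\<dots> \<le> 2 * (\<Sum>\<^sub>\<infinity>h\<in>carrier G. \<bar>cmod (a h y) - q h\<bar>)"
  proof (rule normalised_diff_le[OF _ qs])
    show "0 \<le> q h" for h by (simp add: q_def)
    show "1 \<le> infsum q (carrier G)" unfolding Q by (rule row_sum_abs_ge_1)
    show "(\<lambda>h. \<bar>cmod (a h y) - q h\<bar>) summable_on carrier G"
      unfolding q_def by (rule A0_diff_summable(2)[OF a sa])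
  qed
  also have "\<dots> \<le> 2 * (\<Sum>\<^sub>\<infinity>h\<in>carrier G. cmod (a h y - (\<delta> s \<otimes>\<^bsub>\<A>\<^esub> a) h y))"
    unfolding q_def by (intro mult_left_mono infsum_mono A0_diff_summable a sa norm_triangle_ineq3) simp
  also have "\<dots> \<le> 2 * \<epsilon>" using \<epsilon>[of y] by simp
  finally show ?thesis by (simp add: y_def)
qed

end

declare operator_bimodule_simps [simp del] dual_bimodule_simps [simp del]

section \<open>The dual of the operator bimodule is geometric\<close>

interpretation L: normed_bimodule \<A> \<L>
  by (rule operator_normed_bimodule)

lemma operator_sum_closed:
  assumes "finite I" "\<And>k. k \<in> I \<Longrightarrow> T k \<in> carrier \<L>"
  shows "(\<lambda>q x g. \<Sum>k\<in>I. T k q x g) \<in> carrier \<L>"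
    and "\<Psi> \<in> bounded_functionals \<L> \<Longrightarrow> \<Psi> (\<lambda>q x g. \<Sum>k\<in>I. T k q x g) = (\<Sum>k\<in>I. \<Psi> (T k))"
proof -
  have "(\<lambda>q x g. \<Sum>k\<in>I. T k q x g) \<in> carrier \<L> \<and>
      (\<Psi> \<in> bounded_functionals \<L> \<longrightarrow> \<Psi> (\<lambda>q x g. \<Sum>k\<in>I. T k q x g) = (\<Sum>k\<in>I. \<Psi> (T k)))"
    using assms
  proof (induction I rule: finite_induct)
    case empty
    then show ?case
      using operator_zero_closed L.bounded_functionalD(4)[of \<Psi>] by (simp add: operator_bimodule_simps(2))
  next
    case (insert k I)
    let ?R = "\<lambda>q x g. \<Sum>k\<in>I. T k q x g"
    have eq: "(\<lambda>q x g. \<Sum>k\<in>insert k I. T k q x g) = T k \<oplus>\<^bsub>\<L>\<^esub> ?R"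
      using insert.hyps by (simp add: operator_bimodule_simps(3))
    have T: "T k \<in> carrier \<L>" and R: "?R \<in> carrier \<L>"
      and \<Psi>: "\<Psi> \<in> bounded_functionals \<L> \<longrightarrow> \<Psi> ?R = (\<Sum>k\<in>I. \<Psi> (T k))"
      using insert by simp_all
    show ?case
      unfolding eq using operator_add_closed[OF T R] L.bounded_functionalD(1)[of \<Psi>, OF _ T R] \<Psi> insert.hyps by simp
  qed
  then show "(\<lambda>q x g. \<Sum>k\<in>I. T k q x g) \<in> carrier \<L>"
    and "\<Psi> \<in> bounded_functionals \<L> \<Longrightarrow> \<Psi> (\<lambda>q x g. \<Sum>k\<in>I. T k q x g) = (\<Sum>k\<in>I. \<Psi> (T k))"
    by blast+
qed

lemma lact_cx_apply:
  assumes "T \<in> carrier \<L>"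
  shows "lact \<L> (cx_embed G p) T q x g = p x * T q x g"
proof -
  obtain F where F: "T = (\<lambda>q. pointwise (F q))" "\<And>q. F q \<in> carrier \<A>"
    using operator_carrierE[OF assms] by metis
  show ?thesis
  proof (cases "g \<in> carrier G")
    case True
    then show ?thesis
      unfolding F(1) operator_lact[OF cx_embed_closed F(2)]
      using point_mass_mult_apply[OF one_closed F(2) True, of p q] by (simp add: pointwise_def cx_embed_eq)
  next
    case False
    then show ?thesis
      unfolding F(1) operator_lact[OF cx_embed_closed F(2)]
      using F(2)[of q] by (simp add: pointwise_def A0_mult_outside carrier_A0)
  qed
qed

text \<open>
  At each point \<open>x\<close> the sum is a combination, with the coefficients \<open>p\<^sub>k(x) \<ge> 0\<close>, of rows of norm at most
  \<open>\<parallel>q\<parallel>\<close>.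
\<close>

lemma weighted_operators_nrm_le:
  fixes p :: "nat \<Rightarrow> 'x \<Rightarrow>\<^sub>C complex" and n :: nat
  assumes p: "\<And>k x. k \<in> {1..n} \<Longrightarrow> apply_bcontfun (p k) x \<in> complex_of_real ` {0..1}"
    and T: "\<And>k. k \<in> {1..n} \<Longrightarrow> T k \<in> carrier \<L>" "\<And>k. k \<in> {1..n} \<Longrightarrow> nrm \<L> (T k) \<le> 1"
  shows "nrm \<L> (\<lambda>q x g. \<Sum>k=1..n. lact \<L> (cx_embed G (p k)) (T k) q x g) \<le> norm (\<Sum>k=1..n. p k)"
proof (rule operator_nrm_le)
  fix q :: "'x \<Rightarrow>\<^sub>C complex" and x
  have rows: "(\<lambda>g. cmod (T k q x g)) summable_on carrier G"
    and le: "(\<Sum>\<^sub>\<infinity>g\<in>carrier G. cmod (T k q x g)) \<le> norm q" if k: "k \<in> {1..n}" for k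
  proof -
    obtain F where F: "operator_family F" "T k = (\<lambda>q. pointwise (F q))" "\<And>q. F q \<in> carrier \<A>"
      using operator_carrierE[OF T(1)[OF k]] by metis
    show "(\<lambda>g. cmod (T k q x g)) summable_on carrier G"
      using A0_summable[OF F(3)] by (simp add: F(2) pointwise_def)
    have "(\<Sum>\<^sub>\<infinity>g\<in>carrier G. cmod (T k q x g)) \<le> nrm \<L> (T k) * norm q"
      using nrm_A0_ge[OF F(3)[of q], of x] le_operator_nrm[OF F(1), of q] by (simp add: F(2) pointwise_def)
    also have "\<dots> \<le> 1 * norm q" using T(2)[OF k] by (intro mult_right_mono) auto
    finally show "(\<Sum>\<^sub>\<infinity>g\<in>carrier G. cmod (T k q x g)) \<le> norm q" by simp
  qed
  have pr: "p k x = complex_of_real (cmod (p k x))" if "k \<in> {1..n}" for k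
    using p[OF that, of x] by auto
  have hs: "((\<lambda>g. \<Sum>k=1..n. cmod (p k x) * cmod (T k q x g)) has_sum
      (\<Sum>k=1..n. cmod (p k x) * (\<Sum>\<^sub>\<infinity>g\<in>carrier G. cmod (T k q x g)))) (carrier G)"
    by (intro has_sum_finite_sum has_sum_cmult_right has_sum_infsum rows)
  have dom: "cmod (\<Sum>k=1..n. lact \<L> (cx_embed G (p k)) (T k) q x g) \<le> (\<Sum>k=1..n. cmod (p k x) * cmod (T k q x g))" for g
    by (rule order_trans[OF norm_sum]) (simp add: lact_cx_apply T(1) norm_mult)
  have "(\<Sum>\<^sub>\<infinity>g\<in>carrier G. cmod (\<Sum>k=1..n. lact \<L> (cx_embed G (p k)) (T k) q x g))
      \<le> (\<Sum>\<^sub>\<infinity>g\<in>carrier G. \<Sum>k=1..n. cmod (p k x) * cmod (T k q x g))"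
    by (rule infsum_mono[OF summable_on_comparison_test[OF has_sum_imp_summable[OF hs] dom]
          has_sum_imp_summable[OF hs] dom]) simp
  also have "\<dots> = (\<Sum>k=1..n. cmod (p k x) * (\<Sum>\<^sub>\<infinity>g\<in>carrier G. cmod (T k q x g)))"
    using hs by (rule infsumI)
  also have "\<dots> \<le> (\<Sum>k=1..n. cmod (p k x) * norm q)"
    by (intro sum_mono mult_left_mono le) auto
  also have "\<dots> = cmod ((\<Sum>k=1..n. p k) x) * norm q"
  proof -
    have "(\<Sum>k=1..n. p k) x = (\<Sum>k=1..n. complex_of_real (cmod (p k x)))"
      unfolding apply_bcontfun_sum by (intro sum.cong refl pr)
    also have "\<dots> = complex_of_real (\<Sum>k=1..n. cmod (p k x))" by simp
    finally show ?thesis by (simp add: sum_distrib_right sum_nonneg del: of_real_sum)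
  qed
  also have "\<dots> \<le> norm (\<Sum>k=1..n. p k) * norm q"
    by (intro mult_right_mono norm_bounded) simp
  finally show "(\<Sum>\<^sub>\<infinity>g\<in>carrier G. cmod (\<Sum>k=1..n. lact \<L> (cx_embed G (p k)) (T k) q x g)) \<le> norm (\<Sum>k=1..n. p k) * norm q" .
qed simp

lemma exists_almost_norming:
  assumes \<Psi>: "\<Psi> \<in> bounded_functionals \<L>" and \<epsilon>: "0 < \<epsilon>"
  obtains T where "T \<in> carrier \<L>" "nrm \<L> T \<le> 1" "nrm (dual_bimodule \<L>) \<Psi> - \<epsilon> \<le> cmod (\<Psi> T)"
proof -
  have "\<not> nrm (dual_bimodule \<L>) \<Psi> \<le> nrm (dual_bimodule \<L>) \<Psi> - \<epsilon>" using \<epsilon> by simp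
  then have "\<not> (\<forall>T\<in>{T \<in> carrier \<L>. nrm \<L> T \<le> 1}. cmod (\<Psi> T) \<le> nrm (dual_bimodule \<L>) \<Psi> - \<epsilon>)"
    using cSUP_least[of "{T \<in> carrier \<L>. nrm \<L> T \<le> 1}" "\<lambda>T. cmod (\<Psi> T)" "nrm (dual_bimodule \<L>) \<Psi> - \<epsilon>"]
      operator_zero_closed L.nrm_zero unfolding dual_bimodule_simps(5) by fastforce
  then show thesis using that by force
qed

text \<open>
  Dual to \<open>weighted_operators_nrm_le\<close>: choose \<open>T\<^sub>k\<close> in the unit ball almost norming \<open>\<Psi>.p\<^sub>k\<close>, with phases that make the values
  nonnegative, and evaluate \<open>\<Psi>\<close> at \<open>\<Sum>\<^sub>k p\<^sub>k.T\<^sub>k\<close>.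
\<close>

lemma dual_operator_geometric: "right_l1_geometric (cx_embed G) (dual_bimodule \<L>)"
  unfolding right_l1_geometric_def
proof (intro allI impI ballI)
  fix n :: nat and p :: "nat \<Rightarrow> 'x \<Rightarrow>\<^sub>C complex" and \<Psi>
  assume p: "\<forall>k\<in>{1..n}. \<forall>x. apply_bcontfun (p k) x \<in> complex_of_real ` {0..1}"
    and "\<Psi> \<in> carrier (dual_bimodule \<L>)"
  then have \<Psi>: "\<Psi> \<in> bounded_functionals \<L>" by (simp add: dual_bimodule_simps(1))
  let ?E = "dual_bimodule \<L>"
  define \<Psi>p where "\<Psi>p k = ract ?E \<Psi> (cx_embed G (p k))" for k
  have \<Psi>p: "\<Psi>p k \<in> bounded_functionals \<L>" for k
    unfolding \<Psi>p_def dual_bimodule_simps(7) by (rule L.dual_ract_closed[OF cx_embed_closed \<Psi>])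
  have \<Psi>p_apply: "\<Psi>p k T = \<Psi> (lact \<L> (cx_embed G (p k)) T)" if "T \<in> carrier \<L>" for k T
    using that by (simp add: \<Psi>p_def dual_bimodule_simps(7))
  have main: "(\<Sum>k=1..n. nrm ?E (\<Psi>p k)) \<le> norm (\<Sum>k=1..n. p k) * nrm ?E \<Psi> + real n * \<epsilon>" if \<epsilon>: "0 < \<epsilon>" for \<epsilon>
  proof -
    have "\<exists>T. T \<in> carrier \<L> \<and> nrm \<L> T \<le> 1 \<and> nrm ?E (\<Psi>p k) - \<epsilon> \<le> cmod (\<Psi>p k T)" for k
      using exists_almost_norming[OF \<Psi>p \<epsilon>] by metis
    then obtain T where T: "\<And>k. T k \<in> carrier \<L>" "\<And>k. nrm \<L> (T k) \<le> 1"
      "\<And>k. nrm ?E (\<Psi>p k) - \<epsilon> \<le> cmod (\<Psi>p k (T k))" by metis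
    (* The phase that turns the value at T k into its absolute value. *)
    define z where "z k = cnj (sgn (\<Psi>p k (T k)))" for k
    have z: "cmod (z k) \<le> 1" "z k * \<Psi>p k (T k) = complex_of_real (cmod (\<Psi>p k (T k)))" for k
    proof -
      show "cmod (z k) \<le> 1" by (simp add: z_def norm_sgn)
      show "z k * \<Psi>p k (T k) = complex_of_real (cmod (\<Psi>p k (T k)))"
        using complex_norm_square[of "\<Psi>p k (T k)"]
        by (simp add: z_def sgn_eq mult.commute[of "cnj _"] power2_eq_square divide_eq_eq)
    qed
    define R where "R k = z k \<odot>\<^bsub>\<L>\<^esub> T k" for k
    have R: "R k \<in> carrier \<L>" for k unfolding R_def by (rule operator_smult_closed[OF T(1)])
    have R1: "nrm \<L> (R k) \<le> 1" for k
      using mult_mono[OF z(1)[of k] T(2)[of k]] L.nrm_nonneg[OF T(1)] by (simp add: R_def L.nrm_smult[OF T(1)])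
    let ?U = "\<lambda>q x g. \<Sum>k=1..n. lact \<L> (cx_embed G (p k)) (R k) q x g"
    have PR: "lact \<L> (cx_embed G (p k)) (R k) \<in> carrier \<L>" for k
      by (rule L.lact_closed[OF cx_embed_closed R])
    have U: "?U \<in> carrier \<L>" "\<Psi> ?U = (\<Sum>k=1..n. \<Psi> (lact \<L> (cx_embed G (p k)) (R k)))"
      by (rule operator_sum_closed[OF _ PR] operator_sum_closed(2)[OF _ PR \<Psi>]; simp)+
    have "\<Psi> ?U = (\<Sum>k=1..n. complex_of_real (cmod (\<Psi>p k (T k))))"
      unfolding U(2)
    proof (rule sum.cong[OF refl])
      fix k
      have "\<Psi>p k (R k) = z k * \<Psi>p k (T k)"
        unfolding R_def by (rule L.bounded_functionalD(2)[OF \<Psi>p T(1)])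
      then show "\<Psi> (lact \<L> (cx_embed G (p k)) (R k)) = complex_of_real (cmod (\<Psi>p k (T k)))"
        by (simp only: \<Psi>p_apply[OF R] z(2))
    qed
    then have "cmod (\<Psi> ?U) = (\<Sum>k=1..n. cmod (\<Psi>p k (T k)))"
      by (simp add: sum_nonneg flip: of_real_sum)
    moreover have "cmod (\<Psi> ?U) \<le> nrm ?E \<Psi> * norm (\<Sum>k=1..n. p k)"
    proof (rule order_trans[OF L.le_dual_nrm[OF \<Psi> U(1)] mult_left_mono[OF _ L.dual_nrm_nonneg[OF \<Psi>]]])
      show "nrm \<L> ?U \<le> norm (\<Sum>k=1..n. p k)"
        by (rule weighted_operators_nrm_le) (use p R R1 in auto)
    qed
    moreover have "(\<Sum>k=1..n. nrm ?E (\<Psi>p k)) \<le> (\<Sum>k=1..n. cmod (\<Psi>p k (T k)) + \<epsilon>)"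
      using T(3) by (intro sum_mono) (simp add: diff_le_eq)
    ultimately show ?thesis by (simp add: sum.distrib mult.commute)
  qed
  have "(\<Sum>k=1..n. nrm ?E (\<Psi>p k)) \<le> norm (\<Sum>k=1..n. p k) * nrm ?E \<Psi> + e" if "0 < e" for e
  proof -
    have "real n * (e / (real n + 1)) \<le> e" using that by (simp add: field_simps)
    then show ?thesis using main[of "e / (real n + 1)"] that by simp
  qed
  then have "(\<Sum>k=1..n. nrm ?E (\<Psi>p k)) \<le> norm (\<Sum>k=1..n. p k) * nrm ?E \<Psi>"
    by (rule field_le_epsilon)
  then show "(\<Sum>k=1..n. nrm ?E (ract ?E \<Psi> (cx_embed G (p k)))) \<le> norm (\<Sum>k=1..n. p k) * nrm ?E \<Psi>"
    by (simp add: \<Psi>p_def)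
qed

end

section \<open>A universal derivation\<close>

context continuous_action
begin

interpretation L: normed_bimodule \<A> \<L>
  by (rule operator_normed_bimodule)

text \<open>
  The value \<open>a * (q \<delta>\<^sub>e) - (a.q) \<delta>\<^sub>e\<close> of \<open>a.T\<^sub>0 - T\<^sub>0.a\<close> at \<open>q\<close>, where \<open>T\<^sub>0(q) = q \<delta>\<^sub>e\<close>.
\<close>

definition commutator_family :: "('g \<Rightarrow> ('x \<Rightarrow>\<^sub>C complex)) \<Rightarrow> ('x \<Rightarrow>\<^sub>C complex) \<Rightarrow> 'g \<Rightarrow> ('x \<Rightarrow>\<^sub>C complex)" where
  "commutator_family a q = (a \<otimes>\<^bsub>\<A>\<^esub> cx_embed G q) \<oplus>\<^bsub>\<A>\<^esub> ((-1) \<odot>\<^bsub>\<A>\<^esub> cx_embed G (cx_action a q))"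

definition commutator :: "('g \<Rightarrow> ('x \<Rightarrow>\<^sub>C complex)) \<Rightarrow> ('x \<Rightarrow>\<^sub>C complex) \<Rightarrow> 'x \<Rightarrow> 'g \<Rightarrow> complex" where
  "commutator a = (\<lambda>q. pointwise (commutator_family a q))"

lemma operator_family_cx_embed: "operator_family (cx_embed G)"
  unfolding operator_family_def
  by (auto simp: cx_embed_add[simplified] cx_embed_scale[simplified] nrm_cx_embed_le intro!: exI[of _ 1])

lemma commutator_family_closed: "a \<in> carrier \<A> \<Longrightarrow> commutator_family a q \<in> carrier \<A>"
  unfolding commutator_family_def
  using A0_add_closed[OF A0_mult_closed[OF _ cx_embed_closed] A0_scale_closed[OF cx_embed_closed], of a q "-1" "cx_action a q"]
  by simp

text \<open>
  Summation over \<open>\<Gamma>\<close> sends \<open>T\<^sub>0(q)\<close> to \<open>q\<close> and is a homomorphism of left modules, so both terms have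
  the row sum \<open>a.q\<close>.
\<close>

lemma null_family_commutator:
  assumes a: "a \<in> carrier \<A>"
  shows "null_family (commutator_family a)"
  unfolding null_family_def
proof (intro conjI allI)
  show "operator_family (commutator_family a)"
    unfolding commutator_family_def
    by (intro operator_family_add operator_family_scale operator_family_lact[OF a operator_family_cx_embed]
        operator_family_ract[OF a operator_family_cx_embed])
  fix q x
  have s: "(\<lambda>g. (a \<otimes>\<^bsub>\<A>\<^esub> cx_embed G q) g x) summable_on carrier G"
    "(\<lambda>g. (- 1) * cx_embed G (cx_action a q) g x) summable_on carrier G"
    by (intro A0_row_summable A0_mult_closed a cx_embed_closed summable_on_cmult_right)+
  have "(\<Sum>\<^sub>\<infinity>g\<in>carrier G. commutator_family a q g x)
      = (\<Sum>\<^sub>\<infinity>g\<in>carrier G. (a \<otimes>\<^bsub>\<A>\<^esub> cx_embed G q) g x + (- 1) * cx_embed G (cx_action a q) g x)"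
    by (rule infsum_cong) (simp add: commutator_family_def)
  also have "\<dots> = (\<Sum>\<^sub>\<infinity>g\<in>carrier G. (a \<otimes>\<^bsub>\<A>\<^esub> cx_embed G q) g x) + (- 1) * (\<Sum>\<^sub>\<infinity>g\<in>carrier G. cx_embed G (cx_action a q) g x)"
    unfolding infsum_add[OF s] infsum_cmult_right' ..
  also have "\<dots> = 0"
    unfolding row_sum_mult[OF a cx_embed_closed] row_sum_cx_embed apply_cx_action[OF a] by simp
  finally show "(\<Sum>\<^sub>\<infinity>g\<in>carrier G. commutator_family a q g x) = 0" .
qed

lemma commutator_closed: "a \<in> carrier \<A> \<Longrightarrow> commutator a \<in> carrier \<L>"
  unfolding commutator_def by (intro operator_carrierI null_family_commutator)

lemma commutator_add:
  assumes "a \<in> carrier \<A>" "b \<in> carrier \<A>"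
  shows "commutator (a \<oplus>\<^bsub>\<A>\<^esub> b) = commutator a \<oplus>\<^bsub>\<L>\<^esub> commutator b"
proof -
  have "commutator_family (a \<oplus>\<^bsub>\<A>\<^esub> b) q = commutator_family a q \<oplus>\<^bsub>\<A>\<^esub> commutator_family b q" for q
    unfolding commutator_family_def A0_mult_add_left[OF assms cx_embed_closed] cx_action_add_left[OF assms] cx_embed_add
    by (auto intro!: bcontfun_eqI simp: fun_eq_iff algebra_simps)
  then show ?thesis unfolding commutator_def operator_add by simp
qed

lemma commutator_scale:
  assumes "a \<in> carrier \<A>"
  shows "commutator (c \<odot>\<^bsub>\<A>\<^esub> a) = c \<odot>\<^bsub>\<L>\<^esub> commutator a"
proof -
  have "commutator_family (c \<odot>\<^bsub>\<A>\<^esub> a) q = c \<odot>\<^bsub>\<A>\<^esub> commutator_family a q" for q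
    unfolding commutator_family_def A0_mult_smult(1)[OF assms cx_embed_closed] cx_action_scale(1)[OF assms] cx_embed_scale
    by (auto intro!: bcontfun_eqI simp: fun_eq_iff algebra_simps)
  then show ?thesis unfolding commutator_def operator_smult by simp
qed

text \<open>
  In the larger bimodule of all operators this is the derivation rule for a commutator,
  \<open>ab.T\<^sub>0 - T\<^sub>0.ab = a.(b.T\<^sub>0 - T\<^sub>0.b) + (a.T\<^sub>0 - T\<^sub>0.a).b\<close>.
\<close>

lemma commutator_mult:
  assumes a: "a \<in> carrier \<A>" and b: "b \<in> carrier \<A>"
  shows "commutator (a \<otimes>\<^bsub>\<A>\<^esub> b) = lact \<L> a (commutator b) \<oplus>\<^bsub>\<L>\<^esub> ract \<L> (commutator a) b"
proof -
  have "commutator_family (a \<otimes>\<^bsub>\<A>\<^esub> b) q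
      = (a \<otimes>\<^bsub>\<A>\<^esub> commutator_family b q) \<oplus>\<^bsub>\<A>\<^esub> commutator_family a (cx_action b q)" for q
  proof -
    let ?i = "cx_embed G"
    have "a \<otimes>\<^bsub>\<A>\<^esub> commutator_family b q
        = (a \<otimes>\<^bsub>\<A>\<^esub> (b \<otimes>\<^bsub>\<A>\<^esub> ?i q)) \<oplus>\<^bsub>\<A>\<^esub> ((-1) \<odot>\<^bsub>\<A>\<^esub> (a \<otimes>\<^bsub>\<A>\<^esub> ?i (cx_action b q)))"
      unfolding commutator_family_def
      using A0_scale_closed[OF cx_embed_closed, of "-1" "cx_action b q"]
      by (subst A0_mult_add_right[OF a A0_mult_closed[OF b cx_embed_closed]])
        (simp_all add: A0_mult_smult(2)[OF a cx_embed_closed, simplified])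
    then show ?thesis
      unfolding commutator_family_def A0_mult_assoc[OF a b cx_embed_closed] cx_action_assoc[OF a b]
      by (auto intro!: bcontfun_eqI simp: fun_eq_iff)
  qed
  then show ?thesis
    unfolding commutator_def operator_lact[OF a commutator_family_closed[OF b]] operator_bimodule_simps(7) operator_add
    by simp
qed

lemma commutator_nrm_le:
  assumes a: "a \<in> carrier \<A>"
  shows "nrm \<L> (commutator a) \<le> 2 * nrm \<A> a"
  unfolding commutator_def
proof (rule operator_nrm_le_family)
  show "operator_family (commutator_family a)"
    using null_family_commutator[OF a] by (simp add: null_family_def)
  show "0 \<le> 2 * nrm \<A> a" using nrm_A0_nonneg[of a] by simp
  fix q
  have 1: "a \<otimes>\<^bsub>\<A>\<^esub> cx_embed G q \<in> carrier \<A>" by (rule A0_mult_closed[OF a cx_embed_closed])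
  have 2: "(-1) \<odot>\<^bsub>\<A>\<^esub> cx_embed G (cx_action a q) \<in> carrier \<A>"
    using A0_scale_closed[OF cx_embed_closed] by simp
  have "nrm \<A> (a \<otimes>\<^bsub>\<A>\<^esub> cx_embed G q) \<le> nrm \<A> a * norm q"
    using nrm_A0_mult_le[OF a cx_embed_closed, of q] mult_left_mono[OF nrm_cx_embed_le[of q] nrm_A0_nonneg[of a]]
    by linarith
  moreover have "nrm \<A> ((-1) \<odot>\<^bsub>\<A>\<^esub> cx_embed G (cx_action a q)) \<le> nrm \<A> a * norm q"
    using nrm_A0_scale_le[OF cx_embed_closed, of "-1" "cx_action a q"] nrm_cx_embed_le[of "cx_action a q"]
      norm_cx_action_le[OF a, of q] by simp
  ultimately show "nrm \<A> (commutator_family a q) \<le> 2 * nrm \<A> a * norm q"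
    using nrm_A0_add[OF 1 2] unfolding commutator_family_def by linarith
qed

abbreviation \<E> where "\<E> \<equiv> dual_bimodule \<L>"

lemma dual_operator_banach_bimodule: "banach_bimodule \<A> \<E>"
  by (rule L.dual_banach_bimodule)

interpretation E: normed_bimodule \<A> \<E>
  using dual_operator_banach_bimodule nrm_A0_nonneg by (rule banach_bimodule_imp_normed_bimodule)

text \<open>
  The commutator derivation followed by the canonical embedding of \<open>\<L>\<close> into its bidual.
\<close>

definition universal_derivation where
  "universal_derivation a = (\<lambda>\<Psi>\<in>bounded_functionals \<L>. \<Psi> (commutator a))"

lemma universal_derivation_bounded: "bounded_derivation \<A> (dual_bimodule \<E>) universal_derivation"
proof -
  have cE: "carrier \<E> = bounded_functionals \<L>" by (simp add: dual_bimodule_simps(1))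
  have mem: "universal_derivation a \<in> bounded_functionals \<E>"
    and le: "nrm (dual_bimodule \<E>) (universal_derivation a) \<le> 2 * nrm \<A> a" if a: "a \<in> carrier \<A>" for a
  proof -
    have bound: "cmod (\<Psi> (commutator a)) \<le> (2 * nrm \<A> a) * nrm \<E> \<Psi>" if "\<Psi> \<in> carrier \<E>" for \<Psi>
      using L.le_dual_nrm[OF that[unfolded cE] commutator_closed[OF a]]
        mult_left_mono[OF commutator_nrm_le[OF a] L.dual_nrm_nonneg[OF that[unfolded cE]]]
      by (simp add: mult.commute)
    show "universal_derivation a \<in> bounded_functionals \<E>"
      unfolding universal_derivation_def cE[symmetric]
      by (rule E.bounded_functionalI[OF _ _ bound])
        (simp_all add: dual_bimodule_simps commutator_closed[OF a])
    show "nrm (dual_bimodule \<E>) (universal_derivation a) \<le> 2 * nrm \<A> a"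
      using nrm_A0_nonneg[of a] bound by (intro E.dual_nrm_le) (auto simp: universal_derivation_def cE)
  qed
  show ?thesis
    unfolding E.bounded_derivation_dual_iff
  proof (intro conjI ballI allI)
    fix a assume a: "a \<in> carrier \<A>"
    show "universal_derivation a \<in> bounded_functionals \<E>" by (rule mem[OF a])
    show "universal_derivation (c \<odot>\<^bsub>\<A>\<^esub> a) = (\<lambda>\<Psi>\<in>carrier \<E>. c * universal_derivation a \<Psi>)" for c
      unfolding universal_derivation_def cE commutator_scale[OF a]
      by (rule restrict_ext) (simp add: L.bounded_functionalD(2) commutator_closed a)
    fix b assume b: "b \<in> carrier \<A>"
    show "universal_derivation (a \<oplus>\<^bsub>\<A>\<^esub> b) = (\<lambda>\<Psi>\<in>carrier \<E>. universal_derivation a \<Psi> + universal_derivation b \<Psi>)"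
      unfolding universal_derivation_def cE commutator_add[OF a b]
      by (rule restrict_ext) (simp add: L.bounded_functionalD(1) commutator_closed a b)
    show "universal_derivation (a \<otimes>\<^bsub>\<A>\<^esub> b)
        = (\<lambda>\<Psi>\<in>carrier \<E>. universal_derivation b (ract \<E> \<Psi> a) + universal_derivation a (lact \<E> b \<Psi>))"
      unfolding universal_derivation_def[of "a \<otimes>\<^bsub>\<A>\<^esub> b"] cE commutator_mult[OF a b]
    proof (rule restrict_ext)
      fix \<Psi> assume \<Psi>: "\<Psi> \<in> bounded_functionals \<L>"
      have 1: "ract \<E> \<Psi> a \<in> bounded_functionals \<L>" "lact \<E> b \<Psi> \<in> bounded_functionals \<L>"
        unfolding dual_bimodule_simps using L.dual_ract_closed(1)[OF a \<Psi>] L.dual_lact_closed(1)[OF b \<Psi>] by auto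
      show "\<Psi> (lact \<L> a (commutator b) \<oplus>\<^bsub>\<L>\<^esub> ract \<L> (commutator a) b)
          = universal_derivation b (ract \<E> \<Psi> a) + universal_derivation a (lact \<E> b \<Psi>)"
        unfolding L.bounded_functionalD(1)[OF \<Psi> L.lact_closed[OF a commutator_closed[OF b]]
            L.ract_closed[OF b commutator_closed[OF a]]]
        using 1 by (simp add: universal_derivation_def dual_bimodule_simps commutator_closed a b)
    qed
  qed (use le in blast)
qed

lemma operator_minus_closed:
  assumes "S \<in> carrier \<L>" "T \<in> carrier \<L>"
  shows "(\<lambda>q x g. S q x g - T q x g) \<in> carrier \<L>"
    and "\<Psi> \<in> bounded_functionals \<L> \<Longrightarrow> \<Psi> (\<lambda>q x g. S q x g - T q x g) = \<Psi> S - \<Psi> T"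
proof -
  have eq: "(\<lambda>q x g. S q x g - T q x g) = S \<oplus>\<^bsub>\<L>\<^esub> ((-1) \<odot>\<^bsub>\<L>\<^esub> T)"
    by (simp add: operator_bimodule_simps(3,4))
  show "(\<lambda>q x g. S q x g - T q x g) \<in> carrier \<L>"
    unfolding eq by (intro operator_add_closed operator_smult_closed assms)
  show "\<Psi> (\<lambda>q x g. S q x g - T q x g) = \<Psi> S - \<Psi> T" if "\<Psi> \<in> bounded_functionals \<L>"
    unfolding eq L.bounded_functionalD(1)[OF that assms(1) operator_smult_closed[OF assms(2)]]
      L.bounded_functionalD(2)[OF that assms(2)] by simp
qed

text \<open>
  The commutator \<open>[\<delta>\<^sub>s, T] = \<delta>\<^sub>s.T - T.\<delta>\<^sub>s\<close>.
\<close>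

definition bracket :: "'g \<Rightarrow> (('x \<Rightarrow>\<^sub>C complex) \<Rightarrow> 'x \<Rightarrow> 'g \<Rightarrow> complex) \<Rightarrow> ('x \<Rightarrow>\<^sub>C complex) \<Rightarrow> 'x \<Rightarrow> 'g \<Rightarrow> complex" where
  "bracket s T = (\<lambda>q x g. lact \<L> (\<delta> s) T q x g - ract \<L> T (\<delta> s) q x g)"

lemma bracket_closed:
  assumes "s \<in> carrier G" "T \<in> carrier \<L>"
  shows "bracket s T \<in> carrier \<L>"
    and "\<Psi> \<in> bounded_functionals \<L> \<Longrightarrow> \<Psi> (bracket s T) = \<Psi> (lact \<L> (\<delta> s) T) - \<Psi> (ract \<L> T (\<delta> s))"
  unfolding bracket_def
  by (intro operator_minus_closed L.lact_closed L.ract_closed point_mass_closed assms; assumption)+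

text \<open>If the universal derivation is inner, then a finite family of functionals on \<open>\<L>\<close> that annihilates
  all \<open>[\<delta>\<^sub>s, T]\<close> also annihilates the values of the derivation: by hypothesis
  \<open>\<Sum>\<^sub>s (\<Psi>\<^sub>s.\<delta>\<^sub>s - \<delta>\<^sub>s.\<Psi>\<^sub>s)\<close> is the zero functional on \<open>\<L>\<close>, and the second sum is its image under the
  functional \<open>\<tau>\<close> that implements the derivation.\<close>

lemma inner_annihilates:
  assumes inner: "inner_derivation \<A> (dual_bimodule \<E>) universal_derivation"
    and S: "finite S" "S \<subseteq> carrier G"
    and \<Psi>: "\<And>s. s \<in> S \<Longrightarrow> \<Psi> s \<in> bounded_functionals \<L>"
    and ann: "\<And>T. T \<in> carrier \<L> \<Longrightarrow> (\<Sum>s\<in>S. \<Psi> s (bracket s T)) = 0"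
  shows "(\<Sum>s\<in>S. \<Psi> s (commutator (\<delta> s))) = 0"
proof -
  have cE: "carrier \<E> = bounded_functionals \<L>" by (simp add: dual_bimodule_simps(1))
  obtain \<tau> where \<tau>: "\<tau> \<in> bounded_functionals \<E>"
    "\<forall>a\<in>carrier \<A>. universal_derivation a = (\<lambda>\<Psi>\<in>carrier \<E>. \<tau> (ract \<E> \<Psi> a) - \<tau> (lact \<E> a \<Psi>))"
    using inner unfolding E.inner_derivation_dual_iff by blast
  (* T is tested against Theta s by bracketing with delta s; tau is evaluated at Theta s itself. *)
  define \<Theta> where "\<Theta> s = (\<lambda>T\<in>carrier \<L>. ract \<E> (\<Psi> s) (\<delta> s) T - lact \<E> (\<delta> s) (\<Psi> s) T)" for s
  have rl: "ract \<E> (\<Psi> s) (\<delta> s) \<in> bounded_functionals \<L>" "lact \<E> (\<delta> s) (\<Psi> s) \<in> bounded_functionals \<L>"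
    if s: "s \<in> S" for s
    using E.ract_closed[of "\<delta> s" "\<Psi> s"] E.lact_closed[of "\<delta> s" "\<Psi> s"] \<Psi>[OF s] S(2) s
    by (auto simp: cE)
  have \<Theta>: "\<Theta> s \<in> bounded_functionals \<L>" "\<tau> (\<Theta> s) = \<Psi> s (commutator (\<delta> s))" if s: "s \<in> S" for s
  proof -
    have g: "s \<in> carrier G" using S(2) s by blast
    show "\<Theta> s \<in> bounded_functionals \<L>"
      unfolding \<Theta>_def by (rule L.dual_minus_closed[OF rl[OF s]])
    have eq: "ract \<E> (\<Psi> s) (\<delta> s) = \<Theta> s \<oplus>\<^bsub>\<E>\<^esub> lact \<E> (\<delta> s) (\<Psi> s)"
      unfolding dual_bimodule_simps(3) using L.bounded_functionalD(3)[OF rl(1)[OF s]]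
      by (simp add: \<Theta>_def cong: restrict_cong)
    have "\<tau> (ract \<E> (\<Psi> s) (\<delta> s)) = \<tau> (\<Theta> s) + \<tau> (lact \<E> (\<delta> s) (\<Psi> s))"
      unfolding eq by (rule E.bounded_functionalD(1)[OF \<tau>(1)]) (simp_all add: cE \<open>\<Theta> s \<in> bounded_functionals \<L>\<close> rl[OF s])
    moreover have "universal_derivation (\<delta> s) (\<Psi> s) = \<tau> (ract \<E> (\<Psi> s) (\<delta> s)) - \<tau> (lact \<E> (\<delta> s) (\<Psi> s))"
      using \<tau>(2) g \<Psi>[OF s] by (simp add: cE)
    moreover have "universal_derivation (\<delta> s) (\<Psi> s) = \<Psi> s (commutator (\<delta> s))"
      using \<Psi>[OF s] by (simp add: universal_derivation_def)
    ultimately show "\<tau> (\<Theta> s) = \<Psi> s (commutator (\<delta> s))" by simp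
  qed
  have "(\<lambda>T\<in>carrier \<L>. \<Sum>s\<in>R. \<Theta> s T) \<in> bounded_functionals \<L> \<and>
      \<tau> (\<lambda>T\<in>carrier \<L>. \<Sum>s\<in>R. \<Theta> s T) = (\<Sum>s\<in>R. \<tau> (\<Theta> s))" if "finite R" "R \<subseteq> S" for R
    using that
  proof (induction R rule: finite_induct)
    case empty
    have "(\<lambda>T\<in>carrier \<L>. 0) = \<zero>\<^bsub>\<E>\<^esub>" by (simp add: dual_bimodule_simps(2))
    then show ?case using L.dual_zero_closed E.bounded_functionalD(4)[OF \<tau>(1)] by simp
  next
    case (insert s R)
    let ?R = "\<lambda>T\<in>carrier \<L>. \<Sum>s\<in>R. \<Theta> s T"
    have eq: "(\<lambda>T\<in>carrier \<L>. \<Sum>s\<in>insert s R. \<Theta> s T) = \<Theta> s \<oplus>\<^bsub>\<E>\<^esub> ?R"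
      using insert.hyps by (simp add: dual_bimodule_simps(3) cong: restrict_cong)
    have IH: "?R \<in> bounded_functionals \<L>" "\<tau> ?R = (\<Sum>s\<in>R. \<tau> (\<Theta> s))"
      using insert.IH insert.prems by blast+
    have 1: "\<Theta> s \<in> carrier \<E>" "?R \<in> carrier \<E>"
      unfolding cE using insert.prems \<Theta>(1)[of s] IH(1) by blast+
    have "\<Theta> s \<oplus>\<^bsub>\<E>\<^esub> ?R \<in> bounded_functionals \<L>" using E.M.a_closed[OF 1] unfolding cE .
    moreover have "\<tau> (\<Theta> s \<oplus>\<^bsub>\<E>\<^esub> ?R) = (\<Sum>s\<in>insert s R. \<tau> (\<Theta> s))"
      unfolding sum.insert[OF insert.hyps] IH(2)[symmetric] by (rule E.bounded_functionalD(1)[OF \<tau>(1) 1])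
    ultimately show ?case
      unfolding eq by (rule conjI)
  qed
  from this[OF S(1) order_refl]
  have "\<tau> (\<lambda>T\<in>carrier \<L>. \<Sum>s\<in>S. \<Theta> s T) = (\<Sum>s\<in>S. \<Psi> s (commutator (\<delta> s)))"
    using \<Theta>(2) by simp
  moreover have "(\<lambda>T\<in>carrier \<L>. \<Sum>s\<in>S. \<Theta> s T) = \<zero>\<^bsub>\<E>\<^esub>"
    unfolding dual_bimodule_simps(2)
  proof (rule restrict_ext)
    fix T assume T: "T \<in> carrier \<L>"
    have "(\<Sum>s\<in>S. \<Theta> s T) = (\<Sum>s\<in>S. \<Psi> s (bracket s T))"
    proof (rule sum.cong[OF refl])
      fix s assume s: "s \<in> S"
      then have "s \<in> carrier G" using S(2) by blast
      from bracket_closed(2)[OF this T \<Psi>[OF s]] show "\<Theta> s T = \<Psi> s (bracket s T)"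
        using T by (simp add: \<Theta>_def dual_bimodule_simps(6,7))
    qed
    then show "(\<Sum>s\<in>S. \<Theta> s T) = 0" using ann[OF T] by simp
  qed
  ultimately show ?thesis
    using E.bounded_functionalD(4)[OF \<tau>(1)] by simp
qed

end

section \<open>Almost invariant maps\<close>

context continuous_action
begin

interpretation L: normed_bimodule \<A> \<L>
  by (rule operator_normed_bimodule)

text \<open>
  Inner in the bidual means inner up to a small error in \<open>\<L>\<close>, for finitely many \<open>s\<close> at a time. If the tuple of
  commutators of \<open>T\<^sub>0\<close> had positive distance from the tuples \<open>([\<delta>\<^sub>s, T])\<^sub>s\<close>, a functional on \<open>\<L>\<^sup>S\<close> would separate
  them, and its components would contradict \<open>inner_annihilates\<close>.
\<close>

lemma approximately_inner:
  assumes inner: "inner_derivation \<A> (dual_bimodule \<E>) universal_derivation"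
    and S: "finite S" "S \<subseteq> carrier G" and \<epsilon>: "0 < \<epsilon>"
  shows "\<exists>T\<in>carrier \<L>. \<forall>s\<in>S. nrm \<L> (\<lambda>q x g. commutator (\<delta> s) q x g - bracket s T q x g) < \<epsilon>"
proof (rule ccontr)
  assume neg: "\<not> ?thesis"
  (* A tuple indexed by group elements is one function with an additional index; sec takes components,
     tup builds tuples that vanish off R. *)
  define sec where "sec w s = (\<lambda>q x g. w (s, q, x, g))"
    for w :: "'g \<times> ('x \<Rightarrow>\<^sub>C complex) \<times> 'x \<times> 'g \<Rightarrow> complex" and s
  define tup where "tup R f = (\<lambda>(s, q, x, g). if s \<in> R then f s q x g else 0)"
    for R and f :: "'g \<Rightarrow> ('x \<Rightarrow>\<^sub>C complex) \<Rightarrow> 'x \<Rightarrow> 'g \<Rightarrow> complex"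
  define W where "W = {w. \<forall>s. sec w s \<in> carrier \<L>}"
  define N where "N w = (\<Sum>s\<in>S. nrm \<L> (sec w s))" for w
  have zero: "(\<lambda>q x g. 0) \<in> carrier \<L>" using operator_zero_closed by (simp add: operator_bimodule_simps(2))
  have sec_tup: "sec (tup R f) s = (if s \<in> R then f s else (\<lambda>q x g. 0))" for R f s
    by (simp add: sec_def tup_def)
  have sec_add: "sec (\<lambda>i. v i + w i) s = sec v s \<oplus>\<^bsub>\<L>\<^esub> sec w s" for v w s
    by (simp add: sec_def operator_bimodule_simps(3))
  have sec_scale: "sec (\<lambda>i. z * v i) s = z \<odot>\<^bsub>\<L>\<^esub> sec v s" for z v s
    by (simp add: sec_def operator_bimodule_simps(4))
  have secW: "sec w s \<in> carrier \<L>" if "w \<in> W" for w s using that by (simp add: W_def)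
  have W: "complex_linear_space W"
    unfolding complex_linear_space_def W_def
    using zero by (auto simp: sec_add sec_scale operator_add_closed operator_smult_closed) (simp add: sec_def)
  have tupW: "tup R f \<in> W" if "\<And>s. s \<in> R \<Longrightarrow> f s \<in> carrier \<L>" for R f
    using that zero by (simp add: W_def sec_tup)
  define Y where "Y = (\<lambda>T. tup S (\<lambda>s. bracket s T)) ` carrier \<L>"
  have S_in: "s \<in> carrier G" if "s \<in> S" for s using S(2) that by blast
  have YW: "Y \<subseteq> W" unfolding Y_def by (auto intro!: tupW bracket_closed S_in)
  have br_add: "bracket s (T \<oplus>\<^bsub>\<L>\<^esub> T') q x g = bracket s T q x g + bracket s T' q x g"
    if "s \<in> S" "T \<in> carrier \<L>" "T' \<in> carrier \<L>" for s T T' q x g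
    unfolding bracket_def L.lact_add_right[OF point_mass_closed[OF S_in[OF that(1)]] that(2,3)]
      L.ract_add_left[OF point_mass_closed[OF S_in[OF that(1)]] that(2,3)]
    by (simp add: operator_bimodule_simps(3))
  have br_scale: "bracket s (z \<odot>\<^bsub>\<L>\<^esub> T) q x g = z * bracket s T q x g"
    if "s \<in> S" "T \<in> carrier \<L>" for s z T q x g
    unfolding bracket_def L.lact_smult_right[OF point_mass_closed[OF S_in[OF that(1)]] that(2)]
      L.ract_smult_left[OF point_mass_closed[OF S_in[OF that(1)]] that(2)]
    by (simp add: operator_bimodule_simps(4) right_diff_distrib)
  have Y: "complex_linear_space Y"
    unfolding complex_linear_space_def
  proof (intro conjI ballI allI)
    define Z where "Z = 0 \<odot>\<^bsub>\<L>\<^esub> \<zero>\<^bsub>\<L>\<^esub>"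
    have "bracket s Z q x g = 0" if "s \<in> S" for s q x g
      using br_scale[OF that operator_zero_closed, of 0 q x g] unfolding Z_def by (simp only: mult_zero_left)
    then have "(\<lambda>_. 0) = tup S (\<lambda>s. bracket s Z)" by (auto simp: tup_def fun_eq_iff)
    moreover have "Z \<in> carrier \<L>" unfolding Z_def by (rule operator_smult_closed[OF operator_zero_closed])
    ultimately show "(\<lambda>_. 0) \<in> Y" unfolding Y_def by blast
    fix v assume "v \<in> Y"
    then obtain T where T: "T \<in> carrier \<L>" "v = tup S (\<lambda>s. bracket s T)" by (auto simp: Y_def)
    have "(\<lambda>i. z * v i) = tup S (\<lambda>s. bracket s (z \<odot>\<^bsub>\<L>\<^esub> T))" for z
      using br_scale[OF _ T(1)] by (auto simp: tup_def fun_eq_iff T(2))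
    then show "(\<lambda>i. z * v i) \<in> Y" for z unfolding Y_def using operator_smult_closed[OF T(1)] by blast
    fix w assume "w \<in> Y"
    then obtain T' where T': "T' \<in> carrier \<L>" "w = tup S (\<lambda>s. bracket s T')" by (auto simp: Y_def)
    have "(\<lambda>i. v i + w i) = tup S (\<lambda>s. bracket s (T \<oplus>\<^bsub>\<L>\<^esub> T'))"
      using br_add[OF _ T(1) T'(1)] by (auto simp: tup_def fun_eq_iff T(2) T'(2))
    then show "(\<lambda>i. v i + w i) \<in> Y" unfolding Y_def using operator_add_closed[OF T(1) T'(1)] by blast
  qed
  define b where "b = tup S (\<lambda>s. commutator (\<delta> s))"
  have bW: "b \<in> W" unfolding b_def by (intro tupW commutator_closed point_mass_closed S_in)
  have far: "\<epsilon> \<le> N (\<lambda>i. b i + y i)" if "y \<in> Y" for y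
  proof -
    have "(\<lambda>i. (-1) * y i) \<in> Y" by (rule complex_linear_spaceD(3)[OF Y that])
    then obtain T where T: "T \<in> carrier \<L>" "(\<lambda>i. (-1) * y i) = tup S (\<lambda>s. bracket s T)"
      unfolding Y_def by blast
    obtain s where s: "s \<in> S" "\<epsilon> \<le> nrm \<L> (\<lambda>q x g. commutator (\<delta> s) q x g - bracket s T q x g)"
      using neg T(1) by (meson not_le)
    have y: "y i = - tup S (\<lambda>s. bracket s T) i" for i
    proof -
      have "y i = - ((-1) * y i)" by simp
      then show ?thesis using fun_cong[OF T(2), of i] by (simp only:)
    qed
    have "sec (\<lambda>i. b i + y i) s = (\<lambda>q x g. commutator (\<delta> s) q x g - bracket s T q x g)"
      using s(1) by (simp add: sec_def b_def y tup_def)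
    moreover have "(\<lambda>i. b i + y i) \<in> W" using complex_linear_spaceD(2)[OF W bW] that YW by blast
    then have "nrm \<L> (sec (\<lambda>i. b i + y i) s) \<le> N (\<lambda>i. b i + y i)"
      unfolding N_def using s(1) S(1) L.nrm_nonneg[OF secW] by (intro member_le_sum) auto
    ultimately show ?thesis using s(2) by simp
  qed
  have Nadd: "N (\<lambda>i. v i + w i) \<le> N v + N w" if "v \<in> W" "w \<in> W" for v w
    unfolding N_def sum.distrib[symmetric] sec_add by (intro sum_mono L.nrm_triangle secW that)
  have Nscale: "N (\<lambda>i. z * v i) = cmod z * N v" if "v \<in> W" for z v
    unfolding N_def sum_distrib_left sec_scale by (intro sum.cong refl L.nrm_smult secW that)
  have "\<exists>\<phi>. (\<forall>v\<in>W. \<forall>w\<in>W. \<phi> (\<lambda>i. v i + w i) = \<phi> v + \<phi> w) \<and> (\<forall>c. \<forall>v\<in>W. \<phi> (\<lambda>i. c * v i) = c * \<phi> v) \<and>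
      (\<forall>v\<in>W. cmod (\<phi> v) \<le> 2 * N v) \<and> (\<forall>y\<in>Y. \<phi> y = 0) \<and> \<phi> b \<noteq> 0"
    by (rule separating_functional[OF W Y YW bW]; (rule Nadd Nscale \<epsilon> far)?; assumption?)
  then obtain \<phi> where
    \<phi>': "\<forall>v\<in>W. \<forall>w\<in>W. \<phi> (\<lambda>i. v i + w i) = \<phi> v + \<phi> w" "\<forall>c. \<forall>v\<in>W. \<phi> (\<lambda>i. c * v i) = c * \<phi> v"
      "\<forall>v\<in>W. cmod (\<phi> v) \<le> 2 * N v" "\<forall>y\<in>Y. \<phi> y = 0" "\<phi> b \<noteq> 0"
    by (elim exE conjE)
  note \<phi> = \<phi>'[rule_format]
  define \<Psi> where "\<Psi> s = restrict (\<lambda>T. \<phi> (tup {s} (\<lambda>_. T))) (carrier \<L>)" for s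
  have \<Psi>: "\<Psi> s \<in> bounded_functionals \<L>" if s: "s \<in> S" for s
    unfolding \<Psi>_def
  proof (rule L.bounded_functionalI)
    fix T T' z assume T: "T \<in> carrier \<L>"
    have TW: "tup {s} (\<lambda>_. T) \<in> W" if "T \<in> carrier \<L>" for T by (rule tupW) (rule that)
    show "\<phi> (tup {s} (\<lambda>_. T \<oplus>\<^bsub>\<L>\<^esub> T')) = \<phi> (tup {s} (\<lambda>_. T)) + \<phi> (tup {s} (\<lambda>_. T'))" if T': "T' \<in> carrier \<L>"
    proof -
      have "tup {s} (\<lambda>_. T \<oplus>\<^bsub>\<L>\<^esub> T') = (\<lambda>i. tup {s} (\<lambda>_. T) i + tup {s} (\<lambda>_. T') i)"
        by (auto simp: tup_def operator_bimodule_simps(3))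
      then show ?thesis using \<phi>(1)[OF TW[OF T] TW[OF T']] by simp
    qed
    show "\<phi> (tup {s} (\<lambda>_. z \<odot>\<^bsub>\<L>\<^esub> T)) = z * \<phi> (tup {s} (\<lambda>_. T))"
    proof -
      have "tup {s} (\<lambda>_. z \<odot>\<^bsub>\<L>\<^esub> T) = (\<lambda>i. z * tup {s} (\<lambda>_. T) i)"
        by (auto simp: tup_def operator_bimodule_simps(4))
      then show ?thesis using \<phi>(2)[OF TW[OF T]] by simp
    qed
    have "N (tup {s} (\<lambda>_. T)) = (\<Sum>s'\<in>S. if s' = s then nrm \<L> T else 0)"
      unfolding N_def sec_tup using L.nrm_zero by (intro sum.cong) (auto simp: operator_bimodule_simps(2))
    then have "N (tup {s} (\<lambda>_. T)) = nrm \<L> T" using S(1) s by simp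
    then show "cmod (\<phi> (tup {s} (\<lambda>_. T))) \<le> 2 * nrm \<L> T" using \<phi>(3)[OF TW[OF T]] by simp
  qed
  have \<phi>_tup: "\<phi> (tup R f) = (\<Sum>s\<in>R. \<Psi> s (f s))" if "finite R" "\<And>s. s \<in> R \<Longrightarrow> f s \<in> carrier \<L>" for R f
    using that
  proof (induction R rule: finite_induct)
    case empty
    have "tup {} f = (\<lambda>i. 0 * b i)" by (auto simp: tup_def)
    then show ?case using \<phi>(2)[OF bW, of 0] by simp
  next
    case (insert s R)
    have "tup (insert s R) f = (\<lambda>i. tup {s} (\<lambda>_. f s) i + tup R f i)"
      using insert.hyps by (auto simp: tup_def)
    moreover have "tup {s} (\<lambda>_. f s) \<in> W" "tup R f \<in> W" using insert.prems by (auto intro: tupW)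
    ultimately have "\<phi> (tup (insert s R) f) = \<phi> (tup {s} (\<lambda>_. f s)) + \<phi> (tup R f)"
      using \<phi>(1) by simp
    then show ?case using insert by (simp add: \<Psi>_def)
  qed
  have ann: "(\<Sum>s\<in>S. \<Psi> s (bracket s T)) = 0" if "T \<in> carrier \<L>" for T
    using \<phi>_tup[OF S(1), of "\<lambda>s. bracket s T"] \<phi>(4)[of "tup S (\<lambda>s. bracket s T)"] that
    by (simp add: bracket_closed S_in Y_def)
  have "(\<Sum>s\<in>S. \<Psi> s (commutator (\<delta> s))) = 0"
    using inner S by (rule inner_annihilates) (fact \<Psi> ann)+
  then show False
    using \<phi>_tup[OF S(1), of "\<lambda>s. commutator (\<delta> s)"] \<phi>(5) by (simp add: b_def commutator_closed S_in)
qed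

text \<open>
  Normalise \<open>a = (T\<^sub>0 - T)(1)\<close>. As \<open>\<delta>\<^sub>s.1 = 1\<close> in \<open>CX\<close>, the value at \<open>1\<close> of
  \<open>\<delta>\<^sub>s.(T\<^sub>0 - T) - (T\<^sub>0 - T).\<delta>\<^sub>s\<close>, which is small by \<open>approximately_inner\<close>, is \<open>\<delta>\<^sub>s * a - a\<close>.
\<close>

lemma almost_invariant_map:
  assumes inner: "inner_derivation \<A> (dual_bimodule \<E>) universal_derivation"
    and S: "finite S" "S \<subseteq> carrier G" and \<epsilon>: "0 < \<epsilon>"
  shows "\<exists>m\<in>continuous_prob_maps G. \<forall>s\<in>S. \<forall>x. l1_norm G (\<lambda>h. m (act s x) h - l1_translate G s (m x) h) \<le> \<epsilon>"
proof -
  (* Normalisation doubles the error. *)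
  let ?\<epsilon> = "\<epsilon> / 2" and ?u = "const_bcontfun 1 :: 'x \<Rightarrow>\<^sub>C complex"
  obtain T where T: "T \<in> carrier \<L>"
    "\<forall>s\<in>S. nrm \<L> (\<lambda>q x g. commutator (\<delta> s) q x g - bracket s T q x g) < ?\<epsilon>"
    using approximately_inner[OF inner S, of ?\<epsilon>] \<epsilon> by auto
  obtain F where F: "null_family F" "T = (\<lambda>q. pointwise (F q))" "\<And>q. F q \<in> carrier \<A>"
    using operator_carrierE[OF T(1)] by metis
  define a where "a = cx_embed G ?u \<oplus>\<^bsub>\<A>\<^esub> ((-1) \<odot>\<^bsub>\<A>\<^esub> F ?u)"
  have mF: "(-1) \<odot>\<^bsub>\<A>\<^esub> F ?u \<in> carrier \<A>" using A0_scale_closed[OF F(3)] by simp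
  have a: "a \<in> carrier \<A>" unfolding a_def using A0_add_closed[OF cx_embed_closed mF] by simp
  have sum_1: "(\<Sum>\<^sub>\<infinity>g\<in>carrier G. a g x) = 1" for x
  proof -
    have "(\<Sum>\<^sub>\<infinity>g\<in>carrier G. a g x)
        = (\<Sum>\<^sub>\<infinity>g\<in>carrier G. cx_embed G ?u g x) + (\<Sum>\<^sub>\<infinity>g\<in>carrier G. (-1) * F ?u g x)"
      using infsum_add[OF A0_row_summable[OF cx_embed_closed, of ?u x] A0_row_summable[OF mF, of x]] by (simp add: a_def)
    also have "\<dots> = 1"
      unfolding infsum_cmult_right' row_sum_cx_embed using F(1) by (simp add: null_family_def)
    finally show ?thesis .
  qed
  have close: "(\<Sum>\<^sub>\<infinity>g\<in>carrier G. cmod (a g x - (\<delta> s \<otimes>\<^bsub>\<A>\<^esub> a) g x)) \<le> ?\<epsilon>" if s: "s \<in> S" for s x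
  proof -
    have g: "s \<in> carrier G" using S(2) s by blast
    let ?R = "\<lambda>q x g. commutator (\<delta> s) q x g - bracket s T q x g"
    have "?R \<in> carrier \<L>"
      by (intro operator_minus_closed commutator_closed bracket_closed T(1) point_mass_closed g)
    then have "\<exists>H. ?R = (\<lambda>q. pointwise (H q)) \<and> null_family H"
      unfolding operator_bimodule_simps(1) by (rule CollectD)
    then obtain H where H: "?R = (\<lambda>q. pointwise (H q))" "null_family H" by (elim exE conjE)
    have oH: "operator_family H" using H(2) by (simp add: null_family_def)
    have cu: "cx_action (\<delta> s) ?u = ?u" using g by (simp add: cx_action_delta)
    have da: "\<delta> s \<otimes>\<^bsub>\<A>\<^esub> a = (\<delta> s \<otimes>\<^bsub>\<A>\<^esub> cx_embed G ?u) \<oplus>\<^bsub>\<A>\<^esub> ((-1) \<odot>\<^bsub>\<A>\<^esub> (\<delta> s \<otimes>\<^bsub>\<A>\<^esub> F ?u))"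
      unfolding a_def A0_mult_add_right[OF point_mass_closed[OF g] cx_embed_closed mF]
        A0_mult_smult(2)[OF point_mass_closed[OF g] F(3)] ..
    have "?R ?u x g = (\<delta> s \<otimes>\<^bsub>\<A>\<^esub> a) g x - a g x" for x g
      unfolding da unfolding a_def bracket_def F(2) operator_lact[OF point_mass_closed[OF g] F(3)]
        operator_bimodule_simps(7) commutator_def commutator_family_def cu
      by (simp add: pointwise_def)
    then have "H ?u g x = (\<delta> s \<otimes>\<^bsub>\<A>\<^esub> a) g x - a g x" for x g
      using fun_cong[OF fun_cong[OF fun_cong[OF H(1)]], of ?u x g] by (simp add: pointwise_def)
    then have "(\<Sum>\<^sub>\<infinity>g\<in>carrier G. cmod (a g x - (\<delta> s \<otimes>\<^bsub>\<A>\<^esub> a) g x)) = (\<Sum>\<^sub>\<infinity>g\<in>carrier G. cmod (H ?u g x))"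
      by (simp add: norm_minus_commute)
    also have "\<dots> \<le> nrm \<L> ?R"
      unfolding H(1) by (rule le_operator_nrm_ball[OF oH norm_unit_le])
    also have "\<dots> \<le> ?\<epsilon>" using T(2) s by (simp add: less_imp_le)
    finally show ?thesis .
  qed
  have "l1_norm G (\<lambda>h. normalised a (act s x) h - l1_translate G s (normalised a x) h) \<le> \<epsilon>" if "s \<in> S" for s x
    using normalised_defect_le[OF a sum_1 _ close[OF that], of x] S(2) that by auto
  then show ?thesis
    using normalised_continuous[OF a sum_1] by blast
qed

text \<open>
  The net is indexed by a finite set of group elements and an accuracy \<open>1 / (k + 1)\<close>.
\<close>

lemma right_l1_amenable_imp_amenable_action:
  assumes "right_l1_amenable TYPE((('x \<Rightarrow>\<^sub>C complex) \<Rightarrow> 'x \<Rightarrow> 'g \<Rightarrow> complex) \<Rightarrow> complex) \<A> (cx_embed G)"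
  shows "amenable_action G act"
proof -
  have inner: "inner_derivation \<A> (dual_bimodule \<E>) universal_derivation"
    using assms dual_operator_banach_bimodule dual_operator_geometric universal_derivation_bounded
    unfolding right_l1_amenable_def by blast
  have "\<exists>m\<in>continuous_prob_maps G. \<forall>s\<in>S. \<forall>x. l1_norm G (\<lambda>h. m (act s x) h - l1_translate G s (m x) h) \<le> 1 / real (Suc k)"
    if "finite S" "S \<subseteq> carrier G" for S k
    by (rule almost_invariant_map[OF inner that]) simp
  then obtain m where m: "\<And>S k. finite S \<Longrightarrow> S \<subseteq> carrier G \<Longrightarrow> m S k \<in> continuous_prob_maps G"
    "\<And>S k s x. finite S \<Longrightarrow> S \<subseteq> carrier G \<Longrightarrow> s \<in> S \<Longrightarrow>
      l1_norm G (\<lambda>h. m S k (act s x) h - l1_translate G s (m S k x) h) \<le> 1 / real (Suc k)"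
    by metis
  define B where "B = finite_subsets_at_top (carrier G) \<times>\<^sub>F (sequentially :: nat filter)"
  define F where "F = filtermap (\<lambda>(S, k). m S k) B"
  have big: "\<forall>\<^sub>F (S, k) in B. finite S \<and> S \<subseteq> carrier G \<and> R \<subseteq> S" if "finite R" "R \<subseteq> carrier G" for R
    unfolding B_def eventually_prod_filter case_prod_conv
    using that
    by (intro exI[of _ "\<lambda>S. finite S \<and> S \<subseteq> carrier G \<and> R \<subseteq> S"] exI[of _ "\<lambda>_. True"])
      (auto simp: eventually_finite_subsets_at_top)
  show ?thesis
    unfolding amenable_action_def
  proof (intro exI[of _ F] conjI ballI)
    show "F \<noteq> bot" unfolding F_def B_def by (simp add: filtermap_bot_iff prod_filter_eq_bot)
    show "\<forall>\<^sub>F m in F. m \<in> continuous_prob_maps G"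
      unfolding F_def eventually_filtermap by (rule eventually_mono[OF big[of "{}"]]) (auto intro: m)
    fix g assume g: "g \<in> carrier G"
    have lim: "((\<lambda>p. 1 / real (Suc (snd p))) \<longlongrightarrow> 0) B"
      unfolding B_def by (rule filterlim_compose[OF _ filterlim_snd]) real_asymp
    have "((\<lambda>p. SUP x. l1_norm G (\<lambda>h. m (fst p) (snd p) (act g x) h - l1_translate G g (m (fst p) (snd p) x) h)) \<longlongrightarrow> 0) B"
    proof (rule Lim_null_comparison[OF eventually_mono[OF big[of "{g}"]] lim])
      fix p :: "'g set \<times> nat" assume "case p of (S, k) \<Rightarrow> finite S \<and> S \<subseteq> carrier G \<and> {g} \<subseteq> S"
      then obtain S k where p: "p = (S, k)" "finite S" "S \<subseteq> carrier G" "g \<in> S" by auto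
      let ?f = "\<lambda>x. l1_norm G (\<lambda>h. m S k (act g x) h - l1_translate G g (m S k x) h)"
      have le: "?f x \<le> 1 / real (Suc k)" for x by (rule m(2)[OF p(2,3,4)])
      have nn: "0 \<le> ?f x" for x by (simp add: l1_norm_def infsum_nonneg)
      have "(SUP x. ?f x) \<le> 1 / real (Suc k)" by (rule cSUP_least) (use le in auto)
      moreover have "0 \<le> (SUP x. ?f x)"
      proof -
        have "bdd_above (range ?f)" by (rule bdd_aboveI2[where M = "1 / real (Suc k)"]) (rule le)
        from cSUP_upper[OF UNIV_I this, of undefined] nn[of undefined] show ?thesis by linarith
      qed
      ultimately show "norm (SUP x. l1_norm G (\<lambda>h. m (fst p) (snd p) (act g x) h - l1_translate G g (m (fst p) (snd p) x) h)) \<le> 1 / real (Suc (snd p))"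
        by (simp add: p(1))
    qed (use g in auto)
    then show "((\<lambda>m. SUP x. l1_norm G (\<lambda>h. m (act g x) h - l1_translate G g (m x) h)) \<longlongrightarrow> 0) F"
      unfolding F_def filterlim_filtermap by (simp add: case_prod_unfold)
  qed
qed

end

theorem theorem5p2:
  fixes G :: "('g, 'm) monoid_scheme"
    and act :: "'g \<Rightarrow> 'x::t2_space \<Rightarrow> 'x"
  assumes "group G" and "countable (carrier G)"
    and "compact (UNIV :: 'x set)"
    and "group_action G UNIV act"
    and "\<And>g. g \<in> carrier G \<Longrightarrow> continuous_on UNIV (act g)"
  shows "(amenable_action G act \<longleftrightarrow>
            right_l1_amenable
              TYPE((('x \<Rightarrow>\<^sub>C complex) \<Rightarrow> 'x \<Rightarrow> 'g \<Rightarrow> complex) \<Rightarrow> complex)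
              (A0 G act) (cx_embed G))
       \<and> (amenable_action G act \<longrightarrow>
            right_l1_amenable TYPE('e) (A0 G act) (cx_embed G))"
proof -
  interpret continuous_action G act
    using assms(1,2,4,5) by (intro continuous_action.intro continuous_action_axioms.intro)
  show ?thesis
    by (intro conjI iffI impI)
      (rule right_l1_amenable_imp_amenable_action amenable_action_imp_right_l1_amenable[OF assms(3)];
        assumption)+
qed

end
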